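(* Let $(\mathcal{N}, \mathcal{I}, \partial\mathcal{I}, \mathcal{I}^\circ)$ be the data for an iterated gluing diagram, with induced iterated gluing category $\mathcal{I}_\infty$, and let $\mathcal{E}$ be a category with pullbacks admitting all limits indexed by the categories of elements $\oint_{j \in \mathcal{I}_{<n}} \mathcal{I}^\circ_n(i,j)$ for $n \in \mathcal{N}$ and $i \in \partial\mathcal{I}_n$. Let $f : B \to A$ be a map in $\mathcal{E}^{\mathcal{I}_\infty}$ such that for each $n \in \mathcal{N}$, the maps $f|_{=n} : B|_{=n} \to A|_{=n}$ and $M_n f : M_n B \to M_n A$ in $\mathcal{E}^{\partial\mathcal{I}_n}$ are powerful. Then the dependent product $\Pi_B$ along $f$ (right adjoint to pullback along $f$) exists in $\mathcal{E}^{\mathcal{I}_\infty}$. For $g : C \to B$ in $\mathcal{E}^{\mathcal{I}_\infty}/B$ and $i \in \partial\mathcal{I}_n$, the value of $\Pi_B g : \Pi_B C \to A$ at $[i]_n \in \mathcal{I}_\infty$ is given by the pullback $(\Pi_B C)[i]_n$ in $\mathcal{E}$ of the map $$(\Pi_{B|_{=n}}(g|_{=n}, m_n C))_i : (\Pi_{B|_{=n}} C|_{=n})i \to (\Pi_{B|_{=n}}(B|_{=n} \times_{M_n B} M_n C))i$$ and the composite $$A[i]_n \times_{M_i A} M_i(\Pi_B C) \to A[i]_n \times_{M_i A} (\Pi_{M_n B} M_n C)i \to (\Pi_{B|_{=n}}(B|_{=n} \times_{M_n B} M_n C))i$$ of the components at $i$ of the map $A|_{=n} \times_{M_n A} M_n(\mathrm{ev})^\ddagger$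 and the map $(B|_{=n} \times_{M_n B} \mathrm{ev})^\ddagger$.
   Context: *Iterated gluing diagrams.* A *strict inverse category* is a category $\mathcal{N}$ with a function $\deg : \mathrm{ob}\,\mathcal{N} \to \mathbb{N}$ such that every non-identity map $n \to n'$ has $\deg n > \deg n'$. For $n \in \mathcal{N}$ let $(n/\mathcal{N})^\circ$ be the full subcategory of the coslice $n/\mathcal{N}$ on all objects except $\mathrm{id}_n$. The data $(\mathcal{N}, \mathcal{I}, \partial\mathcal{I}, \mathcal{I}^\circ)$ of an *iterated gluing diagram* consists of: a strict inverse category $\mathcal{N}$; a functor $\mathcal{I} : \mathcal{N}^{\mathrm{op}} \to \mathrm{Cat}$, $n \mapsto \mathcal{I}_n$ (so $\alpha : n \to n'$ induces $\mathcal{I}_\alpha : \mathcal{I}_{n'} \to \mathcal{I}_n$); a family of categories $\partial\mathcal{I}_n$, $n \in \mathrm{ob}\,\mathcal{N}$; and a family of profunctors $\mathcal{I}^\circ_n : (\partial\mathcal{I}_n)^{\mathrm{op}} \times \mathcal{I}_{<n} \to \mathrm{Set}$, where $\mathcal{I}_{<n} := \mathrm{colim}\big(((n/\mathcal{N})^\circ)^{\mathrm{op}} \to \mathcal{N}^{\mathrm{op}} \xrightarrow{\mathcal{I}} \mathrm{Cat}\big)$ (equivalently the colimit of $\mathcal{I}$ weighted by $\mathcal{N}(n,-)$ with the identity removed); such that each $\mathcal{I}_n$ is the collage of $\mathcal{I}_n^\circ$: its objects are $\mathrm{ob}\,\mathcal{I}_{<n} \sqcup \mathrm{ob}\,\partial\mathcal{I}_n$,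 it contains $\mathcal{I}_{<n}$ and $\partial\mathcal{I}_n$ as full subcategories, $\mathcal{I}_n(i,j) = \mathcal{I}_n^\circ(i,j)$ and $\mathcal{I}_n(j,i) = \emptyset$ for $i \in \partial\mathcal{I}_n$, $j \in \mathcal{I}_{<n}$, with composition given by functoriality of $\mathcal{I}^\circ_n$; and the inclusion $\mathcal{I}_{<n} \hookrightarrow \mathcal{I}_n$ is the canonical map induced by the $\mathcal{I}_\alpha$. The *induced iterated gluing category* is $\mathcal{I}_\infty := \mathrm{colim}_{n \in \mathcal{N}^{\mathrm{op}}} \mathcal{I}_n$. For $i \in \partial\mathcal{I}_n$, $[i]_n \in \mathcal{I}_\infty$ denotes the image of $i$. For $X \in \mathcal{E}^{\mathcal{I}_\infty}$, $X|_{=n} \in \mathcal{E}^{\partial\mathcal{I}_n}$ and $X|_{<n} \in \mathcal{E}^{\mathcal{I}_{<n}}$ denote restrictions along $\partial\mathcal{I}_n \hookrightarrow \mathcal{I}_n \to \mathcal{I}_\infty$ and $\mathcal{I}_{<n} \hookrightarrow \mathcal{I}_n \to \mathcal{I}_\infty$. *Matching objects.* $\oint_{j \in \mathcal{I}_{<n}} \mathcal{I}^\circ_n(i,j)$ is the category of elements of $\mathcal{I}^\circ_n(i,-)$ (objects: pairs $(j,u)$, $u \in \mathcal{I}_n^\circ(i,j)$). The *$n$-th matching object functor* $M_n : \mathcal{E}^{\mathcal{I}_{<n}} \to \mathcal{E}^{\partial\mathcal{I}_n}$ is right Kan extension along $\mathcal{I}_{<n} \hookrightarrow \mathcal{I}_n$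 followed by restriction to $\partial\mathcal{I}_n$; explicitly $(M_n X)i = \lim\big(\oint_{j} \mathcal{I}^\circ_n(i,j) \to \mathcal{I}_{<n} \xrightarrow{X} \mathcal{E}\big)$. For $X \in \mathcal{E}^{\mathcal{I}_\infty}$, $M_n X := M_n(X|_{<n})$ and $M_i X := (M_n X)i$. The *matching map* $m_n X : X|_{=n} \to M_n X$ has component at $i$ induced by the maps $X(u) : X[i]_n \to Xj$ for $u \in \mathcal{I}_n^\circ(i,j)$. *Dependent products.* A map is *powerful* if pullbacks along it exist and the pullback functor between slices has a right adjoint, the dependent product. $\Pi_{B|_{=n}}$ and $\Pi_{M_n B}$ are the right adjoints to pullback along $f|_{=n}$ and $M_n f$; $\mathrm{ev}$ denotes counits and $(-)^\ddagger$ transposes. $M_n(\mathrm{ev})^\ddagger : M_n(\Pi_B C) \to \Pi_{M_n B} M_n C$ is the transpose of $M_n B \times_{M_n A} M_n(\Pi_B C) \cong M_n(B \times_A \Pi_B C) \xrightarrow{M_n(\mathrm{ev})} M_n C$, and $A|_{=n} \times_{M_n A} M_n(\mathrm{ev})^\ddagger$ is its pullback along $m_n A$. $(B|_{=n} \times_{M_n B} \mathrm{ev})^\ddagger : A|_{=n} \times_{M_n A} \Pi_{M_n B} M_n C \to \Pi_{B|_{=n}}(B|_{=n} \times_{M_n B} M_n C)$ is the transpose of $B|_{=n} \times_{A|_{=n}} (A|_{=n} \times_{M_n A} \Pi_{M_n B} M_n C) \cong B|_{=n} \times_{M_n B}(M_n B \times_{M_n A} \Pi_{M_n B} M_n C)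 \to B|_{=n} \times_{M_n B} M_n C$, the pullback along $m_n B$ of $\mathrm{ev}$. $(g|_{=n}, m_n C) : C|_{=n} \to B|_{=n} \times_{M_n B} M_n C$ is the induced map. *)

theory Defs
  imports "HOL-Library.FuncSet"
begin

section \<open>Categories, functors, natural transformations\<close>

record ('o, 'm) cat =
  Obj :: "'o set"
  Arr :: "'m set"
  Dom :: "'m \<Rightarrow> 'o"
  Cod :: "'m \<Rightarrow> 'o"
  Ident :: "'o \<Rightarrow> 'm"
  Comp :: "'m \<Rightarrow> 'm \<Rightarrow> 'm" (infixr "\<cdot>\<index>" 70)

definition hom :: "('o, 'm) cat \<Rightarrow> 'o \<Rightarrow> 'o \<Rightarrow> 'm set" where
  "hom C x y = {f \<in> Arr C. Dom C f = x \<and> Cod C f = y}"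

locale category =
  fixes C :: "('o, 'm) cat" (structure)
  assumes dom_in: "f \<in> Arr C \<Longrightarrow> Dom C f \<in> Obj C"
    and cod_in: "f \<in> Arr C \<Longrightarrow> Cod C f \<in> Obj C"
    and ident_in: "x \<in> Obj C \<Longrightarrow> Ident C x \<in> hom C x x"
    and comp_in: "f \<in> hom C x y \<Longrightarrow> g \<in> hom C y z \<Longrightarrow> g \<cdot> f \<in> hom C x z"
    and ident_right: "f \<in> hom C x y \<Longrightarrow> f \<cdot> Ident C x = f"
    and ident_left: "f \<in> hom C x y \<Longrightarrow> Ident C y \<cdot> f = f"
    and assoc: "f \<in> hom C w x \<Longrightarrow> g \<in> hom C x y \<Longrightarrow> h \<in> hom C y z \<Longrightarrow> (h \<cdot> g) \<cdot> f = h \<cdot> (g \<cdot> f)"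

text \<open>Functors and natural transformations carry their source and target and are required to be
  extensional (undefined off the carriers), so that equality in HOL is the mathematical equality.\<close>

record ('o, 'm, 'p, 'q) func =
  Src :: "('o, 'm) cat"
  Tgt :: "('p, 'q) cat"
  FO :: "'o \<Rightarrow> 'p"
  FA :: "'m \<Rightarrow> 'q"

definition is_functor :: "('o, 'm, 'p, 'q) func \<Rightarrow> bool" where
  "is_functor F \<longleftrightarrow> category (Src F) \<and> category (Tgt F)
     \<and> FO F \<in> Obj (Src F) \<rightarrow>\<^sub>E Obj (Tgt F) \<and> FA F \<in> Arr (Src F) \<rightarrow>\<^sub>E Arr (Tgt F)
     \<and> (\<forall>f\<in>Arr (Src F). Dom (Tgt F) (FA F f) = FO F (Dom (Src F) f)
                       \<and> Cod (Tgt F) (FA F f) = FO F (Cod (Src F) f))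
     \<and> (\<forall>x\<in>Obj (Src F). FA F (Ident (Src F) x) = Ident (Tgt F) (FO F x))
     \<and> (\<forall>f\<in>Arr (Src F). \<forall>g\<in>Arr (Src F). Cod (Src F) f = Dom (Src F) g \<longrightarrow>
          FA F (g \<cdot>\<^bsub>Src F\<^esub> f) = FA F g \<cdot>\<^bsub>Tgt F\<^esub> FA F f)"

definition id_func :: "('o, 'm) cat \<Rightarrow> ('o, 'm, 'o, 'm) func" where
  "id_func C = \<lparr>Src = C, Tgt = C, FO = (\<lambda>x\<in>Obj C. x), FA = (\<lambda>f\<in>Arr C. f)\<rparr>"

definition comp_func ::
  "('p, 'q, 'r, 's) func \<Rightarrow> ('o, 'm, 'p, 'q) func \<Rightarrow> ('o, 'm, 'r, 's) func" (infixr "\<bullet>" 70) where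
  "G \<bullet> F = \<lparr>Src = Src F, Tgt = Tgt G,
            FO = (\<lambda>x\<in>Obj (Src F). FO G (FO F x)), FA = (\<lambda>f\<in>Arr (Src F). FA G (FA F f))\<rparr>"

definition is_iso_functor :: "('o, 'm, 'p, 'q) func \<Rightarrow> bool" where
  "is_iso_functor F \<longleftrightarrow> is_functor F \<and> bij_betw (FO F) (Obj (Src F)) (Obj (Tgt F))
     \<and> bij_betw (FA F) (Arr (Src F)) (Arr (Tgt F))"

record ('o, 'm, 'p, 'q) ntrans =
  NDom :: "('o, 'm, 'p, 'q) func"
  NCod :: "('o, 'm, 'p, 'q) func"
  At :: "'o \<Rightarrow> 'q"

definition is_ntrans :: "('o, 'm, 'p, 'q) ntrans \<Rightarrow> bool" where
  "is_ntrans \<tau> \<longleftrightarrow> (let F = NDom \<tau>; G = NCod \<tau>; J = Src F; E = Tgt F in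
     is_functor F \<and> is_functor G \<and> Src G = J \<and> Tgt G = E \<and> At \<tau> \<in> extensional (Obj J)
     \<and> (\<forall>x\<in>Obj J. At \<tau> x \<in> hom E (FO F x) (FO G x))
     \<and> (\<forall>f\<in>Arr J. At \<tau> (Cod J f) \<cdot>\<^bsub>E\<^esub> FA F f = FA G f \<cdot>\<^bsub>E\<^esub> At \<tau> (Dom J f)))"

definition Fun :: "('o, 'm) cat \<Rightarrow> ('p, 'q) cat \<Rightarrow>
    (('o, 'm, 'p, 'q) func, ('o, 'm, 'p, 'q) ntrans) cat" where
  "Fun J E = \<lparr>Obj = {F. is_functor F \<and> Src F = J \<and> Tgt F = E},
     Arr = {\<tau>. is_ntrans \<tau> \<and> Src (NDom \<tau>) = J \<and> Tgt (NDom \<tau>) = E},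
     Dom = NDom, Cod = NCod,
     Ident = (\<lambda>F. \<lparr>NDom = F, NCod = F, At = (\<lambda>x\<in>Obj J. Ident E (FO F x))\<rparr>),
     Comp = (\<lambda>\<sigma> \<tau>. \<lparr>NDom = NDom \<tau>, NCod = NCod \<sigma>, At = (\<lambda>x\<in>Obj J. At \<sigma> x \<cdot>\<^bsub>E\<^esub> At \<tau> x)\<rparr>)\<rparr>"

text \<open>Precomposition \<open>E\<^sup>J \<rightarrow> E\<^sup>I\<close> with \<open>K : I \<rightarrow> J\<close>.\<close>

definition precomp :: "('i, 'k, 'o, 'm) func \<Rightarrow> ('p, 'q) cat \<Rightarrow>
    (('o, 'm, 'p, 'q) func, ('o, 'm, 'p, 'q) ntrans,
     ('i, 'k, 'p, 'q) func, ('i, 'k, 'p, 'q) ntrans) func" where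
  "precomp K E = \<lparr>Src = Fun (Tgt K) E, Tgt = Fun (Src K) E,
     FO = (\<lambda>X\<in>Obj (Fun (Tgt K) E). X \<bullet> K),
     FA = (\<lambda>\<tau>\<in>Arr (Fun (Tgt K) E). \<lparr>NDom = NDom \<tau> \<bullet> K, NCod = NCod \<tau> \<bullet> K,
                                     At = (\<lambda>x\<in>Obj (Src K). At \<tau> (FO K x))\<rparr>)\<rparr>"


section \<open>Basic constructions\<close>

definition op_cat :: "('o, 'm) cat \<Rightarrow> ('o, 'm) cat" where
  "op_cat C = \<lparr>Obj = Obj C, Arr = Arr C, Dom = Cod C, Cod = Dom C, Ident = Ident C,
               Comp = (\<lambda>g f. f \<cdot>\<^bsub>C\<^esub> g)\<rparr>"

definition op_func :: "('o, 'm, 'p, 'q) func \<Rightarrow> ('o, 'm, 'p, 'q) func" where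
  "op_func F = F\<lparr>Src := op_cat (Src F), Tgt := op_cat (Tgt F)\<rparr>"

definition prod_cat :: "('o, 'm) cat \<Rightarrow> ('p, 'q) cat \<Rightarrow> ('o \<times> 'p, 'm \<times> 'q) cat" where
  "prod_cat C D = \<lparr>Obj = Obj C \<times> Obj D, Arr = Arr C \<times> Arr D,
     Dom = map_prod (Dom C) (Dom D), Cod = map_prod (Cod C) (Cod D),
     Ident = map_prod (Ident C) (Ident D),
     Comp = (\<lambda>g f. (fst g \<cdot>\<^bsub>C\<^esub> fst f, snd g \<cdot>\<^bsub>D\<^esub> snd f))\<rparr>"

definition full_subcat :: "('o, 'm) cat \<Rightarrow> 'o set \<Rightarrow> ('o, 'm) cat" where
  "full_subcat C S = C\<lparr>Obj := Obj C \<inter> S, Arr := {f \<in> Arr C. Dom C f \<in> S \<and> Cod C f \<in> S}\<rparr>"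

text \<open>In several categories below an arrow is a triple (source, underlying datum, target).\<close>

abbreviation mid :: "'a \<times> 'b \<times> 'c \<Rightarrow> 'b" where
  "mid t \<equiv> fst (snd t)"

definition SET :: "('u set, 'u set \<times> ('u \<Rightarrow> 'u) \<times> 'u set) cat" where
  "SET = \<lparr>Obj = UNIV, Arr = {(A, h, B). h \<in> A \<rightarrow>\<^sub>E B}, Dom = fst, Cod = (\<lambda>t. snd (snd t)),
     Ident = (\<lambda>A. (A, (\<lambda>u\<in>A. u), A)),
     Comp = (\<lambda>g f. (fst f, compose (fst f) (mid g) (mid f), snd (snd g)))\<rparr>"

definition CAT :: "(('o, 'm) cat, ('o, 'm, 'o, 'm) func) cat" where
  "CAT = \<lparr>Obj = {C. category C}, Arr = {F. is_functor F}, Dom = Src, Cod = Tgt,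
          Ident = id_func, Comp = comp_func\<rparr>"

definition slice :: "('o, 'm) cat \<Rightarrow> 'o \<Rightarrow> ('m, 'm \<times> 'm \<times> 'm) cat" where
  "slice C a = \<lparr>Obj = {x \<in> Arr C. Cod C x = a},
     Arr = {(x, k, y). x \<in> Arr C \<and> Cod C x = a \<and> y \<in> Arr C \<and> Cod C y = a
                       \<and> k \<in> hom C (Dom C x) (Dom C y) \<and> y \<cdot>\<^bsub>C\<^esub> k = x},
     Dom = fst, Cod = (\<lambda>t. snd (snd t)), Ident = (\<lambda>x. (x, Ident C (Dom C x), x)),
     Comp = (\<lambda>t s. (fst s, mid t \<cdot>\<^bsub>C\<^esub> mid s, snd (snd t)))\<rparr>"

definition coslice :: "('o, 'm) cat \<Rightarrow> 'o \<Rightarrow> ('m, 'm \<times> 'm \<times> 'm) cat" where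
  "coslice C a = \<lparr>Obj = {x \<in> Arr C. Dom C x = a},
     Arr = {(x, k, y). x \<in> Arr C \<and> Dom C x = a \<and> y \<in> Arr C \<and> Dom C y = a
                       \<and> k \<in> hom C (Cod C x) (Cod C y) \<and> k \<cdot>\<^bsub>C\<^esub> x = y},
     Dom = fst, Cod = (\<lambda>t. snd (snd t)), Ident = (\<lambda>x. (x, Ident C (Cod C x), x)),
     Comp = (\<lambda>t s. (fst s, mid t \<cdot>\<^bsub>C\<^esub> mid s, snd (snd t)))\<rparr>"

text \<open>\<open>(n/N)\<degree>\<close> and its projection to \<open>N\<close>.\<close>

definition strict_coslice :: "('n, 'a) cat \<Rightarrow> 'n \<Rightarrow> ('a, 'a \<times> 'a \<times> 'a) cat" where
  "strict_coslice N n = full_subcat (coslice N n) (- {Ident N n})"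

definition strict_coslice_proj :: "('n, 'a) cat \<Rightarrow> 'n \<Rightarrow> ('a, 'a \<times> 'a \<times> 'a, 'n, 'a) func" where
  "strict_coslice_proj N n = \<lparr>Src = strict_coslice N n, Tgt = N,
     FO = (\<lambda>x\<in>Obj (strict_coslice N n). Cod N x), FA = (\<lambda>t\<in>Arr (strict_coslice N n). mid t)\<rparr>"

definition elements :: "('j, 'k, 'u set, 'u set \<times> ('u \<Rightarrow> 'u) \<times> 'u set) func \<Rightarrow>
    ('j \<times> 'u, ('j \<times> 'u) \<times> 'k \<times> ('j \<times> 'u)) cat" where
  "elements F = \<lparr>Obj = (SIGMA j:Obj (Src F). FO F j),
     Arr = {((j, u), \<beta>, (j', u')). u \<in> FO F j \<and> \<beta> \<in> hom (Src F) j j' \<and> mid (FA F \<beta>) u = u'},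
     Dom = fst, Cod = (\<lambda>t. snd (snd t)), Ident = (\<lambda>x. (x, Ident (Src F) (fst x), x)),
     Comp = (\<lambda>t s. (fst s, mid t \<cdot>\<^bsub>Src F\<^esub> mid s, snd (snd t)))\<rparr>"

definition elements_proj :: "('j, 'k, 'u set, 'u set \<times> ('u \<Rightarrow> 'u) \<times> 'u set) func \<Rightarrow>
    ('j \<times> 'u, ('j \<times> 'u) \<times> 'k \<times> ('j \<times> 'u), 'j, 'k) func" where
  "elements_proj F = \<lparr>Src = elements F, Tgt = Src F,
     FO = (\<lambda>x\<in>Obj (elements F). fst x), FA = (\<lambda>t\<in>Arr (elements F). mid t)\<rparr>"


section \<open>Profunctors and collages\<close>

type_synonym ('b, 'c, 'j, 'k, 'u) prof =
  "('b \<times> 'j, 'c \<times> 'k, 'u set, 'u set \<times> ('u \<Rightarrow> 'u) \<times> 'u set) func"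

definition is_profunctor :: "('b, 'c) cat \<Rightarrow> ('j, 'k) cat \<Rightarrow> ('b, 'c, 'j, 'k, 'u) prof \<Rightarrow> bool" where
  "is_profunctor D J P \<longleftrightarrow> category D \<and> category J \<and> is_functor P
     \<and> Src P = prod_cat (op_cat D) J \<and> Tgt P = SET"

text \<open>\<open>P(i,-)\<close> as a functor on \<open>J\<close>.\<close>

definition prof_at :: "('b, 'c) cat \<Rightarrow> ('j, 'k) cat \<Rightarrow> ('b, 'c, 'j, 'k, 'u) prof \<Rightarrow> 'b \<Rightarrow>
    ('j, 'k, 'u set, 'u set \<times> ('u \<Rightarrow> 'u) \<times> 'u set) func" where
  "prof_at D J P i = \<lparr>Src = J, Tgt = SET, FO = (\<lambda>j\<in>Obj J. FO P (i, j)),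
                      FA = (\<lambda>\<beta>\<in>Arr J. FA P (Ident D i, \<beta>))\<rparr>"

text \<open>The collage has object set \<open>ob J \<squnion> ob D\<close>; its arrows are those of \<open>J\<close> (\<open>ArrL\<close>), those of
  \<open>D\<close> (\<open>ArrR\<close>), and for \<open>u \<in> P(i,j)\<close> an arrow \<open>Het i u j : i \<rightarrow> j\<close>.\<close>

datatype ('b, 'c, 'j, 'k, 'u) collage_arr = ArrL 'k | ArrR 'c | Het 'b 'u 'j

fun collage_dom :: "('b, 'c) cat \<Rightarrow> ('j, 'k) cat \<Rightarrow> ('b, 'c, 'j, 'k, 'u) collage_arr \<Rightarrow> 'j + 'b" where
  "collage_dom D J (ArrL \<beta>) = Inl (Dom J \<beta>)"
| "collage_dom D J (ArrR \<gamma>) = Inr (Dom D \<gamma>)"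
| "collage_dom D J (Het i u j) = Inr i"

fun collage_cod :: "('b, 'c) cat \<Rightarrow> ('j, 'k) cat \<Rightarrow> ('b, 'c, 'j, 'k, 'u) collage_arr \<Rightarrow> 'j + 'b" where
  "collage_cod D J (ArrL \<beta>) = Inl (Cod J \<beta>)"
| "collage_cod D J (ArrR \<gamma>) = Inr (Cod D \<gamma>)"
| "collage_cod D J (Het i u j) = Inl j"

fun collage_comp :: "('b, 'c) cat \<Rightarrow> ('j, 'k) cat \<Rightarrow> ('b, 'c, 'j, 'k, 'u) prof \<Rightarrow>
    ('b, 'c, 'j, 'k, 'u) collage_arr \<Rightarrow> ('b, 'c, 'j, 'k, 'u) collage_arr \<Rightarrow>
    ('b, 'c, 'j, 'k, 'u) collage_arr" where
  "collage_comp D J P (ArrL \<beta>') (ArrL \<beta>) = ArrL (\<beta>' \<cdot>\<^bsub>J\<^esub> \<beta>)"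
| "collage_comp D J P (ArrR \<gamma>') (ArrR \<gamma>) = ArrR (\<gamma>' \<cdot>\<^bsub>D\<^esub> \<gamma>)"
| "collage_comp D J P (ArrL \<beta>) (Het i u j) = Het i (mid (FA P (Ident D i, \<beta>)) u) (Cod J \<beta>)"
| "collage_comp D J P (Het i u j) (ArrR \<gamma>) = Het (Dom D \<gamma>) (mid (FA P (\<gamma>, Ident J j)) u) j"
| "collage_comp D J P _ _ = undefined"

definition collage :: "('b, 'c) cat \<Rightarrow> ('j, 'k) cat \<Rightarrow> ('b, 'c, 'j, 'k, 'u) prof \<Rightarrow>
    ('j + 'b, ('b, 'c, 'j, 'k, 'u) collage_arr) cat" where
  "collage D J P = \<lparr>Obj = Inl ` Obj J \<union> Inr ` Obj D,
     Arr = ArrL ` Arr J \<union> ArrR ` Arr D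
           \<union> {Het i u j | i u j. i \<in> Obj D \<and> j \<in> Obj J \<and> u \<in> FO P (i, j)},
     Dom = collage_dom D J, Cod = collage_cod D J,
     Ident = case_sum (\<lambda>j. ArrL (Ident J j)) (\<lambda>i. ArrR (Ident D i)),
     Comp = collage_comp D J P\<rparr>"

definition collage_inl :: "('b, 'c) cat \<Rightarrow> ('j, 'k) cat \<Rightarrow> ('b, 'c, 'j, 'k, 'u) prof \<Rightarrow>
    ('j, 'k, 'j + 'b, ('b, 'c, 'j, 'k, 'u) collage_arr) func" where
  "collage_inl D J P = \<lparr>Src = J, Tgt = collage D J P, FO = (\<lambda>j\<in>Obj J. Inl j), FA = (\<lambda>\<beta>\<in>Arr J. ArrL \<beta>)\<rparr>"

definition collage_inr :: "('b, 'c) cat \<Rightarrow> ('j, 'k) cat \<Rightarrow> ('b, 'c, 'j, 'k, 'u) prof \<Rightarrow>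
    ('b, 'c, 'j + 'b, ('b, 'c, 'j, 'k, 'u) collage_arr) func" where
  "collage_inr D J P = \<lparr>Src = D, Tgt = collage D J P, FO = (\<lambda>i\<in>Obj D. Inr i), FA = (\<lambda>\<gamma>\<in>Arr D. ArrR \<gamma>)\<rparr>"


section \<open>Colimits in Cat\<close>

text \<open>The colimit of \<open>D : J \<rightarrow> Cat\<close>, constructed as usual. Its objects are the classes of pairs
  \<open>(j, x)\<close>, \<open>x \<in> D j\<close>, under the equivalence relation generated by \<open>(j, x) \<sim> (j', D\<^sub>\<alpha> x)\<close> for
  \<open>\<alpha> : j \<rightarrow> j'\<close>; this is the vertex set of a graph with an edge \<open>(j, f) : [j, x] \<rightarrow> [j, y]\<close> for each
  \<open>f : x \<rightarrow> y\<close> in \<open>D j\<close>. Its arrows are the paths in this graph (listed in diagrammatic order)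
  modulo the congruence generated by \<open>(j, f) \<sim> (j', D\<^sub>\<alpha> f)\<close>, by \<open>(j, f)(j, g) \<sim> (j, g f)\<close> and by
  \<open>(j, id) \<sim> []\<close>. The universal property is proved below, for target categories of arbitrary type.\<close>

definition colim_pt_rel :: "('j, 'k, ('o, 'm) cat, ('o, 'm, 'o, 'm) func) func \<Rightarrow> (('j \<times> 'o) \<times> ('j \<times> 'o)) set" where
  "colim_pt_rel D = {((Dom (Src D) \<alpha>, x), (Cod (Src D) \<alpha>, FO (FA D \<alpha>) x)) | \<alpha> x.
                     \<alpha> \<in> Arr (Src D) \<and> x \<in> Obj (FO D (Dom (Src D) \<alpha>))}"

definition colim_pt :: "('j, 'k, ('o, 'm) cat, ('o, 'm, 'o, 'm) func) func \<Rightarrow> 'j \<Rightarrow> 'o \<Rightarrow> ('j \<times> 'o) set" where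
  "colim_pt D j x = (colim_pt_rel D \<union> (colim_pt_rel D)\<inverse>)\<^sup>* `` {(j, x)}"

definition colim_pts :: "('j, 'k, ('o, 'm) cat, ('o, 'm, 'o, 'm) func) func \<Rightarrow> ('j \<times> 'o) set set" where
  "colim_pts D = {colim_pt D j x | j x. j \<in> Obj (Src D) \<and> x \<in> Obj (FO D j)}"

fun colim_path :: "('j, 'k, ('o, 'm) cat, ('o, 'm, 'o, 'm) func) func \<Rightarrow>
    ('j \<times> 'o) set \<Rightarrow> ('j \<times> 'm) list \<Rightarrow> ('j \<times> 'o) set \<Rightarrow> bool" where
  "colim_path D v [] w \<longleftrightarrow> v \<in> colim_pts D \<and> v = w"
| "colim_path D v ((j, f) # es) w \<longleftrightarrow> j \<in> Obj (Src D) \<and> f \<in> Arr (FO D j)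
     \<and> v = colim_pt D j (Dom (FO D j) f) \<and> colim_path D (colim_pt D j (Cod (FO D j) f)) es w"

inductive colim_step :: "('j, 'k, ('o, 'm) cat, ('o, 'm, 'o, 'm) func) func \<Rightarrow>
    ('j \<times> 'm) list \<Rightarrow> ('j \<times> 'm) list \<Rightarrow> bool" for D where
  transport: "\<alpha> \<in> hom (Src D) j j' \<Longrightarrow> f \<in> Arr (FO D j) \<Longrightarrow>
     colim_step D (xs @ [(j, f)] @ ys) (xs @ [(j', FA (FA D \<alpha>) f)] @ ys)"
| composite: "j \<in> Obj (Src D) \<Longrightarrow> f \<in> hom (FO D j) x y \<Longrightarrow> g \<in> hom (FO D j) y z \<Longrightarrow>
     colim_step D (xs @ [(j, f), (j, g)] @ ys) (xs @ [(j, g \<cdot>\<^bsub>FO D j\<^esub> f)] @ ys)"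
| identity: "j \<in> Obj (Src D) \<Longrightarrow> x \<in> Obj (FO D j) \<Longrightarrow>
     colim_step D (xs @ [(j, Ident (FO D j) x)] @ ys) (xs @ ys)"

text \<open>Steps are only taken between paths with the same end points \<open>v\<close>, \<open>w\<close>.\<close>

definition colim_arr_rel :: "('j, 'k, ('o, 'm) cat, ('o, 'm, 'o, 'm) func) func \<Rightarrow>
    ('j \<times> 'o) set \<Rightarrow> ('j \<times> 'o) set \<Rightarrow> (('j \<times> 'm) list \<times> ('j \<times> 'm) list) set" where
  "colim_arr_rel D v w = {(es, es'). colim_path D v es w \<and> colim_path D v es' w
                          \<and> (colim_step D es es' \<or> colim_step D es' es)}"

type_synonym ('j, 'o, 'm) colim_arr = "('j \<times> 'o) set \<times> ('j \<times> 'm) list set \<times> ('j \<times> 'o) set"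

definition colim_arr :: "('j, 'k, ('o, 'm) cat, ('o, 'm, 'o, 'm) func) func \<Rightarrow>
    ('j \<times> 'o) set \<Rightarrow> ('j \<times> 'm) list \<Rightarrow> ('j \<times> 'o) set \<Rightarrow> ('j, 'o, 'm) colim_arr" where
  "colim_arr D v es w = (v, (colim_arr_rel D v w)\<^sup>* `` {es}, w)"

definition colim :: "('j, 'k, ('o, 'm) cat, ('o, 'm, 'o, 'm) func) func \<Rightarrow>
    (('j \<times> 'o) set, ('j, 'o, 'm) colim_arr) cat" where
  "colim D = \<lparr>Obj = colim_pts D, Arr = {colim_arr D v es w | v es w. colim_path D v es w},
     Dom = fst, Cod = (\<lambda>t. snd (snd t)), Ident = (\<lambda>v. colim_arr D v [] v),
     Comp = (\<lambda>t s. colim_arr D (fst s) ((SOME es. es \<in> mid s) @ (SOME es. es \<in> mid t)) (snd (snd t)))\<rparr>"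

definition coproj :: "('j, 'k, ('o, 'm) cat, ('o, 'm, 'o, 'm) func) func \<Rightarrow> 'j \<Rightarrow>
    ('o, 'm, ('j \<times> 'o) set, ('j, 'o, 'm) colim_arr) func" where
  "coproj D j = \<lparr>Src = FO D j, Tgt = colim D, FO = (\<lambda>x\<in>Obj (FO D j). colim_pt D j x),
     FA = (\<lambda>f\<in>Arr (FO D j). colim_arr D (colim_pt D j (Dom (FO D j) f)) [(j, f)]
                                           (colim_pt D j (Cod (FO D j) f)))\<rparr>"

lemma rtrancl_class_eq_iff:
  assumes "sym (r\<^sup>*)" shows "r\<^sup>* `` {a} = r\<^sup>* `` {b} \<longleftrightarrow> (a, b) \<in> r\<^sup>*"
proof
  assume "r\<^sup>* `` {a} = r\<^sup>* `` {b}" then show "(a, b) \<in> r\<^sup>*" by auto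
next
  assume "(a, b) \<in> r\<^sup>*"
  moreover have "(b, a) \<in> r\<^sup>*" using assms calculation by (rule symD)
  ultimately show "r\<^sup>* `` {a} = r\<^sup>* `` {b}" by (auto intro: rtrancl_trans)
qed

context
  fixes D :: "('j, 'k, ('o, 'm) cat, ('o, 'm, 'o, 'm) func) func"
  assumes D: "is_functor D" and DT: "Tgt D = CAT"
begin

lemma colim_fibre: "j \<in> Obj (Src D) \<Longrightarrow> category (FO D j)"
  using D DT by (auto simp: is_functor_def CAT_def PiE_def)

lemma colim_trans:
  assumes "\<alpha> \<in> Arr (Src D)"
  shows "is_functor (FA D \<alpha>)" "Src (FA D \<alpha>) = FO D (Dom (Src D) \<alpha>)" "Tgt (FA D \<alpha>) = FO D (Cod (Src D) \<alpha>)"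
    "Dom (Src D) \<alpha> \<in> Obj (Src D)" "Cod (Src D) \<alpha> \<in> Obj (Src D)"
proof -
  have "FA D \<in> Arr (Src D) \<rightarrow> Arr (Tgt D)" using D unfolding is_functor_def PiE_def by blast
  then show "is_functor (FA D \<alpha>)" using assms DT by (auto simp: CAT_def)
  have "Dom (Tgt D) (FA D \<alpha>) = FO D (Dom (Src D) \<alpha>)" "Cod (Tgt D) (FA D \<alpha>) = FO D (Cod (Src D) \<alpha>)"
    using D assms unfolding is_functor_def by blast+
  then show "Src (FA D \<alpha>) = FO D (Dom (Src D) \<alpha>)" "Tgt (FA D \<alpha>) = FO D (Cod (Src D) \<alpha>)"
    by (simp_all add: DT CAT_def)
  show "Dom (Src D) \<alpha> \<in> Obj (Src D)" "Cod (Src D) \<alpha> \<in> Obj (Src D)"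
    using D assms unfolding is_functor_def by (blast intro: category.dom_in category.cod_in)+
qed

lemma colim_pt_in: "j \<in> Obj (Src D) \<Longrightarrow> x \<in> Obj (FO D j) \<Longrightarrow> colim_pt D j x \<in> colim_pts D"
  by (auto simp: colim_pts_def)

lemma colim_pt_eq_iff:
  "colim_pt D j x = colim_pt D j' x' \<longleftrightarrow> ((j, x), (j', x')) \<in> (colim_pt_rel D \<union> (colim_pt_rel D)\<inverse>)\<^sup>*"
  unfolding colim_pt_def by (intro rtrancl_class_eq_iff sym_rtrancl) (auto simp: sym_def)


lemma colim_pt_trans:
  "\<alpha> \<in> Arr (Src D) \<Longrightarrow> x \<in> Obj (FO D (Dom (Src D) \<alpha>)) \<Longrightarrow>
   colim_pt D (Cod (Src D) \<alpha>) (FO (FA D \<alpha>) x) = colim_pt D (Dom (Src D) \<alpha>) x"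
  unfolding colim_pt_eq_iff by (rule r_into_rtrancl) (auto simp: colim_pt_rel_def)

lemma colim_path_ends: "colim_path D v es w \<Longrightarrow> v \<in> colim_pts D \<and> w \<in> colim_pts D"
proof (induction es arbitrary: v)
  case (Cons e es) then show ?case
    by (cases e) (auto intro!: colim_pt_in category.dom_in colim_fibre)
qed auto

lemma colim_path_append: "colim_path D v (xs @ ys) w \<longleftrightarrow> (\<exists>u. colim_path D v xs u \<and> colim_path D u ys w)"
proof (induction xs arbitrary: v)
  case Nil then show ?case using colim_path_ends by auto
next
  case (Cons e xs) then show ?case by (cases e) auto
qed

lemma colim_step_context: "colim_step D xs ys \<Longrightarrow> colim_step D (as @ xs @ bs) (as @ ys @ bs)"
proof (induction rule: colim_step.induct)
  case (transport \<alpha> j j' f xs ys)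
  then show ?case using colim_step.transport[of \<alpha> D j j' f "as @ xs" "ys @ bs"] by simp
next
  case (composite j f x y g z xs ys)
  then show ?case using colim_step.composite[of j D f x y g z "as @ xs" "ys @ bs"] by simp
next
  case (identity j x xs ys)
  then show ?case using colim_step.identity[of j D x "as @ xs" "ys @ bs"] by simp
qed

lemma colim_arr_rel_sym: "sym ((colim_arr_rel D v w)\<^sup>*)"
  by (intro sym_rtrancl) (auto simp: sym_def colim_arr_rel_def)

lemma colim_arr_eq_iff:
  "colim_arr D v es w = colim_arr D v' es' w' \<longleftrightarrow> v = v' \<and> w = w' \<and> (es, es') \<in> (colim_arr_rel D v w)\<^sup>*"
  by (simp add: colim_arr_def) (metis rtrancl_class_eq_iff[OF colim_arr_rel_sym])


lemma colim_arr_rel_path: "(es, es') \<in> (colim_arr_rel D v w)\<^sup>* \<Longrightarrow> colim_path D v es w \<Longrightarrow> colim_path D v es' w"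
  by (induction rule: rtrancl_induct) (auto simp: colim_arr_rel_def)

lemma colim_arr_rel_cong:
  assumes "(es, es') \<in> (colim_arr_rel D u w)\<^sup>*" and a: "colim_path D v as u" and b: "colim_path D w bs z"
  shows "(as @ es @ bs, as @ es' @ bs) \<in> (colim_arr_rel D v z)\<^sup>*"
  using assms(1)
proof (induction rule: rtrancl_induct)
  case base show ?case by simp
next
  case (step y y')
  then have "(as @ y @ bs, as @ y' @ bs) \<in> colim_arr_rel D v z"
    using a b by (auto simp: colim_arr_rel_def colim_path_append intro: colim_step_context)
  with step show ?case by simp
qed

lemma colim_comp:
  assumes es: "colim_path D v es u" and fs: "colim_path D u fs w"
  shows "colim_arr D u fs w \<cdot>\<^bsub>colim D\<^esub> colim_arr D v es u = colim_arr D v (es @ fs) w"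
proof -
  define es' where "es' = (SOME es'. es' \<in> (colim_arr_rel D v u)\<^sup>* `` {es})"
  define fs' where "fs' = (SOME fs'. fs' \<in> (colim_arr_rel D u w)\<^sup>* `` {fs})"
  have 1: "(es, es') \<in> (colim_arr_rel D v u)\<^sup>*"
    unfolding es'_def using someI[of "\<lambda>x. x \<in> (colim_arr_rel D v u)\<^sup>* `` {es}" es] by auto
  have 2: "(fs, fs') \<in> (colim_arr_rel D u w)\<^sup>*"
    unfolding fs'_def using someI[of "\<lambda>x. x \<in> (colim_arr_rel D u w)\<^sup>* `` {fs}" fs] by auto
  have p: "v \<in> colim_pts D" "w \<in> colim_pts D" using es fs colim_path_ends by blast+
  have "(es @ fs, es' @ fs) \<in> (colim_arr_rel D v w)\<^sup>*"
    using colim_arr_rel_cong[OF 1, of v "[]" fs w] p fs by simp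
  moreover have "(es' @ fs, es' @ fs') \<in> (colim_arr_rel D v w)\<^sup>*"
    using colim_arr_rel_cong[OF 2, of v es' "[]" w] p colim_arr_rel_path[OF 1 es] by simp
  ultimately have "colim_arr D v (es @ fs) w = colim_arr D v (es' @ fs') w"
    unfolding colim_arr_eq_iff by auto
  then show ?thesis by (simp add: colim_def colim_arr_def es'_def fs'_def)
qed

lemma colim_simps:
  "Obj (colim D) = colim_pts D" "Arr (colim D) = {colim_arr D v es w | v es w. colim_path D v es w}"
  "Dom (colim D) (colim_arr D v es w) = v" "Cod (colim D) (colim_arr D v es w) = w"
  "Ident (colim D) v = colim_arr D v [] v"
  by (simp_all add: colim_def colim_arr_def)

lemma colim_homE:
  assumes "t \<in> hom (colim D) v w"
  obtains es where "t = colim_arr D v es w" "colim_path D v es w"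
  using assms by (auto simp: hom_def colim_simps)

lemma colim_homI: "colim_path D v es w \<Longrightarrow> colim_arr D v es w \<in> hom (colim D) v w"
  by (auto simp: hom_def colim_simps)

lemma category_colim: "category (colim D)"
proof
  show "Dom (colim D) f \<in> Obj (colim D)" if "f \<in> Arr (colim D)" for f
    using that colim_path_ends by (auto simp: colim_simps)
  show "Cod (colim D) f \<in> Obj (colim D)" if "f \<in> Arr (colim D)" for f
    using that colim_path_ends by (auto simp: colim_simps)
  show "Ident (colim D) x \<in> hom (colim D) x x" if "x \<in> Obj (colim D)" for x
    using that by (auto simp: colim_simps intro!: colim_homI)
  show "g \<cdot>\<^bsub>colim D\<^esub> f \<in> hom (colim D) x z"
    if "f \<in> hom (colim D) x y" "g \<in> hom (colim D) y z" for f g x y z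
    using that by (elim colim_homE) (auto simp: colim_comp colim_path_append intro!: colim_homI)
  show "f \<cdot>\<^bsub>colim D\<^esub> Ident (colim D) x = f" if "f \<in> hom (colim D) x y" for f x y
    using that by (elim colim_homE) (use colim_path_ends in \<open>auto simp: colim_simps colim_comp\<close>)
  show "Ident (colim D) y \<cdot>\<^bsub>colim D\<^esub> f = f" if "f \<in> hom (colim D) x y" for f x y
    using that by (elim colim_homE) (use colim_path_ends in \<open>auto simp: colim_simps colim_comp\<close>)
  show "(h \<cdot>\<^bsub>colim D\<^esub> g) \<cdot>\<^bsub>colim D\<^esub> f = h \<cdot>\<^bsub>colim D\<^esub> (g \<cdot>\<^bsub>colim D\<^esub> f)"
    if "f \<in> hom (colim D) w x" "g \<in> hom (colim D) x y" "h \<in> hom (colim D) y z" for f g h w x y z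
  proof -
    from that obtain a b c where
      "f = colim_arr D w a x" "colim_path D w a x" "g = colim_arr D x b y" "colim_path D x b y"
      "h = colim_arr D y c z" "colim_path D y c z" by (metis colim_homE)
    moreover have "colim_path D w (a @ b) y" "colim_path D x (b @ c) z"
      using calculation by (auto simp: colim_path_append)
    ultimately show ?thesis by (simp add: colim_comp)
  qed
qed

lemma colim_path_single:
  assumes "j \<in> Obj (Src D)" "f \<in> Arr (FO D j)"
  shows "colim_path D (colim_pt D j (Dom (FO D j) f)) [(j, f)] (colim_pt D j (Cod (FO D j) f))"
  using assms by (auto intro!: colim_pt_in category.cod_in colim_fibre)

lemma is_functor_coproj:
  assumes j: "j \<in> Obj (Src D)"
  shows "is_functor (coproj D j)"
proof -
  interpret C: category "FO D j" by (rule colim_fibre[OF j])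
  have s: "Src (coproj D j) = FO D j" "Tgt (coproj D j) = colim D" by (simp_all add: coproj_def)
  show ?thesis unfolding is_functor_def s
  proof (intro conjI ballI impI)
    show "category (FO D j)" by (rule colim_fibre[OF j])
    show "category (colim D)" by (rule category_colim)
    show "FO (coproj D j) \<in> Obj (FO D j) \<rightarrow>\<^sub>E Obj (colim D)"
      by (auto simp: coproj_def colim_simps j intro: colim_pt_in)
    show "FA (coproj D j) \<in> Arr (FO D j) \<rightarrow>\<^sub>E Arr (colim D)"
      unfolding coproj_def colim_simps using colim_path_single[OF j]
      by (intro PiE_I) (simp_all del: colim_path.simps, blast)
    show "Dom (colim D) (FA (coproj D j) f) = FO (coproj D j) (Dom (FO D j) f)" if "f \<in> Arr (FO D j)" for f
      using that by (simp add: coproj_def colim_simps C.dom_in)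
    show "Cod (colim D) (FA (coproj D j) f) = FO (coproj D j) (Cod (FO D j) f)" if "f \<in> Arr (FO D j)" for f
      using that by (simp add: coproj_def colim_simps C.cod_in)
    show "FA (coproj D j) (Ident (FO D j) x) = Ident (colim D) (FO (coproj D j) x)" if x: "x \<in> Obj (FO D j)" for x
    proof -
      have i: "Ident (FO D j) x \<in> Arr (FO D j)" "Dom (FO D j) (Ident (FO D j) x) = x"
        "Cod (FO D j) (Ident (FO D j) x) = x" using C.ident_in[OF x] by (auto simp: hom_def)
      have "([(j, Ident (FO D j) x)], []) \<in> colim_arr_rel D (colim_pt D j x) (colim_pt D j x)"
        using colim_path_single[OF j i(1)] colim_step.identity[of j D x "[]" "[]"] j x
        by (auto simp: colim_arr_rel_def i colim_pt_in)
      then show ?thesis using x i by (auto simp: coproj_def colim_simps colim_arr_eq_iff)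
    qed
    show "FA (coproj D j) (g \<cdot>\<^bsub>FO D j\<^esub> f) = FA (coproj D j) g \<cdot>\<^bsub>colim D\<^esub> FA (coproj D j) f"
      if f: "f \<in> Arr (FO D j)" and g: "g \<in> Arr (FO D j)" and c: "Cod (FO D j) f = Dom (FO D j) g" for f g
    proof -
      have h: "g \<cdot>\<^bsub>FO D j\<^esub> f \<in> hom (FO D j) (Dom (FO D j) f) (Cod (FO D j) g)"
        using f g c by (intro C.comp_in[of _ _ "Cod (FO D j) f"]) (auto simp: hom_def)
      note pf = colim_path_single[OF j f] and pg = colim_path_single[OF j g]
      have pfg: "colim_path D (colim_pt D j (Dom (FO D j) f)) ([(j, f)] @ [(j, g)]) (colim_pt D j (Cod (FO D j) g))"
        using pf pg c unfolding colim_path_append by auto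
      have "([(j, f), (j, g)], [(j, g \<cdot>\<^bsub>FO D j\<^esub> f)])
          \<in> colim_arr_rel D (colim_pt D j (Dom (FO D j) f)) (colim_pt D j (Cod (FO D j) g))"
        using pfg colim_path_single[OF j, of "g \<cdot>\<^bsub>FO D j\<^esub> f"] h f g c
          colim_step.composite[of j D f "Dom (FO D j) f" "Cod (FO D j) f" g "Cod (FO D j) g" "[]" "[]"] j
        by (simp add: colim_arr_rel_def hom_def)
      moreover have "colim_arr D (colim_pt D j (Dom (FO D j) g)) [(j, g)] (colim_pt D j (Cod (FO D j) g))
          \<cdot>\<^bsub>colim D\<^esub> colim_arr D (colim_pt D j (Dom (FO D j) f)) [(j, f)] (colim_pt D j (Cod (FO D j) f))
          = colim_arr D (colim_pt D j (Dom (FO D j) f)) [(j, f), (j, g)] (colim_pt D j (Cod (FO D j) g))"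
        using colim_comp[OF pf, of "[(j, g)]"] pg c by simp
      ultimately show ?thesis using f g h
        by (auto simp: coproj_def hom_def colim_arr_eq_iff colim_arr_rel_sym[THEN symD] r_into_rtrancl)
    qed
  qed
qed

lemma coproj_cocone:
  assumes a: "\<alpha> \<in> Arr (Src D)"
  shows "coproj D (Cod (Src D) \<alpha>) \<bullet> FA D \<alpha> = coproj D (Dom (Src D) \<alpha>)"
proof -
  let ?j = "Dom (Src D) \<alpha>" and ?k = "Cod (Src D) \<alpha>"
  note t = colim_trans[OF a]
  interpret C: category "FO D ?j" by (rule colim_fibre[OF t(4)])
  have o: "FO (FA D \<alpha>) x \<in> Obj (FO D ?k)" if "x \<in> Obj (FO D ?j)" for x
    using t(1) that by (auto simp: is_functor_def t(2,3))
  have m: "FA (FA D \<alpha>) f \<in> Arr (FO D ?k)" "Dom (FO D ?k) (FA (FA D \<alpha>) f) = FO (FA D \<alpha>) (Dom (FO D ?j) f)"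
    "Cod (FO D ?k) (FA (FA D \<alpha>) f) = FO (FA D \<alpha>) (Cod (FO D ?j) f)" if "f \<in> Arr (FO D ?j)" for f
    using t(1) that by (auto simp: is_functor_def t(2,3))
  have "colim_arr D (colim_pt D ?j (Dom (FO D ?j) f)) [(?k, FA (FA D \<alpha>) f)] (colim_pt D ?j (Cod (FO D ?j) f))
      = colim_arr D (colim_pt D ?j (Dom (FO D ?j) f)) [(?j, f)] (colim_pt D ?j (Cod (FO D ?j) f))"
    if f: "f \<in> Arr (FO D ?j)" for f
  proof -
    have "([(?j, f)], [(?k, FA (FA D \<alpha>) f)])
        \<in> colim_arr_rel D (colim_pt D ?j (Dom (FO D ?j) f)) (colim_pt D ?j (Cod (FO D ?j) f))"
      using colim_path_single[OF t(4) f] colim_path_single[OF t(5) m(1)[OF f]] m[OF f]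
        colim_pt_trans[OF a] f colim_step.transport[of \<alpha> D ?j ?k f "[]" "[]"] a
      by (simp add: colim_arr_rel_def hom_def C.dom_in C.cod_in)
    then show ?thesis unfolding colim_arr_eq_iff by (auto intro: colim_arr_rel_sym[THEN symD])
  qed
  then show ?thesis
    by (auto simp: comp_func_def coproj_def t(2) o m colim_pt_trans[OF a] C.dom_in C.cod_in intro!: restrict_ext)
qed

end

text \<open>The functor induced by a cocone \<open>c\<close>.\<close>

fun colim_eval :: "('j \<Rightarrow> ('o, 'm, 'p, 'q) func) \<Rightarrow> ('p, 'q) cat \<Rightarrow> 'p \<Rightarrow> ('j \<times> 'm) list \<Rightarrow> 'q" where
  "colim_eval c T y [] = Ident T y"
| "colim_eval c T y ((j, f) # es) = colim_eval c T (Cod T (FA (c j) f)) es \<cdot>\<^bsub>T\<^esub> FA (c j) f"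

definition colim_desc_pt :: "('j \<Rightarrow> ('o, 'm, 'p, 'q) func) \<Rightarrow> ('j \<times> 'o) set \<Rightarrow> 'p" where
  "colim_desc_pt c v = (let (j, x) = SOME p. p \<in> v in FO (c j) x)"

lemma colim_universal:
  fixes D :: "('j, 'k, ('o, 'm) cat, ('o, 'm, 'o, 'm) func) func" and T :: "('p, 'q) cat"
    and c :: "'j \<Rightarrow> ('o, 'm, 'p, 'q) func"
  assumes D: "is_functor D" and DT: "Tgt D = CAT" and T: "category T"
    and c: "\<And>j. j \<in> Obj (Src D) \<Longrightarrow> is_functor (c j) \<and> Src (c j) = FO D j \<and> Tgt (c j) = T"
    and cocone: "\<And>\<alpha>. \<alpha> \<in> Arr (Src D) \<Longrightarrow> c (Cod (Src D) \<alpha>) \<bullet> FA D \<alpha> = c (Dom (Src D) \<alpha>)"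
  shows "\<exists>!U. is_functor U \<and> Src U = colim D \<and> Tgt U = T \<and> (\<forall>j\<in>Obj (Src D). U \<bullet> coproj D j = c j)"
proof -
  interpret T: category T by (rule T)
  note s = colim_simps[OF D DT]
  note fib = colim_fibre[OF D DT]
  note tr = colim_trans[OF D DT]
  have cO: "FO (c j) x \<in> Obj T" if "j \<in> Obj (Src D)" "x \<in> Obj (FO D j)" for j x
    using c[OF that(1)] that(2) by (auto simp: is_functor_def)
  have cA: "FA (c j) f \<in> hom T (FO (c j) (Dom (FO D j) f)) (FO (c j) (Cod (FO D j) f))"
    if "j \<in> Obj (Src D)" "f \<in> Arr (FO D j)" for j f
    using c[OF that(1)] that(2) by (auto simp: is_functor_def hom_def)
  have ccO: "FO (c (Cod (Src D) \<alpha>)) (FO (FA D \<alpha>) x) = FO (c (Dom (Src D) \<alpha>)) x"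
    if a: "\<alpha> \<in> Arr (Src D)" and x: "x \<in> Obj (FO D (Dom (Src D) \<alpha>))" for \<alpha> x
    using arg_cong[OF cocone[OF a], of "\<lambda>F. FO F x"] x by (simp add: comp_func_def tr[OF a])
  have ccA: "FA (c (Cod (Src D) \<alpha>)) (FA (FA D \<alpha>) f) = FA (c (Dom (Src D) \<alpha>)) f"
    if a: "\<alpha> \<in> Arr (Src D)" and f: "f \<in> Arr (FO D (Dom (Src D) \<alpha>))" for \<alpha> f
    using arg_cong[OF cocone[OF a], of "\<lambda>F. FA F f"] f by (simp add: comp_func_def tr[OF a])
  have rel: "FO (c j) x = FO (c j') x'"
    if "((j, x), (j', x')) \<in> (colim_pt_rel D \<union> (colim_pt_rel D)\<inverse>)\<^sup>*" for j x j' x'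
    using that by (induction rule: rtrancl_induct2) (auto simp: colim_pt_rel_def ccO)
  have pt: "colim_desc_pt c (colim_pt D j x) = FO (c j) x" for j x
  proof -
    obtain j' x' where e: "(SOME p. p \<in> colim_pt D j x) = (j', x')" by (metis surj_pair)
    have "(j, x) \<in> colim_pt D j x" by (auto simp: colim_pt_def)
    then have "(j', x') \<in> colim_pt D j x" using someI[of "\<lambda>p. p \<in> colim_pt D j x"] e by metis
    then show ?thesis using rel[of j x j' x'] by (simp add: colim_desc_pt_def e) (auto simp: colim_pt_def)
  qed
  have ptin: "colim_desc_pt c v \<in> Obj T" if "v \<in> colim_pts D" for v
    using that by (auto simp: colim_pts_def pt cO)
  let ?e = "\<lambda>v. colim_eval c T (colim_desc_pt c v)"
  have ehom: "colim_path D v es w \<Longrightarrow> ?e v es \<in> hom T (colim_desc_pt c v) (colim_desc_pt c w)" for v es w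
  proof (induction es arbitrary: v)
    case Nil then show ?case by (auto intro: T.ident_in ptin)
  next
    case (Cons p es)
    obtain j f where p: "p = (j, f)" by force
    from Cons.prems have j: "j \<in> Obj (Src D)" and f: "f \<in> Arr (FO D j)"
      and v: "v = colim_pt D j (Dom (FO D j) f)" and r: "colim_path D (colim_pt D j (Cod (FO D j) f)) es w"
      by (auto simp: p)
    show ?case using Cons.IH[OF r] cA[OF j f] T.comp_in by (auto simp: p v pt hom_def)
  qed
  have eapp: "?e v (xs @ ys) = ?e u ys \<cdot>\<^bsub>T\<^esub> ?e v xs"
    if "colim_path D v xs u" "colim_path D u ys w" for v xs u ys w
    using that
  proof (induction xs arbitrary: v)
    case Nil
    then show ?case using T.ident_right[OF ehom[OF Nil(2)]] by simp
  next
    case (Cons p xs)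
    obtain j f where p: "p = (j, f)" by force
    from Cons.prems have j: "j \<in> Obj (Src D)" and f: "f \<in> Arr (FO D j)"
      and v: "v = colim_pt D j (Dom (FO D j) f)" and r: "colim_path D (colim_pt D j (Cod (FO D j) f)) xs u"
      by (auto simp: p)
    have cf: "Cod T (FA (c j) f) = colim_desc_pt c (colim_pt D j (Cod (FO D j) f))"
      using cA[OF j f] by (simp add: hom_def pt)
    show ?case unfolding p append_Cons colim_eval.simps cf Cons.IH[OF r Cons.prems(2)]
      by (rule T.assoc[OF _ ehom[OF r] ehom[OF Cons.prems(2)]]) (use cA[OF j f] in \<open>simp add: pt\<close>)
  qed
  have sing: "?e (colim_pt D j (Dom (FO D j) f)) [(j, f)] = FA (c j) f"
    if "j \<in> Obj (Src D)" "f \<in> Arr (FO D j)" for j f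
    using cA[OF that] T.ident_left[OF cA[OF that]] by (simp add: hom_def)
  have step: "?e v es = ?e v es'" if "colim_step D es es'" "colim_path D v es w" for v es es' w
  proof -
    have key: "?e v (xs @ m @ ys) = ?e v (xs @ m' @ ys)"
      if "colim_path D v xs u" "colim_path D u m u'" "colim_path D u m' u'" "colim_path D u' ys w" "?e u m = ?e u m'"
      for xs ys m m' u u'
      using that by (simp add: eapp[OF that(1), of _ w] eapp[OF that(2,4)] eapp[OF that(3,4)]
          colim_path_append[OF D DT] exI[of _ u'])
    from that show ?thesis
    proof (induction rule: colim_step.induct)
      case (transport \<alpha> j j' f xs ys)
      then have a: "\<alpha> \<in> Arr (Src D)" and j: "j = Dom (Src D) \<alpha>" "j' = Cod (Src D) \<alpha>"
        by (auto simp: hom_def)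
      note t = tr[OF a, folded j]
      have m: "FA (FA D \<alpha>) f \<in> Arr (FO D j')" "Dom (FO D j') (FA (FA D \<alpha>) f) = FO (FA D \<alpha>) (Dom (FO D j) f)"
        "Cod (FO D j') (FA (FA D \<alpha>) f) = FO (FA D \<alpha>) (Cod (FO D j) f)"
        using t(1) transport(2) by (auto simp: is_functor_def t(2,3))
      have e: "Dom (FO D j) f \<in> Obj (FO D j)" "Cod (FO D j) f \<in> Obj (FO D j)"
        using fib[OF t(4)] transport(2) by (auto simp: category.dom_in category.cod_in)
      obtain u u' where u: "colim_path D v xs u" "colim_path D u [(j, f)] u'" "colim_path D u' ys w"
        using transport.prems by (auto simp: colim_path_append[OF D DT] simp del: append_Cons append_Nil)
      have ue: "u = colim_pt D j (Dom (FO D j) f)" "u' = colim_pt D j (Cod (FO D j) f)" using u(2) by auto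
      have p: "colim_path D u [(j', FA (FA D \<alpha>) f)] u'"
        using colim_path_single[OF D DT t(5) m(1)] colim_pt_trans[OF D DT a, folded j] e ue m by simp
      have "u = colim_pt D j' (Dom (FO D j') (FA (FA D \<alpha>) f))" using p by simp
      then have "?e u [(j, f)] = ?e u [(j', FA (FA D \<alpha>) f)]"
        using sing[OF t(4) transport(2)] sing[OF t(5) m(1)] ccA[OF a, folded j, OF transport(2)] ue by metis
      from key[OF u(1,2) p u(3) this] show ?case .
    next
      case (composite j f x y g z xs ys)
      interpret C: category "FO D j" by (rule fib[OF composite(1)])
      obtain u u' where u: "colim_path D v xs u" "colim_path D u [(j, f), (j, g)] u'" "colim_path D u' ys w"
        using composite.prems by (auto simp: colim_path_append[OF D DT] simp del: append_Cons append_Nil)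
      have f: "f \<in> Arr (FO D j)" "Dom (FO D j) f = x" "Cod (FO D j) f = y"
        and g: "g \<in> Arr (FO D j)" "Dom (FO D j) g = y" "Cod (FO D j) g = z" using composite by (auto simp: hom_def)
      have h: "g \<cdot>\<^bsub>FO D j\<^esub> f \<in> Arr (FO D j)" "Dom (FO D j) (g \<cdot>\<^bsub>FO D j\<^esub> f) = x" "Cod (FO D j) (g \<cdot>\<^bsub>FO D j\<^esub> f) = z"
        using C.comp_in[OF composite(2,3)] by (auto simp: hom_def)
      have ue: "u = colim_pt D j x" "u' = colim_pt D j z" using u(2) by (auto simp: f g)
      have p: "colim_path D u [(j, g \<cdot>\<^bsub>FO D j\<^esub> f)] u'"
        using colim_path_single[OF D DT composite(1) h(1)] by (simp add: ue h)
      have pf: "colim_path D u [(j, f)] (colim_pt D j y)" and pg: "colim_path D (colim_pt D j y) [(j, g)] u'"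
        using colim_path_single[OF D DT composite(1) f(1)] colim_path_single[OF D DT composite(1) g(1)]
        by (simp_all add: ue f g)
      have "FA (c j) (g \<cdot>\<^bsub>FO D j\<^esub> f) = FA (c j) g \<cdot>\<^bsub>T\<^esub> FA (c j) f"
        using c[OF composite(1)] f g by (auto simp: is_functor_def)
      then have "?e u [(j, f), (j, g)] = ?e u [(j, g \<cdot>\<^bsub>FO D j\<^esub> f)]"
        using eapp[OF pf pg] sing[OF composite(1) f(1)] sing[OF composite(1) g(1)] sing[OF composite(1) h(1)]
        by (simp add: ue f g h)
      from key[OF u(1,2) p u(3) this] show ?case by simp
    next
      case (identity j x xs ys)
      interpret C: category "FO D j" by (rule fib[OF identity(1)])
      obtain u u' where u: "colim_path D v xs u" "colim_path D u [(j, Ident (FO D j) x)] u'" "colim_path D u' ys w"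
        using identity.prems by (auto simp: colim_path_append[OF D DT] simp del: append_Cons append_Nil)
      have i: "Ident (FO D j) x \<in> Arr (FO D j)" "Dom (FO D j) (Ident (FO D j) x) = x"
        "Cod (FO D j) (Ident (FO D j) x) = x" using C.ident_in[OF identity(2)] by (auto simp: hom_def)
      have ue: "u = colim_pt D j x" "u' = colim_pt D j x" using u(2) by (auto simp: i)
      have p: "colim_path D u [] u'" using colim_pt_in[OF D DT identity(1,2)] by (simp add: ue)
      have "FA (c j) (Ident (FO D j) x) = Ident T (FO (c j) x)"
        using c[OF identity(1)] identity(2) by (auto simp: is_functor_def)
      then have "?e u [(j, Ident (FO D j) x)] = ?e u []"
        using sing[OF identity(1) i(1)] by (simp add: ue i pt)
      from key[OF u(1,2) p u(3) this] show ?case by simp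
    qed
  qed
  have evrel: "?e v es = ?e v es'" if "(es, es') \<in> (colim_arr_rel D v w)\<^sup>*" for v w es es'
    using that
  proof (induction rule: rtrancl_induct)
    case (step y z)
    then show ?case using step(2) \<open>\<And>v es es' w. colim_step D es es' \<Longrightarrow> colim_path D v es w \<Longrightarrow> ?e v es = ?e v es'\<close>
      unfolding colim_arr_rel_def by auto
  qed simp
  define U where "U = \<lparr>Src = colim D, Tgt = T, FO = (\<lambda>v\<in>colim_pts D. colim_desc_pt c v),
    FA = (\<lambda>t\<in>Arr (colim D). ?e (fst t) (SOME es. es \<in> mid t))\<rparr>"
  have UA: "FA U (colim_arr D v es w) = ?e v es" if "colim_path D v es w" for v es w
  proof -
    define es' where "es' = (SOME es'. es' \<in> (colim_arr_rel D v w)\<^sup>* `` {es})"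
    have "(es, es') \<in> (colim_arr_rel D v w)\<^sup>*"
      unfolding es'_def using someI[of "\<lambda>x. x \<in> (colim_arr_rel D v w)\<^sup>* `` {es}" es] by auto
    then have "?e v es' = ?e v es" using evrel by metis
    moreover have "colim_arr D v es w \<in> Arr (colim D)" using that by (auto simp: s)
    ultimately show ?thesis by (simp add: U_def es'_def) (simp add: colim_arr_def)
  qed
  have Us: "Src U = colim D" "Tgt U = T" by (simp_all add: U_def)
  have UO: "FO U v = colim_desc_pt c v" if "v \<in> colim_pts D" for v using that by (simp add: U_def)
  note ends = colim_path_ends[OF D DT]
  have Uf: "is_functor U" unfolding is_functor_def Us
  proof (intro conjI ballI impI)
    show "category (colim D)" by (rule category_colim[OF D DT])
    show "category T" by (rule T)
    show "FO U \<in> Obj (colim D) \<rightarrow>\<^sub>E Obj T" by (auto simp: U_def s ptin)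
    show "FA U \<in> Arr (colim D) \<rightarrow>\<^sub>E Arr T"
    proof (rule PiE_I)
      fix t assume "t \<in> Arr (colim D)"
      then show "FA U t \<in> Arr T" using ehom by (auto simp: s UA hom_def)
    qed (simp add: U_def)
    show "Dom T (FA U t) = FO U (Dom (colim D) t)" if "t \<in> Arr (colim D)" for t
      using that ehom ends by (auto simp: s UA UO hom_def)
    show "Cod T (FA U t) = FO U (Cod (colim D) t)" if "t \<in> Arr (colim D)" for t
      using that ehom ends by (fastforce simp: s UA UO hom_def)
    show "FA U (Ident (colim D) v) = Ident T (FO U v)" if "v \<in> Obj (colim D)" for v
      using that by (simp add: s UA UO)
    show "FA U (b \<cdot>\<^bsub>colim D\<^esub> a) = FA U b \<cdot>\<^bsub>T\<^esub> FA U a"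
      if a: "a \<in> Arr (colim D)" and b: "b \<in> Arr (colim D)" and ab: "Cod (colim D) a = Dom (colim D) b" for a b
    proof -
      from a obtain v es u where a: "a = colim_arr D v es u" "colim_path D v es u" by (auto simp: s)
      from b ab obtain fs w where b: "b = colim_arr D u fs w" "colim_path D u fs w" by (auto simp: s a)
      have "colim_path D v (es @ fs) w" using a b by (auto simp: colim_path_append[OF D DT])
      then show ?thesis using a b by (simp add: colim_comp[OF D DT] UA eapp)
    qed
  qed
  have Uc: "U \<bullet> coproj D j = c j" if j: "j \<in> Obj (Src D)" for j
  proof -
    have cj: "is_functor (c j)" "Src (c j) = FO D j" "Tgt (c j) = T" using c[OF j] by auto
    have "(\<lambda>x\<in>Obj (FO D j). FO U (FO (coproj D j) x)) = FO (c j)"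
      using cj j by (intro extensionalityI[of _ "Obj (FO D j)"])
        (auto simp: coproj_def UO colim_pt_in[OF D DT] pt is_functor_def PiE_def)
    moreover have "(\<lambda>f\<in>Arr (FO D j). FA U (FA (coproj D j) f)) = FA (c j)"
      using cj j colim_path_single[OF D DT j] by (intro extensionalityI[of _ "Arr (FO D j)"])
        (auto simp: coproj_def UA sing is_functor_def PiE_def simp del: colim_eval.simps)
    moreover have "Src (coproj D j) = FO D j" by (simp add: coproj_def)
    ultimately show ?thesis using cj by (simp add: comp_func_def Us)
  qed
  show ?thesis
  proof (rule ex1I[of _ U])
    show "is_functor U \<and> Src U = colim D \<and> Tgt U = T \<and> (\<forall>j\<in>Obj (Src D). U \<bullet> coproj D j = c j)"
      using Uf Us Uc by auto
  next
    fix V assume V: "is_functor V \<and> Src V = colim D \<and> Tgt V = T \<and> (\<forall>j\<in>Obj (Src D). V \<bullet> coproj D j = c j)"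
    then have Vs: "Src V = colim D" "Tgt V = T" and Vf: "is_functor V" by auto
    have VO1: "FO V (colim_pt D j x) = FO (c j) x" if "j \<in> Obj (Src D)" "x \<in> Obj (FO D j)" for j x
    proof -
      have "FO (V \<bullet> coproj D j) x = FO (c j) x" using V that by auto
      then show ?thesis using that by (simp add: comp_func_def coproj_def)
    qed
    have VA1: "FA V (colim_arr D (colim_pt D j (Dom (FO D j) f)) [(j, f)] (colim_pt D j (Cod (FO D j) f))) = FA (c j) f"
      if "j \<in> Obj (Src D)" "f \<in> Arr (FO D j)" for j f
    proof -
      have "FA (V \<bullet> coproj D j) f = FA (c j) f" using V that by auto
      then show ?thesis using that by (simp add: comp_func_def coproj_def)
    qed
    have VO: "FO V v = colim_desc_pt c v" if "v \<in> colim_pts D" for v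
      using that VO1 by (auto simp: colim_pts_def pt)
    have VA: "colim_path D v es w \<Longrightarrow> FA V (colim_arr D v es w) = ?e v es" for v es w
    proof (induction es arbitrary: v)
      case Nil
      then have v: "v \<in> colim_pts D" "w = v" by auto
      have "FA V (Ident (colim D) v) = Ident T (FO V v)" using Vf v by (auto simp: is_functor_def Vs s)
      then show ?case using v by (simp add: s VO)
    next
      case (Cons p es)
      obtain j f where p: "p = (j, f)" by force
      from Cons.prems have j: "j \<in> Obj (Src D)" and f: "f \<in> Arr (FO D j)"
        and v: "v = colim_pt D j (Dom (FO D j) f)" and r: "colim_path D (colim_pt D j (Cod (FO D j) f)) es w"
        by (auto simp: p)
      let ?u = "colim_pt D j (Cod (FO D j) f)"
      have pf: "colim_path D v [(j, f)] ?u" using colim_path_single[OF D DT j f] by (simp add: v)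
      have "colim_arr D v [(j, f)] ?u \<in> Arr (colim D)" "colim_arr D ?u es w \<in> Arr (colim D)"
        using pf r by (auto simp: s simp del: colim_path.simps)
      then have "FA V (colim_arr D ?u es w \<cdot>\<^bsub>colim D\<^esub> colim_arr D v [(j, f)] ?u)
          = FA V (colim_arr D ?u es w) \<cdot>\<^bsub>T\<^esub> FA V (colim_arr D v [(j, f)] ?u)"
        using Vf unfolding is_functor_def Vs by (simp only: s(3,4) Ball_def)
      then show ?case using Cons.IH[OF r] VA1[OF j f, folded v] colim_comp[OF D DT pf r] cA[OF j f]
        by (simp add: p hom_def pt)
    qed
    have "FO V = FO U"
      by (rule extensionalityI[of _ "colim_pts D"]) (use Vf Uf in \<open>auto simp: is_functor_def Vs Us s PiE_def VO UO\<close>)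
    moreover have "FA V = FA U"
      by (rule extensionalityI[of _ "Arr (colim D)"])
        (use Vf Uf in \<open>auto simp: is_functor_def Vs Us PiE_def s VA UA\<close>)
    ultimately show "V = U" using Vs Us by (intro func.equality) auto
  qed
qed



section \<open>Limits, pullbacks, adjunctions, dependent products\<close>

definition is_cone :: "('j, 'k, 'e, 'f) func \<Rightarrow> 'e \<Rightarrow> ('j \<Rightarrow> 'f) \<Rightarrow> bool" where
  "is_cone F L l \<longleftrightarrow> L \<in> Obj (Tgt F) \<and> (\<forall>j\<in>Obj (Src F). l j \<in> hom (Tgt F) L (FO F j))
     \<and> (\<forall>\<beta>\<in>Arr (Src F). FA F \<beta> \<cdot>\<^bsub>Tgt F\<^esub> l (Dom (Src F) \<beta>) = l (Cod (Src F) \<beta>))"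

definition is_limit :: "('j, 'k, 'e, 'f) func \<Rightarrow> 'e \<Rightarrow> ('j \<Rightarrow> 'f) \<Rightarrow> bool" where
  "is_limit F L l \<longleftrightarrow> is_cone F L l \<and> (\<forall>L' l'. is_cone F L' l' \<longrightarrow>
     (\<exists>!h. h \<in> hom (Tgt F) L' L \<and> (\<forall>j\<in>Obj (Src F). l j \<cdot>\<^bsub>Tgt F\<^esub> h = l' j)))"

definition has_limits :: "('j, 'k) cat \<Rightarrow> ('e, 'f) cat \<Rightarrow> bool" where
  "has_limits J E \<longleftrightarrow> (\<forall>F. is_functor F \<and> Src F = J \<and> Tgt F = E \<longrightarrow> (\<exists>L l. is_limit F L l))"

text \<open>Limits and pullbacks are fixed by choice.\<close>

definition limit :: "('j, 'k, 'e, 'f) func \<Rightarrow> 'e \<times> ('j \<Rightarrow> 'f)" where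
  "limit F = (SOME (L, l). is_limit F L l)"

abbreviation lim_obj :: "('j, 'k, 'e, 'f) func \<Rightarrow> 'e" where
  "lim_obj F \<equiv> fst (limit F)"

abbreviation lim_leg :: "('j, 'k, 'e, 'f) func \<Rightarrow> 'j \<Rightarrow> 'f" where
  "lim_leg F \<equiv> snd (limit F)"

definition lim_lift :: "('j, 'k, 'e, 'f) func \<Rightarrow> 'e \<Rightarrow> ('j \<Rightarrow> 'f) \<Rightarrow> 'f" where
  "lim_lift F L' l' = (THE h. h \<in> hom (Tgt F) L' (lim_obj F)
                          \<and> (\<forall>j\<in>Obj (Src F). lim_leg F j \<cdot>\<^bsub>Tgt F\<^esub> h = l' j))"

definition is_pullback :: "('e, 'f) cat \<Rightarrow> 'f \<Rightarrow> 'f \<Rightarrow> 'f \<Rightarrow> 'f \<Rightarrow> bool" where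
  "is_pullback E f g p q \<longleftrightarrow> f \<in> Arr E \<and> g \<in> Arr E \<and> Cod E f = Cod E g
     \<and> p \<in> Arr E \<and> q \<in> Arr E \<and> Dom E p = Dom E q \<and> Cod E p = Dom E f \<and> Cod E q = Dom E g
     \<and> f \<cdot>\<^bsub>E\<^esub> p = g \<cdot>\<^bsub>E\<^esub> q
     \<and> (\<forall>x\<in>Arr E. \<forall>y\<in>Arr E. Dom E x = Dom E y \<and> Cod E x = Dom E f \<and> Cod E y = Dom E g
          \<and> f \<cdot>\<^bsub>E\<^esub> x = g \<cdot>\<^bsub>E\<^esub> y \<longrightarrow>
          (\<exists>!h. h \<in> hom E (Dom E x) (Dom E p) \<and> p \<cdot>\<^bsub>E\<^esub> h = x \<and> q \<cdot>\<^bsub>E\<^esub> h = y))"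

definition has_pullbacks_along :: "('e, 'f) cat \<Rightarrow> 'f \<Rightarrow> bool" where
  "has_pullbacks_along E f \<longleftrightarrow> (\<forall>g\<in>Arr E. Cod E g = Cod E f \<longrightarrow> (\<exists>p q. is_pullback E f g p q))"

definition has_pullbacks :: "('e, 'f) cat \<Rightarrow> bool" where
  "has_pullbacks E \<longleftrightarrow> (\<forall>f\<in>Arr E. has_pullbacks_along E f)"

definition pullback :: "('e, 'f) cat \<Rightarrow> 'f \<Rightarrow> 'f \<Rightarrow> 'f \<times> 'f" where
  "pullback E f g = (SOME (p, q). is_pullback E f g p q)"

text \<open>The projections of the chosen pullback of \<open>f : B \<rightarrow> A\<close> and \<open>g : X \<rightarrow> A\<close> to \<open>B\<close> and to \<open>X\<close>.\<close>

abbreviation pb1 :: "('e, 'f) cat \<Rightarrow> 'f \<Rightarrow> 'f \<Rightarrow> 'f" where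
  "pb1 E f g \<equiv> fst (pullback E f g)"

abbreviation pb2 :: "('e, 'f) cat \<Rightarrow> 'f \<Rightarrow> 'f \<Rightarrow> 'f" where
  "pb2 E f g \<equiv> snd (pullback E f g)"

text \<open>The map \<open>(x, y)\<close> into a pullback with projections \<open>p\<close>, \<open>q\<close>.\<close>

definition pb_lift :: "('e, 'f) cat \<Rightarrow> 'f \<Rightarrow> 'f \<Rightarrow> 'f \<Rightarrow> 'f \<Rightarrow> 'f" where
  "pb_lift E p q x y = (THE h. h \<in> hom E (Dom E x) (Dom E p) \<and> p \<cdot>\<^bsub>E\<^esub> h = x \<and> q \<cdot>\<^bsub>E\<^esub> h = y)"

text \<open>The pullback functor \<open>f\<^sup>* : E/A \<rightarrow> E/B\<close> along \<open>f : B \<rightarrow> A\<close>.\<close>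

definition pb_functor :: "('e, 'f) cat \<Rightarrow> 'f \<Rightarrow> ('f, 'f \<times> 'f \<times> 'f, 'f, 'f \<times> 'f \<times> 'f) func" where
  "pb_functor E f = \<lparr>Src = slice E (Cod E f), Tgt = slice E (Dom E f),
     FO = (\<lambda>x\<in>Obj (slice E (Cod E f)). pb1 E f x),
     FA = (\<lambda>(x, k, y)\<in>Arr (slice E (Cod E f)).
             (pb1 E f x, pb_lift E (pb1 E f y) (pb2 E f y) (pb1 E f x) (k \<cdot>\<^bsub>E\<^esub> pb2 E f x), pb1 E f y))\<rparr>"

text \<open>\<open>R\<close> is right adjoint to \<open>F\<close> with counit \<open>\<epsilon>\<close>.\<close>

definition is_right_adjoint :: "('o, 'm, 'p, 'q) func \<Rightarrow> ('p, 'q, 'o, 'm) func \<Rightarrow>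
    ('p, 'q, 'p, 'q) ntrans \<Rightarrow> bool" where
  "is_right_adjoint F R \<epsilon> \<longleftrightarrow> is_functor F \<and> is_functor R \<and> Src R = Tgt F \<and> Tgt R = Src F
     \<and> is_ntrans \<epsilon> \<and> NDom \<epsilon> = F \<bullet> R \<and> NCod \<epsilon> = id_func (Tgt F)
     \<and> (\<forall>x\<in>Obj (Src F). \<forall>y\<in>Obj (Tgt F). \<forall>h\<in>hom (Tgt F) (FO F x) y.
          \<exists>!k. k \<in> hom (Src F) x (FO R y) \<and> At \<epsilon> y \<cdot>\<^bsub>Tgt F\<^esub> FA F k = h)"

definition powerful :: "('e, 'f) cat \<Rightarrow> 'f \<Rightarrow> bool" where
  "powerful E f \<longleftrightarrow> f \<in> Arr E \<and> has_pullbacks_along E f \<and> (\<exists>R \<epsilon>. is_right_adjoint (pb_functor E f) R \<epsilon>)"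

definition dep_prod :: "('e, 'f) cat \<Rightarrow> 'f \<Rightarrow>
    ('f, 'f \<times> 'f \<times> 'f, 'f, 'f \<times> 'f \<times> 'f) func \<times> ('f, 'f \<times> 'f \<times> 'f, 'f, 'f \<times> 'f \<times> 'f) ntrans" where
  "dep_prod E f = (SOME (R, \<epsilon>). is_right_adjoint (pb_functor E f) R \<epsilon>)"

text \<open>The dependent product functor \<open>\<Pi>\<^sub>B : E/B \<rightarrow> E/A\<close> along \<open>f : B \<rightarrow> A\<close>, the counit
  \<open>ev : B \<times>\<^sub>A \<Pi>\<^sub>B C \<rightarrow> C\<close>, and the transpose of a map \<open>h : f\<^sup>* x \<rightarrow> g\<close> of \<open>E/B\<close>.\<close>

definition Pi_functor :: "('e, 'f) cat \<Rightarrow> 'f \<Rightarrow> ('f, 'f \<times> 'f \<times> 'f, 'f, 'f \<times> 'f \<times> 'f) func" where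
  "Pi_functor E f = fst (dep_prod E f)"

abbreviation Pi_ob :: "('e, 'f) cat \<Rightarrow> 'f \<Rightarrow> 'f \<Rightarrow> 'f" where
  "Pi_ob E f g \<equiv> FO (Pi_functor E f) g"

definition ev :: "('e, 'f) cat \<Rightarrow> 'f \<Rightarrow> 'f \<Rightarrow> 'f \<times> 'f \<times> 'f" where
  "ev E f g = At (snd (dep_prod E f)) g"

definition transpose :: "('e, 'f) cat \<Rightarrow> 'f \<Rightarrow> 'f \<Rightarrow> 'f \<Rightarrow> 'f \<times> 'f \<times> 'f \<Rightarrow> 'f \<times> 'f \<times> 'f" where
  "transpose E f x g h = (THE k. k \<in> hom (slice E (Cod E f)) x (Pi_ob E f g)
     \<and> ev E f g \<cdot>\<^bsub>slice E (Dom E f)\<^esub> FA (pb_functor E f) k = h)"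

text \<open>For a functor \<open>K\<close> preserving the pullback \<open>B \<times>\<^sub>A \<Pi>\<^sub>B C\<close>, the map
  \<open>K(ev)\<^sup>\<ddagger> : K(\<Pi>\<^sub>B C) \<rightarrow> \<Pi>\<^bsub>K B\<^esub> (K C)\<close> over \<open>K A\<close>: the transpose of
  \<open>K B \<times>\<^bsub>K A\<^esub> K(\<Pi>\<^sub>B C) \<cong> K(B \<times>\<^sub>A \<Pi>\<^sub>B C) \<rightarrow> K C\<close>.\<close>

definition ev_comparison :: "('o, 'm, 'e, 'f) func \<Rightarrow> 'm \<Rightarrow> 'm \<Rightarrow> 'f \<times> 'f \<times> 'f" where
  "ev_comparison K f g = (let F = Src K; E = Tgt K; P = Pi_ob F f g;
       p = pb1 E (FA K f) (FA K P); q = pb2 E (FA K f) (FA K P);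
       iso = pb_lift E (FA K (pb1 F f P)) (FA K (pb2 F f P)) p q
     in transpose E (FA K f) (FA K P) (FA K g) (p, FA K (mid (ev F f g)) \<cdot>\<^bsub>E\<^esub> iso, FA K g))"


section \<open>Matching objects of a profunctor\<close>

definition match_diag :: "('b, 'c) cat \<Rightarrow> ('j, 'k) cat \<Rightarrow> ('b, 'c, 'j, 'k, 'u) prof \<Rightarrow>
    ('j, 'k, 'e, 'f) func \<Rightarrow> 'b \<Rightarrow> ('j \<times> 'u, ('j \<times> 'u) \<times> 'k \<times> ('j \<times> 'u), 'e, 'f) func" where
  "match_diag D J P X i = X \<bullet> elements_proj (prof_at D J P i)"

definition match_ob :: "('b, 'c) cat \<Rightarrow> ('j, 'k) cat \<Rightarrow> ('b, 'c, 'j, 'k, 'u) prof \<Rightarrow>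
    ('j, 'k, 'e, 'f) func \<Rightarrow> ('b, 'c, 'e, 'f) func" where
  "match_ob D J P X = \<lparr>Src = D, Tgt = Tgt X,
     FO = (\<lambda>i\<in>Obj D. lim_obj (match_diag D J P X i)),
     FA = (\<lambda>\<gamma>\<in>Arr D. lim_lift (match_diag D J P X (Cod D \<gamma>)) (lim_obj (match_diag D J P X (Dom D \<gamma>)))
             (\<lambda>(j, u). lim_leg (match_diag D J P X (Dom D \<gamma>)) (j, mid (FA P (\<gamma>, Ident J j)) u)))\<rparr>"

definition match_functor :: "('b, 'c) cat \<Rightarrow> ('j, 'k) cat \<Rightarrow> ('b, 'c, 'j, 'k, 'u) prof \<Rightarrow> ('e, 'f) cat \<Rightarrow>
    (('j, 'k, 'e, 'f) func, ('j, 'k, 'e, 'f) ntrans, ('b, 'c, 'e, 'f) func, ('b, 'c, 'e, 'f) ntrans) func" where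
  "match_functor D J P E = \<lparr>Src = Fun J E, Tgt = Fun D E,
     FO = (\<lambda>X\<in>Obj (Fun J E). match_ob D J P X),
     FA = (\<lambda>\<tau>\<in>Arr (Fun J E). \<lparr>NDom = match_ob D J P (NDom \<tau>), NCod = match_ob D J P (NCod \<tau>),
             At = (\<lambda>i\<in>Obj D. lim_lift (match_diag D J P (NCod \<tau>) i) (lim_obj (match_diag D J P (NDom \<tau>) i))
                     (\<lambda>x. At \<tau> (fst x) \<cdot>\<^bsub>E\<^esub> lim_leg (match_diag D J P (NDom \<tau>) i) x))\<rparr>)\<rparr>"


section \<open>Iterated gluing diagrams\<close>

definition strict_inverse_category :: "('n, 'a) cat \<Rightarrow> ('n \<Rightarrow> nat) \<Rightarrow> bool" where
  "strict_inverse_category N deg \<longleftrightarrow> category N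
     \<and> (\<forall>\<alpha>\<in>Arr N. \<alpha> \<noteq> Ident N (Dom N \<alpha>) \<longrightarrow> deg (Dom N \<alpha>) > deg (Cod N \<alpha>))"

type_synonym ('a, 'o, 'm) below_ob = "('a \<times> 'o) set"
type_synonym ('a, 'o, 'm) below_arr = "('a, 'o, 'm) colim_arr"

text \<open>The data consist of \<open>\<N>\<close> with its degree function, \<open>\<I> : \<N>\<^sup>o\<^sup>p \<rightarrow> Cat\<close>, the
  \<open>\<partial>\<I>\<^sub>n\<close>, the \<open>\<I>\<degree>\<^sub>n\<close>, and the identification \<open>Glue n\<close> of the collage of \<open>\<I>\<degree>\<^sub>n\<close> with
  \<open>\<I>\<^sub>n\<close> (an isomorphism of categories; literal equality would not be well typed).\<close>

record ('n, 'a, 'o, 'm, 'b, 'c, 'u) gluing =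
  Shape :: "('n, 'a) cat"
  Deg :: "'n \<Rightarrow> nat"
  Diag :: "('n, 'a, ('o, 'm) cat, ('o, 'm, 'o, 'm) func) func"
  Bd :: "'n \<Rightarrow> ('b, 'c) cat"
  Prof :: "'n \<Rightarrow> ('b, 'c, ('a, 'o, 'm) below_ob, ('a, 'o, 'm) below_arr, 'u) prof"
  Glue :: "'n \<Rightarrow> (('a, 'o, 'm) below_ob + 'b,
      ('b, 'c, ('a, 'o, 'm) below_ob, ('a, 'o, 'm) below_arr, 'u) collage_arr, 'o, 'm) func"

definition below_diag :: "('n, 'a, 'o, 'm, 'b, 'c, 'u) gluing \<Rightarrow> 'n \<Rightarrow>
    ('a, 'a \<times> 'a \<times> 'a, ('o, 'm) cat, ('o, 'm, 'o, 'm) func) func" where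
  "below_diag G n = Diag G \<bullet> op_func (strict_coslice_proj (Shape G) n)"

text \<open>\<open>\<I>\<^bsub><n\<^esub>\<close> and \<open>\<I>\<^sub>\<infinity>\<close>\<close>

definition below :: "('n, 'a, 'o, 'm, 'b, 'c, 'u) gluing \<Rightarrow> 'n \<Rightarrow>
    (('a, 'o, 'm) below_ob, ('a, 'o, 'm) below_arr) cat" where
  "below G n = colim (below_diag G n)"

definition gluing_cat :: "('n, 'a, 'o, 'm, 'b, 'c, 'u) gluing \<Rightarrow>
    (('n \<times> 'o) set, ('n, 'o, 'm) colim_arr) cat" where
  "gluing_cat G = colim (Diag G)"

text \<open>The last clause says that \<open>\<I>\<^bsub><n\<^esub> \<hookrightarrow> \<I>\<^sub>n\<close> is the map induced by the \<open>\<I>\<^sub>\<alpha>\<close>, \<open>\<alpha> : n \<rightarrow> n'\<close>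
  a non-identity.\<close>

definition iterated_gluing_diagram :: "('n, 'a, 'o, 'm, 'b, 'c, 'u) gluing \<Rightarrow> bool" where
  "iterated_gluing_diagram G \<longleftrightarrow> strict_inverse_category (Shape G) (Deg G)
     \<and> is_functor (Diag G) \<and> Src (Diag G) = op_cat (Shape G) \<and> Tgt (Diag G) = CAT
     \<and> (\<forall>n\<in>Obj (Shape G). is_profunctor (Bd G n) (below G n) (Prof G n)
          \<and> is_iso_functor (Glue G n) \<and> Src (Glue G n) = collage (Bd G n) (below G n) (Prof G n)
          \<and> Tgt (Glue G n) = FO (Diag G) n
          \<and> (\<forall>\<alpha>\<in>Obj (strict_coslice (Shape G) n).
               Glue G n \<bullet> collage_inl (Bd G n) (below G n) (Prof G n) \<bullet> coproj (below_diag G n) \<alpha>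
               = FA (Diag G) \<alpha>))"

text \<open>The functors \<open>\<partial>\<I>\<^sub>n \<hookrightarrow> \<I>\<^sub>n \<rightarrow> \<I>\<^sub>\<infinity>\<close> and \<open>\<I>\<^bsub><n\<^esub> \<hookrightarrow> \<I>\<^sub>n \<rightarrow> \<I>\<^sub>\<infinity>\<close>, and the image in
  \<open>\<I>\<^sub>\<infinity>\<close> of \<open>u \<in> \<I>\<degree>\<^sub>n(i,j)\<close>.\<close>

definition incl_bd :: "('n, 'a, 'o, 'm, 'b, 'c, 'u) gluing \<Rightarrow> 'n \<Rightarrow>
    ('b, 'c, ('n \<times> 'o) set, ('n, 'o, 'm) colim_arr) func" where
  "incl_bd G n = coproj (Diag G) n \<bullet> Glue G n \<bullet> collage_inr (Bd G n) (below G n) (Prof G n)"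

definition incl_below :: "('n, 'a, 'o, 'm, 'b, 'c, 'u) gluing \<Rightarrow> 'n \<Rightarrow>
    (('a, 'o, 'm) below_ob, ('a, 'o, 'm) below_arr, ('n \<times> 'o) set, ('n, 'o, 'm) colim_arr) func" where
  "incl_below G n = coproj (Diag G) n \<bullet> Glue G n \<bullet> collage_inl (Bd G n) (below G n) (Prof G n)"

definition het_arr :: "('n, 'a, 'o, 'm, 'b, 'c, 'u) gluing \<Rightarrow> 'n \<Rightarrow>
    'b \<Rightarrow> 'u \<Rightarrow> ('a, 'o, 'm) below_ob \<Rightarrow> ('n, 'o, 'm) colim_arr" where
  "het_arr G n i u j = FA (coproj (Diag G) n) (FA (Glue G n) (Het i u j))"

text \<open>\<open>X \<mapsto> X|\<^bsub>=n\<^esub>\<close> and \<open>X \<mapsto> M\<^sub>n X\<close> as functors \<open>\<E>\<^bsup>\<I>\<^sub>\<infinity>\<^esup> \<rightarrow> \<E>\<^bsup>\<partial>\<I>\<^sub>n\<^esup>\<close>, and the matching map.\<close>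

definition restr_eq :: "('n, 'a, 'o, 'm, 'b, 'c, 'u) gluing \<Rightarrow> ('e, 'f) cat \<Rightarrow> 'n \<Rightarrow>
    ((('n \<times> 'o) set, ('n, 'o, 'm) colim_arr, 'e, 'f) func, (('n \<times> 'o) set, ('n, 'o, 'm) colim_arr, 'e, 'f) ntrans,
     ('b, 'c, 'e, 'f) func, ('b, 'c, 'e, 'f) ntrans) func" where
  "restr_eq G E n = precomp (incl_bd G n) E"

definition match :: "('n, 'a, 'o, 'm, 'b, 'c, 'u) gluing \<Rightarrow> ('e, 'f) cat \<Rightarrow> 'n \<Rightarrow>
    ((('n \<times> 'o) set, ('n, 'o, 'm) colim_arr, 'e, 'f) func, (('n \<times> 'o) set, ('n, 'o, 'm) colim_arr, 'e, 'f) ntrans,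
     ('b, 'c, 'e, 'f) func, ('b, 'c, 'e, 'f) ntrans) func" where
  "match G E n = match_functor (Bd G n) (below G n) (Prof G n) E \<bullet> precomp (incl_below G n) E"

definition match_map :: "('n, 'a, 'o, 'm, 'b, 'c, 'u) gluing \<Rightarrow> ('e, 'f) cat \<Rightarrow> 'n \<Rightarrow>
    (('n \<times> 'o) set, ('n, 'o, 'm) colim_arr, 'e, 'f) func \<Rightarrow> ('b, 'c, 'e, 'f) ntrans" where
  "match_map G E n X = \<lparr>NDom = FO (restr_eq G E n) X, NCod = FO (match G E n) X,
     At = (\<lambda>i\<in>Obj (Bd G n).
             lim_lift (match_diag (Bd G n) (below G n) (Prof G n) (X \<bullet> incl_below G n) i)
               (FO X (FO (incl_bd G n) i)) (\<lambda>(j, u). FA X (het_arr G n i u j)))\<rparr>"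


section \<open>The maps in the formula for the dependent product\<close>

text \<open>For \<open>f : B \<rightarrow> A\<close> and \<open>g : C \<rightarrow> B\<close> in \<open>\<E>\<^bsup>\<I>\<^sub>\<infinity>\<^esup>\<close>, all of the following are maps of
  \<open>\<E>\<^bsup>\<partial>\<I>\<^sub>n\<^esup>\<close>, regarded as maps of its slices over \<open>A|\<^bsub>=n\<^esub>\<close> or \<open>B|\<^bsub>=n\<^esub>\<close>.\<close>

text \<open>\<open>A|\<^bsub>=n\<^esub> \<times>\<^bsub>M\<^sub>n A\<^esub> M\<^sub>n(ev)\<^sup>\<ddagger> :
    A|\<^bsub>=n\<^esub> \<times>\<^bsub>M\<^sub>n A\<^esub> M\<^sub>n(\<Pi>\<^sub>B C) \<rightarrow> A|\<^bsub>=n\<^esub> \<times>\<^bsub>M\<^sub>n A\<^esub> \<Pi>\<^bsub>M\<^sub>n B\<^esub> M\<^sub>n C\<close>\<close>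

definition pulled_match_ev where
  "pulled_match_ev G E n f g =
     FA (pb_functor (Fun (Bd G n) E) (match_map G E n (NCod f))) (ev_comparison (match G E n) f g)"

text \<open>\<open>(B|\<^bsub>=n\<^esub> \<times>\<^bsub>M\<^sub>n B\<^esub> ev)\<^sup>\<ddagger> :
    A|\<^bsub>=n\<^esub> \<times>\<^bsub>M\<^sub>n A\<^esub> \<Pi>\<^bsub>M\<^sub>n B\<^esub> M\<^sub>n C \<rightarrow> \<Pi>\<^bsub>B|\<^bsub>=n\<^esub>\<^esub>(B|\<^bsub>=n\<^esub> \<times>\<^bsub>M\<^sub>n B\<^esub> M\<^sub>n C)\<close>\<close>

definition pulled_ev_transpose where
  "pulled_ev_transpose G E n f g = (let
       D = Fun (Bd G n) E; f' = FA (restr_eq G E n) f; Mf = FA (match G E n) f; Mg = FA (match G E n) g;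
       mA = match_map G E n (NCod f); mB = match_map G E n (NDom f); P = Pi_ob D Mf Mg;
       p = pb1 D f' (pb1 D mA P); q = pb2 D f' (pb1 D mA P);
       r = pb_lift D (pb1 D Mf P) (pb2 D Mf P) (mB \<cdot>\<^bsub>D\<^esub> p) (pb2 D mA P \<cdot>\<^bsub>D\<^esub> q);
       iso = pb_lift D (pb1 D mB (pb1 D Mf P)) (pb2 D mB (pb1 D Mf P)) p r
     in transpose D f' (pb1 D mA P) (pb1 D mB Mg)
          (FA (pb_functor D mB) (ev D Mf Mg) \<cdot>\<^bsub>slice D (Dom D f')\<^esub> (p, iso, pb1 D mB (pb1 D Mf P))))"

text \<open>\<open>\<Pi>\<^bsub>B|\<^bsub>=n\<^esub>\<^esub>(g|\<^bsub>=n\<^esub>, m\<^sub>n C) : \<Pi>\<^bsub>B|\<^bsub>=n\<^esub>\<^esub> C|\<^bsub>=n\<^esub> \<rightarrow> \<Pi>\<^bsub>B|\<^bsub>=n\<^esub>\<^esub>(B|\<^bsub>=n\<^esub> \<times>\<^bsub>M\<^sub>n B\<^esub> M\<^sub>n C)\<close>\<close>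

definition Pi_match_map where
  "Pi_match_map G E n f g = (let
       D = Fun (Bd G n) E; g' = FA (restr_eq G E n) g; Mg = FA (match G E n) g;
       mB = match_map G E n (NDom f); mC = match_map G E n (NDom g)
     in FA (Pi_functor D (FA (restr_eq G E n) f))
          (g', pb_lift D (pb1 D mB Mg) (pb2 D mB Mg) g' mC, pb1 D mB Mg))"

text \<open>The projections of the square: the comparison \<open>(\<Pi>\<^sub>B C)|\<^bsub>=n\<^esub> \<rightarrow> \<Pi>\<^bsub>B|\<^bsub>=n\<^esub>\<^esub> C|\<^bsub>=n\<^esub>\<close>, that is
  \<open>(ev|\<^bsub>=n\<^esub>)\<^sup>\<ddagger>\<close>, and \<open>((\<Pi>\<^sub>B g)|\<^bsub>=n\<^esub>, m\<^sub>n(\<Pi>\<^sub>B C)) :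
  (\<Pi>\<^sub>B C)|\<^bsub>=n\<^esub> \<rightarrow> A|\<^bsub>=n\<^esub> \<times>\<^bsub>M\<^sub>n A\<^esub> M\<^sub>n(\<Pi>\<^sub>B C)\<close>.\<close>

definition proj_restr where
  "proj_restr G E n f g = ev_comparison (restr_eq G E n) f g"

definition proj_match where
  "proj_match G E n f g = (let
       D = Fun (Bd G n) E; P = Pi_ob (Fun (gluing_cat G) E) f g;
       P' = FA (restr_eq G E n) P; MP = FA (match G E n) P; mA = match_map G E n (NCod f)
     in (P', pb_lift D (pb1 D mA MP) (pb2 D mA MP) P' (match_map G E n (NDom P)), pb1 D mA MP))"

end

theory Submission
  imports Defs
begin

text \<open>
A functor on \<open>\<I>\<^sub>\<infinity>\<close> is a compatible family of functors on the \<open>\<I>\<^sub>n\<close>, and, \<open>\<I>\<^sub>n\<close> being a collage, a functor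
on \<open>\<I>\<^sub>n\<close> is a functor \<open>X\<close> on \<open>\<I>\<^bsub><n\<^esub>\<close> together with an object of \<open>\<E>\<^bsup>\<partial>\<I>\<^sub>n\<^esup>\<close> over \<open>M\<^sub>n X\<close>. So \<open>\<Pi>\<^sub>B C\<close> is built by
recursion on the degree: given its restriction to \<open>\<I>\<^bsub><n\<^esub>\<close>, its part over \<open>\<partial>\<I>\<^sub>n\<close> has to represent the pairs of a
map \<open>(t, q) : T \<rightarrow> A|\<^bsub>=n\<^esub> \<times>\<^bsub>M\<^sub>n A\<^esub> M\<^sub>n(\<Pi>\<^sub>B C)\<close> and a map \<open>B|\<^bsub>=n\<^esub> \<times>\<^bsub>A|\<^bsub>=n\<^esub>\<^esub> T \<rightarrow> C|\<^bsub>=n\<^esub>\<close> over \<open>B|\<^bsub>=n\<^esub>\<close> that agree in \<open>M\<^sub>n C\<close>.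
Transposing along \<open>f|\<^bsub>=n\<^esub>\<close>, such an object is a pullback; along \<open>M\<^sub>n f\<close> one transposes in order to factor
the second map of this pullback through \<open>\<Pi>\<^bsub>M\<^sub>n B\<^esub> M\<^sub>n C\<close>, as in the formula.
The relative universal properties for all \<open>n\<close> together give the universal property of \<open>\<Pi>\<^sub>B C\<close>, because transposes over
the \<open>\<I>\<^sub>n\<close> are unique and therefore glue. Finally the formula passes to any other choice of \<open>\<Pi>\<^sub>B C\<close> along
the comparison isomorphism.
\<close>

section \<open>Categories and pullbacks\<close>

text \<open>Colimits in Cat glue along equalities of functors, so the pieces of the dependent
  product must restrict to one another on the nose. The pullbacks chosen in a functor category, and
  with them \<open>pb_functor\<close> and \<open>transpose\<close>, give no such equalities. Two
  devices avoid this: \<open>dprod\<close> and \<open>glued\<close> quantify over all pullback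
  squares, and in functor categories the squares used are the pointwise ones \<open>ptpb1\<close>
  and \<open>ptpb2\<close>, which restriction preserves strictly. The recursion on the degree yields
  only a projection \<open>p\<close> and an evaluation \<open>e\<close>, together with their
  relative universal property over the boundary. The full universal property over each
  \<open>\<I>\<^sub>n\<close> comes from a second induction on the degree, after the pairs have been
  glued over the whole category. The chosen \<open>Pi_ob\<close> and \<open>ev\<close> over
  \<open>\<I>\<^sub>\<infinity>\<close> return only for the formula, where the uniqueness of
  dependent products up to isomorphism links them to the constructed pair.\<close>

lemma homD:
  assumes "f \<in> hom C x y"
  shows "f \<in> Arr C" "Dom C f = x" "Cod C f = y"
  using assms by (auto simp: hom_def)

lemma homI: "f \<in> Arr C \<Longrightarrow> Dom C f = x \<Longrightarrow> Cod C f = y \<Longrightarrow> f \<in> hom C x y"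
  by (simp add: hom_def)

lemma hom_iff: "f \<in> hom C x y \<longleftrightarrow> f \<in> Arr C \<and> Dom C f = x \<and> Cod C f = y"
  by (simp add: hom_def)

context category
begin

lemma comp_arr [simp]:
  assumes "f \<in> Arr C" "g \<in> Arr C" "Cod C f = Dom C g"
  shows "g \<cdot> f \<in> Arr C" "Dom C (g \<cdot> f) = Dom C f" "Cod C (g \<cdot> f) = Cod C g"
  using comp_in[of f "Dom C f" "Cod C f" g "Cod C g"] assms by (auto simp: hom_def)

lemma ident_arr [simp]:
  assumes "x \<in> Obj C"
  shows "Ident C x \<in> Arr C" "Dom C (Ident C x) = x" "Cod C (Ident C x) = x"
  using ident_in[OF assms] by (auto simp: hom_def)

lemma ident_left' [simp]: "f \<in> Arr C \<Longrightarrow> Cod C f = y \<Longrightarrow> Ident C y \<cdot> f = f"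
  by (rule ident_left[of f "Dom C f" y]) (simp add: hom_def)

lemma ident_right' [simp]: "f \<in> Arr C \<Longrightarrow> Dom C f = x \<Longrightarrow> f \<cdot> Ident C x = f"
  by (rule ident_right[of f x "Cod C f"]) (simp add: hom_def)

lemma assoc' [simp]:
  "f \<in> Arr C \<Longrightarrow> g \<in> Arr C \<Longrightarrow> h \<in> Arr C \<Longrightarrow> Cod C f = Dom C g \<Longrightarrow> Cod C g = Dom C h \<Longrightarrow>
   (h \<cdot> g) \<cdot> f = h \<cdot> (g \<cdot> f)"
  by (rule assoc[of f "Dom C f" "Dom C g" g "Dom C h" h "Cod C h"]) (simp_all add: hom_def)

declare dom_in [simp] cod_in [simp]

text \<open>The simplifier associates composites to the right, so an equation for
  \<open>g \<cdot> f\<close> no longer matches inside a longer chain. This version, like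
  \<open>comp_ext2\<close>, carries a tail \<open>h\<close> and applies there.\<close>

lemma comp_ext:
  assumes "g \<cdot> f = k" "f \<in> Arr C" "g \<in> Arr C" "Cod C f = Dom C g"
  shows "h \<in> Arr C \<Longrightarrow> Cod C h = Dom C f \<Longrightarrow> g \<cdot> (f \<cdot> h) = k \<cdot> h"
  using assms(1) assoc'[of h f g] assms(2-) by simp

lemma comp_ext2:
  assumes "g \<cdot> f = g' \<cdot> f'" "f \<in> Arr C" "g \<in> Arr C" "Cod C f = Dom C g"
    "f' \<in> Arr C" "g' \<in> Arr C" "Cod C f' = Dom C g'" "Dom C f' = Dom C f"
  shows "h \<in> Arr C \<Longrightarrow> Cod C h = Dom C f \<Longrightarrow> g \<cdot> (f \<cdot> h) = g' \<cdot> (f' \<cdot> h)"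
  using assms(1) assoc'[of h f g] assoc'[of h f' g'] assms(2-) by simp

end

section \<open>Pullback squares, the maps they induce, and their comparison\<close>

lemma pbD:
  assumes "is_pullback C f g p q"
  shows "f \<in> Arr C" "g \<in> Arr C" "Cod C g = Cod C f" "p \<in> Arr C" "q \<in> Arr C"
    "Dom C q = Dom C p" "Cod C p = Dom C f" "Cod C q = Dom C g"
    "f \<cdot>\<^bsub>C\<^esub> p = g \<cdot>\<^bsub>C\<^esub> q"
  using assms by (simp_all add: is_pullback_def)

lemma pb_ex1:
  assumes "is_pullback C f g p q" "x \<in> Arr C" "y \<in> Arr C" "Dom C y = Dom C x" "Cod C x = Dom C f"
    "Cod C y = Dom C g" "f \<cdot>\<^bsub>C\<^esub> x = g \<cdot>\<^bsub>C\<^esub> y"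
  shows "\<exists>!h. h \<in> hom C (Dom C x) (Dom C p) \<and> p \<cdot>\<^bsub>C\<^esub> h = x \<and> q \<cdot>\<^bsub>C\<^esub> h = y"
  using assms unfolding is_pullback_def by metis

lemma pb_lift:
  assumes "is_pullback C f g p q" "x \<in> Arr C" "y \<in> Arr C" "Dom C y = Dom C x" "Cod C x = Dom C f"
    "Cod C y = Dom C g" "f \<cdot>\<^bsub>C\<^esub> x = g \<cdot>\<^bsub>C\<^esub> y"
  shows "pb_lift C p q x y \<in> Arr C" "Dom C (pb_lift C p q x y) = Dom C x"
    "Cod C (pb_lift C p q x y) = Dom C p"
    "p \<cdot>\<^bsub>C\<^esub> pb_lift C p q x y = x" "q \<cdot>\<^bsub>C\<^esub> pb_lift C p q x y = y"
  using theI'[OF pb_ex1[OF assms]] by (auto simp: pb_lift_def hom_def)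

lemma (in category) pb_eqI:
  assumes "is_pullback C f g p q" "h \<in> Arr C" "k \<in> Arr C" "Dom C k = Dom C h" "Cod C h = Dom C p"
    "Cod C k = Dom C p" "p \<cdot> h = p \<cdot> k" "q \<cdot> h = q \<cdot> k"
  shows "h = k"
proof -
  note [simp] = pbD[OF assms(1)] assms(2-6)
  have "f \<cdot> (p \<cdot> k) = g \<cdot> (q \<cdot> k)" by (rule comp_ext2) auto
  from pb_ex1[OF assms(1) _ _ _ _ _ this] have
    "\<exists>!l. l \<in> hom C (Dom C h) (Dom C p) \<and> p \<cdot> l = p \<cdot> k \<and> q \<cdot> l = q \<cdot> k" by simp
  then show ?thesis using assms by (metis homI)
qed

lemma (in category) pb_lift_unique:
  assumes "is_pullback C f g p q" "h \<in> Arr C" "Cod C h = Dom C p" "p \<cdot> h = x" "q \<cdot> h = y"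
  shows "pb_lift C p q x y = h"
proof -
  note [simp] = pbD[OF assms(1)] assms(2-3)
  have "f \<cdot> x = g \<cdot> y" using comp_ext2[of f p g q h] by (simp add: assms(4,5)[symmetric])
  note l = pb_lift[OF assms(1) _ _ _ _ _ this, simplified assms(4,5)[symmetric], simplified]
  show ?thesis by (rule pb_eqI[OF assms(1)]) (simp_all add: assms(4,5)[symmetric] l)
qed

lemma (in category) pb_lift_comp:
  assumes "is_pullback C f g p q" "x \<in> Arr C" "y \<in> Arr C" "Dom C y = Dom C x" "Cod C x = Dom C f"
    "Cod C y = Dom C g" "f \<cdot> x = g \<cdot> y" "h \<in> Arr C" "Cod C h = Dom C x"
  shows "pb_lift C p q x y \<cdot> h = pb_lift C p q (x \<cdot> h) (y \<cdot> h)"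
proof (rule pb_lift_unique[OF assms(1), symmetric])
  note [simp] = pbD[OF assms(1)] pb_lift[OF assms(1-7)] assms(2-6,8,9)
  show "pb_lift C p q x y \<cdot> h \<in> Arr C" "Cod C (pb_lift C p q x y \<cdot> h) = Dom C p" by simp_all
  show "p \<cdot> pb_lift C p q x y \<cdot> h = x \<cdot> h" by (rule comp_ext) auto
  show "q \<cdot> pb_lift C p q x y \<cdot> h = y \<cdot> h" by (rule comp_ext) auto
qed

text \<open>The universal property is split into existence and joint monicity of the projections.
  The second goal compares two arbitrary maps and does not mention the cone, so it can be proved by
  cancellation alone.\<close>

lemma (in category) is_pullbackI:
  assumes "f \<in> Arr C" "g \<in> Arr C" "Cod C g = Cod C f" "p \<in> Arr C" "q \<in> Arr C"
    "Dom C q = Dom C p" "Cod C p = Dom C f" "Cod C q = Dom C g" "f \<cdot> p = g \<cdot> q"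
    and ex: "\<And>x y. x \<in> Arr C \<Longrightarrow> y \<in> Arr C \<Longrightarrow> Dom C y = Dom C x \<Longrightarrow> Cod C x = Dom C f \<Longrightarrow>
      Cod C y = Dom C g \<Longrightarrow> f \<cdot> x = g \<cdot> y \<Longrightarrow>
      \<exists>h. h \<in> hom C (Dom C x) (Dom C p) \<and> p \<cdot> h = x \<and> q \<cdot> h = y"
    and un: "\<And>h k. h \<in> Arr C \<Longrightarrow> k \<in> Arr C \<Longrightarrow> Dom C k = Dom C h \<Longrightarrow> Cod C h = Dom C p \<Longrightarrow>
      Cod C k = Dom C p \<Longrightarrow> p \<cdot> h = p \<cdot> k \<Longrightarrow> q \<cdot> h = q \<cdot> k \<Longrightarrow> h = k"
  shows "is_pullback C f g p q"
  unfolding is_pullback_def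
proof (intro conjI ballI impI)
  fix x y assume a: "x \<in> Arr C" "y \<in> Arr C"
    and b: "Dom C x = Dom C y \<and> Cod C x = Dom C f \<and> Cod C y = Dom C g \<and> f \<cdot> x = g \<cdot> y"
  show "\<exists>!h. h \<in> hom C (Dom C x) (Dom C p) \<and> p \<cdot> h = x \<and> q \<cdot> h = y"
  proof (rule ex_ex1I)
    show "\<exists>h. h \<in> hom C (Dom C x) (Dom C p) \<and> p \<cdot> h = x \<and> q \<cdot> h = y"
      using b by (rule_tac ex[OF a]) simp_all
  next
    fix h k
    assume "h \<in> hom C (Dom C x) (Dom C p) \<and> p \<cdot> h = x \<and> q \<cdot> h = y"
      "k \<in> hom C (Dom C x) (Dom C p) \<and> p \<cdot> k = x \<and> q \<cdot> k = y"
    then show "h = k" by (rule_tac un) (simp_all add: hom_iff)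
  qed
qed (use assms(1-9) in auto)

lemma chosen_pullback:
  assumes "has_pullbacks_along C f" "g \<in> Arr C" "Cod C g = Cod C f"
  shows "is_pullback C f g (pb1 C f g) (pb2 C f g)"
proof -
  from assms obtain p q where "is_pullback C f g p q" unfolding has_pullbacks_along_def by blast
  then have "case_prod (is_pullback C f g) (SOME x. case_prod (is_pullback C f g) x)"
    by (rule_tac someI[of _ "(p, q)"]) simp
  then show ?thesis by (simp add: pullback_def case_prod_unfold)
qed

lemma has_pullbacks_chosen:
  assumes "has_pullbacks C" "f \<in> Arr C" "g \<in> Arr C" "Cod C g = Cod C f"
  shows "is_pullback C f g (pb1 C f g) (pb2 C f g)"
  using assms by (auto simp: has_pullbacks_def intro: chosen_pullback)

text \<open>The apex is replaced along the isomorphism \<open>u\<close>; the new mediating map is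
  the old one followed by the inverse \<open>v\<close>.\<close>

lemma (in category) pullback_iso:
  assumes pb: "is_pullback C f g p q" and u: "u \<in> hom C t (Dom C p)" and v: "v \<in> hom C (Dom C p) t"
    and uv: "u \<cdot> v = Ident C (Dom C p)" and vu: "v \<cdot> u = Ident C t"
  shows "is_pullback C f g (p \<cdot> u) (q \<cdot> u)"
proof -
  note [simp] = pbD[OF pb] homD[OF u] homD[OF v] uv vu
  have [simp]: "t \<in> Obj C" using dom_in[OF homD(1)[OF u]] by simp
  have c: "f \<cdot> p \<cdot> u = g \<cdot> q \<cdot> u" using comp_ext2[of f p g q u] by simp
  show ?thesis
  proof (rule is_pullbackI)
    fix x y assume xy: "x \<in> Arr C" "y \<in> Arr C" "Dom C y = Dom C x" "Cod C x = Dom C f" "Cod C y = Dom C g"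
      "f \<cdot> x = g \<cdot> y"
    note l = pb_lift[OF pb xy]
    have "u \<cdot> v \<cdot> pb_lift C p q x y = pb_lift C p q x y"
      using comp_ext[of u v "Ident C (Dom C p)" "pb_lift C p q x y"] l by simp
    then show "\<exists>h. h \<in> hom C (Dom C x) (Dom C (p \<cdot> u)) \<and> (p \<cdot> u) \<cdot> h = x \<and> (q \<cdot> u) \<cdot> h = y"
      using l by (intro exI[of _ "v \<cdot> pb_lift C p q x y"]) (simp add: hom_iff)
  next
    fix h k assume h: "h \<in> Arr C" "k \<in> Arr C" "Dom C k = Dom C h" "Cod C h = Dom C (p \<cdot> u)"
      "Cod C k = Dom C (p \<cdot> u)" "(p \<cdot> u) \<cdot> h = (p \<cdot> u) \<cdot> k" "(q \<cdot> u) \<cdot> h = (q \<cdot> u) \<cdot> k"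
    then have "u \<cdot> h = u \<cdot> k" by (rule_tac pb_eqI[OF pb]) simp_all
    then have "v \<cdot> u \<cdot> h = v \<cdot> u \<cdot> k" by simp
    then show "h = k" using comp_ext[of v u "Ident C t"] h by simp
  qed (simp_all add: c)
qed

text \<open>\<open>u\<close> and \<open>v\<close> are the maps that each square induces from the
  projections of the other. Both composites fix the projections, hence are identities by joint
  monicity.\<close>

lemma (in category) pullback_compare:
  assumes pb: "is_pullback C f g p q" and pb': "is_pullback C f g p' q'"
  shows "\<exists>u v. u \<in> hom C (Dom C p') (Dom C p) \<and> v \<in> hom C (Dom C p) (Dom C p')
    \<and> u \<cdot> v = Ident C (Dom C p) \<and> v \<cdot> u = Ident C (Dom C p') \<and> p' = p \<cdot> u \<and> q' = q \<cdot> u"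
proof -
  note [simp] = pbD(1-8)[OF pb] pbD(1-8)[OF pb']
  let ?u = "pb_lift C p q p' q'" and ?v = "pb_lift C p' q' p q"
  have [simp]: "g \<cdot> q = f \<cdot> p" "g \<cdot> q' = f \<cdot> p'" using pbD[OF pb] pbD[OF pb'] by auto
  have [simp]: "?u \<in> Arr C" "Dom C ?u = Dom C p'" "Cod C ?u = Dom C p" "p \<cdot> ?u = p'" "q \<cdot> ?u = q'"
    by (rule pb_lift[OF pb]; simp)+
  have [simp]: "?v \<in> Arr C" "Dom C ?v = Dom C p" "Cod C ?v = Dom C p'" "p' \<cdot> ?v = p" "q' \<cdot> ?v = q"
    by (rule pb_lift[OF pb']; simp)+
  have "?u \<cdot> ?v = Ident C (Dom C p)"
    by (rule pb_eqI[OF pb]) (simp_all add: comp_ext[of p ?u p'] comp_ext[of q ?u q'])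
  moreover have "?v \<cdot> ?u = Ident C (Dom C p')"
    by (rule pb_eqI[OF pb']) (simp_all add: comp_ext[of p' ?v p] comp_ext[of q' ?v q])
  ultimately show ?thesis by (intro exI[of _ ?u] exI[of _ ?v]) (simp add: hom_iff)
qed

section \<open>Functors\<close>

lemma Fun_ObjD:
  assumes "F \<in> Obj (Fun J E)"
  shows "is_functor F" "Src F = J" "Tgt F = E" "category J" "category E"
  using assms by (auto simp: Fun_def is_functor_def)

lemma Fun_ObjI: "is_functor F \<Longrightarrow> Src F = J \<Longrightarrow> Tgt F = E \<Longrightarrow> F \<in> Obj (Fun J E)"
  by (simp add: Fun_def)

locale functor_on =
  fixes J :: "('o, 'm) cat" and E :: "('p, 'q) cat" and F :: "('o, 'm, 'p, 'q) func"
  assumes F_in: "F \<in> Obj (Fun J E)"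
begin

lemma func: "is_functor F" and src [simp]: "Src F = J" and tgt [simp]: "Tgt F = E"
  and catJ: "category J" and catE: "category E"
  using Fun_ObjD[OF F_in] by auto

lemma FO_in [simp]: "x \<in> Obj J \<Longrightarrow> FO F x \<in> Obj E"
  using func by (auto simp: is_functor_def)

lemma FA_arr [simp]:
  assumes "f \<in> Arr J"
  shows "FA F f \<in> Arr E" "Dom E (FA F f) = FO F (Dom J f)" "Cod E (FA F f) = FO F (Cod J f)"
  using func assms by (auto simp: is_functor_def)

lemma FA_ident [simp]: "x \<in> Obj J \<Longrightarrow> FA F (Ident J x) = Ident E (FO F x)"
  using func by (auto simp: is_functor_def)

lemma FA_comp: "f \<in> Arr J \<Longrightarrow> g \<in> Arr J \<Longrightarrow> Cod J f = Dom J g \<Longrightarrow>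
    FA F (g \<cdot>\<^bsub>J\<^esub> f) = FA F g \<cdot>\<^bsub>E\<^esub> FA F f"
  using func by (auto simp: is_functor_def)

lemma FA_hom: "f \<in> hom J x y \<Longrightarrow> FA F f \<in> hom E (FO F x) (FO F y)"
  using FA_arr by (auto simp: hom_iff)

lemma FO_ext: "FO F \<in> extensional (Obj J)" and FA_ext: "FA F \<in> extensional (Arr J)"
  using func by (auto simp: is_functor_def PiE_def)

lemma FA_pb_lift:
  assumes pb: "is_pullback J f g p q" and pb': "is_pullback E (FA F f) (FA F g) (FA F p) (FA F q)"
    and xy: "x \<in> Arr J" "y \<in> Arr J" "Dom J y = Dom J x" "Cod J x = Dom J f" "Cod J y = Dom J g"
      "f \<cdot>\<^bsub>J\<^esub> x = g \<cdot>\<^bsub>J\<^esub> y"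
  shows "FA F (pb_lift J p q x y) = pb_lift E (FA F p) (FA F q) (FA F x) (FA F y)"
proof -
  interpret E: category E by (rule catE)
  interpret J: category J by (rule catJ)
  note [simp] = pbD[OF pb] pbD[OF pb'] pb_lift[OF pb xy]
  show ?thesis
    by (rule E.pb_lift_unique[OF pb', symmetric]) (simp_all flip: FA_comp)
qed

end

lemma functor_onI:
  assumes "category J" "category E" "Src F = J" "Tgt F = E"
    "FO F \<in> extensional (Obj J)" "FA F \<in> extensional (Arr J)"
    "\<And>x. x \<in> Obj J \<Longrightarrow> FO F x \<in> Obj E"
    "\<And>f. f \<in> Arr J \<Longrightarrow> FA F f \<in> hom E (FO F (Dom J f)) (FO F (Cod J f))"
    "\<And>x. x \<in> Obj J \<Longrightarrow> FA F (Ident J x) = Ident E (FO F x)"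
    "\<And>f g. f \<in> Arr J \<Longrightarrow> g \<in> Arr J \<Longrightarrow> Cod J f = Dom J g \<Longrightarrow>
      FA F (g \<cdot>\<^bsub>J\<^esub> f) = FA F g \<cdot>\<^bsub>E\<^esub> FA F f"
  shows "F \<in> Obj (Fun J E)"
  unfolding Fun_def is_functor_def using assms by (auto simp: hom_iff PiE_def)

text \<open>Functors are undefined off their carriers, so agreement on objects and arrows already
  gives equality of the records. All strict equations between restrictions rest on this.\<close>

lemma Fun_Obj_eqI:
  assumes "F \<in> Obj (Fun J E)" "G \<in> Obj (Fun J E)"
    "\<And>x. x \<in> Obj J \<Longrightarrow> FO F x = FO G x" "\<And>f. f \<in> Arr J \<Longrightarrow> FA F f = FA G f"
  shows "F = G"
proof -
  interpret F: functor_on J E F using assms by unfold_locales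
  interpret G: functor_on J E G using assms by unfold_locales
  have "FO F = FO G" by (rule extensionalityI[OF F.FO_ext G.FO_ext]) (rule assms)
  moreover have "FA F = FA G" by (rule extensionalityI[OF F.FA_ext G.FA_ext]) (rule assms)
  ultimately show ?thesis by (intro func.equality) auto
qed

lemma comp_func_simps [simp]:
  "Src (G \<bullet> F) = Src F" "Tgt (G \<bullet> F) = Tgt G"
  "x \<in> Obj (Src F) \<Longrightarrow> FO (G \<bullet> F) x = FO G (FO F x)"
  "f \<in> Arr (Src F) \<Longrightarrow> FA (G \<bullet> F) f = FA G (FA F f)"
  by (simp_all add: comp_func_def)

lemma comp_func_in:
  assumes "F \<in> Obj (Fun I J)" "G \<in> Obj (Fun J E)"
  shows "G \<bullet> F \<in> Obj (Fun I E)"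
proof -
  interpret F: functor_on I J F using assms by unfold_locales
  interpret G: functor_on J E G using assms by unfold_locales
  interpret I: category I by (rule F.catJ)
  show ?thesis
  proof (rule functor_onI)
    show "FA (G \<bullet> F) f \<in> hom E (FO (G \<bullet> F) (Dom I f)) (FO (G \<bullet> F) (Cod I f))" if "f \<in> Arr I" for f
      using that by (simp add: hom_iff)
  qed (simp_all add: F.catJ G.catE F.FA_comp G.FA_comp, simp_all add: comp_func_def)
qed

lemma comp_func_assoc:
  assumes "F \<in> Obj (Fun I J)" "G \<in> Obj (Fun J K)" "H \<in> Obj (Fun K L)"
  shows "(H \<bullet> G) \<bullet> F = H \<bullet> (G \<bullet> F)"
proof -
  interpret F: functor_on I J F using assms by unfold_locales
  interpret G: functor_on J K G using assms by unfold_locales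
  show ?thesis using assms by (intro Fun_Obj_eqI[of _ I L]) (auto intro: comp_func_in)
qed

lemma id_func_in: "category J \<Longrightarrow> id_func J \<in> Obj (Fun J J)"
  by (rule functor_onI) (auto simp: id_func_def hom_iff category.comp_arr category.ident_arr category.dom_in category.cod_in)

lemma comp_id_func:
  assumes "F \<in> Obj (Fun I J)"
  shows "F \<bullet> id_func I = F"
proof -
  interpret F: functor_on I J F using assms by unfold_locales
  show ?thesis
    by (intro Fun_Obj_eqI[of _ I J] comp_func_in[OF id_func_in] F.catJ assms) (simp_all add: id_func_def)
qed

section \<open>Dependent products\<close>

lemma slice_simps [simp]:
  "x \<in> Obj (slice E a) \<longleftrightarrow> x \<in> Arr E \<and> Cod E x = a"
  "Ident (slice E a) x = (x, Ident E (Dom E x), x)"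
  "Dom (slice E a) (x, k, y) = x" "Cod (slice E a) (x, k, y) = y"
  "(y', l, z) \<cdot>\<^bsub>slice E a\<^esub> (x, k, y) = (x, l \<cdot>\<^bsub>E\<^esub> k, z)"
  "(x, k, y) \<in> Arr (slice E a) \<longleftrightarrow> x \<in> Arr E \<and> Cod E x = a \<and> y \<in> Arr E \<and> Cod E y = a
     \<and> k \<in> Arr E \<and> Dom E k = Dom E x \<and> Cod E k = Dom E y \<and> y \<cdot>\<^bsub>E\<^esub> k = x"
  by (auto simp: slice_def hom_iff)

lemma slice_ArrE:
  assumes "t \<in> Arr (slice E a)"
  obtains x k y where "t = (x, k, y)" "x \<in> Arr E" "Cod E x = a" "y \<in> Arr E" "Cod E y = a"
    "k \<in> Arr E" "Dom E k = Dom E x" "Cod E k = Dom E y" "y \<cdot>\<^bsub>E\<^esub> k = x"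
  using assms by (cases t) auto

lemma slice_hom_iff:
  "t \<in> hom (slice E a) x y \<longleftrightarrow> (\<exists>k. t = (x, k, y) \<and> x \<in> Arr E \<and> Cod E x = a \<and> y \<in> Arr E \<and> Cod E y = a
     \<and> k \<in> Arr E \<and> Dom E k = Dom E x \<and> Cod E k = Dom E y \<and> y \<cdot>\<^bsub>E\<^esub> k = x)"
  by (cases t) (simp add: hom_iff, blast)

lemma (in category) category_slice: "category (slice C a)"
proof
  show "Dom (slice C a) t \<in> Obj (slice C a)" "Cod (slice C a) t \<in> Obj (slice C a)"
    if t: "t \<in> Arr (slice C a)" for t
    by (rule slice_ArrE[OF t]; simp)+
  show "Ident (slice C a) x \<in> hom (slice C a) x x" if "x \<in> Obj (slice C a)" for x
    using that by (simp add: slice_hom_iff)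
  show "t \<cdot>\<^bsub>slice C a\<^esub> s \<in> hom (slice C a) x z"
    if s: "s \<in> hom (slice C a) x y" and t: "t \<in> hom (slice C a) y z" for s t x y z
  proof -
    obtain k l where "s = (x, k, y)" "t = (y, l, z)" using s t unfolding slice_hom_iff by blast
    then show ?thesis using s t comp_ext[of z l y k] by (simp add: slice_hom_iff)
  qed
  show "t \<cdot>\<^bsub>slice C a\<^esub> Ident (slice C a) x = t" "Ident (slice C a) y \<cdot>\<^bsub>slice C a\<^esub> t = t"
    if t: "t \<in> hom (slice C a) x y" for t x y
  proof -
    obtain k where "t = (x, k, y)" using t unfolding slice_hom_iff by blast
    then show "t \<cdot>\<^bsub>slice C a\<^esub> Ident (slice C a) x = t" "Ident (slice C a) y \<cdot>\<^bsub>slice C a\<^esub> t = t"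
      using t by (simp_all add: slice_hom_iff)
  qed
  show "(t \<cdot>\<^bsub>slice C a\<^esub> s) \<cdot>\<^bsub>slice C a\<^esub> r = t \<cdot>\<^bsub>slice C a\<^esub> (s \<cdot>\<^bsub>slice C a\<^esub> r)"
    if rst: "r \<in> hom (slice C a) w x" "s \<in> hom (slice C a) x y" "t \<in> hom (slice C a) y z" for r s t w x y z
  proof -
    obtain k l m where "r = (w, k, x)" "s = (x, l, y)" "t = (y, m, z)"
      using rst unfolding slice_hom_iff by blast
    then show ?thesis using rst by (simp add: slice_hom_iff)
  qed
qed

section \<open>Base change of maps between arbitrary pullback squares\<close>

context category
begin

lemma pb_map_commute:
  assumes w: "is_pullback C f p w1 w2" and y: "is_pullback C f x y1 y2"
    and k: "k \<in> Arr C" "Dom C k = Dom C x" "Cod C k = Dom C p" "p \<cdot> k = x"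
  shows "f \<cdot> y1 = p \<cdot> (k \<cdot> y2)"
  using pbD[OF w] pbD[OF y] k comp_ext[of p k x y2] by simp

text \<open>The lift with legs \<open>y1\<close> and \<open>k \<cdot> y2\<close> is the base change
  of \<open>k\<close> along \<open>f\<close>, formed for any two squares over \<open>x\<close> and
  \<open>p\<close> instead of the chosen ones.\<close>

lemma pb_map:
  assumes w: "is_pullback C f p w1 w2" and y: "is_pullback C f x y1 y2"
    and k: "k \<in> Arr C" "Dom C k = Dom C x" "Cod C k = Dom C p" "p \<cdot> k = x"
  shows "pb_lift C w1 w2 y1 (k \<cdot> y2) \<in> Arr C" "Dom C (pb_lift C w1 w2 y1 (k \<cdot> y2)) = Dom C y1"
    "Cod C (pb_lift C w1 w2 y1 (k \<cdot> y2)) = Dom C w1" "w1 \<cdot> pb_lift C w1 w2 y1 (k \<cdot> y2) = y1"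
    "w2 \<cdot> pb_lift C w1 w2 y1 (k \<cdot> y2) = k \<cdot> y2"
proof -
  note [simp] = pbD(1-8)[OF w] pbD(1-8)[OF y] k(1-3)
  note c = pb_map_commute[OF assms]
  show "pb_lift C w1 w2 y1 (k \<cdot> y2) \<in> Arr C" "Dom C (pb_lift C w1 w2 y1 (k \<cdot> y2)) = Dom C y1"
    "Cod C (pb_lift C w1 w2 y1 (k \<cdot> y2)) = Dom C w1" "w1 \<cdot> pb_lift C w1 w2 y1 (k \<cdot> y2) = y1"
    "w2 \<cdot> pb_lift C w1 w2 y1 (k \<cdot> y2) = k \<cdot> y2"
    by (rule pb_lift[OF w _ _ _ _ _ c]; simp)+
qed

text \<open>Functoriality of this base change, with three independently given squares.\<close>

lemma pb_map_comp:
  assumes w: "is_pullback C f p w1 w2" and y: "is_pullback C f x y1 y2" and z: "is_pullback C f x' z1 z2"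
    and k: "k \<in> Arr C" "Dom C k = Dom C x" "Cod C k = Dom C p" "p \<cdot> k = x"
    and l: "l \<in> Arr C" "Dom C l = Dom C x'" "Cod C l = Dom C x" "x \<cdot> l = x'"
  shows "pb_lift C w1 w2 y1 (k \<cdot> y2) \<cdot> pb_lift C y1 y2 z1 (l \<cdot> z2) = pb_lift C w1 w2 z1 ((k \<cdot> l) \<cdot> z2)"
proof -
  note [simp] = pbD(1-8)[OF w] pbD(1-8)[OF y] pbD(1-8)[OF z] k(1-3) l(1-3) pb_map[OF w y k] pb_map[OF y z l]
  show ?thesis
  proof (rule pb_lift_unique[OF w, symmetric])
  show "w1 \<cdot> pb_lift C w1 w2 y1 (k \<cdot> y2) \<cdot> pb_lift C y1 y2 z1 (l \<cdot> z2) = z1"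
    by (subst comp_ext[OF pb_map(4)[OF w y k]]) simp_all
  show "w2 \<cdot> pb_lift C w1 w2 y1 (k \<cdot> y2) \<cdot> pb_lift C y1 y2 z1 (l \<cdot> z2) = (k \<cdot> l) \<cdot> z2"
    by (subst comp_ext[OF pb_map(5)[OF w y k]]) simp_all
  qed simp_all
qed

lemma pb_functor_in:
  assumes f: "f \<in> Arr C" and pbs: "has_pullbacks_along C f"
  shows "pb_functor C f \<in> Obj (Fun (slice C (Cod C f)) (slice C (Dom C f)))"
proof (rule functor_onI)
  note pb = chosen_pullback[OF pbs]
  note [simp] = f
  show "category (slice C (Cod C f))" "category (slice C (Dom C f))" by (rule category_slice)+
  have ob: "pb1 C f x \<in> Arr C" "Cod C (pb1 C f x) = Dom C f" if "x \<in> Arr C" "Cod C x = Cod C f" for x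
    using pbD[OF pb[OF that]] by auto
  show "FO (pb_functor C f) x \<in> Obj (slice C (Dom C f))" if "x \<in> Obj (slice C (Cod C f))" for x
    using that by (simp add: pb_functor_def ob)
  show "FA (pb_functor C f) t \<in> hom (slice C (Dom C f)) (FO (pb_functor C f) (Dom (slice C (Cod C f)) t))
      (FO (pb_functor C f) (Cod (slice C (Cod C f)) t))" if "t \<in> Arr (slice C (Cod C f))" for t
    by (rule slice_ArrE[OF that]) (simp add: pb_functor_def slice_hom_iff ob pb_map[OF pb pb])
  show "FA (pb_functor C f) (Ident (slice C (Cod C f)) x) = Ident (slice C (Dom C f)) (FO (pb_functor C f) x)"
    if "x \<in> Obj (slice C (Cod C f))" for x
  proof -
    have x: "x \<in> Arr C" "Cod C x = Cod C f" using that by simp_all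
    note [simp] = pbD[OF pb[OF x]] x
    have "pb_lift C (pb1 C f x) (pb2 C f x) (pb1 C f x) (Ident C (Dom C x) \<cdot> pb2 C f x) = Ident C (Dom C (pb1 C f x))"
      by (rule pb_lift_unique[OF pb[OF x]]) simp_all
    then show ?thesis by (simp add: pb_functor_def)
  qed
  show "FA (pb_functor C f) (t \<cdot>\<^bsub>slice C (Cod C f)\<^esub> s)
      = FA (pb_functor C f) t \<cdot>\<^bsub>slice C (Dom C f)\<^esub> FA (pb_functor C f) s"
    if s: "s \<in> Arr (slice C (Cod C f))" and t: "t \<in> Arr (slice C (Cod C f))"
      and c: "Cod (slice C (Cod C f)) s = Dom (slice C (Cod C f)) t" for s t
  proof -
    from s t c obtain x y z k l where [simp]: "s = (x, k, y)" "t = (y, l, z)"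
      by (elim slice_ArrE) simp
    have x: "x \<in> Arr C" "Cod C x = Cod C f" and y: "y \<in> Arr C" "Cod C y = Cod C f"
      and z: "z \<in> Arr C" "Cod C z = Cod C f" using s t by simp_all
    have k: "k \<in> Arr C" "Dom C k = Dom C x" "Cod C k = Dom C y" "y \<cdot> k = x"
      and l: "l \<in> Arr C" "Dom C l = Dom C y" "Cod C l = Dom C z" "z \<cdot> l = y" using s t by simp_all
    show ?thesis using x y z k l
      by (simp add: pb_functor_def comp_ext[of z l y k]) (use pb_map_comp[OF pb[OF z] pb[OF y] pb[OF x] l k] in simp)
  qed
qed (auto simp: pb_functor_def)

end

text \<open>\<open>(p, e)\<close> is a dependent product of \<open>g\<close> along \<open>f\<close>; the square \<open>(w1, w2)\<close> is any pullback of \<open>f\<close>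
  and \<open>p\<close>. Quantifying over all pullback squares keeps the notion independent of the choices
  hidden in the pullback functor.\<close>

definition dprod :: "('e, 'f) cat \<Rightarrow> 'f \<Rightarrow> 'f \<Rightarrow> 'f \<Rightarrow> 'f \<Rightarrow> 'f \<Rightarrow> 'f \<Rightarrow> bool" where
  "dprod C f g p w1 w2 e \<longleftrightarrow> g \<in> Arr C \<and> Cod C g = Dom C f \<and> is_pullback C f p w1 w2
     \<and> e \<in> hom C (Dom C w1) (Dom C g) \<and> g \<cdot>\<^bsub>C\<^esub> e = w1
     \<and> (\<forall>x y1 y2 h. is_pullback C f x y1 y2 \<longrightarrow> h \<in> hom C (Dom C y1) (Dom C g) \<longrightarrow> g \<cdot>\<^bsub>C\<^esub> h = y1 \<longrightarrow>
         (\<exists>!k. k \<in> hom C (Dom C x) (Dom C p) \<and> p \<cdot>\<^bsub>C\<^esub> k = x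
            \<and> e \<cdot>\<^bsub>C\<^esub> pb_lift C w1 w2 y1 (k \<cdot>\<^bsub>C\<^esub> y2) = h))"

lemma dprodD:
  assumes "dprod C f g p w1 w2 e"
  shows "g \<in> Arr C" "Cod C g = Dom C f" "is_pullback C f p w1 w2"
    "e \<in> Arr C" "Dom C e = Dom C w1" "Cod C e = Dom C g" "g \<cdot>\<^bsub>C\<^esub> e = w1"
  using assms by (auto simp: dprod_def hom_iff)

lemma dprod_ex1:
  assumes "dprod C f g p w1 w2 e" "is_pullback C f x y1 y2" "h \<in> hom C (Dom C y1) (Dom C g)" "g \<cdot>\<^bsub>C\<^esub> h = y1"
  shows "\<exists>!k. k \<in> hom C (Dom C x) (Dom C p) \<and> p \<cdot>\<^bsub>C\<^esub> k = x \<and> e \<cdot>\<^bsub>C\<^esub> pb_lift C w1 w2 y1 (k \<cdot>\<^bsub>C\<^esub> y2) = h"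
  using assms unfolding dprod_def by blast

text \<open>The common composite is itself a map over the domain of \<open>f\<close>, so the
  uniqueness of transposes applies to it.\<close>

lemma (in category) dprod_eqI:
  assumes d: "dprod C f g p w1 w2 e" and y: "is_pullback C f x y1 y2"
    and k: "k \<in> Arr C" "Dom C k = Dom C x" "Cod C k = Dom C p" "p \<cdot> k = x"
    and l: "l \<in> Arr C" "Dom C l = Dom C x" "Cod C l = Dom C p" "p \<cdot> l = x"
    and eq: "e \<cdot> pb_lift C w1 w2 y1 (k \<cdot> y2) = e \<cdot> pb_lift C w1 w2 y1 (l \<cdot> y2)"
  shows "k = l"
proof -
  note D = dprodD[OF d]
  let ?h = "e \<cdot> pb_lift C w1 w2 y1 (k \<cdot> y2)"
  note [simp] = D(1,2,4-6) pb_map[OF D(3) y k]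
  have "?h \<in> hom C (Dom C y1) (Dom C g)" by (simp add: hom_iff)
  moreover have "g \<cdot> ?h = y1" by (subst comp_ext[OF D(7)]) simp_all
  ultimately show ?thesis using dprod_ex1[OF d y, of ?h] k l eq by (auto simp: hom_iff)
qed

text \<open>One pullback square for each \<open>x\<close> suffices: any other square over the same
  cospan differs from it by an isomorphism, and composing with that isomorphism carries one
  transposition problem into the other.\<close>

lemma (in category) dprodI:
  assumes g: "g \<in> Arr C" "Cod C g = Dom C f" and w: "is_pullback C f p w1 w2"
    and e: "e \<in> Arr C" "Dom C e = Dom C w1" "Cod C e = Dom C g" "g \<cdot> e = w1"
    and ex: "\<And>x. x \<in> Arr C \<Longrightarrow> Cod C x = Cod C f \<Longrightarrow> \<exists>y1 y2. is_pullback C f x y1 y2 \<and>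
      (\<forall>h. h \<in> hom C (Dom C y1) (Dom C g) \<longrightarrow> g \<cdot> h = y1 \<longrightarrow>
         (\<exists>!k. k \<in> hom C (Dom C x) (Dom C p) \<and> p \<cdot> k = x \<and> e \<cdot> pb_lift C w1 w2 y1 (k \<cdot> y2) = h))"
  shows "dprod C f g p w1 w2 e"
  unfolding dprod_def
proof (intro conjI allI impI)
  fix x z1 z2 h
  assume z: "is_pullback C f x z1 z2" and h: "h \<in> hom C (Dom C z1) (Dom C g)" "g \<cdot> h = z1"
  obtain y1 y2 where y: "is_pullback C f x y1 y2" and
    ex': "\<And>h. h \<in> hom C (Dom C y1) (Dom C g) \<Longrightarrow> g \<cdot> h = y1 \<Longrightarrow>
         \<exists>!k. k \<in> hom C (Dom C x) (Dom C p) \<and> p \<cdot> k = x \<and> e \<cdot> pb_lift C w1 w2 y1 (k \<cdot> y2) = h"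
    using ex[of x] pbD[OF z] by auto
  obtain u v where u: "u \<in> hom C (Dom C z1) (Dom C y1)" and v: "v \<in> hom C (Dom C y1) (Dom C z1)"
    and uv: "u \<cdot> v = Ident C (Dom C y1)" "v \<cdot> u = Ident C (Dom C z1)" and z12: "z1 = y1 \<cdot> u" "z2 = y2 \<cdot> u"
    using pullback_compare[OF y z] by blast
  note [simp] = pbD(1-8)[OF w] pbD(1-8)[OF y] pbD(1-8)[OF z] homD[OF u] homD[OF v] homD[OF h(1)] e(1-3) g
  have "z1 \<cdot> v = y1" using uv by (subst z12(1)) simp
  then have hv: "g \<cdot> h \<cdot> v = y1" using comp_ext[of g h z1 v] h by simp
  \<comment> \<open>The problem posed by \<open>h\<close> on the square \<open>(z1, z2)\<close> has
    the same solutions as the problem posed by \<open>h \<cdot> v\<close> on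
    \<open>(y1, y2)\<close>.\<close>
  have "e \<cdot> pb_lift C w1 w2 z1 (k \<cdot> z2) = h \<longleftrightarrow> e \<cdot> pb_lift C w1 w2 y1 (k \<cdot> y2) = h \<cdot> v"
    if "k \<in> hom C (Dom C x) (Dom C p) \<and> p \<cdot> k = x" for k
  proof -
    have k: "k \<in> Arr C" "Dom C k = Dom C x" "Cod C k = Dom C p" "p \<cdot> k = x"
      using that by (auto simp: hom_iff)
    note m = pb_map[OF w y k] pb_map[OF w z k]
    have l: "pb_lift C w1 w2 z1 (k \<cdot> z2) = pb_lift C w1 w2 y1 (k \<cdot> y2) \<cdot> u"
      using pb_lift_comp[OF w _ _ _ _ _ pb_map_commute[OF w y k], of u] k(1-3) by (simp add: z12[symmetric])
    then have l': "pb_lift C w1 w2 z1 (k \<cdot> z2) \<cdot> v = pb_lift C w1 w2 y1 (k \<cdot> y2)"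
      using m uv by simp
    have huv: "h \<cdot> v \<cdot> u = h" using uv by simp
    show ?thesis
    proof
      assume "e \<cdot> pb_lift C w1 w2 z1 (k \<cdot> z2) = h"
      then have "(e \<cdot> pb_lift C w1 w2 z1 (k \<cdot> z2)) \<cdot> v = h \<cdot> v" by simp
      then show "e \<cdot> pb_lift C w1 w2 y1 (k \<cdot> y2) = h \<cdot> v" using l' m by simp
    next
      assume "e \<cdot> pb_lift C w1 w2 y1 (k \<cdot> y2) = h \<cdot> v"
      then have "(e \<cdot> pb_lift C w1 w2 y1 (k \<cdot> y2)) \<cdot> u = h"
        using huv by simp
      then show "e \<cdot> pb_lift C w1 w2 z1 (k \<cdot> z2) = h" using l m by simp
    qed
  qed
  moreover have "\<exists>!k. k \<in> hom C (Dom C x) (Dom C p) \<and> p \<cdot> k = x \<and> e \<cdot> pb_lift C w1 w2 y1 (k \<cdot> y2) = h \<cdot> v"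
    by (rule ex') (simp_all add: hv hom_iff)
  ultimately show "\<exists>!k. k \<in> hom C (Dom C x) (Dom C p) \<and> p \<cdot> k = x \<and> e \<cdot> pb_lift C w1 w2 z1 (k \<cdot> z2) = h"
    by (metis (no_types, lifting))
qed (use g w e in \<open>auto simp: hom_iff\<close>)

text \<open>A right adjoint is assembled from one universal arrow for each object. Its action on
  arrows is the factorisation of \<open>h\<close> composed with the universal arrow; uniqueness of
  factorisations then gives the functor laws.\<close>

lemma right_adjoint_exists:
  assumes F: "F \<in> Obj (Fun X Y)"
    and ex: "\<And>y. y \<in> Obj Y \<Longrightarrow> \<exists>r e. r \<in> Obj X \<and> e \<in> hom Y (FO F r) y \<and>
      (\<forall>x\<in>Obj X. \<forall>h\<in>hom Y (FO F x) y. \<exists>!k. k \<in> hom X x r \<and> e \<cdot>\<^bsub>Y\<^esub> FA F k = h)"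
  shows "\<exists>R \<epsilon>. is_right_adjoint F R \<epsilon>"
proof -
  interpret F: functor_on X Y F using F by unfold_locales
  interpret X: category X by (rule F.catJ)
  interpret Y: category Y by (rule F.catE)
  from ex obtain r e where r: "\<And>y. y \<in> Obj Y \<Longrightarrow> r y \<in> Obj X"
    and e: "\<And>y. y \<in> Obj Y \<Longrightarrow> e y \<in> hom Y (FO F (r y)) y"
    and un: "\<And>y x h. y \<in> Obj Y \<Longrightarrow> x \<in> Obj X \<Longrightarrow> h \<in> hom Y (FO F x) y \<Longrightarrow>
      \<exists>!k. k \<in> hom X x (r y) \<and> e y \<cdot>\<^bsub>Y\<^esub> FA F k = h"
    by metis
  define tr where "tr x y h = (THE k. k \<in> hom X x (r y) \<and> e y \<cdot>\<^bsub>Y\<^esub> FA F k = h)" for x y h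
  have tr: "tr x y h \<in> hom X x (r y)" "e y \<cdot>\<^bsub>Y\<^esub> FA F (tr x y h) = h"
    if "y \<in> Obj Y" "x \<in> Obj X" "h \<in> hom Y (FO F x) y" for x y h
    using theI'[OF un[OF that]] by (auto simp: tr_def)
  have eqI: "k = l" if "y \<in> Obj Y" "x \<in> Obj X" "k \<in> hom X x (r y)" "l \<in> hom X x (r y)"
    "e y \<cdot>\<^bsub>Y\<^esub> FA F k = e y \<cdot>\<^bsub>Y\<^esub> FA F l" for x y k l
  proof -
    have "e y \<cdot>\<^bsub>Y\<^esub> FA F l \<in> hom Y (FO F x) y"
      using that F.FA_hom[OF that(4)] e[OF that(1)] by (auto simp: hom_iff)
    from un[OF that(1,2) this] show ?thesis using that by auto
  qed
  have [simp]: "e y \<in> Arr Y" "Dom Y (e y) = FO F (r y)" "Cod Y (e y) = y" "r y \<in> Obj X" if "y \<in> Obj Y" for y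
    using e[OF that] r[OF that] by (auto simp: hom_iff)
  define R where "R = \<lparr>Src = Y, Tgt = X, FO = (\<lambda>y\<in>Obj Y. r y),
    FA = (\<lambda>h\<in>Arr Y. tr (r (Dom Y h)) (Cod Y h) (h \<cdot>\<^bsub>Y\<^esub> e (Dom Y h)))\<rparr>"
  have Rs [simp]: "Src R = Y" "Tgt R = X" by (simp_all add: R_def)
  have RO [simp]: "FO R y = r y" if "y \<in> Obj Y" for y using that by (simp add: R_def)
  have RA: "FA R h \<in> hom X (r (Dom Y h)) (r (Cod Y h))"
    "e (Cod Y h) \<cdot>\<^bsub>Y\<^esub> FA F (FA R h) = h \<cdot>\<^bsub>Y\<^esub> e (Dom Y h)" if h: "h \<in> Arr Y" for h
    using tr[of "Cod Y h" "r (Dom Y h)" "h \<cdot>\<^bsub>Y\<^esub> e (Dom Y h)"] h by (auto simp: R_def hom_iff)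
  have [simp]: "FA R h \<in> Arr X" "Dom X (FA R h) = r (Dom Y h)" "Cod X (FA R h) = r (Cod Y h)"
    if "h \<in> Arr Y" for h
    using RA(1)[OF that] by (auto simp: hom_iff)
  have RF: "R \<in> Obj (Fun Y X)"
  proof (rule functor_onI)
    show "FA R (Ident Y y) = Ident X (FO R y)" if "y \<in> Obj Y" for y
      by (rule eqI[of y "r y"]) (use that RA[of "Ident Y y"] in \<open>auto simp: hom_iff\<close>)
    show "FA R (h \<cdot>\<^bsub>Y\<^esub> g) = FA R h \<cdot>\<^bsub>X\<^esub> FA R g"
      if g: "g \<in> Arr Y" and h: "h \<in> Arr Y" and c: "Cod Y g = Dom Y h" for g h
    proof (rule eqI[of "Cod Y h" "r (Dom Y g)"])
      note [simp] = g h c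
      have "e (Cod Y h) \<cdot>\<^bsub>Y\<^esub> FA F (FA R h) \<cdot>\<^bsub>Y\<^esub> FA F (FA R g)
          = h \<cdot>\<^bsub>Y\<^esub> e (Dom Y h) \<cdot>\<^bsub>Y\<^esub> FA F (FA R g)"
        by (rule Y.comp_ext2[OF RA(2)[OF h]]) simp_all
      then show "e (Cod Y h) \<cdot>\<^bsub>Y\<^esub> FA F (FA R (h \<cdot>\<^bsub>Y\<^esub> g))
          = e (Cod Y h) \<cdot>\<^bsub>Y\<^esub> FA F (FA R h \<cdot>\<^bsub>X\<^esub> FA R g)"
        using RA(2)[of "h \<cdot>\<^bsub>Y\<^esub> g"] RA(2)[OF g] by (simp add: F.FA_comp)
    qed (use g h c in \<open>simp_all add: hom_iff\<close>)
  qed (simp_all add: F.catE F.catJ hom_iff, simp_all add: R_def)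
  define \<epsilon> where "\<epsilon> = \<lparr>NDom = F \<bullet> R, NCod = id_func Y, At = (\<lambda>y\<in>Obj Y. e y)\<rparr>"
  have "is_ntrans \<epsilon>"
    using Fun_ObjD[OF comp_func_in[OF RF F]] Fun_ObjD[OF id_func_in[OF F.catE]] e
    by (simp add: is_ntrans_def \<epsilon>_def Let_def) (simp add: id_func_def RA)
  then have "is_right_adjoint F R \<epsilon>"
    using F.func Fun_ObjD[OF RF] un by (simp add: is_right_adjoint_def \<epsilon>_def)
  then show ?thesis by blast
qed

context category
begin

text \<open>The given evaluation lives on an arbitrary square \<open>(w1, w2)\<close>, while the
  counit has to live on the chosen one. So \<open>e\<close> is precomposed with the comparison
  \<open>u\<close>, and \<open>key\<close> shows that this does not change the transposition
  problem.\<close>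

lemma powerfulI:
  assumes f: "f \<in> Arr C" and pbs: "has_pullbacks_along C f"
    and ex: "\<And>g. g \<in> Arr C \<Longrightarrow> Cod C g = Dom C f \<Longrightarrow> \<exists>p w1 w2 e. dprod C f g p w1 w2 e"
  shows "powerful C f"
  unfolding powerful_def
proof (intro conjI f pbs right_adjoint_exists[OF pb_functor_in[OF f pbs]])
  fix g assume "g \<in> Obj (slice C (Dom C f))"
  then have g: "g \<in> Arr C" "Cod C g = Dom C f" by simp_all
  then obtain p w1 w2 e where d: "dprod C f g p w1 w2 e" using ex by blast
  note D = dprodD[OF d] and pb = chosen_pullback[OF pbs]
  have p: "p \<in> Arr C" "Cod C p = Cod C f" using pbD[OF D(3)] by auto
  let ?w1 = "pb1 C f p" and ?w2 = "pb2 C f p"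
  obtain u v where u: "u \<in> hom C (Dom C ?w1) (Dom C w1)" and v: "v \<in> hom C (Dom C w1) (Dom C ?w1)"
    and uv: "u \<cdot> v = Ident C (Dom C w1)" "v \<cdot> u = Ident C (Dom C ?w1)" and w: "?w1 = w1 \<cdot> u" "?w2 = w2 \<cdot> u"
    using pullback_compare[OF D(3) pb[OF p]] by blast
  note [simp] = g p pbD(1-8)[OF D(3)] pbD(1-8)[OF pb[OF p]] homD[OF u] homD[OF v] D(4-6)
  let ?e = "(?w1, e \<cdot> u, g)"
  have ge: "g \<cdot> e \<cdot> u = ?w1" using comp_ext[OF D(7), of u] by (simp add: w[symmetric])
  have fo: "FO (pb_functor C f) x = pb1 C f x" if "x \<in> Arr C" "Cod C x = Cod C f" for x
    using that by (simp add: pb_functor_def)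
  show "\<exists>r e. r \<in> Obj (slice C (Cod C f)) \<and> e \<in> hom (slice C (Dom C f)) (FO (pb_functor C f) r) g \<and>
     (\<forall>x\<in>Obj (slice C (Cod C f)). \<forall>h\<in>hom (slice C (Dom C f)) (FO (pb_functor C f) x) g.
        \<exists>!k. k \<in> hom (slice C (Cod C f)) x r \<and> e \<cdot>\<^bsub>slice C (Dom C f)\<^esub> FA (pb_functor C f) k = h)"
  proof (intro exI[of _ p] exI[of _ ?e] conjI ballI)
    show "p \<in> Obj (slice C (Cod C f))" by simp
    show "?e \<in> hom (slice C (Dom C f)) (FO (pb_functor C f) p) g"
      using ge f by (simp add: slice_hom_iff fo)
    fix x t assume "x \<in> Obj (slice C (Cod C f))" and t: "t \<in> hom (slice C (Dom C f)) (FO (pb_functor C f) x) g"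
    then have x: "x \<in> Arr C" "Cod C x = Cod C f" by simp_all
    let ?y1 = "pb1 C f x" and ?y2 = "pb2 C f x"
    note y = pb[OF x]
    from t obtain h where th: "t = (?y1, h, g)" and h: "h \<in> Arr C" "Dom C h = Dom C ?y1" "Cod C h = Dom C g" "g \<cdot> h = ?y1"
      using x by (simp add: slice_hom_iff fo) blast
    have key: "e \<cdot> u \<cdot> pb_lift C ?w1 ?w2 ?y1 (k \<cdot> ?y2) = e \<cdot> pb_lift C w1 w2 ?y1 (k \<cdot> ?y2)"
      if k: "k \<in> Arr C" "Dom C k = Dom C x" "Cod C k = Dom C p" "p \<cdot> k = x" for k
    proof -
      note [simp] = pb_map[OF D(3) y k] pb_map[OF pb[OF p] y k]
      have "u \<cdot> pb_lift C ?w1 ?w2 ?y1 (k \<cdot> ?y2) = pb_lift C w1 w2 ?y1 (k \<cdot> ?y2)"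
        by (rule pb_lift_unique[OF D(3), symmetric]) (simp_all add: comp_ext[OF w(1)[symmetric]] comp_ext[OF w(2)[symmetric]])
      then show ?thesis by simp
    qed
    \<comment> \<open>Arrows of the slice are triples with fixed ends, so unique existence of a
      triple is reduced to unique existence of its middle component.\<close>
    have iff: "s \<in> hom (slice C (Cod C f)) x p \<and> ?e \<cdot>\<^bsub>slice C (Dom C f)\<^esub> FA (pb_functor C f) s = t
        \<longleftrightarrow> (\<exists>k. s = (x, k, p) \<and> k \<in> hom C (Dom C x) (Dom C p) \<and> p \<cdot> k = x \<and> e \<cdot> pb_lift C w1 w2 ?y1 (k \<cdot> ?y2) = h)" for s
    proof
      assume s: "s \<in> hom (slice C (Cod C f)) x p \<and> ?e \<cdot>\<^bsub>slice C (Dom C f)\<^esub> FA (pb_functor C f) s = t"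
      then obtain k where "s = (x, k, p)" "k \<in> Arr C" "Dom C k = Dom C x" "Cod C k = Dom C p" "p \<cdot> k = x"
        unfolding slice_hom_iff by blast
      with s show "\<exists>k. s = (x, k, p) \<and> k \<in> hom C (Dom C x) (Dom C p) \<and> p \<cdot> k = x \<and> e \<cdot> pb_lift C w1 w2 ?y1 (k \<cdot> ?y2) = h"
        using x pb_map[OF pb[OF p] y] key[of k] by (simp add: pb_functor_def hom_iff th)
    next
      assume "\<exists>k. s = (x, k, p) \<and> k \<in> hom C (Dom C x) (Dom C p) \<and> p \<cdot> k = x \<and> e \<cdot> pb_lift C w1 w2 ?y1 (k \<cdot> ?y2) = h"
      then obtain k where "s = (x, k, p)" "k \<in> Arr C" "Dom C k = Dom C x" "Cod C k = Dom C p" "p \<cdot> k = x"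
        "e \<cdot> pb_lift C w1 w2 ?y1 (k \<cdot> ?y2) = h" unfolding hom_iff by blast
      then show "s \<in> hom (slice C (Cod C f)) x p \<and> ?e \<cdot>\<^bsub>slice C (Dom C f)\<^esub> FA (pb_functor C f) s = t"
        using x pb_map[OF pb[OF p] y] key[of k] by (simp add: slice_hom_iff pb_functor_def th)
    qed
    have "\<exists>!k. k \<in> hom C (Dom C x) (Dom C p) \<and> p \<cdot> k = x \<and> e \<cdot> pb_lift C w1 w2 ?y1 (k \<cdot> ?y2) = h"
      by (rule dprod_ex1[OF d y]) (simp_all add: h hom_iff)
    then show "\<exists>!k. k \<in> hom (slice C (Cod C f)) x p \<and> ?e \<cdot>\<^bsub>slice C (Dom C f)\<^esub> FA (pb_functor C f) k = t"
      unfolding iff by auto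
  qed
qed

lemma powerfulD:
  assumes "powerful C f"
  shows "f \<in> Arr C" "has_pullbacks_along C f" "is_right_adjoint (pb_functor C f) (Pi_functor C f) (snd (dep_prod C f))"
proof -
  from assms obtain R \<epsilon> where r: "is_right_adjoint (pb_functor C f) R \<epsilon>" by (auto simp: powerful_def)
  have "case_prod (is_right_adjoint (pb_functor C f)) (SOME x. case_prod (is_right_adjoint (pb_functor C f)) x)"
    by (rule someI[of _ "(R, \<epsilon>)"]) (simp add: r)
  then show "is_right_adjoint (pb_functor C f) (Pi_functor C f) (snd (dep_prod C f))"
    by (simp add: Pi_functor_def dep_prod_def case_prod_unfold)
qed (use assms in \<open>auto simp: powerful_def\<close>)

text \<open>The passage opposite to \<open>powerfulI\<close>: the chosen adjunction is read as a
  \<open>dprod\<close>, after which the slices can be forgotten. The second claim fixes the ends of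
  the triple \<open>ev C f g\<close>.\<close>

lemma Pi_dprod:
  assumes pw: "powerful C f" and g: "g \<in> Arr C" "Cod C g = Dom C f"
  defines "p \<equiv> Pi_ob C f g"
  shows "dprod C f g p (pb1 C f p) (pb2 C f p) (mid (ev C f g))"
    and "ev C f g = (pb1 C f p, mid (ev C f g), g)"
proof -
  note P = powerfulD[OF pw] and pb = chosen_pullback[OF powerfulD(2)[OF pw]]
  have R: "Pi_functor C f \<in> Obj (Fun (slice C (Dom C f)) (slice C (Cod C f)))"
    using P(3) by (auto simp: is_right_adjoint_def pb_functor_def intro: Fun_ObjI)
  interpret R: functor_on "slice C (Dom C f)" "slice C (Cod C f)" "Pi_functor C f"
    using R by unfold_locales
  have p: "p \<in> Arr C" "Cod C p = Cod C f" using R.FO_in[of g] g by (auto simp: p_def)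
  have fo: "FO (pb_functor C f) x = pb1 C f x" if "x \<in> Arr C" "Cod C x = Cod C f" for x
    using that by (simp add: pb_functor_def)
  have "ev C f g \<in> hom (slice C (Dom C f)) (FO (pb_functor C f \<bullet> Pi_functor C f) g) (FO (id_func (slice C (Dom C f))) g)"
  proof -
    let ?\<epsilon> = "snd (dep_prod C f)"
    have e: "is_ntrans ?\<epsilon>" "NDom ?\<epsilon> = pb_functor C f \<bullet> Pi_functor C f" "NCod ?\<epsilon> = id_func (slice C (Dom C f))"
      using P(3) unfolding is_right_adjoint_def by (simp_all add: pb_functor_def)
    have "Src (NDom ?\<epsilon>) = slice C (Dom C f)" "Tgt (NDom ?\<epsilon>) = slice C (Dom C f)"
      by (simp_all add: e(2)) (simp add: pb_functor_def)
    then show ?thesis using e(1) g unfolding is_ntrans_def Let_def ev_def e(2,3) by simp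
  qed
  then have "ev C f g \<in> hom (slice C (Dom C f)) (pb1 C f p) g"
    using g p by (simp add: id_func_def fo flip: p_def)
  then obtain e where e: "ev C f g = (pb1 C f p, e, g)" "e \<in> Arr C" "Dom C e = Dom C (pb1 C f p)"
    "Cod C e = Dom C g" "g \<cdot> e = pb1 C f p" unfolding slice_hom_iff by blast
  show ev: "ev C f g = (pb1 C f p, mid (ev C f g), g)" by (simp add: e(1))
  show "dprod C f g p (pb1 C f p) (pb2 C f p) (mid (ev C f g))"
  proof (rule dprodI)
    fix x assume x: "x \<in> Arr C" "Cod C x = Cod C f"
    let ?y1 = "pb1 C f x" and ?y2 = "pb2 C f x"
    show "\<exists>y1 y2. is_pullback C f x y1 y2 \<and> (\<forall>h. h \<in> hom C (Dom C y1) (Dom C g) \<longrightarrow> g \<cdot> h = y1 \<longrightarrow>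
         (\<exists>!k. k \<in> hom C (Dom C x) (Dom C p) \<and> p \<cdot> k = x \<and>
            mid (ev C f g) \<cdot> pb_lift C (pb1 C f p) (pb2 C f p) y1 (k \<cdot> y2) = h))"
    proof (intro exI conjI allI impI)
      show "is_pullback C f x ?y1 ?y2" by (rule pb[OF x])
      fix h assume h: "h \<in> hom C (Dom C ?y1) (Dom C g)" "g \<cdot> h = ?y1"
      have "(?y1, h, g) \<in> hom (slice C (Dom C f)) (FO (pb_functor C f) x) g"
        using h x g pbD[OF pb[OF x]] by (simp add: slice_hom_iff fo hom_iff)
      then have ex1: "\<exists>!t. t \<in> hom (slice C (Cod C f)) x p \<and> ev C f g \<cdot>\<^bsub>slice C (Dom C f)\<^esub> FA (pb_functor C f) t = (?y1, h, g)"
        using P(3) x g unfolding is_right_adjoint_def p_def ev_def by (simp add: pb_functor_def)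
      have iff: "t \<in> hom (slice C (Cod C f)) x p \<and> ev C f g \<cdot>\<^bsub>slice C (Dom C f)\<^esub> FA (pb_functor C f) t = (?y1, h, g)
        \<longleftrightarrow> (\<exists>k. t = (x, k, p) \<and> k \<in> hom C (Dom C x) (Dom C p) \<and> p \<cdot> k = x \<and>
              e \<cdot> pb_lift C (pb1 C f p) (pb2 C f p) ?y1 (k \<cdot> ?y2) = h)" (is "?L \<longleftrightarrow> ?R") for t
      proof
        assume t: "?L"
        then obtain k where "t = (x, k, p)" "k \<in> Arr C" "Dom C k = Dom C x" "Cod C k = Dom C p" "p \<cdot> k = x"
          unfolding slice_hom_iff by blast
        with t show "?R" using x p by (simp add: pb_functor_def hom_iff e(1))
      next
        assume "?R"
        then obtain k where "t = (x, k, p)" "k \<in> Arr C" "Dom C k = Dom C x" "Cod C k = Dom C p" "p \<cdot> k = x"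
          "e \<cdot> pb_lift C (pb1 C f p) (pb2 C f p) ?y1 (k \<cdot> ?y2) = h" unfolding hom_iff by blast
        then show "?L" using x p by (simp add: slice_hom_iff pb_functor_def e(1))
      qed
      show "\<exists>!k. k \<in> hom C (Dom C x) (Dom C p) \<and> p \<cdot> k = x \<and>
            mid (ev C f g) \<cdot> pb_lift C (pb1 C f p) (pb2 C f p) ?y1 (k \<cdot> ?y2) = h"
        using ex1 unfolding iff by (simp add: e(1)) blast
    qed
  qed (use g p e pb in auto)
qed

text \<open>Evaluates the definite description in \<open>transpose\<close>: it ranges over triples
  of the slice, and its middle component is the unique \<open>k\<close> that \<open>dprod\<close>
  provides.\<close>

lemma transpose:
  assumes pw: "powerful C f" and g: "g \<in> Arr C" "Cod C g = Dom C f" and x: "x \<in> Arr C" "Cod C x = Cod C f"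
    and h: "h \<in> Arr C" "Dom C h = Dom C (pb1 C f x)" "Cod C h = Dom C g" "g \<cdot> h = pb1 C f x"
  defines "p \<equiv> Pi_ob C f g" and "k \<equiv> mid (transpose C f x g (pb1 C f x, h, g))"
  shows "transpose C f x g (pb1 C f x, h, g) = (x, k, p)" "k \<in> Arr C" "Dom C k = Dom C x" "Cod C k = Dom C p"
    "p \<cdot> k = x" "mid (ev C f g) \<cdot> pb_lift C (pb1 C f p) (pb2 C f p) (pb1 C f x) (k \<cdot> pb2 C f x) = h"
proof -
  note pb = chosen_pullback[OF powerfulD(2)[OF pw]]
  note d = Pi_dprod[OF pw g, folded p_def]
  note D = dprodD[OF d(1)]
  have p: "p \<in> Arr C" "Cod C p = Cod C f" using pbD[OF D(3)] by auto
  let ?P = "\<lambda>k. k \<in> hom C (Dom C x) (Dom C p) \<and> p \<cdot> k = x \<and>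
     mid (ev C f g) \<cdot> pb_lift C (pb1 C f p) (pb2 C f p) (pb1 C f x) (k \<cdot> pb2 C f x) = h"
  have ex1: "\<exists>!k. ?P k" by (rule dprod_ex1[OF d(1) pb[OF x]]) (simp_all add: h hom_iff)
  let ?e = "mid (ev C f g)"
  have iff: "t \<in> hom (slice C (Cod C f)) x p \<and> ev C f g \<cdot>\<^bsub>slice C (Dom C f)\<^esub> FA (pb_functor C f) t = (pb1 C f x, h, g)
        \<longleftrightarrow> (\<exists>k. t = (x, k, p) \<and> ?P k)" (is "?L \<longleftrightarrow> ?R") for t
  proof
    assume t: "?L"
    then obtain k where k: "t = (x, k, p)" "k \<in> Arr C" "Dom C k = Dom C x" "Cod C k = Dom C p" "p \<cdot> k = x"
      unfolding slice_hom_iff by blast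
    with t have "(pb1 C f p, ?e, g) \<cdot>\<^bsub>slice C (Dom C f)\<^esub> FA (pb_functor C f) (x, k, p) = (pb1 C f x, h, g)"
      using d(2) by metis
    then show "?R" using k x p by (simp add: pb_functor_def hom_iff)
  next
    assume "?R"
    then obtain k where k: "t = (x, k, p)" "k \<in> Arr C" "Dom C k = Dom C x" "Cod C k = Dom C p" "p \<cdot> k = x"
      "?e \<cdot> pb_lift C (pb1 C f p) (pb2 C f p) (pb1 C f x) (k \<cdot> pb2 C f x) = h" unfolding hom_iff by blast
    then have "(pb1 C f p, ?e, g) \<cdot>\<^bsub>slice C (Dom C f)\<^esub> FA (pb_functor C f) (x, k, p) = (pb1 C f x, h, g)"
      using x p by (simp add: pb_functor_def)
    then have "ev C f g \<cdot>\<^bsub>slice C (Dom C f)\<^esub> FA (pb_functor C f) (x, k, p) = (pb1 C f x, h, g)"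
      using d(2) by metis
    then show "?L" using k x p by (simp add: slice_hom_iff)
  qed
  obtain l where l: "?P l" using ex1 by blast
  have "transpose C f x g (pb1 C f x, h, g) = (THE t. \<exists>k. t = (x, k, p) \<and> ?P k)"
    unfolding transpose_def p_def[symmetric] iff ..
  also have "\<dots> = (x, l, p)" by (rule the_equality) (use l ex1 in auto)
  finally have t: "transpose C f x g (pb1 C f x, h, g) = (x, l, p)" .
  then have "k = l" by (simp add: k_def)
  with t l show "transpose C f x g (pb1 C f x, h, g) = (x, k, p)" "k \<in> Arr C" "Dom C k = Dom C x" "Cod C k = Dom C p"
    "p \<cdot> k = x" "mid (ev C f g) \<cdot> pb_lift C (pb1 C f p) (pb2 C f p) (pb1 C f x) (k \<cdot> pb2 C f x) = h"
    by (auto simp: hom_iff)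
qed

end

section \<open>Gluing dependent products along matching maps\<close>

text \<open>The relative universal property that characterises \<open>(\<Pi>\<^sub>B C)|\<^bsub>=n\<^esub>\<close> over \<open>M\<^sub>n(\<Pi>\<^sub>B C)\<close>. Primed data live
  over the matching objects; \<open>(p', e')\<close> plays the role of \<open>M\<^sub>n\<close> of the dependent product and its
  counit.\<close>

definition glued :: "('e, 'f) cat \<Rightarrow> 'f \<Rightarrow> 'f \<Rightarrow> 'f \<Rightarrow> 'f \<Rightarrow> 'f \<Rightarrow> 'f \<Rightarrow> 'f \<Rightarrow> 'f \<Rightarrow> 'f \<Rightarrow>
    'f \<Rightarrow> 'f \<Rightarrow> 'f \<Rightarrow> 'f \<Rightarrow> 'f \<Rightarrow> bool" where
  "glued C r g mA mB mC p' w1' w2' e' p mP w1 w2 e \<longleftrightarrow>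
     mP \<in> hom C (Dom C p) (Dom C p') \<and> mA \<cdot>\<^bsub>C\<^esub> p = p' \<cdot>\<^bsub>C\<^esub> mP \<and> is_pullback C r p w1 w2
     \<and> e \<in> hom C (Dom C w1) (Dom C g) \<and> g \<cdot>\<^bsub>C\<^esub> e = w1
     \<and> mC \<cdot>\<^bsub>C\<^esub> e = e' \<cdot>\<^bsub>C\<^esub> pb_lift C w1' w2' (mB \<cdot>\<^bsub>C\<^esub> w1) (mP \<cdot>\<^bsub>C\<^esub> w2)
     \<and> (\<forall>t q y1 y2 s. is_pullback C r t y1 y2 \<longrightarrow> q \<in> hom C (Dom C t) (Dom C p') \<longrightarrow> mA \<cdot>\<^bsub>C\<^esub> t = p' \<cdot>\<^bsub>C\<^esub> q \<longrightarrow>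
          s \<in> hom C (Dom C y1) (Dom C g) \<longrightarrow> g \<cdot>\<^bsub>C\<^esub> s = y1 \<longrightarrow>
          mC \<cdot>\<^bsub>C\<^esub> s = e' \<cdot>\<^bsub>C\<^esub> pb_lift C w1' w2' (mB \<cdot>\<^bsub>C\<^esub> y1) (q \<cdot>\<^bsub>C\<^esub> y2) \<longrightarrow>
          (\<exists>!k. k \<in> hom C (Dom C t) (Dom C p) \<and> p \<cdot>\<^bsub>C\<^esub> k = t \<and> mP \<cdot>\<^bsub>C\<^esub> k = q
             \<and> e \<cdot>\<^bsub>C\<^esub> pb_lift C w1 w2 y1 (k \<cdot>\<^bsub>C\<^esub> y2) = s))"

text \<open>The situation over one boundary category in the abstract: \<open>r\<close> and
  \<open>g\<close> are the restrictions of the two given maps, \<open>f'\<close>, \<open>g'\<close>,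
  \<open>p'\<close>, \<open>e'\<close> the images under the matching functor of these maps, of the
  projection and of the evaluation, and \<open>mA\<close>, \<open>mB\<close>, \<open>mC\<close> the
  matching maps. Of \<open>(p', e')\<close> only \<open>g' \<cdot> e' = w1'\<close> is required,
  because a stage is built before the universal property of the lower stages is available.\<close>

locale matching_data = category C for C :: "('e, 'f) cat" (structure) +
  fixes r g mA mB mC f' g' p' w1' w2' e'
  assumes r [simp]: "r \<in> Arr C" and g [simp]: "g \<in> Arr C" "Cod C g = Dom C r"
    and f' [simp]: "f' \<in> Arr C" and g' [simp]: "g' \<in> Arr C" "Cod C g' = Dom C f'"
    and mA [simp]: "mA \<in> Arr C" "Dom C mA = Cod C r" "Cod C mA = Cod C f'"
    and mB [simp]: "mB \<in> Arr C" "Dom C mB = Dom C r" "Cod C mB = Dom C f'"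
    and mC [simp]: "mC \<in> Arr C" "Dom C mC = Dom C g" "Cod C mC = Dom C g'"
    and nat_f: "f' \<cdot> mB = mA \<cdot> r" and nat_g: "g' \<cdot> mC = mB \<cdot> g"
    and w': "is_pullback C f' p' w1' w2'"
    and e' [simp]: "e' \<in> Arr C" "Dom C e' = Dom C w1'" "Cod C e' = Dom C g'" and ge': "g' \<cdot> e' = w1'"
begin

lemmas w'_simps [simp] = pbD(1-8)[OF w']

lemma match_commute:
  assumes y: "is_pullback C r t y1 y2" and q: "q \<in> Arr C" "Dom C q = Dom C t" "Cod C q = Dom C p'"
    and c: "mA \<cdot> t = p' \<cdot> q"
  shows "f' \<cdot> (mB \<cdot> y1) = p' \<cdot> (q \<cdot> y2)"
proof -
  note [simp] = pbD(1-8)[OF y] q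
  have "f' \<cdot> (mB \<cdot> y1) = mA \<cdot> (r \<cdot> y1)" by (rule comp_ext2[OF nat_f]) simp_all
  also have "\<dots> = mA \<cdot> (t \<cdot> y2)" by (simp add: pbD(9)[OF y])
  also have "\<dots> = p' \<cdot> (q \<cdot> y2)" by (rule comp_ext2[OF c]) simp_all
  finally show ?thesis .
qed

text \<open>This is the map that \<open>mB\<close> and \<open>q\<close> induce from the base change
  of \<open>t\<close> along \<open>r\<close> to the base change of \<open>p'\<close> along
  \<open>f'\<close>. Followed by \<open>e'\<close> it gives the component over the matching object
  of the third map that a transpose has to agree with.\<close>

lemma match_lift:
  assumes y: "is_pullback C r t y1 y2" and q: "q \<in> Arr C" "Dom C q = Dom C t" "Cod C q = Dom C p'"
    and c: "mA \<cdot> t = p' \<cdot> q"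
  shows "pb_lift C w1' w2' (mB \<cdot> y1) (q \<cdot> y2) \<in> Arr C" "Dom C (pb_lift C w1' w2' (mB \<cdot> y1) (q \<cdot> y2)) = Dom C y1"
    "Cod C (pb_lift C w1' w2' (mB \<cdot> y1) (q \<cdot> y2)) = Dom C w1'"
    "w1' \<cdot> pb_lift C w1' w2' (mB \<cdot> y1) (q \<cdot> y2) = mB \<cdot> y1"
    "w2' \<cdot> pb_lift C w1' w2' (mB \<cdot> y1) (q \<cdot> y2) = q \<cdot> y2"
proof -
  note [simp] = pbD(1-8)[OF y] q
  note l = pb_lift[OF w' _ _ _ _ _ match_commute[OF y q c]]
  show "pb_lift C w1' w2' (mB \<cdot> y1) (q \<cdot> y2) \<in> Arr C" "Dom C (pb_lift C w1' w2' (mB \<cdot> y1) (q \<cdot> y2)) = Dom C y1"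
    "Cod C (pb_lift C w1' w2' (mB \<cdot> y1) (q \<cdot> y2)) = Dom C w1'"
    "w1' \<cdot> pb_lift C w1' w2' (mB \<cdot> y1) (q \<cdot> y2) = mB \<cdot> y1"
    "w2' \<cdot> pb_lift C w1' w2' (mB \<cdot> y1) (q \<cdot> y2) = q \<cdot> y2"
    using l by simp_all
qed

lemma match_lift_comp:
  assumes y: "is_pullback C r t y1 y2" and q: "q \<in> Arr C" "Dom C q = Dom C t" "Cod C q = Dom C p'"
    and c: "mA \<cdot> t = p' \<cdot> q" and z: "is_pullback C r u z1 z2"
    and k: "k \<in> Arr C" "Dom C k = Dom C u" "Cod C k = Dom C t" "t \<cdot> k = u"
  shows "pb_lift C w1' w2' (mB \<cdot> y1) (q \<cdot> y2) \<cdot> pb_lift C y1 y2 z1 (k \<cdot> z2)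
    = pb_lift C w1' w2' (mB \<cdot> z1) ((q \<cdot> k) \<cdot> z2)"
proof -
  note [simp] = pbD(1-8)[OF y] pbD(1-8)[OF z] q k(1-3) pb_map[OF y z k] match_lift[OF y q c]
  show ?thesis
  proof (rule pb_lift_unique[OF w', symmetric])
    show "w1' \<cdot> pb_lift C w1' w2' (mB \<cdot> y1) (q \<cdot> y2) \<cdot> pb_lift C y1 y2 z1 (k \<cdot> z2) = mB \<cdot> z1"
      by (subst comp_ext[OF match_lift(4)[OF y q c]]) simp_all
    show "w2' \<cdot> pb_lift C w1' w2' (mB \<cdot> y1) (q \<cdot> y2) \<cdot> pb_lift C y1 y2 z1 (k \<cdot> z2) = (q \<cdot> k) \<cdot> z2"
      by (subst comp_ext[OF match_lift(5)[OF y q c]]) simp_all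
  qed simp_all
qed

lemma z_arr:
  assumes z: "is_pullback C mA p' z1 z2"
  shows "z2 \<in> Arr C" "Dom C z2 = Dom C z1" "Cod C z2 = Dom C p'" "mA \<cdot> z1 = p' \<cdot> z2"
  using pbD[OF z] by simp_all

lemma pair_mC:
  assumes y: "is_pullback C mB g' y1 y2"
  shows "pb_lift C y1 y2 g mC \<in> Arr C" "Dom C (pb_lift C y1 y2 g mC) = Dom C g"
    "Cod C (pb_lift C y1 y2 g mC) = Dom C y1" "y1 \<cdot> pb_lift C y1 y2 g mC = g" "y2 \<cdot> pb_lift C y1 y2 g mC = mC"
  by (rule pb_lift[OF y]; simp add: nat_g)+

text \<open>The map whose transpose along \<open>r\<close> is the second side of the square in the
  formula. It lands in the pullback of \<open>g'\<close> along \<open>mB\<close> because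
  \<open>g' \<cdot> e' = w1'\<close>.\<close>

lemma pair_match_lift:
  assumes y: "is_pullback C mB g' y1 y2" and z: "is_pullback C mA p' z1 z2" and x: "is_pullback C r z1 x1 x2"
  defines "l \<equiv> pb_lift C y1 y2 x1 (e' \<cdot> pb_lift C w1' w2' (mB \<cdot> x1) (z2 \<cdot> x2))"
  shows "l \<in> Arr C" "Dom C l = Dom C x1" "Cod C l = Dom C y1" "y1 \<cdot> l = x1"
    "y2 \<cdot> l = e' \<cdot> pb_lift C w1' w2' (mB \<cdot> x1) (z2 \<cdot> x2)"
proof -
  note [simp] = pbD(1-8)[OF y] pbD(1-8)[OF z] pbD(1-8)[OF x]
  note ml = match_lift[OF x z_arr[OF z]]
  have c: "mB \<cdot> x1 = g' \<cdot> e' \<cdot> pb_lift C w1' w2' (mB \<cdot> x1) (z2 \<cdot> x2)"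
    using ml comp_ext[OF ge'] by simp
  show "l \<in> Arr C" "Dom C l = Dom C x1" "Cod C l = Dom C y1" "y1 \<cdot> l = x1"
    "y2 \<cdot> l = e' \<cdot> pb_lift C w1' w2' (mB \<cdot> x1) (z2 \<cdot> x2)"
    unfolding l_def by (rule pb_lift[OF y _ _ _ _ _ c]; use ml in simp)+
qed

end

lemma gluedD:
  assumes "glued C r g mA mB mC p' w1' w2' e' p mP w1 w2 e"
  shows "mP \<in> Arr C" "Dom C mP = Dom C p" "Cod C mP = Dom C p'" "mA \<cdot>\<^bsub>C\<^esub> p = p' \<cdot>\<^bsub>C\<^esub> mP"
    "is_pullback C r p w1 w2" "e \<in> Arr C" "Dom C e = Dom C w1" "Cod C e = Dom C g" "g \<cdot>\<^bsub>C\<^esub> e = w1"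
    "mC \<cdot>\<^bsub>C\<^esub> e = e' \<cdot>\<^bsub>C\<^esub> pb_lift C w1' w2' (mB \<cdot>\<^bsub>C\<^esub> w1) (mP \<cdot>\<^bsub>C\<^esub> w2)"
  using assms by (simp_all add: glued_def hom_iff)

lemma glued_ex1:
  assumes "glued C r g mA mB mC p' w1' w2' e' p mP w1 w2 e"
    and "is_pullback C r t y1 y2" "q \<in> hom C (Dom C t) (Dom C p')" "mA \<cdot>\<^bsub>C\<^esub> t = p' \<cdot>\<^bsub>C\<^esub> q"
    "s \<in> hom C (Dom C y1) (Dom C g)" "g \<cdot>\<^bsub>C\<^esub> s = y1"
    "mC \<cdot>\<^bsub>C\<^esub> s = e' \<cdot>\<^bsub>C\<^esub> pb_lift C w1' w2' (mB \<cdot>\<^bsub>C\<^esub> y1) (q \<cdot>\<^bsub>C\<^esub> y2)"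
  shows "\<exists>!k. k \<in> hom C (Dom C t) (Dom C p) \<and> p \<cdot>\<^bsub>C\<^esub> k = t \<and> mP \<cdot>\<^bsub>C\<^esub> k = q
     \<and> e \<cdot>\<^bsub>C\<^esub> pb_lift C w1 w2 y1 (k \<cdot>\<^bsub>C\<^esub> y2) = s"
  using assms unfolding glued_def by blast

text \<open>The square of the theorem, with the dependent products \<open>\<pi>1\<close> of \<open>g\<close> and \<open>\<pi>2\<close> of \<open>y1\<close> along \<open>r\<close>.\<close>

locale matching_square = matching_data +
  fixes \<pi>1 u1 u2 \<epsilon>1 y1 y2 \<pi>2 v1 v2 \<epsilon>2 z1 z2 x1 x2 c h
  assumes d1: "dprod C r g \<pi>1 u1 u2 \<epsilon>1" and y: "is_pullback C mB g' y1 y2"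
    and d2: "dprod C r y1 \<pi>2 v1 v2 \<epsilon>2" and z: "is_pullback C mA p' z1 z2" and x: "is_pullback C r z1 x1 x2"
    and c [simp]: "c \<in> Arr C" "Dom C c = Dom C \<pi>1" "Cod C c = Dom C \<pi>2" and pc: "\<pi>2 \<cdot> c = \<pi>1"
    and ec: "\<epsilon>2 \<cdot> pb_lift C v1 v2 u1 (c \<cdot> u2) = pb_lift C y1 y2 g mC \<cdot> \<epsilon>1"
    and h [simp]: "h \<in> Arr C" "Dom C h = Dom C z1" "Cod C h = Dom C \<pi>2" and ph: "\<pi>2 \<cdot> h = z1"
    and eh: "\<epsilon>2 \<cdot> pb_lift C v1 v2 x1 (h \<cdot> x2)
      = pb_lift C y1 y2 x1 (e' \<cdot> pb_lift C w1' w2' (mB \<cdot> x1) (z2 \<cdot> x2))"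
begin

lemmas square_simps [simp] = dprodD(1,2,4-6)[OF d1] dprodD(1,2,4-6)[OF d2] pbD(1-8)[OF dprodD(3)[OF d1]]
  pbD(1-8)[OF dprodD(3)[OF d2]] pbD(1-8)[OF y] pbD(1-8)[OF z] pbD(1-8)[OF x]

lemmas zlift = z_arr[OF z]
lemmas gmC = pair_mC[OF y]
lemmas xe = pair_match_lift[OF y z x]

text \<open>Equality of the two maps into \<open>Dom C \<pi>2\<close> may be tested after
  transposing along \<open>r\<close>, thus in the pullback of \<open>mB\<close> and
  \<open>g'\<close>. There the first components agree, both being the projection \<open>t1\<close>,
  so only the second ones remain to be compared. This translates the square into the compatibility
  condition of \<open>glued\<close>.\<close>

lemma square_iff:
  assumes a: "a \<in> Arr C" "Dom C a = Dom C t" "Cod C a = Dom C \<pi>1" "\<pi>1 \<cdot> a = t"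
    and b: "b \<in> Arr C" "Dom C b = Dom C t" "Cod C b = Dom C z1" "z1 \<cdot> b = t"
    and t: "is_pullback C r t t1 t2"
  shows "c \<cdot> a = h \<cdot> b \<longleftrightarrow> mC \<cdot> \<epsilon>1 \<cdot> pb_lift C u1 u2 t1 (a \<cdot> t2)
    = e' \<cdot> pb_lift C w1' w2' (mB \<cdot> t1) ((z2 \<cdot> b) \<cdot> t2)"
proof -
  note D1 = dprodD(3)[OF d1] and D2 = dprodD(3)[OF d2]
  note la = pb_map[OF D1 t a] and lb = pb_map[OF x t b]
  have c': "c \<in> Arr C" "Dom C c = Dom C \<pi>1" "Cod C c = Dom C \<pi>2" "\<pi>2 \<cdot> c = \<pi>1" by (simp_all add: pc)
  have h': "h \<in> Arr C" "Dom C h = Dom C z1" "Cod C h = Dom C \<pi>2" "\<pi>2 \<cdot> h = z1" by (simp_all add: ph)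
  note lc = pb_map[OF D2 D1 c'] and lh = pb_map[OF D2 x h'] and lz = match_lift[OF x zlift]
  have ca: "c \<cdot> a \<in> Arr C" "Dom C (c \<cdot> a) = Dom C t" "Cod C (c \<cdot> a) = Dom C \<pi>2" "\<pi>2 \<cdot> c \<cdot> a = t"
    using a comp_ext[OF pc] by simp_all
  have hb: "h \<cdot> b \<in> Arr C" "Dom C (h \<cdot> b) = Dom C t" "Cod C (h \<cdot> b) = Dom C \<pi>2" "\<pi>2 \<cdot> h \<cdot> b = t"
    using b comp_ext[OF ph] by simp_all
  note [simp] = pbD(1-8)[OF t] a(1-3) b(1-3) la lb lc lh lz gmC xe
  let ?L = "pb_lift C y1 y2 g mC \<cdot> \<epsilon>1 \<cdot> pb_lift C u1 u2 t1 (a \<cdot> t2)"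
  let ?R = "pb_lift C y1 y2 x1 (e' \<cdot> pb_lift C w1' w2' (mB \<cdot> x1) (z2 \<cdot> x2)) \<cdot> pb_lift C x1 x2 t1 (b \<cdot> t2)"
  have L: "\<epsilon>2 \<cdot> pb_lift C v1 v2 t1 ((c \<cdot> a) \<cdot> t2) = ?L"
    unfolding pb_map_comp[OF D2 D1 t c' a, symmetric] by (subst comp_ext[OF ec]) simp_all
  have R: "\<epsilon>2 \<cdot> pb_lift C v1 v2 t1 ((h \<cdot> b) \<cdot> t2) = ?R"
    unfolding pb_map_comp[OF D2 x t h' b, symmetric] by (subst comp_ext[OF eh]) simp_all
  have "c \<cdot> a = h \<cdot> b \<longleftrightarrow> ?L = ?R"
    using dprod_eqI[OF d2 t ca hb] L R by metis
  \<comment> \<open>Both composites have first component \<open>t1\<close>, so \<open>y2\<close>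
    alone decides the equality.\<close>
  also have "\<dots> \<longleftrightarrow> y2 \<cdot> ?L = y2 \<cdot> ?R"
  proof
    assume y2: "y2 \<cdot> ?L = y2 \<cdot> ?R"
    have "y1 \<cdot> ?L = g \<cdot> \<epsilon>1 \<cdot> pb_lift C u1 u2 t1 (a \<cdot> t2)" by (subst comp_ext[OF gmC(4)]) simp_all
    also have "\<dots> = t1" by (subst comp_ext[OF dprodD(7)[OF d1]]) simp_all
    finally have y1: "y1 \<cdot> ?L = y1 \<cdot> ?R" by (subst comp_ext[OF xe(4)]) simp_all
    show "?L = ?R" by (rule pb_eqI[OF y _ _ _ _ _ y1 y2]) simp_all
  qed simp
  also have "y2 \<cdot> ?L = mC \<cdot> \<epsilon>1 \<cdot> pb_lift C u1 u2 t1 (a \<cdot> t2)" by (subst comp_ext[OF gmC(5)]) simp_all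
  also have "y2 \<cdot> ?R = e' \<cdot> pb_lift C w1' w2' (mB \<cdot> t1) ((z2 \<cdot> b) \<cdot> t2)"
    unfolding match_lift_comp[OF x zlift t b, symmetric] by (subst comp_ext[OF xe(5)]) simp_all
  finally show ?thesis .
qed

text \<open>A map into the pullback of \<open>c\<close> and \<open>h\<close> is a pair: its
  component over \<open>\<pi>1\<close> is the transpose of a map \<open>s\<close>, its component
  over \<open>z1\<close> is a pair \<open>(t, q)\<close>. By \<open>square_iff\<close> the two
  components agree exactly when \<open>s\<close> and \<open>q\<close> satisfy the compatibility in
  \<open>glued\<close>.\<close>

lemma glued_of_pullback:
  assumes ab: "is_pullback C c h a b" and w: "is_pullback C r (\<pi>1 \<cdot> a) w1 w2"
  shows "glued C r g mA mB mC p' w1' w2' e' (\<pi>1 \<cdot> a) (z2 \<cdot> b) w1 w2 (\<epsilon>1 \<cdot> pb_lift C u1 u2 w1 (a \<cdot> w2))"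
proof -
  note D1 = dprodD(3)[OF d1]
  note [simp] = pbD(1-8)[OF ab]
  have zb: "z1 \<cdot> b = \<pi>1 \<cdot> a"
    using comp_ext[OF ph, of b] comp_ext[OF pc, of a] pbD(9)[OF ab] by simp
  have a': "a \<in> Arr C" "Dom C a = Dom C (\<pi>1 \<cdot> a)" "Cod C a = Dom C \<pi>1" "\<pi>1 \<cdot> a = \<pi>1 \<cdot> a" by simp_all
  have b': "b \<in> Arr C" "Dom C b = Dom C (\<pi>1 \<cdot> a)" "Cod C b = Dom C z1" "z1 \<cdot> b = \<pi>1 \<cdot> a" by (simp_all add: zb)
  note la = pb_map[OF D1 w a']
  note [simp] = pbD(1-8)[OF w, simplified] la[simplified]
  have comm: "mA \<cdot> \<pi>1 \<cdot> a = p' \<cdot> z2 \<cdot> b"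
    using comp_ext2[OF zlift(4), of b] zb by simp
  show ?thesis unfolding glued_def
  proof (intro conjI allI impI)
    show "mA \<cdot> \<pi>1 \<cdot> a = p' \<cdot> z2 \<cdot> b" by (rule comm)
    show "g \<cdot> \<epsilon>1 \<cdot> pb_lift C u1 u2 w1 (a \<cdot> w2) = w1"
      by (subst comp_ext[OF dprodD(7)[OF d1]]) simp_all
    show "mC \<cdot> \<epsilon>1 \<cdot> pb_lift C u1 u2 w1 (a \<cdot> w2) = e' \<cdot> pb_lift C w1' w2' (mB \<cdot> w1) ((z2 \<cdot> b) \<cdot> w2)"
      using square_iff[OF a' b' w] pbD(9)[OF ab] by simp
    fix t q t1 t2 s
    assume t: "is_pullback C r t t1 t2" and q: "q \<in> hom C (Dom C t) (Dom C p')" and qc: "mA \<cdot> t = p' \<cdot> q"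
      and s: "s \<in> hom C (Dom C t1) (Dom C g)" "g \<cdot> s = t1"
      and sq: "mC \<cdot> s = e' \<cdot> pb_lift C w1' w2' (mB \<cdot> t1) (q \<cdot> t2)"
    note [simp] = pbD(1-8)[OF t] homD[OF q] homD[OF s(1)]
    obtain a0 where a0: "a0 \<in> Arr C" "Dom C a0 = Dom C t" "Cod C a0 = Dom C \<pi>1" "\<pi>1 \<cdot> a0 = t"
      "\<epsilon>1 \<cdot> pb_lift C u1 u2 t1 (a0 \<cdot> t2) = s"
      using dprod_ex1[OF d1 t s] unfolding hom_iff by blast
    let ?b0 = "pb_lift C z1 z2 t q"
    have b0: "?b0 \<in> Arr C" "Dom C ?b0 = Dom C t" "Cod C ?b0 = Dom C z1" "z1 \<cdot> ?b0 = t" "z2 \<cdot> ?b0 = q"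
      by (rule pb_lift[OF z]; simp add: qc)+
    have ab0: "c \<cdot> a0 = h \<cdot> ?b0"
      using square_iff[OF a0(1-4) b0(1-4) t] sq a0(5) b0(5) by simp
    \<comment> \<open>The conditions on \<open>k\<close> in \<open>glued\<close> become those of the
      universal property of \<open>(a, b)\<close>. The case distinction is needed because the
      translation makes sense only for maps over \<open>t\<close>; for any other \<open>k\<close>
      both sides fail.\<close>
    have eq: "k \<in> hom C (Dom C t) (Dom C (\<pi>1 \<cdot> a)) \<and> (\<pi>1 \<cdot> a) \<cdot> k = t \<and> (z2 \<cdot> b) \<cdot> k = q
        \<and> (\<epsilon>1 \<cdot> pb_lift C u1 u2 w1 (a \<cdot> w2)) \<cdot> pb_lift C w1 w2 t1 (k \<cdot> t2) = s
      \<longleftrightarrow> k \<in> hom C (Dom C a0) (Dom C a) \<and> a \<cdot> k = a0 \<and> b \<cdot> k = ?b0" (is "?A \<longleftrightarrow> ?B") for k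
    proof (cases "k \<in> hom C (Dom C t) (Dom C a) \<and> \<pi>1 \<cdot> a \<cdot> k = t")
      case True
      then have k: "k \<in> Arr C" "Dom C k = Dom C t" "Cod C k = Dom C a" "\<pi>1 \<cdot> a \<cdot> k = t" by (simp_all add: hom_iff)
      then have k': "k \<in> Arr C" "Dom C k = Dom C t" "Cod C k = Dom C (\<pi>1 \<cdot> a)" "(\<pi>1 \<cdot> a) \<cdot> k = t" by simp_all
      note [simp] = k(1-3) pb_map[OF w t k']
      have zbk: "z1 \<cdot> b \<cdot> k = t" using comp_ext[OF zb, of k] k by simp
      have ak: "a \<cdot> k \<in> Arr C" "Dom C (a \<cdot> k) = Dom C t" "Cod C (a \<cdot> k) = Dom C \<pi>1" "\<pi>1 \<cdot> a \<cdot> k = t"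
        using k by simp_all
      have 1: "(\<epsilon>1 \<cdot> pb_lift C u1 u2 w1 (a \<cdot> w2)) \<cdot> pb_lift C w1 w2 t1 (k \<cdot> t2)
          = \<epsilon>1 \<cdot> pb_lift C u1 u2 t1 ((a \<cdot> k) \<cdot> t2)"
        using pb_map_comp[OF D1 w t a' k'] by simp
      have "\<epsilon>1 \<cdot> pb_lift C u1 u2 t1 ((a \<cdot> k) \<cdot> t2) = s \<longleftrightarrow> a \<cdot> k = a0"
        using dprod_eqI[OF d1 t ak a0(1-4)] a0(5) by metis
      moreover have "z2 \<cdot> b \<cdot> k = q \<longleftrightarrow> b \<cdot> k = ?b0"
      proof
        assume "z2 \<cdot> b \<cdot> k = q"
        then show "b \<cdot> k = ?b0" by (rule_tac pb_eqI[OF z, of "b \<cdot> k" ?b0]) (simp_all add: zbk b0)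
      qed (simp add: b0)
      moreover have "?A \<longleftrightarrow> z2 \<cdot> b \<cdot> k = q \<and> \<epsilon>1 \<cdot> pb_lift C u1 u2 t1 ((a \<cdot> k) \<cdot> t2) = s"
        using k' unfolding 1 by (simp add: hom_iff)
      moreover have "?B \<longleftrightarrow> a \<cdot> k = a0 \<and> b \<cdot> k = ?b0" using k a0(2) by (simp add: hom_iff)
      ultimately show ?thesis by blast
    next
      case False
      have "\<not> ?B"
      proof
        assume B: ?B
        then have "\<pi>1 \<cdot> a \<cdot> k = t" using a0(4) by simp
        then show False using False B a0(2) by simp
      qed
      moreover have "\<not> ?A"
      proof
        assume A: ?A
        then have "k \<in> Arr C" "Cod C k = Dom C a" "(\<pi>1 \<cdot> a) \<cdot> k = t" by (simp_all add: hom_iff)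
        then have "\<pi>1 \<cdot> a \<cdot> k = t" by simp
        then show False using False A by simp
      qed
      ultimately show ?thesis by blast
    qed
    show "\<exists>!k. k \<in> hom C (Dom C t) (Dom C (\<pi>1 \<cdot> a)) \<and> (\<pi>1 \<cdot> a) \<cdot> k = t \<and> (z2 \<cdot> b) \<cdot> k = q
        \<and> (\<epsilon>1 \<cdot> pb_lift C u1 u2 w1 (a \<cdot> w2)) \<cdot> pb_lift C w1 w2 t1 (k \<cdot> t2) = s"
      unfolding eq by (rule pb_ex1[OF ab]) (simp_all add: a0(1-3) b0 ab0)
  qed (simp_all add: hom_iff w)
qed

text \<open>The same correspondence read backwards, for a given \<open>glued\<close> object in place
  of the constructed one; this is what yields the formula. Pullbacks along \<open>r\<close> are
  required so that every cone comes with a square on which its transpose can be tested.\<close>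

lemma pullback_of_glued:
  assumes pbs: "has_pullbacks_along C r" and gl: "glued C r g mA mB mC p' w1' w2' e' p mP w1 w2 e"
    and a: "a \<in> Arr C" "Dom C a = Dom C p" "Cod C a = Dom C \<pi>1" "\<pi>1 \<cdot> a = p"
      "\<epsilon>1 \<cdot> pb_lift C u1 u2 w1 (a \<cdot> w2) = e"
    and b: "b \<in> Arr C" "Dom C b = Dom C p" "Cod C b = Dom C z1" "z1 \<cdot> b = p" "z2 \<cdot> b = mP"
  shows "is_pullback C c h a b"
proof -
  note D1 = dprodD(3)[OF d1] and G = gluedD[OF gl]
  note la = pb_map[OF D1 G(5) a(1-4)]
  note [simp] = a(1-3) b(1-3) G(1-3,6-8) pbD(1-8)[OF G(5)] la
  have key: "k \<in> hom C (Dom C t) (Dom C p) \<and> p \<cdot> k = t \<and> mP \<cdot> k = z2 \<cdot> b0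
        \<and> e \<cdot> pb_lift C w1 w2 t1 (k \<cdot> t2) = \<epsilon>1 \<cdot> pb_lift C u1 u2 t1 (a0 \<cdot> t2)
      \<longleftrightarrow> k \<in> hom C (Dom C a0) (Dom C a) \<and> a \<cdot> k = a0 \<and> b \<cdot> k = b0" (is "?A \<longleftrightarrow> ?B")
    if t: "is_pullback C r t t1 t2" and a0: "a0 \<in> Arr C" "Dom C a0 = Dom C t" "Cod C a0 = Dom C \<pi>1" "\<pi>1 \<cdot> a0 = t"
      and b0: "b0 \<in> Arr C" "Dom C b0 = Dom C t" "Cod C b0 = Dom C z1" "z1 \<cdot> b0 = t"
    for k t t1 t2 a0 b0
  proof (cases "k \<in> hom C (Dom C t) (Dom C p) \<and> p \<cdot> k = t")
    case True
    then have k: "k \<in> Arr C" "Dom C k = Dom C t" "Cod C k = Dom C p" "p \<cdot> k = t" by (simp_all add: hom_iff)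
    note [simp] = k(1-3) pb_map[OF G(5) t k]
    have ak: "a \<cdot> k \<in> Arr C" "Dom C (a \<cdot> k) = Dom C t" "Cod C (a \<cdot> k) = Dom C \<pi>1" "\<pi>1 \<cdot> a \<cdot> k = t"
      using comp_ext[OF a(4), of k] k(4) by simp_all
    have "e \<cdot> pb_lift C w1 w2 t1 (k \<cdot> t2) = \<epsilon>1 \<cdot> pb_lift C u1 u2 t1 ((a \<cdot> k) \<cdot> t2)"
      using pb_map_comp[OF D1 G(5) t a(1-4) k]
        comp_ext[OF a(5), of "pb_lift C w1 w2 t1 (k \<cdot> t2)"] by simp
    then have "e \<cdot> pb_lift C w1 w2 t1 (k \<cdot> t2) = \<epsilon>1 \<cdot> pb_lift C u1 u2 t1 (a0 \<cdot> t2) \<longleftrightarrow> a \<cdot> k = a0"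
      using dprod_eqI[OF d1 t ak a0] by metis
    moreover have "mP \<cdot> k = z2 \<cdot> b0 \<longleftrightarrow> b \<cdot> k = b0"
    proof
      assume "mP \<cdot> k = z2 \<cdot> b0"
      then show "b \<cdot> k = b0" using comp_ext[OF b(4), of k] comp_ext[OF b(5), of k] k(4) b0
        by (rule_tac pb_eqI[OF z, of "b \<cdot> k" b0]) simp_all
    next
      assume "b \<cdot> k = b0"
      then show "mP \<cdot> k = z2 \<cdot> b0" using comp_ext[OF b(5), of k] by simp
    qed
    moreover have "?B \<longleftrightarrow> a \<cdot> k = a0 \<and> b \<cdot> k = b0" using k a0(2) by (simp add: hom_iff)
    moreover have "?A \<longleftrightarrow> mP \<cdot> k = z2 \<cdot> b0 \<and> e \<cdot> pb_lift C w1 w2 t1 (k \<cdot> t2) = \<epsilon>1 \<cdot> pb_lift C u1 u2 t1 (a0 \<cdot> t2)"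
      using k by (simp add: hom_iff)
    ultimately show ?thesis by blast
  next
    case False
    have "\<not> ?B"
    proof
      assume B: ?B
      then have k: "k \<in> Arr C" "Cod C k = Dom C a" "Dom C k = Dom C t" using a0 by (simp_all add: hom_iff)
      then have "p \<cdot> k = t" using comp_ext[OF a(4), of k] B a0(4) by simp
      then show False using False k by (simp add: hom_iff)
    qed
    then show ?thesis using False by blast
  qed
  have ch: "c \<cdot> a = h \<cdot> b"
    using square_iff[OF a(1-4) b(1-4) G(5)] G(10) a(5) b(5) by simp
  show ?thesis
  proof (rule is_pullbackI)
    show "c \<cdot> a = h \<cdot> b" by (rule ch)
    fix a0 b0 assume a0: "a0 \<in> Arr C" "b0 \<in> Arr C" "Dom C b0 = Dom C a0" "Cod C a0 = Dom C c"
      "Cod C b0 = Dom C h" and cc: "c \<cdot> a0 = h \<cdot> b0"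
    note [simp] = a0
    \<comment> \<open>A cone \<open>(a0, b0)\<close> carries no map to the base by itself; the
      common composite \<open>?t\<close> of its two legs provides one, and the problem of
      \<open>glued\<close> is posed over it.\<close>
    let ?t = "\<pi>1 \<cdot> a0"
    have zb: "z1 \<cdot> b0 = ?t" using comp_ext[OF ph, of b0] comp_ext[OF pc, of a0] cc by simp
    have t: "is_pullback C r ?t (pb1 C r ?t) (pb2 C r ?t)" by (rule chosen_pullback[OF pbs]) simp_all
    have a': "a0 \<in> Arr C" "Dom C a0 = Dom C ?t" "Cod C a0 = Dom C \<pi>1" "\<pi>1 \<cdot> a0 = ?t" by simp_all
    have b': "b0 \<in> Arr C" "Dom C b0 = Dom C ?t" "Cod C b0 = Dom C z1" "z1 \<cdot> b0 = ?t" by (simp_all add: zb)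
    let ?s = "\<epsilon>1 \<cdot> pb_lift C u1 u2 (pb1 C r ?t) (a0 \<cdot> pb2 C r ?t)"
    note [simp] = pb_map[OF D1 t a'] pbD(1-8)[OF t, simplified]
    have "g \<cdot> ?s = pb1 C r ?t" by (subst comp_ext[OF dprodD(7)[OF d1]]) simp_all
    moreover have "mC \<cdot> ?s = e' \<cdot> pb_lift C w1' w2' (mB \<cdot> pb1 C r ?t) ((z2 \<cdot> b0) \<cdot> pb2 C r ?t)"
      using square_iff[OF a' b' t] cc by simp
    moreover have "mA \<cdot> ?t = p' \<cdot> z2 \<cdot> b0" using comp_ext2[OF zlift(4), of b0] zb by simp
    ultimately have "\<exists>!k. k \<in> hom C (Dom C ?t) (Dom C p) \<and> p \<cdot> k = ?t \<and> mP \<cdot> k = z2 \<cdot> b0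
        \<and> e \<cdot> pb_lift C w1 w2 (pb1 C r ?t) (k \<cdot> pb2 C r ?t) = ?s"
      by (intro glued_ex1[OF gl t]) (simp_all add: hom_iff)
    then show "\<exists>k. k \<in> hom C (Dom C a0) (Dom C a) \<and> a \<cdot> k = a0 \<and> b \<cdot> k = b0"
      unfolding key[OF t a' b'] by blast
  next
    fix k l assume kl: "k \<in> Arr C" "l \<in> Arr C" "Dom C l = Dom C k" "Cod C k = Dom C a" "Cod C l = Dom C a"
      and eq: "a \<cdot> k = a \<cdot> l" "b \<cdot> k = b \<cdot> l"
    let ?t = "p \<cdot> k"
    note [simp] = kl
    have t: "is_pullback C r ?t (pb1 C r ?t) (pb2 C r ?t)" by (rule chosen_pullback[OF pbs]) simp_all
    note [simp] = pbD(1-8)[OF t, simplified]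
    have a': "a \<cdot> k \<in> Arr C" "Dom C (a \<cdot> k) = Dom C ?t" "Cod C (a \<cdot> k) = Dom C \<pi>1" "\<pi>1 \<cdot> a \<cdot> k = ?t"
      using comp_ext[OF a(4), of k] by simp_all
    have b': "b \<cdot> k \<in> Arr C" "Dom C (b \<cdot> k) = Dom C ?t" "Cod C (b \<cdot> k) = Dom C z1" "z1 \<cdot> b \<cdot> k = ?t"
      using comp_ext[OF b(4), of k] by simp_all
    \<comment> \<open>For uniqueness, \<open>k\<close> and \<open>l\<close> are both solutions of
      the problem posed by the pair \<open>(a \<cdot> k, b \<cdot> k)\<close>.\<close>
    let ?s = "\<epsilon>1 \<cdot> pb_lift C u1 u2 (pb1 C r ?t) ((a \<cdot> k) \<cdot> pb2 C r ?t)"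
    note lm = pb_map[OF D1 t a']
    have "g \<cdot> ?s = pb1 C r ?t" by (subst comp_ext[OF dprodD(7)[OF d1]]) (use lm in simp_all)
    moreover have "mC \<cdot> ?s = e' \<cdot> pb_lift C w1' w2' (mB \<cdot> pb1 C r ?t) ((z2 \<cdot> b \<cdot> k) \<cdot> pb2 C r ?t)"
      using iffD1[OF square_iff[OF a' b' t]] comp_ext2[OF ch, of k] by simp
    moreover have "mA \<cdot> ?t = p' \<cdot> z2 \<cdot> b \<cdot> k" using comp_ext2[OF zlift(4), of "b \<cdot> k"] b'(4) by simp
    moreover have "?s \<in> hom C (Dom C (pb1 C r ?t)) (Dom C g)" using lm by (simp add: hom_iff)
    ultimately have "\<exists>!j. j \<in> hom C (Dom C ?t) (Dom C p) \<and> p \<cdot> j = ?t \<and> mP \<cdot> j = z2 \<cdot> b \<cdot> k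
        \<and> e \<cdot> pb_lift C w1 w2 (pb1 C r ?t) (j \<cdot> pb2 C r ?t) = ?s"
      by (intro glued_ex1[OF gl t]) (simp_all add: hom_iff)
    then show "k = l" unfolding key[OF t a' b'] using eq by (metis kl homI a'(2) comp_arr(2) a(1) b(1))
  qed simp_all
qed

end

text \<open>The object with the relative universal property is the pullback of \<open>\<Pi>(g, m\<^sub>C)\<close> along the transpose of
  \<open>B \<times>\<^sub>A (A \<times>\<^bsub>A'\<^esub> P') \<rightarrow> B \<times>\<^bsub>B'\<^esub> C'\<close>.\<close>

lemma (in matching_data) glued_exists:
  assumes pw: "powerful C r" and pbs: "has_pullbacks C"
    and W: "\<And>p. p \<in> Arr C \<Longrightarrow> Cod C p = Cod C r \<Longrightarrow> is_pullback C r p (W1 p) (W2 p)"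
  shows "\<exists>p mP e. p \<in> Arr C \<and> Cod C p = Cod C r \<and> glued C r g mA mB mC p' w1' w2' e' p mP (W1 p) (W2 p) e"
proof -
  note pb = has_pullbacks_chosen[OF pbs]
  let ?\<pi>1 = "Pi_ob C r g" and ?y1 = "pb1 C mB g'" and ?y2 = "pb2 C mB g'" and ?z1 = "pb1 C mA p'" and ?z2 = "pb2 C mA p'"
  let ?u1 = "pb1 C r ?\<pi>1" and ?u2 = "pb2 C r ?\<pi>1" and ?\<epsilon>1 = "mid (ev C r g)"
  let ?x1 = "pb1 C r ?z1" and ?x2 = "pb2 C r ?z1"
  have y: "is_pullback C mB g' ?y1 ?y2" by (rule pb) simp_all
  have z: "is_pullback C mA p' ?z1 ?z2" by (rule pb) simp_all
  note [simp] = pbD(1-8)[OF y] pbD(1-8)[OF z]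
  have x: "is_pullback C r ?z1 ?x1 ?x2" by (rule pb) simp_all
  let ?\<pi>2 = "Pi_ob C r ?y1"
  let ?v1 = "pb1 C r ?\<pi>2" and ?v2 = "pb2 C r ?\<pi>2" and ?\<epsilon>2 = "mid (ev C r ?y1)"
  have d1: "dprod C r g ?\<pi>1 ?u1 ?u2 ?\<epsilon>1" by (rule Pi_dprod[OF pw]) simp_all
  have d2: "dprod C r ?y1 ?\<pi>2 ?v1 ?v2 ?\<epsilon>2" by (rule Pi_dprod[OF pw]) simp_all
  note D1 = dprodD[OF d1] and D2 = dprodD[OF d2]
  note gmC = pair_mC[OF y] and xe = pair_match_lift[OF y z x]
  \<comment> \<open>\<open>c\<close> is the action of the dependent product along \<open>r\<close>
    on the map \<open>(g, mC)\<close>, obtained as the transpose of the evaluation followed by that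
    map.\<close>
  have "\<exists>c. c \<in> hom C (Dom C ?\<pi>1) (Dom C ?\<pi>2) \<and> ?\<pi>2 \<cdot> c = ?\<pi>1 \<and>
      ?\<epsilon>2 \<cdot> pb_lift C ?v1 ?v2 ?u1 (c \<cdot> ?u2) = pb_lift C ?y1 ?y2 g mC \<cdot> ?\<epsilon>1"
  proof -
    have "?y1 \<cdot> pb_lift C ?y1 ?y2 g mC \<cdot> ?\<epsilon>1 = ?u1"
      by (subst comp_ext[OF gmC(4)]) (simp_all add: gmC D1)
    moreover have "pb_lift C ?y1 ?y2 g mC \<cdot> ?\<epsilon>1 \<in> hom C (Dom C ?u1) (Dom C ?y1)"
      using gmC D1 by (simp add: hom_iff)
    ultimately show ?thesis using dprod_ex1[OF d2 D1(3), of "pb_lift C ?y1 ?y2 g mC \<cdot> ?\<epsilon>1"] by blast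
  qed
  then obtain c where c: "c \<in> hom C (Dom C ?\<pi>1) (Dom C ?\<pi>2)" "?\<pi>2 \<cdot> c = ?\<pi>1"
    "?\<epsilon>2 \<cdot> pb_lift C ?v1 ?v2 ?u1 (c \<cdot> ?u2) = pb_lift C ?y1 ?y2 g mC \<cdot> ?\<epsilon>1" by blast
  \<comment> \<open>\<open>h\<close> is obtained as the direct transpose of \<open>?l\<close>;
    \<open>composite_transpose\<close> later identifies it with the composite in the
    formula.\<close>
  let ?l = "pb_lift C ?y1 ?y2 ?x1 (e' \<cdot> pb_lift C w1' w2' (mB \<cdot> ?x1) (?z2 \<cdot> ?x2))"
  have "?l \<in> hom C (Dom C ?x1) (Dom C ?y1)" using xe by (simp add: hom_iff)
  then obtain h where h: "h \<in> hom C (Dom C ?z1) (Dom C ?\<pi>2)" "?\<pi>2 \<cdot> h = ?z1"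
    "?\<epsilon>2 \<cdot> pb_lift C ?v1 ?v2 ?x1 (h \<cdot> ?x2) = ?l"
    using dprod_ex1[OF d2 x _ xe(4)] by blast
  interpret matching_square C r g mA mB mC f' g' p' w1' w2' e' ?\<pi>1 ?u1 ?u2 ?\<epsilon>1 ?y1 ?y2 ?\<pi>2 ?v1 ?v2 ?\<epsilon>2
    ?z1 ?z2 ?x1 ?x2 c h
    by unfold_locales (use d1 d2 y z x c h in \<open>auto simp: hom_iff\<close>)
  have ab: "is_pullback C c h (pb1 C c h) (pb2 C c h)" by (rule pb) simp_all
  note [simp] = pbD(1-8)[OF ab]
  have "is_pullback C r (?\<pi>1 \<cdot> pb1 C c h) (W1 (?\<pi>1 \<cdot> pb1 C c h)) (W2 (?\<pi>1 \<cdot> pb1 C c h))"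
    by (rule W) simp_all
  note gl = glued_of_pullback[OF ab this]
  have "?\<pi>1 \<cdot> pb1 C c h \<in> Arr C" "Cod C (?\<pi>1 \<cdot> pb1 C c h) = Cod C r" by simp_all
  then show ?thesis using gl by blast
qed

text \<open>The property is invariant under isomorphism of the boundary part and of the part over
  the matching objects simultaneously: \<open>j\<close> solves a problem for \<open>q\<close>
  exactly when \<open>\<theta> \<cdot> j\<close> solves the corresponding one for \<open>p\<close>.
  It serves to replace the constructed dependent product by the chosen one.\<close>

lemma (in matching_data) glued_iso:
  assumes gl: "glued C r g mA mB mC p' w1' w2' e' p mP w1 w2 e"
    and v': "is_pullback C f' q' v1' v2'"
    and \<theta>': "\<theta>' \<in> hom C (Dom C q') (Dom C p')" "\<eta>' \<in> hom C (Dom C p') (Dom C q')" "\<theta>' \<cdot> \<eta>' = Ident C (Dom C p')"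
      "\<eta>' \<cdot> \<theta>' = Ident C (Dom C q')" "p' \<cdot> \<theta>' = q'"
    and d': "d' = e' \<cdot> pb_lift C w1' w2' v1' (\<theta>' \<cdot> v2')"
    and v: "is_pullback C r q v1 v2"
    and \<theta>: "\<theta> \<in> hom C (Dom C q) (Dom C p)" "\<eta> \<in> hom C (Dom C p) (Dom C q)" "\<theta> \<cdot> \<eta> = Ident C (Dom C p)"
      "\<eta> \<cdot> \<theta> = Ident C (Dom C q)" "p \<cdot> \<theta> = q"
    and d: "d = e \<cdot> pb_lift C w1 w2 v1 (\<theta> \<cdot> v2)"
    and mQ: "mQ \<in> hom C (Dom C q) (Dom C q')" "\<theta>' \<cdot> mQ = mP \<cdot> \<theta>"
  shows "glued C r g mA mB mC q' v1' v2' d' q mQ v1 v2 d"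
proof -
  note G = gluedD[OF gl]
  note [simp] = G(1-3,6-8) pbD(1-8)[OF v'] homD[OF \<theta>'(1)] homD[OF \<theta>'(2)] \<theta>'(3,4) pbD(1-8)[OF v] pbD(1-8)[OF G(5)]
    homD[OF \<theta>(1)] homD[OF \<theta>(2)] \<theta>(3,4) homD[OF mQ(1)]
  have th: "\<theta> \<in> Arr C" "Dom C \<theta> = Dom C q" "Cod C \<theta> = Dom C p" "p \<cdot> \<theta> = q" by (simp_all add: \<theta>(5))
  have th': "\<theta>' \<in> Arr C" "Dom C \<theta>' = Dom C q'" "Cod C \<theta>' = Dom C p'" "p' \<cdot> \<theta>' = q'" by (simp_all add: \<theta>'(5))
  note lv = pb_map[OF G(5) v th] and lv' = pb_map[OF w' v' th']
  note [simp] = lv lv'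
  have q\<eta>: "q \<cdot> \<eta> = p" using comp_ext[OF \<theta>(5), of \<eta>] by simp
  have cQ: "mA \<cdot> q = q' \<cdot> mQ"
  proof -
    have "mA \<cdot> q = mA \<cdot> p \<cdot> \<theta>" by (simp add: \<theta>(5))
    also have "\<dots> = p' \<cdot> mP \<cdot> \<theta>" by (rule comp_ext2[OF G(4)]) simp_all
    also have "\<dots> = p' \<cdot> \<theta>' \<cdot> mQ" by (simp add: mQ(2))
    also have "\<dots> = q' \<cdot> mQ" by (subst comp_ext[OF \<theta>'(5)]) simp_all
    finally show ?thesis .
  qed
  \<comment> \<open>Evaluating by \<open>d'\<close> on the \<open>q'\<close> side amounts to moving
    the second leg along \<open>\<theta>'\<close> and evaluating by \<open>e'\<close>.\<close>
  have d'lift: "d' \<cdot> pb_lift C v1' v2' (mB \<cdot> y1) (k \<cdot> y2) = e' \<cdot> pb_lift C w1' w2' (mB \<cdot> y1) ((\<theta>' \<cdot> k) \<cdot> y2)"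
    if y: "is_pullback C r t y1 y2" and k: "k \<in> Arr C" "Dom C k = Dom C t" "Cod C k = Dom C q'" "mA \<cdot> t = q' \<cdot> k"
    for t y1 y2 k
  proof -
    note [simp] = pbD(1-8)[OF y] k(1-3)
    interpret Q: matching_data C r g mA mB mC f' g' q' v1' v2' d'
      by unfold_locales (simp_all add: nat_f nat_g v' d' comp_ext[OF ge'])
    note l = Q.match_lift[OF y k]
    have "pb_lift C w1' w2' v1' (\<theta>' \<cdot> v2') \<cdot> pb_lift C v1' v2' (mB \<cdot> y1) (k \<cdot> y2)
        = pb_lift C w1' w2' (mB \<cdot> y1) ((\<theta>' \<cdot> k) \<cdot> y2)"
      by (rule pb_lift_unique[OF w', symmetric]) (simp_all add: l comp_ext[OF lv'(4)] comp_ext[OF lv'(5)])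
    then show ?thesis using l by (simp add: d')
  qed
  show ?thesis unfolding glued_def
  proof (intro conjI allI impI)
    show "mA \<cdot> q = q' \<cdot> mQ" by (rule cQ)
    show "g \<cdot> d = v1" unfolding d by (subst comp_ext[OF G(9)]) simp_all
    have m: "mP \<in> Arr C" "Dom C mP = Dom C p" "Cod C mP = Dom C p'" "mA \<cdot> p = p' \<cdot> mP" by (simp_all add: G(4))
    note lm = match_lift[OF G(5) m]
    have "mC \<cdot> d = e' \<cdot> pb_lift C w1' w2' (mB \<cdot> w1) (mP \<cdot> w2) \<cdot> pb_lift C w1 w2 v1 (\<theta> \<cdot> v2)"
      unfolding d by (subst comp_ext[OF G(10)]) (simp_all add: lm)
    also have "\<dots> = d' \<cdot> pb_lift C v1' v2' (mB \<cdot> v1) (mQ \<cdot> v2)"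
      unfolding match_lift_comp[OF G(5) m v th] by (subst d'lift[OF v _ _ _ cQ]) (simp_all add: comp_ext2[OF mQ(2)])
    finally show "mC \<cdot> d = d' \<cdot> pb_lift C v1' v2' (mB \<cdot> v1) (mQ \<cdot> v2)" .
    show "d \<in> hom C (Dom C v1) (Dom C g)" by (simp add: d hom_iff)
    fix t k y1 y2 s
    assume y: "is_pullback C r t y1 y2" and k: "k \<in> hom C (Dom C t) (Dom C q')" and kc: "mA \<cdot> t = q' \<cdot> k"
      and s: "s \<in> hom C (Dom C y1) (Dom C g)" "g \<cdot> s = y1"
      and sc: "mC \<cdot> s = d' \<cdot> pb_lift C v1' v2' (mB \<cdot> y1) (k \<cdot> y2)"
    note [simp] = pbD(1-8)[OF y] homD[OF k]
    have k': "\<theta>' \<cdot> k \<in> hom C (Dom C t) (Dom C p')" by (simp add: hom_iff)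
    have kc': "mA \<cdot> t = p' \<cdot> \<theta>' \<cdot> k" using comp_ext[OF \<theta>'(5), of k] kc by simp
    have ex: "\<exists>!j. j \<in> hom C (Dom C t) (Dom C p) \<and> p \<cdot> j = t \<and> mP \<cdot> j = \<theta>' \<cdot> k
         \<and> e \<cdot> pb_lift C w1 w2 y1 (j \<cdot> y2) = s"
      by (rule glued_ex1[OF gl y k' kc' s]) (use sc d'lift[OF y homD[OF k] kc] in simp)
    have dl: "d \<cdot> pb_lift C v1 v2 y1 (j \<cdot> y2) = e \<cdot> pb_lift C w1 w2 y1 ((\<theta> \<cdot> j) \<cdot> y2)"
      if j: "j \<in> Arr C" "Dom C j = Dom C t" "Cod C j = Dom C q" "q \<cdot> j = t" for j
      using pb_map_comp[OF G(5) v y th j] pb_map[OF v y j] by (simp add: d)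
    have qj: "q \<cdot> j = p \<cdot> \<theta> \<cdot> j" if "j \<in> hom C (Dom C t) (Dom C q)" for j
      using that comp_ext[OF \<theta>(5), of j] by (simp add: hom_iff)
    have mj: "mQ \<cdot> j = k \<longleftrightarrow> mP \<cdot> \<theta> \<cdot> j = \<theta>' \<cdot> k" if "j \<in> hom C (Dom C t) (Dom C q)" for j
    proof -
      note [simp] = homD[OF that]
      have 1: "mP \<cdot> \<theta> \<cdot> j = \<theta>' \<cdot> mQ \<cdot> j" by (rule comp_ext2[OF mQ(2)[symmetric]]) simp_all
      show ?thesis
      proof
        assume "mP \<cdot> \<theta> \<cdot> j = \<theta>' \<cdot> k"
        then have "\<eta>' \<cdot> \<theta>' \<cdot> mQ \<cdot> j = \<eta>' \<cdot> \<theta>' \<cdot> k" by (simp add: 1)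
        then show "mQ \<cdot> j = k" by (simp add: comp_ext[OF \<theta>'(4)])
      qed (simp add: 1)
    qed
    let ?Q = "\<lambda>j. j \<in> hom C (Dom C t) (Dom C q) \<and> q \<cdot> j = t \<and> mQ \<cdot> j = k \<and> d \<cdot> pb_lift C v1 v2 y1 (j \<cdot> y2) = s"
    let ?P = "\<lambda>j. j \<in> hom C (Dom C t) (Dom C p) \<and> p \<cdot> j = t \<and> mP \<cdot> j = \<theta>' \<cdot> k \<and> e \<cdot> pb_lift C w1 w2 y1 (j \<cdot> y2) = s"
    have QP: "?Q j \<longleftrightarrow> ?P (\<theta> \<cdot> j)" if j: "j \<in> hom C (Dom C t) (Dom C q)" for j
    proof -
      note j' = homD[OF j]
      have "\<theta> \<cdot> j \<in> hom C (Dom C t) (Dom C p)" using j' by (simp add: hom_iff)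
      then show ?thesis using j qj[OF j] mj[OF j] dl[OF j'] by (metis)
    qed
    show "\<exists>!j. ?Q j"
    proof (rule ex_ex1I)
      obtain j where j: "?P j" using ex by blast
      then have j': "j \<in> Arr C" "Dom C j = Dom C t" "Cod C j = Dom C p" by (simp_all add: hom_iff)
      have "\<theta> \<cdot> \<eta> \<cdot> j = j" using j' by (simp add: comp_ext[OF \<theta>(3)])
      then have "?P (\<theta> \<cdot> \<eta> \<cdot> j)" using j by simp
      moreover have "\<eta> \<cdot> j \<in> hom C (Dom C t) (Dom C q)" using j' by (simp add: hom_iff)
      ultimately have "?Q (\<eta> \<cdot> j)" by (subst QP)
      then show "\<exists>j. ?Q j" by blast
    next
      fix i j assume i: "?Q i" and j: "?Q j"
      then have ij: "i \<in> hom C (Dom C t) (Dom C q)" "j \<in> hom C (Dom C t) (Dom C q)" by blast+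
      have "\<theta> \<cdot> i = \<theta> \<cdot> j" using ex QP[OF ij(1)] QP[OF ij(2)] i j by blast
      then have "\<eta> \<cdot> \<theta> \<cdot> i = \<eta> \<cdot> \<theta> \<cdot> j" by simp
      then show "i = j" using ij by (simp add: comp_ext[OF \<theta>(4)] hom_iff)
    qed
  qed (simp_all add: hom_iff v)
qed

section \<open>Functor categories\<close>

lemma Fun_sel:
  "Dom (Fun J E) \<tau> = NDom \<tau>" "Cod (Fun J E) \<tau> = NCod \<tau>"
  "At (Ident (Fun J E) X) = (\<lambda>x\<in>Obj J. Ident E (FO X x))"
  "At (\<sigma> \<cdot>\<^bsub>Fun J E\<^esub> \<tau>) = (\<lambda>x\<in>Obj J. At \<sigma> x \<cdot>\<^bsub>E\<^esub> At \<tau> x)"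
  by (simp_all add: Fun_def)

lemma Fun_hom_iff:
  "\<tau> \<in> hom (Fun J E) X Y \<longleftrightarrow> X \<in> Obj (Fun J E) \<and> Y \<in> Obj (Fun J E) \<and> NDom \<tau> = X \<and> NCod \<tau> = Y
     \<and> At \<tau> \<in> extensional (Obj J) \<and> (\<forall>x\<in>Obj J. At \<tau> x \<in> hom E (FO X x) (FO Y x))
     \<and> (\<forall>f\<in>Arr J. At \<tau> (Cod J f) \<cdot>\<^bsub>E\<^esub> FA X f = FA Y f \<cdot>\<^bsub>E\<^esub> At \<tau> (Dom J f))"
  unfolding hom_iff[of \<tau>] by (auto simp: Fun_def is_ntrans_def Let_def)

lemma Fun_homD:
  assumes "\<tau> \<in> hom (Fun J E) X Y"
  shows "X \<in> Obj (Fun J E)" "Y \<in> Obj (Fun J E)" "NDom \<tau> = X" "NCod \<tau> = Y"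
    "At \<tau> \<in> extensional (Obj J)" "\<And>x. x \<in> Obj J \<Longrightarrow> At \<tau> x \<in> hom E (FO X x) (FO Y x)"
    "\<And>f. f \<in> Arr J \<Longrightarrow> At \<tau> (Cod J f) \<cdot>\<^bsub>E\<^esub> FA X f = FA Y f \<cdot>\<^bsub>E\<^esub> At \<tau> (Dom J f)"
  using assms by (simp_all add: Fun_hom_iff)

lemma Fun_hom_eqI:
  assumes "\<tau> \<in> hom (Fun J E) X Y" "\<sigma> \<in> hom (Fun J E) X Y" "\<And>x. x \<in> Obj J \<Longrightarrow> At \<tau> x = At \<sigma> x"
  shows "\<tau> = \<sigma>"
proof -
  note t = Fun_homD[OF assms(1)] and s = Fun_homD[OF assms(2)]
  have "At \<tau> = At \<sigma>" by (rule extensionalityI[OF t(5) s(5) assms(3)])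
  then show ?thesis using t s by (intro ntrans.equality) simp_all
qed

lemma Fun_homI:
  assumes "X \<in> Obj (Fun J E)" "Y \<in> Obj (Fun J E)" "\<And>x. x \<in> Obj J \<Longrightarrow> c x \<in> hom E (FO X x) (FO Y x)"
    "\<And>f. f \<in> Arr J \<Longrightarrow> c (Cod J f) \<cdot>\<^bsub>E\<^esub> FA X f = FA Y f \<cdot>\<^bsub>E\<^esub> c (Dom J f)"
  shows "\<lparr>NDom = X, NCod = Y, At = restrict c (Obj J)\<rparr> \<in> hom (Fun J E) X Y"
proof -
  have "category J" using Fun_ObjD[OF assms(1)] by simp
  then show ?thesis using assms by (simp add: Fun_hom_iff category.dom_in category.cod_in)
qed

locale functor_category = J: category J + E: category E
  for J :: "('o, 'm) cat" and E :: "('e, 'f) cat"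
begin

lemma category_Fun: "category (Fun J E)"
proof
  fix \<tau> assume t: "\<tau> \<in> Arr (Fun J E)"
  then have "\<tau> \<in> hom (Fun J E) (Dom (Fun J E) \<tau>) (Cod (Fun J E) \<tau>)" by (simp add: hom_iff)
  then show "Dom (Fun J E) \<tau> \<in> Obj (Fun J E)" "Cod (Fun J E) \<tau> \<in> Obj (Fun J E)"
    by (rule Fun_homD)+
next
  fix X assume X: "X \<in> Obj (Fun J E)"
  interpret X: functor_on J E X using X by unfold_locales
  have "\<lparr>NDom = X, NCod = X, At = (\<lambda>x\<in>Obj J. Ident E (FO X x))\<rparr> \<in> hom (Fun J E) X X"
    by (rule Fun_homI) (simp_all add: X hom_iff)
  then show "Ident (Fun J E) X \<in> hom (Fun J E) X X" by (simp add: Fun_def[of J E])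
next
  show comp: "\<sigma> \<cdot>\<^bsub>Fun J E\<^esub> \<tau> \<in> hom (Fun J E) X Z"
    if t: "\<tau> \<in> hom (Fun J E) X Y" and s: "\<sigma> \<in> hom (Fun J E) Y Z" for \<tau> \<sigma> X Y Z
  proof -
    note T = Fun_homD[OF t] and S = Fun_homD[OF s]
    interpret X: functor_on J E X using T by unfold_locales
    interpret Y: functor_on J E Y using T by unfold_locales
    interpret Z: functor_on J E Z using S by unfold_locales
    note [simp] = homD[OF T(6)] homD[OF S(6)]
    have "\<lparr>NDom = X, NCod = Z, At = (\<lambda>x\<in>Obj J. At \<sigma> x \<cdot>\<^bsub>E\<^esub> At \<tau> x)\<rparr> \<in> hom (Fun J E) X Z"
    proof (rule Fun_homI)
      fix f assume f: "f \<in> Arr J"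
      have "At \<sigma> (Cod J f) \<cdot>\<^bsub>E\<^esub> FA Y f \<cdot>\<^bsub>E\<^esub> At \<tau> (Dom J f)
          = FA Z f \<cdot>\<^bsub>E\<^esub> At \<sigma> (Dom J f) \<cdot>\<^bsub>E\<^esub> At \<tau> (Dom J f)"
        using f by (intro E.comp_ext2[OF S(7)]) simp_all
      then show "(At \<sigma> (Cod J f) \<cdot>\<^bsub>E\<^esub> At \<tau> (Cod J f)) \<cdot>\<^bsub>E\<^esub> FA X f
          = FA Z f \<cdot>\<^bsub>E\<^esub> At \<sigma> (Dom J f) \<cdot>\<^bsub>E\<^esub> At \<tau> (Dom J f)"
        using f T(7)[OF f] by simp
    qed (use T S in \<open>simp_all add: hom_iff\<close>)
    then show ?thesis using T(3) S(4) by (simp add: Fun_def[of J E])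
  qed
  show "\<tau> \<cdot>\<^bsub>Fun J E\<^esub> Ident (Fun J E) X = \<tau>" "Ident (Fun J E) Y \<cdot>\<^bsub>Fun J E\<^esub> \<tau> = \<tau>"
    if t: "\<tau> \<in> hom (Fun J E) X Y" for \<tau> X Y
  proof -
    note T = Fun_homD[OF t]
    interpret X: functor_on J E X using T by unfold_locales
    interpret Y: functor_on J E Y using T by unfold_locales
    note [simp] = homD[OF T(6)]
    have "\<lparr>NDom = X, NCod = X, At = (\<lambda>x\<in>Obj J. Ident E (FO X x))\<rparr> \<in> hom (Fun J E) X X"
      by (rule Fun_homI) (simp_all add: T hom_iff)
    then have iX: "Ident (Fun J E) X \<in> hom (Fun J E) X X" by (simp add: Fun_def[of J E])
    have "\<lparr>NDom = Y, NCod = Y, At = (\<lambda>x\<in>Obj J. Ident E (FO Y x))\<rparr> \<in> hom (Fun J E) Y Y"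
      by (rule Fun_homI) (simp_all add: T hom_iff)
    then have iY: "Ident (Fun J E) Y \<in> hom (Fun J E) Y Y" by (simp add: Fun_def[of J E])
    show "\<tau> \<cdot>\<^bsub>Fun J E\<^esub> Ident (Fun J E) X = \<tau>"
      by (rule Fun_hom_eqI[OF comp[OF iX t] t]) (simp add: Fun_sel)
    show "Ident (Fun J E) Y \<cdot>\<^bsub>Fun J E\<^esub> \<tau> = \<tau>"
      by (rule Fun_hom_eqI[OF comp[OF t iY] t]) (simp add: Fun_sel)
  qed
  show "(\<rho> \<cdot>\<^bsub>Fun J E\<^esub> \<sigma>) \<cdot>\<^bsub>Fun J E\<^esub> \<tau> = \<rho> \<cdot>\<^bsub>Fun J E\<^esub> (\<sigma> \<cdot>\<^bsub>Fun J E\<^esub> \<tau>)"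
    if t: "\<tau> \<in> hom (Fun J E) W X" and s: "\<sigma> \<in> hom (Fun J E) X Y" and r: "\<rho> \<in> hom (Fun J E) Y Z"
    for \<tau> \<sigma> \<rho> W X Y Z
  proof -
    note [simp] = homD[OF Fun_homD(6)[OF t]] homD[OF Fun_homD(6)[OF s]] homD[OF Fun_homD(6)[OF r]]
    show ?thesis
      by (rule Fun_hom_eqI[OF comp[OF t comp[OF s r]] comp[OF comp[OF t s] r]]) (simp add: Fun_sel)
  qed
qed

end

sublocale functor_category \<subseteq> F: category "Fun J E"
  by (rule category_Fun)

context functor_category
begin

lemma Arr_hom: "\<tau> \<in> Arr (Fun J E) \<Longrightarrow> \<tau> \<in> hom (Fun J E) (Dom (Fun J E) \<tau>) (Cod (Fun J E) \<tau>)"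
  by (simp add: hom_iff)

lemma At_arr [simp]:
  assumes "\<tau> \<in> Arr (Fun J E)" "x \<in> Obj J"
  shows "At \<tau> x \<in> Arr E" "Dom E (At \<tau> x) = FO (Dom (Fun J E) \<tau>) x" "Cod E (At \<tau> x) = FO (Cod (Fun J E) \<tau>) x"
  using homD[OF Fun_homD(6)[OF Arr_hom[OF assms(1)] assms(2)]] by simp_all

lemma At_nat:
  assumes "\<tau> \<in> Arr (Fun J E)" "f \<in> Arr J"
  shows "At \<tau> (Cod J f) \<cdot>\<^bsub>E\<^esub> FA (Dom (Fun J E) \<tau>) f = FA (Cod (Fun J E) \<tau>) f \<cdot>\<^bsub>E\<^esub> At \<tau> (Dom J f)"
  using Fun_homD(7)[OF Arr_hom[OF assms(1)] assms(2)] .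

lemma At_comp [simp]: "x \<in> Obj J \<Longrightarrow> At (\<sigma> \<cdot>\<^bsub>Fun J E\<^esub> \<tau>) x = At \<sigma> x \<cdot>\<^bsub>E\<^esub> At \<tau> x"
  by (simp add: Fun_sel)

lemma At_Ident [simp]: "x \<in> Obj J \<Longrightarrow> At (Ident (Fun J E) X) x = Ident E (FO X x)"
  by (simp add: Fun_sel)

lemma Fun_eqI:
  assumes "\<tau> \<in> Arr (Fun J E)" "\<sigma> \<in> Arr (Fun J E)" "Dom (Fun J E) \<sigma> = Dom (Fun J E) \<tau>"
    "Cod (Fun J E) \<sigma> = Cod (Fun J E) \<tau>" "\<And>x. x \<in> Obj J \<Longrightarrow> At \<tau> x = At \<sigma> x"
  shows "\<tau> = \<sigma>"
  using assms by (intro Fun_hom_eqI[of \<tau> J E "Dom (Fun J E) \<tau>" "Cod (Fun J E) \<tau>"]) (simp_all add: hom_iff)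

lemma FO_obj [simp]: "X \<in> Obj (Fun J E) \<Longrightarrow> x \<in> Obj J \<Longrightarrow> FO X x \<in> Obj E"
  by (rule functor_on.FO_in[OF functor_on.intro])

lemma FA_arr [simp]:
  assumes "X \<in> Obj (Fun J E)" "f \<in> Arr J"
  shows "FA X f \<in> Arr E" "Dom E (FA X f) = FO X (Dom J f)" "Cod E (FA X f) = FO X (Cod J f)"
  using functor_on.FA_arr[OF functor_on.intro[OF assms(1)] assms(2)] by simp_all

text \<open>The mediating transformation is formed from the componentwise lifts. It is natural
  because the two sides of a naturality square have equal composites with the projections at
  \<open>Cod J u\<close>, and these are jointly monic.\<close>

lemma fun_pullbackI:
  assumes arr: "f \<in> Arr (Fun J E)" "g \<in> Arr (Fun J E)" "Cod (Fun J E) g = Cod (Fun J E) f"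
    "p \<in> Arr (Fun J E)" "q \<in> Arr (Fun J E)" "Dom (Fun J E) q = Dom (Fun J E) p"
    "Cod (Fun J E) p = Dom (Fun J E) f" "Cod (Fun J E) q = Dom (Fun J E) g"
    and pb: "\<And>x. x \<in> Obj J \<Longrightarrow> is_pullback E (At f x) (At g x) (At p x) (At q x)"
  shows "is_pullback (Fun J E) f g p q"
proof -
  note [simp] = arr
  show ?thesis
  proof (rule F.is_pullbackI)
    show "f \<cdot>\<^bsub>Fun J E\<^esub> p = g \<cdot>\<^bsub>Fun J E\<^esub> q"
      by (rule Fun_eqI) (simp_all add: pbD(9)[OF pb])
  next
    fix a b assume a: "a \<in> Arr (Fun J E)" "b \<in> Arr (Fun J E)" "Dom (Fun J E) b = Dom (Fun J E) a"
      "Cod (Fun J E) a = Dom (Fun J E) f" "Cod (Fun J E) b = Dom (Fun J E) g" and c: "f \<cdot>\<^bsub>Fun J E\<^esub> a = g \<cdot>\<^bsub>Fun J E\<^esub> b"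
    note [simp] = a
    define h where "h x = pb_lift E (At p x) (At q x) (At a x) (At b x)" for x
    have cx: "At f x \<cdot>\<^bsub>E\<^esub> At a x = At g x \<cdot>\<^bsub>E\<^esub> At b x" if "x \<in> Obj J" for x
      using arg_cong[OF c, of "\<lambda>t. At t x"] that by simp
    have h [simp]: "h x \<in> Arr E" "Dom E (h x) = FO (Dom (Fun J E) a) x" "Cod E (h x) = FO (Dom (Fun J E) p) x"
      and hp: "At p x \<cdot>\<^bsub>E\<^esub> h x = At a x" and hq: "At q x \<cdot>\<^bsub>E\<^esub> h x = At b x"
      if "x \<in> Obj J" for x
      using pb_lift[OF pb[OF that] _ _ _ _ _ cx[OF that]] that by (simp_all add: h_def)
    let ?h = "\<lparr>NDom = Dom (Fun J E) a, NCod = Dom (Fun J E) p, At = restrict h (Obj J)\<rparr>"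
    have "?h \<in> hom (Fun J E) (Dom (Fun J E) a) (Dom (Fun J E) p)"
    proof (rule Fun_homI)
      fix u assume u: "u \<in> Arr J"
      note [simp] = u
      show "h (Cod J u) \<cdot>\<^bsub>E\<^esub> FA (Dom (Fun J E) a) u = FA (Dom (Fun J E) p) u \<cdot>\<^bsub>E\<^esub> h (Dom J u)"
      proof (rule E.pb_eqI[OF pb[OF J.cod_in[OF u]]])
        show "At p (Cod J u) \<cdot>\<^bsub>E\<^esub> h (Cod J u) \<cdot>\<^bsub>E\<^esub> FA (Dom (Fun J E) a) u
            = At p (Cod J u) \<cdot>\<^bsub>E\<^esub> FA (Dom (Fun J E) p) u \<cdot>\<^bsub>E\<^esub> h (Dom J u)"
          using At_nat[OF a(1) u] At_nat[OF arr(4) u] by (simp add: E.comp_ext[OF hp] E.comp_ext2[OF At_nat[OF arr(4) u]] hp)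
        show "At q (Cod J u) \<cdot>\<^bsub>E\<^esub> h (Cod J u) \<cdot>\<^bsub>E\<^esub> FA (Dom (Fun J E) a) u
            = At q (Cod J u) \<cdot>\<^bsub>E\<^esub> FA (Dom (Fun J E) p) u \<cdot>\<^bsub>E\<^esub> h (Dom J u)"
          using At_nat[OF a(2) u] E.comp_ext2[OF At_nat[OF arr(5) u], of "h (Dom J u)"]
          by (simp add: E.comp_ext[OF hq] hq)
      qed simp_all
    qed (simp_all add: hom_iff)
    note hh = homD[OF this]
    moreover have "p \<cdot>\<^bsub>Fun J E\<^esub> ?h = a" by (rule Fun_eqI) (simp_all add: hh hp)
    moreover have "q \<cdot>\<^bsub>Fun J E\<^esub> ?h = b" by (rule Fun_eqI) (simp_all add: hh hq)
    ultimately show "\<exists>h. h \<in> hom (Fun J E) (Dom (Fun J E) a) (Dom (Fun J E) p) \<and> p \<cdot>\<^bsub>Fun J E\<^esub> h = a \<and> q \<cdot>\<^bsub>Fun J E\<^esub> h = b"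
      by (intro exI[of _ ?h]) (simp add: hom_iff)
  next
    fix h k assume hk: "h \<in> Arr (Fun J E)" "k \<in> Arr (Fun J E)" "Dom (Fun J E) k = Dom (Fun J E) h"
      "Cod (Fun J E) h = Dom (Fun J E) p" "Cod (Fun J E) k = Dom (Fun J E) p"
      and e: "p \<cdot>\<^bsub>Fun J E\<^esub> h = p \<cdot>\<^bsub>Fun J E\<^esub> k" "q \<cdot>\<^bsub>Fun J E\<^esub> h = q \<cdot>\<^bsub>Fun J E\<^esub> k"
    show "h = k"
    proof (rule Fun_eqI)
      fix x assume x: "x \<in> Obj J"
      show "At h x = At k x"
        by (rule E.pb_eqI[OF pb[OF x]])
          (use hk x arg_cong[OF e(1), of "\<lambda>t. At t x"] arg_cong[OF e(2), of "\<lambda>t. At t x"] in simp_all)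
    qed (use hk in simp_all)
  qed simp_all
qed

end

text \<open>Pointwise pullbacks formed with the chosen pullbacks of \<open>E\<close>. Unlike the chosen pullbacks of the
  functor category they commute strictly with restriction.\<close>

definition ptpb_ob :: "('o, 'm) cat \<Rightarrow> ('e, 'f) cat \<Rightarrow> ('o, 'm, 'e, 'f) ntrans \<Rightarrow> ('o, 'm, 'e, 'f) ntrans \<Rightarrow>
    ('o, 'm, 'e, 'f) func" where
  "ptpb_ob J E f g = \<lparr>Src = J, Tgt = E, FO = (\<lambda>x\<in>Obj J. Dom E (pb1 E (At f x) (At g x))),
     FA = (\<lambda>u\<in>Arr J. pb_lift E (pb1 E (At f (Cod J u)) (At g (Cod J u))) (pb2 E (At f (Cod J u)) (At g (Cod J u)))
        (FA (NDom f) u \<cdot>\<^bsub>E\<^esub> pb1 E (At f (Dom J u)) (At g (Dom J u)))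
        (FA (NDom g) u \<cdot>\<^bsub>E\<^esub> pb2 E (At f (Dom J u)) (At g (Dom J u))))\<rparr>"

definition ptpb1 :: "('o, 'm) cat \<Rightarrow> ('e, 'f) cat \<Rightarrow> ('o, 'm, 'e, 'f) ntrans \<Rightarrow> ('o, 'm, 'e, 'f) ntrans \<Rightarrow>
    ('o, 'm, 'e, 'f) ntrans" where
  "ptpb1 J E f g = \<lparr>NDom = ptpb_ob J E f g, NCod = NDom f, At = (\<lambda>x\<in>Obj J. pb1 E (At f x) (At g x))\<rparr>"

definition ptpb2 :: "('o, 'm) cat \<Rightarrow> ('e, 'f) cat \<Rightarrow> ('o, 'm, 'e, 'f) ntrans \<Rightarrow> ('o, 'm, 'e, 'f) ntrans \<Rightarrow>
    ('o, 'm, 'e, 'f) ntrans" where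
  "ptpb2 J E f g = \<lparr>NDom = ptpb_ob J E f g, NCod = NDom g, At = (\<lambda>x\<in>Obj J. pb2 E (At f x) (At g x))\<rparr>"

locale functor_category_pb = functor_category +
  assumes pbs: "has_pullbacks E"
begin

text \<open>\<open>ptpb_ob\<close> acts on arrows by induced maps, so its functor laws can be
  checked after composing with the two projections.\<close>

lemma ptpb:
  assumes f: "f \<in> Arr (Fun J E)" and g: "g \<in> Arr (Fun J E)" "Cod (Fun J E) g = Cod (Fun J E) f"
  shows "is_pullback (Fun J E) f g (ptpb1 J E f g) (ptpb2 J E f g)"
proof -
  note [simp] = f g
  let ?p = "\<lambda>x. pb1 E (At f x) (At g x)" and ?q = "\<lambda>x. pb2 E (At f x) (At g x)" and ?W = "ptpb_ob J E f g"
  let ?B = "Dom (Fun J E) f" and ?C = "Dom (Fun J E) g"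
  interpret B: functor_on J E ?B by unfold_locales simp
  interpret C: functor_on J E ?C by unfold_locales simp
  have pb: "is_pullback E (At f x) (At g x) (?p x) (?q x)" if "x \<in> Obj J" for x
    using that by (intro has_pullbacks_chosen[OF pbs]) simp_all
  have [simp]: "?p x \<in> Arr E" "Cod E (?p x) = FO ?B x" "?q x \<in> Arr E" "Dom E (?q x) = Dom E (?p x)" "Cod E (?q x) = FO ?C x"
    if "x \<in> Obj J" for x
    using that pbD[OF pb[OF that]] by simp_all
  have l: "pb_lift E (?p (Cod J u)) (?q (Cod J u)) (FA ?B u \<cdot>\<^bsub>E\<^esub> ?p (Dom J u)) (FA ?C u \<cdot>\<^bsub>E\<^esub> ?q (Dom J u)) = FA ?W u"
    if "u \<in> Arr J" for u using that by (simp add: ptpb_ob_def Fun_sel)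
  have WA: "FA ?W u \<in> Arr E" "Dom E (FA ?W u) = Dom E (?p (Dom J u))" "Cod E (FA ?W u) = Dom E (?p (Cod J u))"
    "?p (Cod J u) \<cdot>\<^bsub>E\<^esub> FA ?W u = FA ?B u \<cdot>\<^bsub>E\<^esub> ?p (Dom J u)"
    "?q (Cod J u) \<cdot>\<^bsub>E\<^esub> FA ?W u = FA ?C u \<cdot>\<^bsub>E\<^esub> ?q (Dom J u)" if u: "u \<in> Arr J" for u
  proof -
    note [simp] = u
    have c: "At f (Cod J u) \<cdot>\<^bsub>E\<^esub> FA ?B u \<cdot>\<^bsub>E\<^esub> ?p (Dom J u) = At g (Cod J u) \<cdot>\<^bsub>E\<^esub> FA ?C u \<cdot>\<^bsub>E\<^esub> ?q (Dom J u)"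
      using E.comp_ext2[OF At_nat[OF f u], of "?p (Dom J u)"] E.comp_ext2[OF At_nat[OF g(1) u], of "?q (Dom J u)"]
        pbD(9)[OF pb[of "Dom J u"]] by simp
    note m = pb_lift[OF pb[OF J.cod_in[OF u]] _ _ _ _ _ c, unfolded l[OF u]]
    show "FA ?W u \<in> Arr E" "Dom E (FA ?W u) = Dom E (?p (Dom J u))" "Cod E (FA ?W u) = Dom E (?p (Cod J u))"
      "?p (Cod J u) \<cdot>\<^bsub>E\<^esub> FA ?W u = FA ?B u \<cdot>\<^bsub>E\<^esub> ?p (Dom J u)"
      "?q (Cod J u) \<cdot>\<^bsub>E\<^esub> FA ?W u = FA ?C u \<cdot>\<^bsub>E\<^esub> ?q (Dom J u)" using m by simp_all
  qed
  have WO: "FO ?W x = Dom E (?p x)" if "x \<in> Obj J" for x using that by (simp add: ptpb_ob_def)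
  note [simp] = WA(1-3) WO
  have W: "?W \<in> Obj (Fun J E)"
  proof (rule functor_onI)
    show "FA ?W (Ident J x) = Ident E (FO ?W x)" if "x \<in> Obj J" for x
      by (rule E.pb_eqI[OF pb[OF that]]) (use that WA(4,5)[of "Ident J x"] in simp_all)
    show "FA ?W (v \<cdot>\<^bsub>J\<^esub> u) = FA ?W v \<cdot>\<^bsub>E\<^esub> FA ?W u"
      if uv: "u \<in> Arr J" "v \<in> Arr J" "Cod J u = Dom J v" for u v
    proof -
      note [simp] = uv
      have v: "Cod J v \<in> Obj J" by simp
      show ?thesis
        by (rule E.pb_eqI[OF pb[OF v]])
          (use WA(4,5)[of "v \<cdot>\<^bsub>J\<^esub> u"] WA(4,5)[of u] E.comp_ext2[OF WA(4)[OF uv(2)], of "FA ?W u"]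
            E.comp_ext2[OF WA(5)[OF uv(2)], of "FA ?W u"] in \<open>simp_all add: B.FA_comp C.FA_comp\<close>)
    qed
  qed (simp_all add: J.category_axioms E.category_axioms hom_iff, simp_all add: ptpb_ob_def)
  have 1: "ptpb1 J E f g \<in> hom (Fun J E) ?W ?B" unfolding ptpb1_def Fun_sel(1)[symmetric, of _ J E]
    by (rule Fun_homI) (simp_all add: W hom_iff WA(4))
  have 2: "ptpb2 J E f g \<in> hom (Fun J E) ?W ?C" unfolding ptpb2_def Fun_sel(1)[symmetric, of _ J E]
    by (rule Fun_homI) (simp_all add: W hom_iff WA(5))
  show ?thesis
  proof (rule fun_pullbackI)
    show "is_pullback E (At f x) (At g x) (At (ptpb1 J E f g) x) (At (ptpb2 J E f g) x)" if "x \<in> Obj J" for x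
      using pb[OF that] that by (simp add: ptpb1_def ptpb2_def)
  qed (simp_all add: homD[OF 1] homD[OF 2])
qed

lemma has_pullbacks_Fun: "has_pullbacks (Fun J E)"
  unfolding has_pullbacks_def has_pullbacks_along_def using ptpb by blast

text \<open>Any pullback square of functors is isomorphic to the pointwise one. Evaluating that
  isomorphism at \<open>x\<close> transports the pullback property, so every such square is
  pointwise.\<close>

lemma fun_pullbackD:
  assumes pb: "is_pullback (Fun J E) f g p q" and x: "x \<in> Obj J"
  shows "is_pullback E (At f x) (At g x) (At p x) (At q x)"
proof -
  note [simp] = pbD(1-8)[OF pb]
  let ?p = "ptpb1 J E f g" and ?q = "ptpb2 J E f g"
  have pt: "is_pullback (Fun J E) f g ?p ?q" by (rule ptpb) simp_all
  note [simp] = pbD(1-8)[OF pt]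
  from F.pullback_compare[OF pt pb] obtain u v where
    u: "u \<in> hom (Fun J E) (Dom (Fun J E) p) (Dom (Fun J E) ?p)" and v: "v \<in> hom (Fun J E) (Dom (Fun J E) ?p) (Dom (Fun J E) p)"
    and uv: "u \<cdot>\<^bsub>Fun J E\<^esub> v = Ident (Fun J E) (Dom (Fun J E) ?p)" "v \<cdot>\<^bsub>Fun J E\<^esub> u = Ident (Fun J E) (Dom (Fun J E) p)"
    and pq: "p = ?p \<cdot>\<^bsub>Fun J E\<^esub> u" "q = ?q \<cdot>\<^bsub>Fun J E\<^esub> u" by blast
  have *: "is_pullback E (At f x) (At g x) (At ?p x) (At ?q x)"
    unfolding ptpb1_def ptpb2_def using x by (simp add: has_pullbacks_chosen[OF pbs])
  have "At p x = At ?p x \<cdot>\<^bsub>E\<^esub> At u x" using arg_cong[OF pq(1), of "\<lambda>t. At t x"] x by simp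
  moreover have "At q x = At ?q x \<cdot>\<^bsub>E\<^esub> At u x" using arg_cong[OF pq(2), of "\<lambda>t. At t x"] x by simp
  moreover have "is_pullback E (At f x) (At g x) (At ?p x \<cdot>\<^bsub>E\<^esub> At u x) (At ?q x \<cdot>\<^bsub>E\<^esub> At u x)"
    by (rule E.pullback_iso[OF *, of _ "FO (Dom (Fun J E) p) x" "At v x"])
      (use x homD[OF u] homD[OF v] arg_cong[OF uv(1), of "\<lambda>t. At t x"] arg_cong[OF uv(2), of "\<lambda>t. At t x"] in \<open>simp_all add: hom_iff\<close>)
  ultimately show ?thesis by simp
qed

end

text \<open>Restriction along \<open>K\<close>: the action of the precomposition functor on arrows, without the bounded
  abstraction.\<close>

definition whisk :: "('o, 'm, 'p, 'q) ntrans \<Rightarrow> ('i, 'k, 'o, 'm) func \<Rightarrow> ('i, 'k, 'p, 'q) ntrans" where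
  "whisk \<tau> K = \<lparr>NDom = NDom \<tau> \<bullet> K, NCod = NCod \<tau> \<bullet> K, At = (\<lambda>x\<in>Obj (Src K). At \<tau> (FO K x))\<rparr>"

lemma whisk_sel:
  "NDom (whisk \<tau> K) = NDom \<tau> \<bullet> K" "NCod (whisk \<tau> K) = NCod \<tau> \<bullet> K"
  "At (whisk \<tau> K) = (\<lambda>x\<in>Obj (Src K). At \<tau> (FO K x))"
  by (simp_all add: whisk_def)

locale restriction = K: functor_on I J K + E: category E
  for I :: "('i, 'k) cat" and J :: "('o, 'm) cat" and E :: "('p, 'q) cat" and K
begin

sublocale I: functor_category I E
  using K.catJ E.category_axioms by (simp add: functor_category_def)
sublocale J: functor_category J E
  using K.catE E.category_axioms by (simp add: functor_category_def)

lemma whisk_hom: "\<tau> \<in> hom (Fun J E) X Y \<Longrightarrow> whisk \<tau> K \<in> hom (Fun I E) (X \<bullet> K) (Y \<bullet> K)"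
  unfolding Fun_hom_iff by (simp add: whisk_sel comp_func_in[OF K.F_in])
    (metis K.FO_in K.FA_arr I.J.dom_in I.J.cod_in)

lemma whisk_arr [simp]:
  assumes "\<tau> \<in> Arr (Fun J E)"
  shows "whisk \<tau> K \<in> Arr (Fun I E)" "Dom (Fun I E) (whisk \<tau> K) = Dom (Fun J E) \<tau> \<bullet> K"
    "Cod (Fun I E) (whisk \<tau> K) = Cod (Fun J E) \<tau> \<bullet> K"
  using homD[OF whisk_hom[OF J.Arr_hom[OF assms]]] by simp_all

lemma At_whisk [simp]: "x \<in> Obj I \<Longrightarrow> At (whisk \<tau> K) x = At \<tau> (FO K x)"
  by (simp add: whisk_sel)

lemma comp_K_in [simp]: "X \<in> Obj (Fun J E) \<Longrightarrow> X \<bullet> K \<in> Obj (Fun I E)"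
  by (rule comp_func_in[OF K.F_in])

lemma whisk_comp:
  assumes "\<tau> \<in> Arr (Fun J E)" "\<sigma> \<in> Arr (Fun J E)" "Cod (Fun J E) \<tau> = Dom (Fun J E) \<sigma>"
  shows "whisk (\<sigma> \<cdot>\<^bsub>Fun J E\<^esub> \<tau>) K = whisk \<sigma> K \<cdot>\<^bsub>Fun I E\<^esub> whisk \<tau> K"
  by (rule I.Fun_eqI) (use assms in simp_all)

lemma whisk_ident: "X \<in> Obj (Fun J E) \<Longrightarrow> whisk (Ident (Fun J E) X) K = Ident (Fun I E) (X \<bullet> K)"
  by (rule I.Fun_eqI) simp_all

lemma precomp_sel [simp]:
  "Src (precomp K E) = Fun J E" "Tgt (precomp K E) = Fun I E"
  "X \<in> Obj (Fun J E) \<Longrightarrow> FO (precomp K E) X = X \<bullet> K"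
  "\<tau> \<in> Arr (Fun J E) \<Longrightarrow> FA (precomp K E) \<tau> = whisk \<tau> K"
  by (simp_all add: precomp_def whisk_def)

lemma precomp_in: "precomp K E \<in> Obj (Fun (Fun J E) (Fun I E))"
  by (rule functor_onI)
    (simp_all add: J.F.category_axioms I.F.category_axioms hom_iff whisk_comp whisk_ident, simp_all add: precomp_def)

end

lemma whisk_whisk:
  assumes "K \<in> Obj (Fun I J)" "L \<in> Obj (Fun H I)" "\<tau> \<in> Arr (Fun J E)"
  shows "whisk (whisk \<tau> K) L = whisk \<tau> (K \<bullet> L)"
proof -
  have "is_ntrans \<tau>" using assms(3) by (simp add: Fun_def)
  then have X: "NDom \<tau> \<in> Obj (Fun J E)" "NCod \<tau> \<in> Obj (Fun J E)"
    using assms(3) by (auto simp: Fun_def is_ntrans_def Let_def)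
  interpret K: functor_on I J K using assms by unfold_locales
  interpret L: functor_on H I L using assms by unfold_locales
  show ?thesis
    by (auto simp: whisk_def comp_func_assoc[OF assms(2,1) X(1)] comp_func_assoc[OF assms(2,1) X(2)] intro!: restrict_ext)
qed

lemma whisk_id_func:
  assumes "\<tau> \<in> Arr (Fun J E)"
  shows "whisk \<tau> (id_func J) = \<tau>"
proof -
  have X: "NDom \<tau> \<in> Obj (Fun J E)" "NCod \<tau> \<in> Obj (Fun J E)" and "At \<tau> \<in> extensional (Obj J)"
    using assms by (auto simp: Fun_def is_ntrans_def Let_def)
  moreover have "(\<lambda>x\<in>Obj J. At \<tau> (FO (id_func J) x)) = restrict (At \<tau>) (Obj J)"
    by (rule restrict_ext) (simp add: id_func_def)
  moreover have "Src (id_func J) = J" by (simp add: id_func_def)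
  ultimately show ?thesis by (simp add: whisk_def comp_id_func extensional_restrict)
qed

locale restriction_pb = restriction +
  assumes pbs: "has_pullbacks E"
begin

sublocale I: functor_category_pb I E using pbs by unfold_locales
sublocale J: functor_category_pb J E using pbs by unfold_locales

text \<open>Pullbacks of functors are pointwise in both directions, and restriction only reindexes
  the points.\<close>

lemma whisk_pullback:
  assumes pb: "is_pullback (Fun J E) f g p q"
  shows "is_pullback (Fun I E) (whisk f K) (whisk g K) (whisk p K) (whisk q K)"
proof -
  note [simp] = pbD(1-8)[OF pb]
  show ?thesis by (rule I.fun_pullbackI) (simp_all add: J.fun_pullbackD[OF pb])
qed

lemma whisk_pb_lift:
  assumes pb: "is_pullback (Fun J E) f g p q"
    and xy: "x \<in> Arr (Fun J E)" "y \<in> Arr (Fun J E)" "Dom (Fun J E) y = Dom (Fun J E) x"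
      "Cod (Fun J E) x = Dom (Fun J E) f" "Cod (Fun J E) y = Dom (Fun J E) g"
      "f \<cdot>\<^bsub>Fun J E\<^esub> x = g \<cdot>\<^bsub>Fun J E\<^esub> y"
  shows "whisk (pb_lift (Fun J E) p q x y) K = pb_lift (Fun I E) (whisk p K) (whisk q K) (whisk x K) (whisk y K)"
proof -
  interpret P: functor_on "Fun J E" "Fun I E" "precomp K E" by unfold_locales (rule precomp_in)
  show ?thesis
    using P.FA_pb_lift[OF pb _ xy] whisk_pullback[OF pb] pbD[OF pb] xy pb_lift[OF pb xy] by simp
qed

text \<open>These are equalities and not mere isomorphisms: at each \<open>x\<close> both sides use
  the pullback that was chosen in \<open>E\<close> for the same two components.\<close>

lemma whisk_ptpb:
  assumes f: "f \<in> Arr (Fun J E)" and g: "g \<in> Arr (Fun J E)" "Cod (Fun J E) g = Cod (Fun J E) f"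
  shows "ptpb1 I E (whisk f K) (whisk g K) = whisk (ptpb1 J E f g) K"
    "ptpb2 I E (whisk f K) (whisk g K) = whisk (ptpb2 J E f g) K"
proof -
  note pb = J.ptpb[OF f g]
  have W: "ptpb_ob J E f g \<in> Obj (Fun J E)"
    using J.F.dom_in[OF pbD(4)[OF pb]] by (simp add: ptpb1_def Fun_sel)
  have W': "ptpb_ob I E (whisk f K) (whisk g K) \<in> Obj (Fun I E)"
    using I.F.dom_in[OF pbD(4)[OF I.ptpb[of "whisk f K" "whisk g K"]]] f g by (simp add: ptpb1_def Fun_sel whisk_sel)
  have "ptpb_ob I E (whisk f K) (whisk g K) = ptpb_ob J E f g \<bullet> K"
    by (rule Fun_Obj_eqI[OF W' comp_K_in[OF W]]) (simp_all add: ptpb_ob_def whisk_sel)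
  then show "ptpb1 I E (whisk f K) (whisk g K) = whisk (ptpb1 J E f g) K"
    "ptpb2 I E (whisk f K) (whisk g K) = whisk (ptpb2 J E f g) K"
    by (auto simp: ptpb1_def ptpb2_def whisk_def intro!: restrict_ext)
qed

end

section \<open>Matching objects\<close>

lemma limit_is_limit:
  assumes "has_limits J E" "F \<in> Obj (Fun J E)"
  shows "is_limit F (lim_obj F) (lim_leg F)"
proof -
  obtain L l where "is_limit F L l" using assms Fun_ObjD[OF assms(2)] by (auto simp: has_limits_def)
  then have "case_prod (is_limit F) (SOME x. case_prod (is_limit F) x)"
    by (rule_tac someI[of _ "(L, l)"]) simp
  then show ?thesis by (simp add: limit_def case_prod_unfold)
qed

lemma lim_lift:
  assumes F: "has_limits J E" "F \<in> Obj (Fun J E)" and c: "is_cone F L l"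
  shows "lim_lift F L l \<in> hom E L (lim_obj F)" "\<And>j. j \<in> Obj J \<Longrightarrow> lim_leg F j \<cdot>\<^bsub>E\<^esub> lim_lift F L l = l j"
proof -
  note [simp] = Fun_ObjD(2,3)[OF F(2)]
  have "\<exists>!h. h \<in> hom E L (lim_obj F) \<and> (\<forall>j\<in>Obj J. lim_leg F j \<cdot>\<^bsub>E\<^esub> h = l j)"
    using limit_is_limit[OF F] c by (simp add: is_limit_def)
  from theI'[OF this] show "lim_lift F L l \<in> hom E L (lim_obj F)"
    "\<And>j. j \<in> Obj J \<Longrightarrow> lim_leg F j \<cdot>\<^bsub>E\<^esub> lim_lift F L l = l j"
    by (simp_all add: lim_lift_def)
qed

lemma lim_eqI:
  assumes F: "has_limits J E" "F \<in> Obj (Fun J E)" and h: "h \<in> hom E L (lim_obj F)" and k: "k \<in> hom E L (lim_obj F)"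
    and eq: "\<And>j. j \<in> Obj J \<Longrightarrow> lim_leg F j \<cdot>\<^bsub>E\<^esub> h = lim_leg F j \<cdot>\<^bsub>E\<^esub> k"
  shows "h = k"
proof -
  note [simp] = Fun_ObjD(2,3)[OF F(2)]
  interpret E: category E using Fun_ObjD[OF F(2)] by simp
  interpret J: category J using Fun_ObjD[OF F(2)] by simp
  interpret F: functor_on J E F using F by unfold_locales
  have c: "is_cone F (lim_obj F) (lim_leg F)" using limit_is_limit[OF F] by (simp add: is_limit_def)
  then have leg: "lim_leg F j \<in> hom E (lim_obj F) (FO F j)" if "j \<in> Obj J" for j
    using that by (simp add: is_cone_def)
  have nat: "FA F \<beta> \<cdot>\<^bsub>E\<^esub> lim_leg F (Dom J \<beta>) = lim_leg F (Cod J \<beta>)" if "\<beta> \<in> Arr J" for \<beta>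
    using c that by (simp add: is_cone_def)
  note [simp] = homD[OF h] homD[OF k] homD[OF leg]
  have "is_cone F L (\<lambda>j. lim_leg F j \<cdot>\<^bsub>E\<^esub> h)"
    unfolding is_cone_def using E.dom_in[OF homD(1)[OF h]] by (simp add: hom_iff E.comp_ext[OF nat])
  then have "\<exists>!h'. h' \<in> hom E L (lim_obj F) \<and> (\<forall>j\<in>Obj J. lim_leg F j \<cdot>\<^bsub>E\<^esub> h' = lim_leg F j \<cdot>\<^bsub>E\<^esub> h)"
    using limit_is_limit[OF F] by (simp add: is_limit_def)
  then show ?thesis using h k eq by metis
qed

lemma op_prod_simps [simp]:
  "Obj (prod_cat (op_cat D) J) = Obj D \<times> Obj J" "Arr (prod_cat (op_cat D) J) = Arr D \<times> Arr J"
  "Dom (prod_cat (op_cat D) J) (\<gamma>, \<beta>) = (Cod D \<gamma>, Dom J \<beta>)"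
  "Cod (prod_cat (op_cat D) J) (\<gamma>, \<beta>) = (Dom D \<gamma>, Cod J \<beta>)"
  "Ident (prod_cat (op_cat D) J) (i, j) = (Ident D i, Ident J j)"
  "(\<gamma>', \<beta>') \<cdot>\<^bsub>prod_cat (op_cat D) J\<^esub> (\<gamma>, \<beta>) = (\<gamma> \<cdot>\<^bsub>D\<^esub> \<gamma>', \<beta>' \<cdot>\<^bsub>J\<^esub> \<beta>)"
  by (simp_all add: prod_cat_def op_cat_def)

lemma SET_simps:
  "(A, h, B) \<in> Arr SET \<longleftrightarrow> h \<in> A \<rightarrow>\<^sub>E B" "Dom SET (A, h, B) = A" "Cod SET (A, h, B) = B"
  "mid (Ident SET A) = (\<lambda>u\<in>A. u)" "mid (g \<cdot>\<^bsub>SET\<^esub> f) = compose (fst f) (mid g) (mid f)"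
  by (auto simp: SET_def)

lemma (in category) category_op: "category (op_cat C)"
  by unfold_locales (simp_all add: op_cat_def hom_iff)

lemma functor_op_func:
  assumes "F \<in> Obj (Fun I J)"
  shows "op_func F \<in> Obj (Fun (op_cat I) (op_cat J))"
proof -
  interpret F: functor_on I J F using assms by unfold_locales
  show ?thesis
    by (rule functor_onI)
      (simp_all add: category.category_op F.catJ F.catE op_func_def, simp_all add: op_cat_def hom_iff F.FA_comp F.FO_ext F.FA_ext)
qed

section \<open>Categories of elements and the matching functor of a profunctor\<close>

locale profunctor_limits = functor_category_pb J E + D: category D
  for D :: "('b, 'c) cat" and J :: "('j, 'k) cat" and P :: "('b, 'c, 'j, 'k, 'u) prof" and E :: "('e, 'f) cat" +
  assumes prof: "is_profunctor D J P"
    and lims: "\<And>i. i \<in> Obj D \<Longrightarrow> has_limits (elements (prof_at D J P i)) E"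
begin

sublocale D: functor_category_pb D E using pbs by unfold_locales

abbreviation act :: "'c \<Rightarrow> 'k \<Rightarrow> 'u \<Rightarrow> 'u" where "act \<gamma> \<beta> u \<equiv> mid (FA P (\<gamma>, \<beta>)) u"

lemma P_in: "P \<in> Obj (Fun (prod_cat (op_cat D) J) SET)"
  using prof by (auto simp: is_profunctor_def intro: Fun_ObjI)

sublocale P: functor_on "prod_cat (op_cat D) J" SET P by unfold_locales (rule P_in)

lemma act_in: "\<gamma> \<in> Arr D \<Longrightarrow> \<beta> \<in> Arr J \<Longrightarrow> u \<in> FO P (Cod D \<gamma>, Dom J \<beta>) \<Longrightarrow> act \<gamma> \<beta> u \<in> FO P (Dom D \<gamma>, Cod J \<beta>)"
  using P.FA_arr[of "(\<gamma>, \<beta>)"] by (cases "FA P (\<gamma>, \<beta>)") (auto simp: SET_simps)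

lemma act_ident: "i \<in> Obj D \<Longrightarrow> j \<in> Obj J \<Longrightarrow> u \<in> FO P (i, j) \<Longrightarrow> act (Ident D i) (Ident J j) u = u"
  using P.FA_ident[of "(i, j)"] by (simp add: SET_simps)

lemma act_comp:
  assumes "\<gamma> \<in> Arr D" "\<gamma>' \<in> Arr D" "Cod D \<gamma>' = Dom D \<gamma>" "\<beta> \<in> Arr J" "\<beta>' \<in> Arr J" "Cod J \<beta> = Dom J \<beta>'"
    "u \<in> FO P (Cod D \<gamma>, Dom J \<beta>)"
  shows "act (\<gamma> \<cdot>\<^bsub>D\<^esub> \<gamma>') (\<beta>' \<cdot>\<^bsub>J\<^esub> \<beta>) u = act \<gamma>' \<beta>' (act \<gamma> \<beta> u)"
  using P.FA_comp[of "(\<gamma>, \<beta>)" "(\<gamma>', \<beta>')"] P.FA_arr[of "(\<gamma>, \<beta>)"] assms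
  by (cases "FA P (\<gamma>, \<beta>)") (simp add: SET_simps compose_def)

abbreviation El :: "'b \<Rightarrow> ('j \<times> 'u, ('j \<times> 'u) \<times> 'k \<times> ('j \<times> 'u)) cat" where
  "El i \<equiv> elements (prof_at D J P i)"

lemma El_simps:
  assumes "i \<in> Obj D"
  shows "(j, u) \<in> Obj (El i) \<longleftrightarrow> j \<in> Obj J \<and> u \<in> FO P (i, j)"
    "(x, \<beta>, y) \<in> Arr (El i) \<longleftrightarrow> \<beta> \<in> Arr J \<and> (\<exists>u\<in>FO P (i, Dom J \<beta>). x = (Dom J \<beta>, u) \<and> y = (Cod J \<beta>, act (Ident D i) \<beta> u))"
    "Dom (El i) (x, \<beta>, y) = x" "Cod (El i) (x, \<beta>, y) = y" "Ident (El i) x = (x, Ident J (fst x), x)"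
    "(y', \<beta>', z) \<cdot>\<^bsub>El i\<^esub> (x, \<beta>, y) = (x, \<beta>' \<cdot>\<^bsub>J\<^esub> \<beta>, z)"
  by (auto simp: elements_def prof_at_def hom_iff)

lemma category_El:
  assumes i: "i \<in> Obj D"
  shows "category (El i)"
proof
  note s = El_simps[OF i]
  show "Dom (El i) f \<in> Obj (El i)" "Cod (El i) f \<in> Obj (El i)" if "f \<in> Arr (El i)" for f
    using that act_in[of "Ident D i" "mid f"] i by (cases f; auto simp: s)+
  show "Ident (El i) x \<in> hom (El i) x x" if "x \<in> Obj (El i)" for x
    using that i by (cases x) (auto simp: s hom_iff act_ident)
  show "f \<cdot>\<^bsub>El i\<^esub> Ident (El i) x = f" if "f \<in> hom (El i) x y" for f x y
    using that by (cases f) (auto simp: s hom_iff)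
  show "Ident (El i) y \<cdot>\<^bsub>El i\<^esub> f = f" if "f \<in> hom (El i) x y" for f x y
    using that by (cases f) (auto simp: s hom_iff)
  show "g \<cdot>\<^bsub>El i\<^esub> f \<in> hom (El i) x z" if "f \<in> hom (El i) x y" "g \<in> hom (El i) y z" for f g x y z
    using that i act_comp[of "Ident D i" "Ident D i" "mid f" "mid g" "snd x"]
    by (cases f; cases g) (auto simp: s hom_iff)
  show "(h \<cdot>\<^bsub>El i\<^esub> g) \<cdot>\<^bsub>El i\<^esub> f = h \<cdot>\<^bsub>El i\<^esub> (g \<cdot>\<^bsub>El i\<^esub> f)"
    if "f \<in> hom (El i) w x" "g \<in> hom (El i) x y" "h \<in> hom (El i) y z" for f g h w x y z
    using that by (cases f; cases g; cases h) (auto simp: s hom_iff)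
qed

lemma match_diag_in:
  assumes X: "X \<in> Obj (Fun J E)" and i: "i \<in> Obj D"
  shows "match_diag D J P X i \<in> Obj (Fun (El i) E)"
proof -
  note s = El_simps[OF i]
  have [simp]: "Src (prof_at D J P i) = J" by (simp add: prof_at_def)
  have "elements_proj (prof_at D J P i) \<in> Obj (Fun (El i) J)"
  proof (rule functor_onI)
    interpret El: category "El i" by (rule category_El[OF i])
    show "FO (elements_proj (prof_at D J P i)) x \<in> Obj J" if "x \<in> Obj (El i)" for x
      using that by (cases x) (simp add: elements_proj_def s)
    show "FA (elements_proj (prof_at D J P i)) f \<in> hom J (FO (elements_proj (prof_at D J P i)) (Dom (El i) f))
        (FO (elements_proj (prof_at D J P i)) (Cod (El i) f))" if "f \<in> Arr (El i)" for f
      using that El.dom_in[OF that] El.cod_in[OF that] by (cases f) (auto simp: elements_proj_def s hom_iff)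
    show "FA (elements_proj (prof_at D J P i)) (Ident (El i) x) = Ident J (FO (elements_proj (prof_at D J P i)) x)"
      if "x \<in> Obj (El i)" for x
      using that El.ident_arr(1)[OF that] by (cases x) (simp add: elements_proj_def s(5))
    show "FA (elements_proj (prof_at D J P i)) (g \<cdot>\<^bsub>El i\<^esub> f)
        = FA (elements_proj (prof_at D J P i)) g \<cdot>\<^bsub>J\<^esub> FA (elements_proj (prof_at D J P i)) f"
      if "f \<in> Arr (El i)" "g \<in> Arr (El i)" "Cod (El i) f = Dom (El i) g" for f g
      using that El.comp_arr(1)[OF that] by (cases f; cases g) (simp add: elements_proj_def s(6))
  qed (simp_all add: J.category_axioms category_El[OF i] elements_proj_def)
  then show ?thesis unfolding match_diag_def by (rule comp_func_in[OF _ X])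
qed

lemma match_diag_sel:
  assumes X: "X \<in> Obj (Fun J E)" and i: "i \<in> Obj D"
  shows "Src (match_diag D J P X i) = El i" "Tgt (match_diag D J P X i) = E"
    "(j, u) \<in> Obj (El i) \<Longrightarrow> FO (match_diag D J P X i) (j, u) = FO X j"
    "(x, \<beta>, y) \<in> Arr (El i) \<Longrightarrow> FA (match_diag D J P X i) (x, \<beta>, y) = FA X \<beta>"
  using Fun_ObjD[OF match_diag_in[OF X i]] by (auto simp: match_diag_def elements_proj_def)

abbreviation leg :: "('j, 'k, 'e, 'f) func \<Rightarrow> 'b \<Rightarrow> 'j \<Rightarrow> 'u \<Rightarrow> 'f" where
  "leg X i j u \<equiv> lim_leg (match_diag D J P X i) (j, u)"

abbreviation mob :: "('j, 'k, 'e, 'f) func \<Rightarrow> 'b \<Rightarrow> 'e" where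
  "mob X i \<equiv> lim_obj (match_diag D J P X i)"

text \<open>An arrow of the category of elements is determined by \<open>\<beta>\<close> and the
  element at its source, so a cone is a family indexed by \<open>j\<close> and \<open>u\<close>
  subject to one equation for each such pair. This hides the triples from most later
  arguments.\<close>

lemma is_cone_match:
  assumes X: "X \<in> Obj (Fun J E)" and i: "i \<in> Obj D"
  shows "is_cone (match_diag D J P X i) L l \<longleftrightarrow> L \<in> Obj E
    \<and> (\<forall>j\<in>Obj J. \<forall>u\<in>FO P (i, j). l (j, u) \<in> hom E L (FO X j))
    \<and> (\<forall>\<beta>\<in>Arr J. \<forall>u\<in>FO P (i, Dom J \<beta>). FA X \<beta> \<cdot>\<^bsub>E\<^esub> l (Dom J \<beta>, u) = l (Cod J \<beta>, act (Ident D i) \<beta> u))"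
proof -
  note s = El_simps[OF i] and m = match_diag_sel[OF X i]
  have "(\<forall>x\<in>Obj (El i). l x \<in> hom E L (FO (match_diag D J P X i) x))
      \<longleftrightarrow> (\<forall>j\<in>Obj J. \<forall>u\<in>FO P (i, j). l (j, u) \<in> hom E L (FO X j))"
  proof (intro iffI ballI)
    fix j u assume L: "\<forall>x\<in>Obj (El i). l x \<in> hom E L (FO (match_diag D J P X i) x)" and "j \<in> Obj J" "u \<in> FO P (i, j)"
    then have "(j, u) \<in> Obj (El i)" by (simp add: s)
    then show "l (j, u) \<in> hom E L (FO X j)" using bspec[OF L] m(3) by force
  next
    fix x assume R: "\<forall>j\<in>Obj J. \<forall>u\<in>FO P (i, j). l (j, u) \<in> hom E L (FO X j)" and x: "x \<in> Obj (El i)"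
    obtain j u where [simp]: "x = (j, u)" by (cases x)
    show "l x \<in> hom E L (FO (match_diag D J P X i) x)" using R x m(3)[of j u] by (simp add: s)
  qed
  moreover have "(\<forall>\<beta>\<in>Arr (El i). FA (match_diag D J P X i) \<beta> \<cdot>\<^bsub>E\<^esub> l (Dom (El i) \<beta>) = l (Cod (El i) \<beta>))
      \<longleftrightarrow> (\<forall>\<beta>\<in>Arr J. \<forall>u\<in>FO P (i, Dom J \<beta>). FA X \<beta> \<cdot>\<^bsub>E\<^esub> l (Dom J \<beta>, u) = l (Cod J \<beta>, act (Ident D i) \<beta> u))"
    (is "?L \<longleftrightarrow> ?R")
  proof
    assume L: ?L
    show ?R
    proof (intro ballI)
      fix \<beta> u assume "\<beta> \<in> Arr J" "u \<in> FO P (i, Dom J \<beta>)"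
      then have a: "((Dom J \<beta>, u), \<beta>, (Cod J \<beta>, act (Ident D i) \<beta> u)) \<in> Arr (El i)" by (simp add: s)
      from bspec[OF L this] show "FA X \<beta> \<cdot>\<^bsub>E\<^esub> l (Dom J \<beta>, u) = l (Cod J \<beta>, act (Ident D i) \<beta> u)"
        by (simp add: m(4)[OF a] s)
    qed
  next
    assume R: ?R
    show ?L
    proof
      fix t assume t: "t \<in> Arr (El i)"
      obtain x \<beta> y where [simp]: "t = (x, \<beta>, y)" by (cases t)
      show "FA (match_diag D J P X i) t \<cdot>\<^bsub>E\<^esub> l (Dom (El i) t) = l (Cod (El i) t)"
        using R t m(4)[of x \<beta> y] by (auto simp: s)
    qed
  qed
  ultimately show ?thesis by (simp add: is_cone_def m(1,2))
qed

lemma leg: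
  assumes X: "X \<in> Obj (Fun J E)" and i: "i \<in> Obj D"
  shows mob_in: "mob X i \<in> Obj E"
    and leg_arr: "j \<in> Obj J \<Longrightarrow> u \<in> FO P (i, j) \<Longrightarrow> leg X i j u \<in> Arr E"
      "j \<in> Obj J \<Longrightarrow> u \<in> FO P (i, j) \<Longrightarrow> Dom E (leg X i j u) = mob X i"
      "j \<in> Obj J \<Longrightarrow> u \<in> FO P (i, j) \<Longrightarrow> Cod E (leg X i j u) = FO X j"
    and leg_nat: "\<beta> \<in> Arr J \<Longrightarrow> u \<in> FO P (i, Dom J \<beta>) \<Longrightarrow>
      FA X \<beta> \<cdot>\<^bsub>E\<^esub> leg X i (Dom J \<beta>) u = leg X i (Cod J \<beta>) (act (Ident D i) \<beta> u)"
  using limit_is_limit[OF lims[OF i] match_diag_in[OF X i]]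
  unfolding is_limit_def is_cone_match[OF X i] hom_iff by blast+

lemma mob_lift:
  assumes X: "X \<in> Obj (Fun J E)" and i: "i \<in> Obj D" and L: "L \<in> Obj E"
    and l: "\<And>j u. j \<in> Obj J \<Longrightarrow> u \<in> FO P (i, j) \<Longrightarrow> l (j, u) \<in> hom E L (FO X j)"
    and n: "\<And>\<beta> u. \<beta> \<in> Arr J \<Longrightarrow> u \<in> FO P (i, Dom J \<beta>) \<Longrightarrow> FA X \<beta> \<cdot>\<^bsub>E\<^esub> l (Dom J \<beta>, u) = l (Cod J \<beta>, act (Ident D i) \<beta> u)"
  defines "h \<equiv> lim_lift (match_diag D J P X i) L l"
  shows "h \<in> Arr E" "Dom E h = L" "Cod E h = mob X i"
    "\<And>j u. j \<in> Obj J \<Longrightarrow> u \<in> FO P (i, j) \<Longrightarrow> leg X i j u \<cdot>\<^bsub>E\<^esub> h = l (j, u)"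
proof -
  have "is_cone (match_diag D J P X i) L l" using L l n by (simp add: is_cone_match[OF X i])
  from lim_lift[OF lims[OF i] match_diag_in[OF X i] this] El_simps(1)[OF i]
  show "h \<in> Arr E" "Dom E h = L" "Cod E h = mob X i"
    "\<And>j u. j \<in> Obj J \<Longrightarrow> u \<in> FO P (i, j) \<Longrightarrow> leg X i j u \<cdot>\<^bsub>E\<^esub> h = l (j, u)"
    unfolding h_def hom_iff by blast+
qed

lemma mob_eqI:
  assumes X: "X \<in> Obj (Fun J E)" and i: "i \<in> Obj D"
    and h: "h \<in> Arr E" "k \<in> Arr E" "Dom E k = Dom E h" "Cod E h = mob X i" "Cod E k = mob X i"
    and eq: "\<And>j u. j \<in> Obj J \<Longrightarrow> u \<in> FO P (i, j) \<Longrightarrow> leg X i j u \<cdot>\<^bsub>E\<^esub> h = leg X i j u \<cdot>\<^bsub>E\<^esub> k"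
  shows "h = k"
proof (rule lim_eqI[OF lims[OF i] match_diag_in[OF X i], of _ "Dom E h"])
  show "lim_leg (match_diag D J P X i) x \<cdot>\<^bsub>E\<^esub> h = lim_leg (match_diag D J P X i) x \<cdot>\<^bsub>E\<^esub> k"
    if "x \<in> Obj (El i)" for x
    using that eq by (cases x) (simp add: El_simps(1)[OF i])
qed (use h in \<open>simp_all add: hom_iff\<close>)

lemma match_ob_sel [simp]: "Src (match_ob D J P X) = D" "i \<in> Obj D \<Longrightarrow> FO (match_ob D J P X) i = mob X i"
  by (simp_all add: match_ob_def)

lemma match_ob_FA:
  assumes X: "X \<in> Obj (Fun J E)" and \<gamma>: "\<gamma> \<in> Arr D"
  shows "FA (match_ob D J P X) \<gamma> \<in> Arr E" "Dom E (FA (match_ob D J P X) \<gamma>) = mob X (Dom D \<gamma>)"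
    "Cod E (FA (match_ob D J P X) \<gamma>) = mob X (Cod D \<gamma>)"
    "\<And>j u. j \<in> Obj J \<Longrightarrow> u \<in> FO P (Cod D \<gamma>, j) \<Longrightarrow>
      leg X (Cod D \<gamma>) j u \<cdot>\<^bsub>E\<^esub> FA (match_ob D J P X) \<gamma> = leg X (Dom D \<gamma>) j (act \<gamma> (Ident J j) u)"
proof -
  note [simp] = \<gamma>
  let ?l = "\<lambda>(j, u). leg X (Dom D \<gamma>) j (act \<gamma> (Ident J j) u)"
  have a: "act \<gamma> (Ident J j) u \<in> FO P (Dom D \<gamma>, j)" if "j \<in> Obj J" "u \<in> FO P (Cod D \<gamma>, j)" for j u
    using act_in[of \<gamma> "Ident J j" u] that by simp
  \<comment> \<open>The two actions commute, since either order gives the action of the pair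
    \<open>(\<gamma>, \<beta>)\<close>.\<close>
  have c: "act (Ident D (Dom D \<gamma>)) \<beta> (act \<gamma> (Ident J (Dom J \<beta>)) u) = act \<gamma> (Ident J (Cod J \<beta>)) (act (Ident D (Cod D \<gamma>)) \<beta> u)"
    if "\<beta> \<in> Arr J" "u \<in> FO P (Cod D \<gamma>, Dom J \<beta>)" for \<beta> u
    using act_comp[of \<gamma> "Ident D (Dom D \<gamma>)" "Ident J (Dom J \<beta>)" \<beta> u]
      act_comp[of "Ident D (Cod D \<gamma>)" \<gamma> \<beta> "Ident J (Cod J \<beta>)" u] that by simp
  have n: "FA X \<beta> \<cdot>\<^bsub>E\<^esub> ?l (Dom J \<beta>, u) = ?l (Cod J \<beta>, act (Ident D (Cod D \<gamma>)) \<beta> u)"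
    if "\<beta> \<in> Arr J" "u \<in> FO P (Cod D \<gamma>, Dom J \<beta>)" for \<beta> u
    using that leg_nat[OF X D.dom_in[OF \<gamma>] that(1) a] c by simp
  note m = mob_lift[OF X D.cod_in[OF \<gamma>] mob_in[OF X D.dom_in[OF \<gamma>]], of ?l, OF _ n]
  have FA: "FA (match_ob D J P X) \<gamma> = lim_lift (match_diag D J P X (Cod D \<gamma>)) (mob X (Dom D \<gamma>)) ?l"
    by (simp add: match_ob_def)
  show "FA (match_ob D J P X) \<gamma> \<in> Arr E" "Dom E (FA (match_ob D J P X) \<gamma>) = mob X (Dom D \<gamma>)"
    "Cod E (FA (match_ob D J P X) \<gamma>) = mob X (Cod D \<gamma>)"
    "\<And>j u. j \<in> Obj J \<Longrightarrow> u \<in> FO P (Cod D \<gamma>, j) \<Longrightarrow>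
      leg X (Cod D \<gamma>) j u \<cdot>\<^bsub>E\<^esub> FA (match_ob D J P X) \<gamma> = leg X (Dom D \<gamma>) j (act \<gamma> (Ident J j) u)"
    unfolding FA by (subst m; (simp add: hom_iff leg_arr[OF X D.dom_in[OF \<gamma>]] a)?)+
qed

lemma match_ob_in:
  assumes X: "X \<in> Obj (Fun J E)"
  shows "match_ob D J P X \<in> Obj (Fun D E)"
proof (rule functor_onI)
  note M = match_ob_FA[OF X]
  show "FA (match_ob D J P X) (Ident D i) = Ident E (FO (match_ob D J P X) i)" if i: "i \<in> Obj D" for i
    by (rule mob_eqI[OF X i]) (use i M[of "Ident D i"] leg[OF X i] in \<open>simp_all add: act_ident\<close>)
  show "FA (match_ob D J P X) (\<delta> \<cdot>\<^bsub>D\<^esub> \<gamma>) = FA (match_ob D J P X) \<delta> \<cdot>\<^bsub>E\<^esub> FA (match_ob D J P X) \<gamma>"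
    if gd: "\<gamma> \<in> Arr D" "\<delta> \<in> Arr D" "Cod D \<gamma> = Dom D \<delta>" for \<gamma> \<delta>
  proof -
    note [simp] = gd M(1-3)
    have i: "Cod D \<delta> \<in> Obj D" by simp
    have "leg X (Cod D \<delta>) j u \<cdot>\<^bsub>E\<^esub> FA (match_ob D J P X) (\<delta> \<cdot>\<^bsub>D\<^esub> \<gamma>)
        = leg X (Cod D \<delta>) j u \<cdot>\<^bsub>E\<^esub> FA (match_ob D J P X) \<delta> \<cdot>\<^bsub>E\<^esub> FA (match_ob D J P X) \<gamma>"
      if j: "j \<in> Obj J" and u: "u \<in> FO P (Cod D \<delta>, j)" for j u
    proof -
      have a: "act \<delta> (Ident J j) u \<in> FO P (Cod D \<gamma>, j)" using act_in[of \<delta> "Ident J j" u] j u by simp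
      have "leg X (Cod D \<delta>) j u \<cdot>\<^bsub>E\<^esub> FA (match_ob D J P X) \<delta> \<cdot>\<^bsub>E\<^esub> FA (match_ob D J P X) \<gamma>
          = leg X (Cod D \<gamma>) j (act \<delta> (Ident J j) u) \<cdot>\<^bsub>E\<^esub> FA (match_ob D J P X) \<gamma>"
        using E.comp_ext[OF M(4)[OF gd(2) j u]] leg_arr[OF X i j u] by simp
      also have "\<dots> = leg X (Dom D \<gamma>) j (act \<gamma> (Ident J j) (act \<delta> (Ident J j) u))"
        by (rule M(4)[OF gd(1) j a])
      also have "\<dots> = leg X (Cod D \<delta>) j u \<cdot>\<^bsub>E\<^esub> FA (match_ob D J P X) (\<delta> \<cdot>\<^bsub>D\<^esub> \<gamma>)"
        using M(4)[of "\<delta> \<cdot>\<^bsub>D\<^esub> \<gamma>" j u] act_comp[of \<delta> \<gamma> "Ident J j" "Ident J j" u] j u by simp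
      finally show ?thesis by simp
    qed
    then show ?thesis by (rule_tac mob_eqI[OF X i]) simp_all
  qed
  show "Tgt (match_ob D J P X) = E" using Fun_ObjD[OF X] by (simp add: match_ob_def)
qed (simp_all add: D.category_axioms E.category_axioms hom_iff mob_in[OF X] match_ob_FA[OF X], simp_all add: match_ob_def)

abbreviation MF where "MF \<equiv> match_functor D J P E"

lemma match_functor_sel [simp]:
  "X \<in> Obj (Fun J E) \<Longrightarrow> FO MF X = match_ob D J P X" "Src MF = Fun J E" "Tgt MF = Fun D E"
  by (simp_all add: match_functor_def)

lemma match_functor_arr:
  assumes t: "\<tau> \<in> Arr (Fun J E)"
  shows "FA MF \<tau> \<in> hom (Fun D E) (match_ob D J P (Dom (Fun J E) \<tau>)) (match_ob D J P (Cod (Fun J E) \<tau>))"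
    and "\<And>i j u. i \<in> Obj D \<Longrightarrow> j \<in> Obj J \<Longrightarrow> u \<in> FO P (i, j) \<Longrightarrow>
      leg (Cod (Fun J E) \<tau>) i j u \<cdot>\<^bsub>E\<^esub> At (FA MF \<tau>) i = At \<tau> j \<cdot>\<^bsub>E\<^esub> leg (Dom (Fun J E) \<tau>) i j u"
proof -
  let ?X = "Dom (Fun J E) \<tau>" and ?Y = "Cod (Fun J E) \<tau>"
  have X: "?X \<in> Obj (Fun J E)" and Y: "?Y \<in> Obj (Fun J E)" using t by simp_all
  let ?l = "\<lambda>i x. At \<tau> (fst x) \<cdot>\<^bsub>E\<^esub> lim_leg (match_diag D J P ?X i) x"
  define c where "c i = lim_lift (match_diag D J P ?Y i) (mob ?X i) (?l i)" for i
  note [simp] = t mob_in[OF X] mob_in[OF Y] leg_arr[OF X] leg_arr[OF Y]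
  have c: "c i \<in> Arr E" "Dom E (c i) = mob ?X i" "Cod E (c i) = mob ?Y i"
    "\<And>j u. j \<in> Obj J \<Longrightarrow> u \<in> FO P (i, j) \<Longrightarrow> leg ?Y i j u \<cdot>\<^bsub>E\<^esub> c i = At \<tau> j \<cdot>\<^bsub>E\<^esub> leg ?X i j u"
    if i: "i \<in> Obj D" for i
  proof -
    note [simp] = i
    have n: "FA ?Y \<beta> \<cdot>\<^bsub>E\<^esub> ?l i (Dom J \<beta>, u) = ?l i (Cod J \<beta>, act (Ident D i) \<beta> u)"
      if b: "\<beta> \<in> Arr J" "u \<in> FO P (i, Dom J \<beta>)" for \<beta> u
      using E.comp_ext2[OF At_nat[OF t b(1), symmetric], of "leg ?X i (Dom J \<beta>) u"] leg_nat[OF X i b] b by simp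
    note m = mob_lift[OF Y i mob_in[OF X i], of "?l i", OF _ n, folded c_def]
    show "c i \<in> Arr E" "Dom E (c i) = mob ?X i" "Cod E (c i) = mob ?Y i"
      "\<And>j u. j \<in> Obj J \<Longrightarrow> u \<in> FO P (i, j) \<Longrightarrow> leg ?Y i j u \<cdot>\<^bsub>E\<^esub> c i = At \<tau> j \<cdot>\<^bsub>E\<^esub> leg ?X i j u"
      by (subst m; (simp add: hom_iff)?)+
  qed
  have FA: "FA MF \<tau> = \<lparr>NDom = match_ob D J P ?X, NCod = match_ob D J P ?Y, At = restrict c (Obj D)\<rparr>"
    using t by (simp add: match_functor_def Fun_sel c_def restrict_def cong: if_cong)
  show "FA MF \<tau> \<in> hom (Fun D E) (match_ob D J P ?X) (match_ob D J P ?Y)" unfolding FA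
  proof (rule Fun_homI)
    fix \<gamma> assume g: "\<gamma> \<in> Arr D"
    note [simp] = g
    note MX = match_ob_FA[OF X g] and MY = match_ob_FA[OF Y g]
    note [simp] = MX(1-3) MY(1-3) c(1-3)
    have i: "Cod D \<gamma> \<in> Obj D" "Dom D \<gamma> \<in> Obj D" by simp_all
    have "leg ?Y (Cod D \<gamma>) j u \<cdot>\<^bsub>E\<^esub> c (Cod D \<gamma>) \<cdot>\<^bsub>E\<^esub> FA (match_ob D J P ?X) \<gamma>
        = leg ?Y (Cod D \<gamma>) j u \<cdot>\<^bsub>E\<^esub> FA (match_ob D J P ?Y) \<gamma> \<cdot>\<^bsub>E\<^esub> c (Dom D \<gamma>)"
      if j: "j \<in> Obj J" and u: "u \<in> FO P (Cod D \<gamma>, j)" for j u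
    proof -
      note [simp] = j u
      have a: "act \<gamma> (Ident J j) u \<in> FO P (Dom D \<gamma>, j)" using act_in[of \<gamma> "Ident J j" u] by simp
      show ?thesis
        using E.comp_ext2[OF c(4)[OF i(1) j u], of "FA (match_ob D J P ?X) \<gamma>"] MX(4)[OF j u]
          E.comp_ext[OF MY(4)[OF j u], of "c (Dom D \<gamma>)"] c(4)[OF i(2) j a] by simp
    qed
    then show "c (Cod D \<gamma>) \<cdot>\<^bsub>E\<^esub> FA (match_ob D J P ?X) \<gamma> = FA (match_ob D J P ?Y) \<gamma> \<cdot>\<^bsub>E\<^esub> c (Dom D \<gamma>)"
      by (rule_tac mob_eqI[OF Y i(1)]) simp_all
  qed (simp_all add: match_ob_in[OF X] match_ob_in[OF Y] hom_iff c)
  show "leg ?Y i j u \<cdot>\<^bsub>E\<^esub> At (FA MF \<tau>) i = At \<tau> j \<cdot>\<^bsub>E\<^esub> leg ?X i j u"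
    if "i \<in> Obj D" "j \<in> Obj J" "u \<in> FO P (i, j)" for i j u
    unfolding FA using that c(4) by simp
qed

lemma match_functor_arr' [simp]:
  assumes "\<tau> \<in> Arr (Fun J E)"
  shows "FA MF \<tau> \<in> Arr (Fun D E)" "Dom (Fun D E) (FA MF \<tau>) = match_ob D J P (Dom (Fun J E) \<tau>)"
    "Cod (Fun D E) (FA MF \<tau>) = match_ob D J P (Cod (Fun J E) \<tau>)"
  using homD[OF match_functor_arr(1)[OF assms]] by simp_all

lemma match_functor_in: "MF \<in> Obj (Fun (Fun J E) (Fun D E))"
proof (rule functor_onI)
  show "FA MF (Ident (Fun J E) X) = Ident (Fun D E) (FO MF X)" if X: "X \<in> Obj (Fun J E)" for X
  proof (rule D.Fun_eqI)
    fix i assume i: "i \<in> Obj D"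
    show "At (FA MF (Ident (Fun J E) X)) i = At (Ident (Fun D E) (FO MF X)) i"
      by (rule mob_eqI[OF X i])
        (use X i match_functor_arr(2)[of "Ident (Fun J E) X"] leg[OF X i] match_ob_in[OF X] in simp_all)
  qed (use X match_ob_in[OF X] in simp_all)
  show "FA MF (\<sigma> \<cdot>\<^bsub>Fun J E\<^esub> \<tau>) = FA MF \<sigma> \<cdot>\<^bsub>Fun D E\<^esub> FA MF \<tau>"
    if ts: "\<tau> \<in> Arr (Fun J E)" "\<sigma> \<in> Arr (Fun J E)" "Cod (Fun J E) \<tau> = Dom (Fun J E) \<sigma>" for \<tau> \<sigma>
  proof (rule D.Fun_eqI)
    note [simp] = ts
    fix i assume i: "i \<in> Obj D"
    note [simp] = i
    have Y: "Cod (Fun J E) \<sigma> \<in> Obj (Fun J E)" and X: "Dom (Fun J E) \<tau> \<in> Obj (Fun J E)"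
      and Z: "Dom (Fun J E) \<sigma> \<in> Obj (Fun J E)" by simp_all
    have "leg (Cod (Fun J E) \<sigma>) i j u \<cdot>\<^bsub>E\<^esub> At (FA MF (\<sigma> \<cdot>\<^bsub>Fun J E\<^esub> \<tau>)) i
        = leg (Cod (Fun J E) \<sigma>) i j u \<cdot>\<^bsub>E\<^esub> At (FA MF \<sigma>) i \<cdot>\<^bsub>E\<^esub> At (FA MF \<tau>) i"
      if j: "j \<in> Obj J" and u: "u \<in> FO P (i, j)" for j u
    proof -
      note [simp] = j leg_arr[OF X i j u] leg_arr[OF Y i j u] leg_arr[OF Z i j u]
      show ?thesis
        using match_functor_arr(2)[of "\<sigma> \<cdot>\<^bsub>Fun J E\<^esub> \<tau>", OF _ i j u] match_functor_arr(2)[OF ts(1) i j u]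
          E.comp_ext2[OF match_functor_arr(2)[OF ts(2) i j u], of "At (FA MF \<tau>) i"] by simp
    qed
    then show "At (FA MF (\<sigma> \<cdot>\<^bsub>Fun J E\<^esub> \<tau>)) i = At (FA MF \<sigma> \<cdot>\<^bsub>Fun D E\<^esub> FA MF \<tau>) i"
      by (rule_tac mob_eqI[OF Y i]) simp_all
  qed (use ts in simp_all)
qed (simp_all add: F.category_axioms D.F.category_axioms match_ob_in hom_iff, simp_all add: match_functor_def)

sublocale MF: functor_on "Fun J E" "Fun D E" MF by unfold_locales (rule match_functor_in)

text \<open>Limits commute with pullbacks: a cone over the limits gives, for each leg, a cone over
  the pullback at \<open>j\<close>, and the induced maps again form a cone over the matching
  diagram.\<close>

lemma match_pullback:
  assumes pb: "is_pullback (Fun J E) f g p q"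
  shows "is_pullback (Fun D E) (FA MF f) (FA MF g) (FA MF p) (FA MF q)"
proof (rule D.fun_pullbackI)
  note [simp] = pbD(1-8)[OF pb]
  show "FA MF f \<in> Arr (Fun D E)" "FA MF g \<in> Arr (Fun D E)" "Cod (Fun D E) (FA MF g) = Cod (Fun D E) (FA MF f)"
    "FA MF p \<in> Arr (Fun D E)" "FA MF q \<in> Arr (Fun D E)" "Dom (Fun D E) (FA MF q) = Dom (Fun D E) (FA MF p)"
    "Cod (Fun D E) (FA MF p) = Dom (Fun D E) (FA MF f)" "Cod (Fun D E) (FA MF q) = Dom (Fun D E) (FA MF g)"
    by simp_all
  fix i assume i: "i \<in> Obj D"
  note [simp] = i
  let ?A = "Cod (Fun J E) f" and ?B = "Dom (Fun J E) f" and ?C = "Dom (Fun J E) g" and ?P = "Dom (Fun J E) p"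
  have X: "?A \<in> Obj (Fun J E)" "?B \<in> Obj (Fun J E)" "?C \<in> Obj (Fun J E)" "?P \<in> Obj (Fun J E)" by simp_all
  note [simp] = leg_arr[OF X(1) i] leg_arr[OF X(2) i] leg_arr[OF X(3) i] leg_arr[OF X(4) i]
  have Lf: "leg ?A i j u \<cdot>\<^bsub>E\<^esub> At (FA MF f) i = At f j \<cdot>\<^bsub>E\<^esub> leg ?B i j u"
    and Lg: "leg ?A i j u \<cdot>\<^bsub>E\<^esub> At (FA MF g) i = At g j \<cdot>\<^bsub>E\<^esub> leg ?C i j u"
    and Lp: "leg ?B i j u \<cdot>\<^bsub>E\<^esub> At (FA MF p) i = At p j \<cdot>\<^bsub>E\<^esub> leg ?P i j u"
    and Lq: "leg ?C i j u \<cdot>\<^bsub>E\<^esub> At (FA MF q) i = At q j \<cdot>\<^bsub>E\<^esub> leg ?P i j u"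
    if "j \<in> Obj J" "u \<in> FO P (i, j)" for j u
    using match_functor_arr(2)[of f i j u] match_functor_arr(2)[of g i j u]
      match_functor_arr(2)[of p i j u] match_functor_arr(2)[of q i j u] that by simp_all
  note pbj = fun_pullbackD[OF pb]
  show "is_pullback E (At (FA MF f) i) (At (FA MF g) i) (At (FA MF p) i) (At (FA MF q) i)"
  proof (rule E.is_pullbackI)
    have "FA MF f \<cdot>\<^bsub>Fun D E\<^esub> FA MF p = FA MF g \<cdot>\<^bsub>Fun D E\<^esub> FA MF q"
      using MF.FA_comp[of p f] MF.FA_comp[of q g] pbD(9)[OF pb] by simp
    from arg_cong[OF this, of "\<lambda>t. At t i"]
    show "At (FA MF f) i \<cdot>\<^bsub>E\<^esub> At (FA MF p) i = At (FA MF g) i \<cdot>\<^bsub>E\<^esub> At (FA MF q) i" by simp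
  next
    fix x y assume xy: "x \<in> Arr E" "y \<in> Arr E" "Dom E y = Dom E x" "Cod E x = Dom E (At (FA MF f) i)"
      "Cod E y = Dom E (At (FA MF g) i)" and c: "At (FA MF f) i \<cdot>\<^bsub>E\<^esub> x = At (FA MF g) i \<cdot>\<^bsub>E\<^esub> y"
    have [simp]: "Cod E x = mob ?B i" "Cod E y = mob ?C i" using xy by simp_all
    note [simp] = xy(1-3)
    have cj: "At f j \<cdot>\<^bsub>E\<^esub> leg ?B i j u \<cdot>\<^bsub>E\<^esub> x = At g j \<cdot>\<^bsub>E\<^esub> leg ?C i j u \<cdot>\<^bsub>E\<^esub> y"
      if ju: "j \<in> Obj J" "u \<in> FO P (i, j)" for j u
      using E.comp_ext2[OF Lf[OF ju], of x] E.comp_ext2[OF Lg[OF ju], of y] ju c by simp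
    \<comment> \<open>The leg at \<open>(j, u)\<close> is induced by the
      \<open>(j, u)\<close>-components of \<open>x\<close> and \<open>y\<close>; compatibility along
      \<open>\<beta>\<close> is then checked by joint monicity at
      \<open>Cod J \<beta>\<close>.\<close>
    define l where "l = (\<lambda>(j, u). pb_lift E (At p j) (At q j) (leg ?B i j u \<cdot>\<^bsub>E\<^esub> x) (leg ?C i j u \<cdot>\<^bsub>E\<^esub> y))"
    have l: "l (j, u) \<in> Arr E" "Dom E (l (j, u)) = Dom E x" "Cod E (l (j, u)) = FO ?P j"
      "At p j \<cdot>\<^bsub>E\<^esub> l (j, u) = leg ?B i j u \<cdot>\<^bsub>E\<^esub> x" "At q j \<cdot>\<^bsub>E\<^esub> l (j, u) = leg ?C i j u \<cdot>\<^bsub>E\<^esub> y"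
      if ju: "j \<in> Obj J" "u \<in> FO P (i, j)" for j u
      using pb_lift[OF pbj[OF ju(1)] _ _ _ _ _ cj[OF ju]] ju by (simp_all add: l_def)
    have n: "FA ?P \<beta> \<cdot>\<^bsub>E\<^esub> l (Dom J \<beta>, u) = l (Cod J \<beta>, act (Ident D i) \<beta> u)"
      if b: "\<beta> \<in> Arr J" "u \<in> FO P (i, Dom J \<beta>)" for \<beta> u
    proof -
      note [simp] = b
      have a: "act (Ident D i) \<beta> u \<in> FO P (i, Cod J \<beta>)" using act_in[of "Ident D i" \<beta> u] by simp
      have o: "Dom J \<beta> \<in> Obj J" "Cod J \<beta> \<in> Obj J" by simp_all
      note [simp] = a l(1-3)[OF o(1) b(2)] l(1-3)[OF o(2) a]
      show ?thesis
      proof (rule E.pb_eqI[OF pbj[OF o(2)]])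
        show "At p (Cod J \<beta>) \<cdot>\<^bsub>E\<^esub> FA ?P \<beta> \<cdot>\<^bsub>E\<^esub> l (Dom J \<beta>, u) = At p (Cod J \<beta>) \<cdot>\<^bsub>E\<^esub> l (Cod J \<beta>, act (Ident D i) \<beta> u)"
          using E.comp_ext2[OF At_nat[of p \<beta>], of "l (Dom J \<beta>, u)"] l(4)[OF o(1) b(2)] l(4)[OF o(2) a]
            E.comp_ext[OF leg_nat[OF X(2) i b], of x] by simp
        show "At q (Cod J \<beta>) \<cdot>\<^bsub>E\<^esub> FA ?P \<beta> \<cdot>\<^bsub>E\<^esub> l (Dom J \<beta>, u) = At q (Cod J \<beta>) \<cdot>\<^bsub>E\<^esub> l (Cod J \<beta>, act (Ident D i) \<beta> u)"
          using E.comp_ext2[OF At_nat[of q \<beta>], of "l (Dom J \<beta>, u)"] l(5)[OF o(1) b(2)] l(5)[OF o(2) a]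
            E.comp_ext[OF leg_nat[OF X(3) i b], of y] by simp
      qed simp_all
    qed
    have "l (j, u) \<in> hom E (Dom E x) (FO ?P j)" if "j \<in> Obj J" "u \<in> FO P (i, j)" for j u
      using l[OF that] by (simp add: hom_iff)
    note h = mob_lift[OF X(4) i E.dom_in[OF xy(1)] this n]
    let ?h = "lim_lift (match_diag D J P ?P i) (Dom E x) l"
    have "At (FA MF p) i \<cdot>\<^bsub>E\<^esub> ?h = x"
      by (rule mob_eqI[OF X(2) i]) (simp_all add: h E.comp_ext2[OF Lp] l)
    moreover have "At (FA MF q) i \<cdot>\<^bsub>E\<^esub> ?h = y"
      by (rule mob_eqI[OF X(3) i]) (simp_all add: h E.comp_ext2[OF Lq] l)
    ultimately show "\<exists>h. h \<in> hom E (Dom E x) (Dom E (At (FA MF p) i)) \<and> At (FA MF p) i \<cdot>\<^bsub>E\<^esub> h = x \<and> At (FA MF q) i \<cdot>\<^bsub>E\<^esub> h = y"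
      using h by (intro exI[of _ ?h]) (simp add: hom_iff)
  next
    fix h k assume hk: "h \<in> Arr E" "k \<in> Arr E" "Dom E k = Dom E h" "Cod E h = Dom E (At (FA MF p) i)"
      "Cod E k = Dom E (At (FA MF p) i)" and e: "At (FA MF p) i \<cdot>\<^bsub>E\<^esub> h = At (FA MF p) i \<cdot>\<^bsub>E\<^esub> k"
      "At (FA MF q) i \<cdot>\<^bsub>E\<^esub> h = At (FA MF q) i \<cdot>\<^bsub>E\<^esub> k"
    have [simp]: "Cod E h = mob ?P i" "Cod E k = mob ?P i" using hk by simp_all
    note [simp] = hk(1-3)
    show "h = k"
    proof (rule mob_eqI[OF X(4) i])
      fix j u assume ju: "j \<in> Obj J" "u \<in> FO P (i, j)"
      note [simp] = ju
      show "leg ?P i j u \<cdot>\<^bsub>E\<^esub> h = leg ?P i j u \<cdot>\<^bsub>E\<^esub> k"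
        by (rule E.pb_eqI[OF pbj[OF ju(1)]])
          (use E.comp_ext2[OF Lp[OF ju], of h] E.comp_ext2[OF Lp[OF ju], of k]
            E.comp_ext2[OF Lq[OF ju], of h] E.comp_ext2[OF Lq[OF ju], of k] e in simp_all)
    qed simp_all
  qed simp_all
qed

end

section \<open>Functors and transformations on collages and colimits\<close>

text \<open>The matching map for a functor that so far exists only on one collage. During the
  recursion nothing is defined on \<open>\<I>\<^sub>\<infinity>\<close> yet, so
  \<open>match_map\<close> itself cannot be used there.\<close>

definition collage_match :: "('b, 'c) cat \<Rightarrow> ('j, 'k) cat \<Rightarrow> ('b, 'c, 'j, 'k, 'u) prof \<Rightarrow>
    ('j + 'b, ('b, 'c, 'j, 'k, 'u) collage_arr, 'e, 'f) func \<Rightarrow> ('b, 'c, 'e, 'f) ntrans" where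
  "collage_match D J P Z = \<lparr>NDom = Z \<bullet> collage_inr D J P, NCod = match_ob D J P (Z \<bullet> collage_inl D J P),
     At = (\<lambda>i\<in>Obj D. lim_lift (match_diag D J P (Z \<bullet> collage_inl D J P) i) (FO Z (Inr i)) (\<lambda>(j, u). FA Z (Het i u j)))\<rparr>"

lemma collage_simps [simp]:
  "Inl j \<in> Obj (collage D J P) \<longleftrightarrow> j \<in> Obj J" "Inr i \<in> Obj (collage D J P) \<longleftrightarrow> i \<in> Obj D"
  "ArrL \<beta> \<in> Arr (collage D J P) \<longleftrightarrow> \<beta> \<in> Arr J" "ArrR \<gamma> \<in> Arr (collage D J P) \<longleftrightarrow> \<gamma> \<in> Arr D"
  "Het i u j \<in> Arr (collage D J P) \<longleftrightarrow> i \<in> Obj D \<and> j \<in> Obj J \<and> u \<in> FO P (i, j)"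
  "Dom (collage D J P) = collage_dom D J" "Cod (collage D J P) = collage_cod D J"
  "Ident (collage D J P) (Inl j) = ArrL (Ident J j)" "Ident (collage D J P) (Inr i) = ArrR (Ident D i)"
  "b \<cdot>\<^bsub>collage D J P\<^esub> a = collage_comp D J P b a"
  by (auto simp: collage_def)

lemma collage_objE:
  assumes "x \<in> Obj (collage D J P)"
  obtains j where "x = Inl j" "j \<in> Obj J" | i where "x = Inr i" "i \<in> Obj D"
  using assms by (auto simp: collage_def)

lemma collage_arrE:
  assumes "a \<in> Arr (collage D J P)"
  obtains \<beta> where "a = ArrL \<beta>" "\<beta> \<in> Arr J" | \<gamma> where "a = ArrR \<gamma>" "\<gamma> \<in> Arr D"
    | i u j where "a = Het i u j" "i \<in> Obj D" "j \<in> Obj J" "u \<in> FO P (i, j)"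
  using assms by (auto simp: collage_def)

text \<open>That the collage is a category is assumed here because in use it is part of
  \<open>Glue G n\<close> being a functor.\<close>

locale collage_limits = profunctor_limits +
  assumes category_collage: "category (collage D J P)"
begin

abbreviation I where "I \<equiv> collage D J P"
abbreviation inl where "inl \<equiv> collage_inl D J P"
abbreviation inr where "inr \<equiv> collage_inr D J P"
abbreviation \<mu> where "\<mu> \<equiv> collage_match D J P"

lemma inl_in: "inl \<in> Obj (Fun J I)"
  by (rule functor_onI)
    (simp_all add: J.category_axioms category_collage collage_inl_def hom_iff)

lemma inr_in: "inr \<in> Obj (Fun D I)"
  by (rule functor_onI)
    (simp_all add: D.category_axioms category_collage collage_inr_def hom_iff)

lemma inl_sel [simp]:
  "Src inl = J" "j \<in> Obj J \<Longrightarrow> FO inl j = Inl j" "\<beta> \<in> Arr J \<Longrightarrow> FA inl \<beta> = ArrL \<beta>"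
  by (simp_all add: collage_inl_def)

lemma inr_sel [simp]:
  "Src inr = D" "i \<in> Obj D \<Longrightarrow> FO inr i = Inr i" "\<gamma> \<in> Arr D \<Longrightarrow> FA inr \<gamma> = ArrR \<gamma>"
  by (simp_all add: collage_inr_def)

sublocale I: functor_category_pb I E
  using category_collage pbs E.category_axioms
  by (simp add: functor_category_pb_def functor_category_def functor_category_pb_axioms_def)

sublocale L: restriction_pb J I E inl
  by unfold_locales (simp_all add: inl_in pbs)

sublocale R: restriction_pb D I E inr
  by unfold_locales (simp_all add: inr_in pbs)

lemma FA_Het_comp:
  assumes Z: "Z \<in> Obj (Fun I E)"
  shows "i \<in> Obj D \<Longrightarrow> \<beta> \<in> Arr J \<Longrightarrow> u \<in> FO P (i, Dom J \<beta>) \<Longrightarrow>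
      FA Z (ArrL \<beta>) \<cdot>\<^bsub>E\<^esub> FA Z (Het i u (Dom J \<beta>)) = FA Z (Het i (act (Ident D i) \<beta> u) (Cod J \<beta>))"
    and "\<gamma> \<in> Arr D \<Longrightarrow> j \<in> Obj J \<Longrightarrow> u \<in> FO P (Cod D \<gamma>, j) \<Longrightarrow>
      FA Z (Het (Cod D \<gamma>) u j) \<cdot>\<^bsub>E\<^esub> FA Z (ArrR \<gamma>) = FA Z (Het (Dom D \<gamma>) (act \<gamma> (Ident J j) u) j)"
proof -
  interpret Z: functor_on I E Z using Z by unfold_locales
  show "i \<in> Obj D \<Longrightarrow> \<beta> \<in> Arr J \<Longrightarrow> u \<in> FO P (i, Dom J \<beta>) \<Longrightarrow>
      FA Z (ArrL \<beta>) \<cdot>\<^bsub>E\<^esub> FA Z (Het i u (Dom J \<beta>)) = FA Z (Het i (act (Ident D i) \<beta> u) (Cod J \<beta>))"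
    using Z.FA_comp[of "Het i u (Dom J \<beta>)" "ArrL \<beta>"] by simp
  show "\<gamma> \<in> Arr D \<Longrightarrow> j \<in> Obj J \<Longrightarrow> u \<in> FO P (Cod D \<gamma>, j) \<Longrightarrow>
      FA Z (Het (Cod D \<gamma>) u j) \<cdot>\<^bsub>E\<^esub> FA Z (ArrR \<gamma>) = FA Z (Het (Dom D \<gamma>) (act \<gamma> (Ident J j) u) j)"
    using Z.FA_comp[of "ArrR \<gamma>" "Het (Cod D \<gamma>) u j"] by simp
qed

text \<open>Functoriality of \<open>Z\<close> on the two kinds of composites with a
  \<open>Het\<close> is what is used: composites with \<open>ArrL\<close> make the maps out of
  \<open>i\<close> a cone, composites with \<open>ArrR\<close> give naturality in
  \<open>i\<close>.\<close>

lemma collage_match: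
  assumes Z: "Z \<in> Obj (Fun I E)"
  shows "\<mu> Z \<in> hom (Fun D E) (Z \<bullet> inr) (match_ob D J P (Z \<bullet> inl))"
    and "\<And>i j u. i \<in> Obj D \<Longrightarrow> j \<in> Obj J \<Longrightarrow> u \<in> FO P (i, j) \<Longrightarrow>
      leg (Z \<bullet> inl) i j u \<cdot>\<^bsub>E\<^esub> At (\<mu> Z) i = FA Z (Het i u j)"
proof -
  interpret Z: functor_on I E Z using Z by unfold_locales
  let ?X = "Z \<bullet> inl"
  have X: "?X \<in> Obj (Fun J E)" using Z by simp
  let ?l = "\<lambda>i. \<lambda>(j, u). FA Z (Het i u j)"
  define c where "c i = lim_lift (match_diag D J P ?X i) (FO Z (Inr i)) (?l i)" for i
  have c: "c i \<in> Arr E" "Dom E (c i) = FO Z (Inr i)" "Cod E (c i) = mob ?X i"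
    "\<And>j u. j \<in> Obj J \<Longrightarrow> u \<in> FO P (i, j) \<Longrightarrow> leg ?X i j u \<cdot>\<^bsub>E\<^esub> c i = FA Z (Het i u j)"
    if i: "i \<in> Obj D" for i
  proof -
    have n: "FA ?X \<beta> \<cdot>\<^bsub>E\<^esub> ?l i (Dom J \<beta>, u) = ?l i (Cod J \<beta>, act (Ident D i) \<beta> u)"
      if b: "\<beta> \<in> Arr J" "u \<in> FO P (i, Dom J \<beta>)" for \<beta> u
      using FA_Het_comp(1)[OF Z i b] b by simp
    have "FO Z (Inr i) \<in> Obj E" using i by simp
    note m = mob_lift[OF X i this, of "?l i", OF _ n, folded c_def]
    show "c i \<in> Arr E" "Dom E (c i) = FO Z (Inr i)" "Cod E (c i) = mob ?X i"
      "\<And>j u. j \<in> Obj J \<Longrightarrow> u \<in> FO P (i, j) \<Longrightarrow> leg ?X i j u \<cdot>\<^bsub>E\<^esub> c i = FA Z (Het i u j)"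
      using i by (subst m; simp add: hom_iff)+
  qed
  have mu: "\<mu> Z = \<lparr>NDom = Z \<bullet> inr, NCod = match_ob D J P ?X, At = restrict c (Obj D)\<rparr>"
    by (simp add: collage_match_def c_def[abs_def] restrict_def cong: if_cong)
  show "\<mu> Z \<in> hom (Fun D E) (Z \<bullet> inr) (match_ob D J P ?X)" unfolding mu
  proof (rule Fun_homI)
    fix \<gamma> assume g: "\<gamma> \<in> Arr D"
    note [simp] = g
    have i: "Cod D \<gamma> \<in> Obj D" "Dom D \<gamma> \<in> Obj D" by simp_all
    note M = match_ob_FA[OF X g]
    note [simp] = M(1-3) c(1-3)
    have "leg ?X (Cod D \<gamma>) j u \<cdot>\<^bsub>E\<^esub> c (Cod D \<gamma>) \<cdot>\<^bsub>E\<^esub> FA Z (ArrR \<gamma>)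
        = leg ?X (Cod D \<gamma>) j u \<cdot>\<^bsub>E\<^esub> FA (match_ob D J P ?X) \<gamma> \<cdot>\<^bsub>E\<^esub> c (Dom D \<gamma>)"
      if ju: "j \<in> Obj J" "u \<in> FO P (Cod D \<gamma>, j)" for j u
    proof -
      note [simp] = ju leg_arr[OF X i(1) ju]
      have a: "act \<gamma> (Ident J j) u \<in> FO P (Dom D \<gamma>, j)" using act_in[of \<gamma> "Ident J j" u] by simp
      show ?thesis
        using E.comp_ext[OF c(4)[OF i(1) ju], of "FA Z (ArrR \<gamma>)"] FA_Het_comp(2)[OF Z g ju]
          E.comp_ext[OF M(4)[OF ju], of "c (Dom D \<gamma>)"] c(4)[OF i(2) ju(1) a] by simp
    qed
    then have "c (Cod D \<gamma>) \<cdot>\<^bsub>E\<^esub> FA Z (ArrR \<gamma>) = FA (match_ob D J P ?X) \<gamma> \<cdot>\<^bsub>E\<^esub> c (Dom D \<gamma>)"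
      by (rule_tac mob_eqI[OF X i(1)]) simp_all
    then show "c (Cod D \<gamma>) \<cdot>\<^bsub>E\<^esub> FA (Z \<bullet> inr) \<gamma> = FA (match_ob D J P ?X) \<gamma> \<cdot>\<^bsub>E\<^esub> c (Dom D \<gamma>)" by simp
  qed (use Z in \<open>simp_all add: match_ob_in[OF X] hom_iff c\<close>)
  show "leg ?X i j u \<cdot>\<^bsub>E\<^esub> At (\<mu> Z) i = FA Z (Het i u j)" if "i \<in> Obj D" "j \<in> Obj J" "u \<in> FO P (i, j)" for i j u
    unfolding mu using that c(4) by simp
qed

lemma collage_match_arr [simp]:
  assumes "Z \<in> Obj (Fun I E)"
  shows "\<mu> Z \<in> Arr (Fun D E)" "Dom (Fun D E) (\<mu> Z) = Z \<bullet> inr" "Cod (Fun D E) (\<mu> Z) = match_ob D J P (Z \<bullet> inl)"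
  using homD[OF collage_match(1)[OF assms]] by simp_all

text \<open>Compared on the legs, this is naturality of \<open>\<tau>\<close> at the arrows
  \<open>Het i u j\<close>.\<close>

lemma collage_match_nat:
  assumes t: "\<tau> \<in> Arr (Fun I E)"
  shows "FA MF (whisk \<tau> inl) \<cdot>\<^bsub>Fun D E\<^esub> \<mu> (Dom (Fun I E) \<tau>) = \<mu> (Cod (Fun I E) \<tau>) \<cdot>\<^bsub>Fun D E\<^esub> whisk \<tau> inr"
proof (rule D.Fun_eqI)
  let ?X = "Dom (Fun I E) \<tau>" and ?Y = "Cod (Fun I E) \<tau>"
  note [simp] = t
  have XY: "?X \<in> Obj (Fun I E)" "?Y \<in> Obj (Fun I E)" by simp_all
  then have XYJ: "?X \<bullet> inl \<in> Obj (Fun J E)" "?Y \<bullet> inl \<in> Obj (Fun J E)" by simp_all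
  fix i assume i: "i \<in> Obj D"
  note [simp] = i leg_arr[OF XYJ(1) i] leg_arr[OF XYJ(2) i]
  have "leg (?Y \<bullet> inl) i j u \<cdot>\<^bsub>E\<^esub> At (FA MF (whisk \<tau> inl)) i \<cdot>\<^bsub>E\<^esub> At (\<mu> ?X) i
      = leg (?Y \<bullet> inl) i j u \<cdot>\<^bsub>E\<^esub> At (\<mu> ?Y) i \<cdot>\<^bsub>E\<^esub> At \<tau> (Inr i)" if ju: "j \<in> Obj J" "u \<in> FO P (i, j)" for j u
  proof -
    note [simp] = ju
    have 1: "leg (?Y \<bullet> inl) i j u \<cdot>\<^bsub>E\<^esub> At (FA MF (whisk \<tau> inl)) i = At \<tau> (Inl j) \<cdot>\<^bsub>E\<^esub> leg (?X \<bullet> inl) i j u"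
      using match_functor_arr(2)[of "whisk \<tau> inl" i j u] by simp
    show ?thesis
      using E.comp_ext2[OF 1, of "At (\<mu> ?X) i"] collage_match(2)[OF XY(1) i ju]
        E.comp_ext[OF collage_match(2)[OF XY(2) i ju], of "At \<tau> (Inr i)"] I.At_nat[OF t, of "Het i u j"] by simp
  qed
  then show "At (FA MF (whisk \<tau> inl) \<cdot>\<^bsub>Fun D E\<^esub> \<mu> ?X) i = At (\<mu> ?Y \<cdot>\<^bsub>Fun D E\<^esub> whisk \<tau> inr) i"
    by (rule_tac mob_eqI[OF XYJ(2) i]) simp_all
qed (use t in simp_all)

lemma collage_eqI:
  assumes "\<tau> \<in> Arr (Fun I E)" "\<sigma> \<in> Arr (Fun I E)" "Dom (Fun I E) \<sigma> = Dom (Fun I E) \<tau>"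
    "Cod (Fun I E) \<sigma> = Cod (Fun I E) \<tau>" "whisk \<tau> inl = whisk \<sigma> inl" "whisk \<tau> inr = whisk \<sigma> inr"
  shows "\<tau> = \<sigma>"
proof (rule I.Fun_eqI)
  fix x assume "x \<in> Obj I"
  then show "At \<tau> x = At \<sigma> x"
  proof (cases rule: collage_objE)
    case (1 j)
    then show ?thesis using arg_cong[OF assms(5), of "\<lambda>t. At t j"] by simp
  next
    case (2 i)
    then show ?thesis using arg_cong[OF assms(6), of "\<lambda>t. At t i"] by simp
  qed
qed (use assms in simp_all)

text \<open>Naturality at the arrows of \<open>J\<close> and of \<open>D\<close> comes from
  \<open>k\<close> and \<open>l\<close>. Naturality at \<open>Het i u j\<close> is the leg
  \<open>(j, u)\<close> of the equation \<open>kl\<close>.\<close>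

lemma collage_nat:
  assumes X: "X \<in> Obj (Fun I E)" and Y: "Y \<in> Obj (Fun I E)"
    and k: "k \<in> hom (Fun J E) (X \<bullet> inl) (Y \<bullet> inl)" and l: "l \<in> hom (Fun D E) (X \<bullet> inr) (Y \<bullet> inr)"
    and kl: "FA MF k \<cdot>\<^bsub>Fun D E\<^esub> \<mu> X = \<mu> Y \<cdot>\<^bsub>Fun D E\<^esub> l"
  shows "\<exists>t. t \<in> hom (Fun I E) X Y \<and> whisk t inl = k \<and> whisk t inr = l"
proof -
  interpret X: functor_on I E X using X by unfold_locales
  interpret Y: functor_on I E Y using Y by unfold_locales
  note [simp] = X Y homD[OF k] homD[OF l]
  define c where "c = case_sum (At k) (At l)"
  have [simp]: "c (Inl j) = At k j" "c (Inr i) = At l i" for i j by (simp_all add: c_def)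
  have XYJ: "X \<bullet> inl \<in> Obj (Fun J E)" "Y \<bullet> inl \<in> Obj (Fun J E)" by simp_all
  let ?t = "\<lparr>NDom = X, NCod = Y, At = restrict c (Obj I)\<rparr>"
  have t: "?t \<in> hom (Fun I E) X Y"
  proof (rule Fun_homI)
    show "c x \<in> hom E (FO X x) (FO Y x)" if "x \<in> Obj I" for x
      using that by (cases rule: collage_objE) (simp_all add: hom_iff)
    show "c (Cod I a) \<cdot>\<^bsub>E\<^esub> FA X a = FA Y a \<cdot>\<^bsub>E\<^esub> c (Dom I a)" if "a \<in> Arr I" for a
      using that
    proof (cases rule: collage_arrE)
      case (1 \<beta>)
      then show ?thesis using At_nat[of k \<beta>] by simp
    next
      case (2 \<gamma>)
      then show ?thesis using D.At_nat[of l \<gamma>] by simp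
    next
      case (3 i u j)
      note [simp] = 3 leg_arr[OF XYJ(1) 3(2-4)] leg_arr[OF XYJ(2) 3(2-4)]
      have kl': "At (FA MF k) i \<cdot>\<^bsub>E\<^esub> At (\<mu> X) i = At (\<mu> Y) i \<cdot>\<^bsub>E\<^esub> At l i"
        using arg_cong[OF kl, of "\<lambda>t. At t i"] by simp
      have 1: "leg (Y \<bullet> inl) i j u \<cdot>\<^bsub>E\<^esub> At (FA MF k) i = At k j \<cdot>\<^bsub>E\<^esub> leg (X \<bullet> inl) i j u"
        using match_functor_arr(2)[of k i j u] by simp
      have "FA Y (Het i u j) \<cdot>\<^bsub>E\<^esub> At l i = leg (Y \<bullet> inl) i j u \<cdot>\<^bsub>E\<^esub> At (\<mu> Y) i \<cdot>\<^bsub>E\<^esub> At l i"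
        using E.comp_ext[OF collage_match(2)[OF Y 3(2-4)], of "At l i"] by simp
      also have "\<dots> = At k j \<cdot>\<^bsub>E\<^esub> leg (X \<bullet> inl) i j u \<cdot>\<^bsub>E\<^esub> At (\<mu> X) i"
        using E.comp_ext2[OF 1, of "At (\<mu> X) i"] by (simp flip: kl')
      also have "\<dots> = At k j \<cdot>\<^bsub>E\<^esub> FA X (Het i u j)"
        using collage_match(2)[OF X 3(2-4)] by simp
      finally show ?thesis by simp
    qed
  qed (use X Y in simp_all)
  note [simp] = homD[OF t]
  have "whisk ?t inl = k" by (rule Fun_eqI) simp_all
  moreover have "whisk ?t inr = l" by (rule D.Fun_eqI) simp_all
  ultimately show ?thesis using t by blast
qed

text \<open>The arrow \<open>Het i u j\<close> is sent to the leg at \<open>(j, u)\<close> after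
  \<open>y\<close>. Composites with an \<open>ArrL\<close> are respected because the legs form a
  cone, those with an \<open>ArrR\<close> because \<open>y\<close> is natural. With
  \<open>collage_nat\<close>, this describes functors on the collage as pairs of functors joined by
  a map into the matching object.\<close>

lemma collage_ext:
  assumes X: "X \<in> Obj (Fun J E)" and Y: "Y \<in> Obj (Fun D E)" and y: "y \<in> hom (Fun D E) Y (match_ob D J P X)"
  shows "\<exists>Z. Z \<in> Obj (Fun I E) \<and> Z \<bullet> inl = X \<and> Z \<bullet> inr = Y \<and> \<mu> Z = y"
proof -
  interpret X: functor_on J E X using X by unfold_locales
  interpret Y: functor_on D E Y using Y by unfold_locales
  note [simp] = X Y homD[OF y]
  define fa where "fa a = (case a of ArrL \<beta> \<Rightarrow> FA X \<beta> | ArrR \<gamma> \<Rightarrow> FA Y \<gamma> | Het i u j \<Rightarrow> leg X i j u \<cdot>\<^bsub>E\<^esub> At y i)" for a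
  have fa [simp]: "fa (ArrL \<beta>) = FA X \<beta>" "fa (ArrR \<gamma>) = FA Y \<gamma>" "fa (Het i u j) = leg X i j u \<cdot>\<^bsub>E\<^esub> At y i" for \<beta> \<gamma> i u j
    by (simp_all add: fa_def)
  define Z where "Z = \<lparr>Src = I, Tgt = E, FO = restrict (case_sum (FO X) (FO Y)) (Obj I), FA = restrict fa (Arr I)\<rparr>"
  have ZO: "j \<in> Obj J \<Longrightarrow> FO Z (Inl j) = FO X j" "i \<in> Obj D \<Longrightarrow> FO Z (Inr i) = FO Y i" for i j by (simp_all add: Z_def)
  have ZA: "FA Z a = fa a" if "a \<in> Arr I" for a using that by (simp add: Z_def)
  have Zin: "Z \<in> Obj (Fun I E)"
  proof (rule functor_onI)
    show "FO Z x \<in> Obj E" if "x \<in> Obj I" for x using that by (cases rule: collage_objE) (simp_all add: ZO)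
    show "FA Z a \<in> hom E (FO Z (Dom I a)) (FO Z (Cod I a))" if "a \<in> Arr I" for a
      using that by (cases rule: collage_arrE) (simp_all add: ZO ZA hom_iff leg_arr[OF X])
    show "FA Z (Ident I x) = Ident E (FO Z x)" if "x \<in> Obj I" for x
      using that by (cases rule: collage_objE) (simp_all add: ZO ZA)
    show "FA Z (b \<cdot>\<^bsub>I\<^esub> a) = FA Z b \<cdot>\<^bsub>E\<^esub> FA Z a" if a: "a \<in> Arr I" and b: "b \<in> Arr I" and c: "Cod I a = Dom I b" for a b
    proof -
      have ba: "b \<cdot>\<^bsub>I\<^esub> a \<in> Arr I" using a b c by (rule category.comp_arr(1)[OF category_collage])
      have "fa (b \<cdot>\<^bsub>I\<^esub> a) = fa b \<cdot>\<^bsub>E\<^esub> fa a" using a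
      proof (cases rule: collage_arrE)
        case (1 \<beta>)
        show ?thesis using b by (cases rule: collage_arrE) (use 1 c in \<open>simp_all add: X.FA_comp\<close>)
      next
        case (2 \<gamma>)
        show ?thesis using b
        proof (cases rule: collage_arrE)
          case (2 \<delta>)
          then show ?thesis using \<open>a = ArrR \<gamma>\<close> \<open>\<gamma> \<in> Arr D\<close> c by (simp add: Y.FA_comp)
        next
          case (3 i u j)
          then have i: "i = Cod D \<gamma>" and u: "u \<in> FO P (Cod D \<gamma>, j)" using c 2 by simp_all
          note [simp] = 2 match_ob_FA(1-3)[OF X 2(2)] leg_arr[OF X _ 3(3) u]
          have "At y (Cod D \<gamma>) \<cdot>\<^bsub>E\<^esub> FA Y \<gamma> = FA (match_ob D J P X) \<gamma> \<cdot>\<^bsub>E\<^esub> At y (Dom D \<gamma>)"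
            using D.At_nat[of y \<gamma>] by simp
          then show ?thesis using 3 i
            E.comp_ext[OF match_ob_FA(4)[OF X 2(2) 3(3) u], of "At y (Dom D \<gamma>)"] by simp
        qed (use 2 c in simp)
      next
        case (3 i u j)
        show ?thesis using b
        proof (cases rule: collage_arrE)
          case (1 \<beta>)
          then have j: "j = Dom J \<beta>" and u: "u \<in> FO P (i, Dom J \<beta>)" using c 3 by simp_all
          have o: "Dom J \<beta> \<in> Obj J" using 1 by simp
          note [simp] = leg_arr[OF X 3(2) o u]
          show ?thesis using 1 3(1,2) j E.comp_ext[OF leg_nat[OF X 3(2) 1(2) u], of "At y i"] by simp
        qed (use 3 c in simp_all)
      qed
      then show ?thesis using ba a b by (simp only: ZA)
    qed
  qed (simp_all add: Z_def category_collage E.category_axioms)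
  have ZX: "Z \<bullet> inl = X" by (rule Fun_Obj_eqI[of _ J E]) (use Zin in \<open>simp_all add: ZO ZA\<close>)
  have ZY: "Z \<bullet> inr = Y" by (rule Fun_Obj_eqI[of _ D E]) (use Zin in \<open>simp_all add: ZO ZA\<close>)
  have "\<mu> Z = y"
  proof (rule D.Fun_eqI)
    fix i assume i: "i \<in> Obj D"
    show "At (\<mu> Z) i = At y i"
      by (rule mob_eqI[OF X i]) (use i Zin collage_match(2)[OF Zin i] in \<open>simp_all add: ZX ZY ZA\<close>)
  qed (use Zin in \<open>simp_all add: ZX ZY\<close>)
  then show ?thesis using Zin ZX ZY by blast
qed

end

section \<open>Gluing functors and transformations over a colimit of categories\<close>

locale colim_diagram =
  fixes D :: "('j, 'k, ('o, 'm) cat, ('o, 'm, 'o, 'm) func) func"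
  assumes D: "is_functor D" and DT: "Tgt D = CAT"
begin

lemma coproj_in: "j \<in> Obj (Src D) \<Longrightarrow> coproj D j \<in> Obj (Fun (FO D j) (colim D))"
  by (rule Fun_ObjI[OF is_functor_coproj[OF D DT]]) (simp_all add: coproj_def)

lemma coproj_sel [simp]:
  "Src (coproj D j) = FO D j" "Tgt (coproj D j) = colim D" "x \<in> Obj (FO D j) \<Longrightarrow> FO (coproj D j) x = colim_pt D j x"
  by (simp_all add: coproj_def)

lemma trans_in: "\<alpha> \<in> Arr (Src D) \<Longrightarrow> FA D \<alpha> \<in> Obj (Fun (FO D (Dom (Src D) \<alpha>)) (FO D (Cod (Src D) \<alpha>)))"
  using colim_trans[OF D DT] by (simp add: Fun_ObjI)

lemma colim_functor:
  fixes T :: "('p, 'q) cat"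
  assumes "category T" and c: "\<And>j. j \<in> Obj (Src D) \<Longrightarrow> c j \<in> Obj (Fun (FO D j) T)"
    and "\<And>\<alpha>. \<alpha> \<in> Arr (Src D) \<Longrightarrow> c (Cod (Src D) \<alpha>) \<bullet> FA D \<alpha> = c (Dom (Src D) \<alpha>)"
  shows "\<exists>U. U \<in> Obj (Fun (colim D) T) \<and> (\<forall>j\<in>Obj (Src D). U \<bullet> coproj D j = c j)"
proof -
  have "\<exists>!U. is_functor U \<and> Src U = colim D \<and> Tgt U = T \<and> (\<forall>j\<in>Obj (Src D). U \<bullet> coproj D j = c j)"
    by (rule colim_universal[OF D DT]) (use assms Fun_ObjD[OF c] in simp_all)
  then show ?thesis by (blast intro: Fun_ObjI)
qed

lemma colim_eqI:
  assumes "category E" and t: "\<tau> \<in> hom (Fun (colim D) E) X Y" "\<sigma> \<in> hom (Fun (colim D) E) X Y"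
    and eq: "\<And>j. j \<in> Obj (Src D) \<Longrightarrow> whisk \<tau> (coproj D j) = whisk \<sigma> (coproj D j)"
  shows "\<tau> = \<sigma>"
proof (rule Fun_hom_eqI[OF t])
  fix v assume "v \<in> Obj (colim D)"
  then obtain j x where "j \<in> Obj (Src D)" "x \<in> Obj (FO D j)" "v = colim_pt D j x"
    by (auto simp: colim_simps[OF D DT] colim_pts_def)
  then show "At \<tau> v = At \<sigma> v" using arg_cong[OF eq, of j "\<lambda>t. At t x"] by (simp add: whisk_sel)
qed

text \<open>The two-dimensional part of the universal property, which \<open>colim_universal\<close>
  does not state. The component at a class is read off a representative, and \<open>compat\<close>
  makes it independent of the choice. Naturality holds on single edges and extends to paths by
  induction.\<close>

lemma colim_nat:
  assumes E: "category E" and X: "X \<in> Obj (Fun (colim D) E)" and Y: "Y \<in> Obj (Fun (colim D) E)"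
    and k: "\<And>j. j \<in> Obj (Src D) \<Longrightarrow> k j \<in> hom (Fun (FO D j) E) (X \<bullet> coproj D j) (Y \<bullet> coproj D j)"
    and compat: "\<And>\<alpha>. \<alpha> \<in> Arr (Src D) \<Longrightarrow> whisk (k (Cod (Src D) \<alpha>)) (FA D \<alpha>) = k (Dom (Src D) \<alpha>)"
  shows "\<exists>\<tau>. \<tau> \<in> hom (Fun (colim D) E) X Y \<and> (\<forall>j\<in>Obj (Src D). whisk \<tau> (coproj D j) = k j)"
proof -
  interpret E: category E by (rule E)
  interpret X: functor_on "colim D" E X using X by unfold_locales
  interpret Y: functor_on "colim D" E Y using Y by unfold_locales
  interpret C: category "colim D" by (rule X.catJ)
  define c where "c v = (let (j, x) = SOME p. p \<in> v in At (k j) x)" for v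
  have rel: "At (k j) x = At (k j') x'"
    if "((j, x), (j', x')) \<in> (colim_pt_rel D \<union> (colim_pt_rel D)\<inverse>)\<^sup>*" for j x j' x'
  proof -
    have "At (k (Cod (Src D) \<alpha>)) (FO (FA D \<alpha>) x) = At (k (Dom (Src D) \<alpha>)) x"
      if "\<alpha> \<in> Arr (Src D)" "x \<in> Obj (FO D (Dom (Src D) \<alpha>))" for \<alpha> x
      using arg_cong[OF compat[OF that(1)], of "\<lambda>t. At t x"] colim_trans[OF D DT that(1)] that(2) by (simp add: whisk_sel)
    note step = this
    show ?thesis using that by (induction rule: rtrancl_induct2) (auto simp: colim_pt_rel_def step)
  qed
  have c: "c (colim_pt D j x) = At (k j) x" for j x
  proof -
    obtain j' x' where e: "(SOME p. p \<in> colim_pt D j x) = (j', x')" by (metis surj_pair)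
    have "(j, x) \<in> colim_pt D j x" by (auto simp: colim_pt_def)
    then have "(j', x') \<in> colim_pt D j x" using someI[of "\<lambda>p. p \<in> colim_pt D j x"] e by metis
    then show ?thesis using rel[of j x j' x'] by (simp add: c_def e) (auto simp: colim_pt_def)
  qed
  have kA: "At (k j) x \<in> hom E (FO X (colim_pt D j x)) (FO Y (colim_pt D j x))"
    if "j \<in> Obj (Src D)" "x \<in> Obj (FO D j)" for j x
    using Fun_homD(6)[OF k[OF that(1)] that(2)] that by simp
  have pts: "Obj (colim D) = colim_pts D" by (rule colim_simps[OF D DT])
  have cA [simp]: "c v \<in> Arr E" "Dom E (c v) = FO X v" "Cod E (c v) = FO Y v" if "v \<in> Obj (colim D)" for v
    using that kA by (auto simp: pts colim_pts_def c hom_iff)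
  have nat: "colim_path D v es w \<Longrightarrow> c w \<cdot>\<^bsub>E\<^esub> FA X (colim_arr D v es w) = FA Y (colim_arr D v es w) \<cdot>\<^bsub>E\<^esub> c v" for v es w
  proof (induction es arbitrary: v)
    case Nil
    then have v: "v \<in> Obj (colim D)" "w = v" by (auto simp: pts)
    then show ?case using X.FA_ident[OF v(1)] Y.FA_ident[OF v(1)] by (simp add: colim_simps[OF D DT])
  next
    case (Cons p es)
    obtain j f where p: "p = (j, f)" by force
    from Cons.prems have j: "j \<in> Obj (Src D)" and f: "f \<in> Arr (FO D j)"
      and v: "v = colim_pt D j (Dom (FO D j) f)" and r: "colim_path D (colim_pt D j (Cod (FO D j) f)) es w"
      by (auto simp: p)
    let ?u = "colim_pt D j (Cod (FO D j) f)" and ?a = "colim_arr D v [(j, f)] (colim_pt D j (Cod (FO D j) f))"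
    let ?b = "colim_arr D ?u es w"
    have pf: "colim_path D v [(j, f)] ?u" using colim_path_single[OF D DT j f] by (simp add: v)
    note a = homD[OF colim_homI[OF D DT pf]] and b = homD[OF colim_homI[OF D DT r]]
    note [simp] = a b
    have [simp]: "v \<in> Obj (colim D)" "?u \<in> Obj (colim D)" "w \<in> Obj (colim D)"
      using C.dom_in[OF a(1)] C.cod_in[OF a(1)] C.cod_in[OF b(1)] by simp_all
    have fa: "FA (coproj D j) f = ?a" using f by (simp add: coproj_def v)
    have 1: "c ?u \<cdot>\<^bsub>E\<^esub> FA X ?a = FA Y ?a \<cdot>\<^bsub>E\<^esub> c v"
      using Fun_homD(7)[OF k[OF j] f] f by (simp add: c v[symmetric] fa) (simp add: v c)
    have ab: "colim_arr D v ((j, f) # es) w = ?b \<cdot>\<^bsub>colim D\<^esub> ?a"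
      using colim_comp[OF D DT pf r] by simp
    have "c w \<cdot>\<^bsub>E\<^esub> FA X ?b \<cdot>\<^bsub>E\<^esub> FA X ?a = FA Y ?b \<cdot>\<^bsub>E\<^esub> FA Y ?a \<cdot>\<^bsub>E\<^esub> c v"
      using E.comp_ext2[OF Cons.IH[OF r], of "FA X ?a"] 1 by simp
    then show ?case unfolding p ab by (simp add: X.FA_comp Y.FA_comp)
  qed
  let ?t = "\<lparr>NDom = X, NCod = Y, At = restrict c (Obj (colim D))\<rparr>"
  have t: "?t \<in> hom (Fun (colim D) E) X Y"
  proof (rule Fun_homI[OF X Y])
    show "c v \<in> hom E (FO X v) (FO Y v)" if "v \<in> Obj (colim D)" for v using that by (simp add: hom_iff)
    show "c (Cod (colim D) a) \<cdot>\<^bsub>E\<^esub> FA X a = FA Y a \<cdot>\<^bsub>E\<^esub> c (Dom (colim D) a)" if "a \<in> Arr (colim D)" for a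
      using that nat by (auto simp: colim_simps[OF D DT])
  qed
  moreover have "whisk ?t (coproj D j) = k j" if j: "j \<in> Obj (Src D)" for j
  proof -
    interpret K: restriction "FO D j" "colim D" E "coproj D j"
      using coproj_in[OF j] by unfold_locales
    show ?thesis
      by (rule Fun_hom_eqI[OF K.whisk_hom[OF t] k[OF j]])
        (simp add: c pts colim_pt_in[OF D DT j])
  qed
  ultimately show ?thesis by blast
qed

end

section \<open>Dependent products with pointwise pullbacks\<close>

text \<open>\<open>h\<close> in \<open>over_map\<close> is a map \<open>f\<^sup>*x \<rightarrow> g\<close> of the slice over \<open>B\<close>, and \<open>k\<close> in \<open>is_transpose\<close> its transpose
  \<open>x \<rightarrow> p\<close> over \<open>A\<close>; \<open>pre_dprod\<close> drops the universal property from \<open>dprod\<close>. All pullbacks are pointwise, so that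
  these predicates are stable under restriction on the nose.\<close>

definition pre_dprod where
  "pre_dprod J E f g p e \<longleftrightarrow> f \<in> Arr (Fun J E) \<and> g \<in> Arr (Fun J E) \<and> Cod (Fun J E) g = Dom (Fun J E) f
     \<and> p \<in> Arr (Fun J E) \<and> Cod (Fun J E) p = Cod (Fun J E) f
     \<and> e \<in> hom (Fun J E) (Dom (Fun J E) (ptpb1 J E f p)) (Dom (Fun J E) g) \<and> g \<cdot>\<^bsub>Fun J E\<^esub> e = ptpb1 J E f p"

definition over_map where
  "over_map J E f g x h \<longleftrightarrow> x \<in> Arr (Fun J E) \<and> Cod (Fun J E) x = Cod (Fun J E) f
     \<and> h \<in> hom (Fun J E) (Dom (Fun J E) (ptpb1 J E f x)) (Dom (Fun J E) g) \<and> g \<cdot>\<^bsub>Fun J E\<^esub> h = ptpb1 J E f x"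

definition base_map where
  "base_map J E f p x k = pb_lift (Fun J E) (ptpb1 J E f p) (ptpb2 J E f p) (ptpb1 J E f x) (k \<cdot>\<^bsub>Fun J E\<^esub> ptpb2 J E f x)"

definition is_transpose where
  "is_transpose J E f p e x h k \<longleftrightarrow> k \<in> hom (Fun J E) (Dom (Fun J E) x) (Dom (Fun J E) p) \<and> p \<cdot>\<^bsub>Fun J E\<^esub> k = x
     \<and> e \<cdot>\<^bsub>Fun J E\<^esub> base_map J E f p x k = h"

abbreviation ptdprod where
  "ptdprod J E f g p e \<equiv> dprod (Fun J E) f g p (ptpb1 J E f p) (ptpb2 J E f p) e"

lemma pre_dprodD:
  assumes "pre_dprod J E f g p e"
  shows "f \<in> Arr (Fun J E)" "g \<in> Arr (Fun J E)" "Cod (Fun J E) g = Dom (Fun J E) f"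
    "p \<in> Arr (Fun J E)" "Cod (Fun J E) p = Cod (Fun J E) f" "e \<in> Arr (Fun J E)"
    "Dom (Fun J E) e = Dom (Fun J E) (ptpb1 J E f p)" "Cod (Fun J E) e = Dom (Fun J E) g"
    "g \<cdot>\<^bsub>Fun J E\<^esub> e = ptpb1 J E f p"
  using assms by (simp_all add: pre_dprod_def hom_iff)

lemma over_mapD:
  assumes "over_map J E f g x h"
  shows "x \<in> Arr (Fun J E)" "Cod (Fun J E) x = Cod (Fun J E) f" "h \<in> Arr (Fun J E)"
    "Dom (Fun J E) h = Dom (Fun J E) (ptpb1 J E f x)" "Cod (Fun J E) h = Dom (Fun J E) g"
    "g \<cdot>\<^bsub>Fun J E\<^esub> h = ptpb1 J E f x"
  using assms by (simp_all add: over_map_def hom_iff)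

lemma is_transposeD:
  assumes "is_transpose J E f p e x h k"
  shows "k \<in> Arr (Fun J E)" "Dom (Fun J E) k = Dom (Fun J E) x" "Cod (Fun J E) k = Dom (Fun J E) p"
    "p \<cdot>\<^bsub>Fun J E\<^esub> k = x" "e \<cdot>\<^bsub>Fun J E\<^esub> base_map J E f p x k = h"
  using assms by (simp_all add: is_transpose_def hom_iff)

context functor_category_pb
begin

text \<open>One square for each \<open>x\<close> suffices by \<open>dprodI\<close>, so the universal
  property may be tested on pointwise squares only. In this form every ingredient restricts
  strictly.\<close>

lemma ptdprod_iff:
  assumes c: "pre_dprod J E f g p e"
  shows "ptdprod J E f g p e \<longleftrightarrow> (\<forall>x h. over_map J E f g x h \<longrightarrow> (\<exists>!k. is_transpose J E f p e x h k))"
proof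
  assume d: "ptdprod J E f g p e"
  show "\<forall>x h. over_map J E f g x h \<longrightarrow> (\<exists>!k. is_transpose J E f p e x h k)"
  proof (intro allI impI)
    fix x h assume "over_map J E f g x h"
    note p = over_mapD[OF this]
    show "\<exists>!k. is_transpose J E f p e x h k" unfolding is_transpose_def base_map_def
      by (rule dprod_ex1[OF d ptpb]) (use p pre_dprodD[OF c] in \<open>simp_all add: hom_iff\<close>)
  qed
next
  assume R: "\<forall>x h. over_map J E f g x h \<longrightarrow> (\<exists>!k. is_transpose J E f p e x h k)"
  note C = pre_dprodD[OF c]
  show "ptdprod J E f g p e"
  proof (rule F.dprodI)
    fix x assume x: "x \<in> Arr (Fun J E)" "Cod (Fun J E) x = Cod (Fun J E) f"
    show "\<exists>y1 y2. is_pullback (Fun J E) f x y1 y2 \<and>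
        (\<forall>h. h \<in> hom (Fun J E) (Dom (Fun J E) y1) (Dom (Fun J E) g) \<longrightarrow> g \<cdot>\<^bsub>Fun J E\<^esub> h = y1 \<longrightarrow>
          (\<exists>!k. k \<in> hom (Fun J E) (Dom (Fun J E) x) (Dom (Fun J E) p) \<and> p \<cdot>\<^bsub>Fun J E\<^esub> k = x \<and>
            e \<cdot>\<^bsub>Fun J E\<^esub> pb_lift (Fun J E) (ptpb1 J E f p) (ptpb2 J E f p) y1 (k \<cdot>\<^bsub>Fun J E\<^esub> y2) = h))"
      by (rule exI[of _ "ptpb1 J E f x"], rule exI[of _ "ptpb2 J E f x"])
        (use R x C in \<open>simp add: ptpb over_map_def is_transpose_def base_map_def\<close>)
  qed (use C in \<open>simp_all add: ptpb\<close>)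
qed

lemma base_map:
  assumes f: "f \<in> Arr (Fun J E)" and p: "p \<in> Arr (Fun J E)" "Cod (Fun J E) p = Cod (Fun J E) f"
    and x: "x \<in> Arr (Fun J E)" "Cod (Fun J E) x = Cod (Fun J E) f"
    and k: "k \<in> Arr (Fun J E)" "Dom (Fun J E) k = Dom (Fun J E) x" "Cod (Fun J E) k = Dom (Fun J E) p"
      "p \<cdot>\<^bsub>Fun J E\<^esub> k = x"
  shows "base_map J E f p x k \<in> Arr (Fun J E)" "Dom (Fun J E) (base_map J E f p x k) = Dom (Fun J E) (ptpb1 J E f x)"
    "Cod (Fun J E) (base_map J E f p x k) = Dom (Fun J E) (ptpb1 J E f p)"
    "ptpb1 J E f p \<cdot>\<^bsub>Fun J E\<^esub> base_map J E f p x k = ptpb1 J E f x"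
    "ptpb2 J E f p \<cdot>\<^bsub>Fun J E\<^esub> base_map J E f p x k = k \<cdot>\<^bsub>Fun J E\<^esub> ptpb2 J E f x"
  unfolding base_map_def using F.pb_map[OF ptpb[OF f p] ptpb[OF f x] k] by simp_all

lemma ptpb_simps [simp]:
  assumes "f \<in> Arr (Fun J E)" "p \<in> Arr (Fun J E)" "Cod (Fun J E) p = Cod (Fun J E) f"
  shows "ptpb1 J E f p \<in> Arr (Fun J E)" "ptpb2 J E f p \<in> Arr (Fun J E)"
    "Dom (Fun J E) (ptpb2 J E f p) = Dom (Fun J E) (ptpb1 J E f p)"
    "Cod (Fun J E) (ptpb1 J E f p) = Dom (Fun J E) f" "Cod (Fun J E) (ptpb2 J E f p) = Dom (Fun J E) p"
  using pbD(4-8)[OF ptpb[OF assms]] by simp_all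

end

context restriction_pb
begin

lemma whisk_base_map:
  assumes f: "f \<in> Arr (Fun J E)" and p: "p \<in> Arr (Fun J E)" "Cod (Fun J E) p = Cod (Fun J E) f"
    and x: "x \<in> Arr (Fun J E)" "Cod (Fun J E) x = Cod (Fun J E) f"
    and k: "k \<in> Arr (Fun J E)" "Dom (Fun J E) k = Dom (Fun J E) x" "Cod (Fun J E) k = Dom (Fun J E) p"
      "p \<cdot>\<^bsub>Fun J E\<^esub> k = x"
  shows "whisk (base_map J E f p x k) K = base_map I E (whisk f K) (whisk p K) (whisk x K) (whisk k K)"
proof -
  note [simp] = f p x k(1-3)
  note c = J.F.pb_map_commute[OF J.ptpb[OF f p] J.ptpb[OF f x] k]
  show ?thesis unfolding base_map_def
    by (simp add: whisk_ptpb whisk_pb_lift[OF J.ptpb[OF f p] _ _ _ _ _ c] whisk_comp)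
qed

lemma pre_dprod_whisk:
  assumes "pre_dprod J E f g p e"
  shows "pre_dprod I E (whisk f K) (whisk g K) (whisk p K) (whisk e K)"
proof -
  note [simp] = pre_dprodD(1-8)[OF assms]
  show ?thesis unfolding pre_dprod_def
    by (simp add: whisk_ptpb hom_iff) (simp flip: whisk_comp add: pre_dprodD(9)[OF assms])
qed

lemma over_map_whisk:
  assumes "over_map J E f g x h" and [simp]: "f \<in> Arr (Fun J E)" "g \<in> Arr (Fun J E)"
  shows "over_map I E (whisk f K) (whisk g K) (whisk x K) (whisk h K)"
proof -
  note [simp] = over_mapD(1-5)[OF assms(1)]
  show ?thesis unfolding over_map_def
    by (simp add: whisk_ptpb hom_iff) (simp flip: whisk_comp add: over_mapD(6)[OF assms(1)])
qed

text \<open>Along an arbitrary \<open>K\<close> only the defining equations of a transpose are shown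
  to restrict. Together with uniqueness over the pieces this is what makes separately found
  transposes agree.\<close>

lemma is_transpose_whisk:
  assumes c: "pre_dprod J E f g p e" and p: "over_map J E f g x h" and s: "is_transpose J E f p e x h k"
  shows "is_transpose I E (whisk f K) (whisk p K) (whisk e K) (whisk x K) (whisk h K) (whisk k K)"
proof -
  note C = pre_dprodD[OF c] and P = over_mapD[OF p] and S = is_transposeD[OF s]
  note L = J.base_map[OF C(1,4,5) P(1,2) S(1-4)]
  note [simp] = C(1-8) P(1-5) S(1-3) L(1-3)
  have "whisk p K \<cdot>\<^bsub>Fun I E\<^esub> whisk k K = whisk x K" by (simp flip: whisk_comp add: S(4))
  moreover have "whisk e K \<cdot>\<^bsub>Fun I E\<^esub> whisk (base_map J E f p x k) K = whisk h K" by (simp flip: whisk_comp add: S(5))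
  ultimately show ?thesis using whisk_base_map[OF C(1,4,5) P(1,2) S(1-4)] by (simp add: is_transpose_def hom_iff)
qed

end

text \<open>Meant for \<open>Glue G n\<close>, which identifies the collage with
  \<open>\<I>\<^sub>n\<close> only up to isomorphism. A problem is restricted along
  \<open>K\<close>, solved there, and its solution is brought back along \<open>K'\<close>.\<close>

lemma ptdprod_iso:
  assumes K: "K \<in> Obj (Fun I J)" and K': "K' \<in> Obj (Fun J I)" and KK': "K \<bullet> K' = id_func J" "K' \<bullet> K = id_func I"
    and E: "category E" "has_pullbacks E" and c: "pre_dprod J E f g p e"
    and d: "ptdprod I E (whisk f K) (whisk g K) (whisk p K) (whisk e K)"
  shows "ptdprod J E f g p e"
proof -
  interpret E: category E by (rule E)
  interpret K: restriction_pb I J E K using K E by unfold_locales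
  interpret K': restriction_pb J I E K' using K' E by unfold_locales
  note C = pre_dprodD[OF c]
  note wc = K.pre_dprod_whisk[OF c]
  have whisk_back: "whisk (whisk \<tau> K) K' = \<tau>" if "\<tau> \<in> Arr (Fun J E)" for \<tau>
    using whisk_whisk[OF K K' that] whisk_id_func[OF that] by (simp add: KK')
  show ?thesis unfolding K.J.ptdprod_iff[OF c]
  proof (intro allI impI)
    fix x h assume p: "over_map J E f g x h"
    note wp = K.over_map_whisk[OF p C(1,2)] and P = over_mapD[OF p]
    have ex: "\<exists>!k. is_transpose I E (whisk f K) (whisk p K) (whisk e K) (whisk x K) (whisk h K) k"
      using d wp unfolding K.I.ptdprod_iff[OF wc] by blast
    then obtain k where k: "is_transpose I E (whisk f K) (whisk p K) (whisk e K) (whisk x K) (whisk h K) k" by blast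
    show "\<exists>!k. is_transpose J E f p e x h k"
    proof (rule ex1I)
      show "is_transpose J E f p e x h (whisk k K')"
        using K'.is_transpose_whisk[OF wc wp k] C P by (simp add: whisk_back)
      fix l assume l: "is_transpose J E f p e x h l"
      have "whisk l K = k" using ex K.is_transpose_whisk[OF c p l] k by blast
      then show "l = whisk k K'" using whisk_back[OF is_transposeD(1)[OF l]] by simp
    qed
  qed
qed

locale colim_restriction = colim_diagram D + E: category E
  for D :: "('j, 'k, ('o, 'm) cat, ('o, 'm, 'o, 'm) func) func" and E :: "('e, 'f) cat" +
  assumes pbs: "has_pullbacks E"
begin

lemma coproj_restriction: "j \<in> Obj (Src D) \<Longrightarrow> restriction_pb (FO D j) (colim D) E (coproj D j)"
  using coproj_in pbs E.category_axioms
  by (simp add: restriction_pb_def restriction_pb_axioms_def restriction_def functor_on_def)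

lemma whisk_trans:
  assumes a: "\<alpha> \<in> Arr (Src D)" and t: "\<tau> \<in> Arr (Fun (colim D) E)"
  shows "whisk (whisk \<tau> (coproj D (Cod (Src D) \<alpha>))) (FA D \<alpha>) = whisk \<tau> (coproj D (Dom (Src D) \<alpha>))"
  using whisk_whisk[OF coproj_in trans_in[OF a] t] colim_trans[OF D DT a] coproj_cocone[OF D DT a] by simp

lemma colim_arr_eqI:
  assumes "\<tau> \<in> Arr (Fun (colim D) E)" "\<sigma> \<in> Arr (Fun (colim D) E)" "Dom (Fun (colim D) E) \<sigma> = Dom (Fun (colim D) E) \<tau>"
    "Cod (Fun (colim D) E) \<sigma> = Cod (Fun (colim D) E) \<tau>"
    "\<And>j. j \<in> Obj (Src D) \<Longrightarrow> whisk \<tau> (coproj D j) = whisk \<sigma> (coproj D j)"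
  shows "\<tau> = \<sigma>"
  by (rule colim_eqI[OF E.category_axioms, of _ "Dom (Fun (colim D) E) \<tau>" "Cod (Fun (colim D) E) \<tau>"])
    (use assms in \<open>simp_all add: hom_iff\<close>)

sublocale F: functor_category_pb "colim D" E
  using category_colim[OF D DT] pbs E.category_axioms
  by (simp add: functor_category_pb_def functor_category_def functor_category_pb_axioms_def)

text \<open>A dependent product over a colimit of categories is detected on the pieces: the transposes over the pieces
  are unique, hence compatible, hence glue.\<close>

lemma colim_ptdprod:
  assumes c: "pre_dprod (colim D) E f g p e"
    and d: "\<And>j. j \<in> Obj (Src D) \<Longrightarrow> ptdprod (FO D j) E (whisk f (coproj D j)) (whisk g (coproj D j))
      (whisk p (coproj D j)) (whisk e (coproj D j))"
  shows "ptdprod (colim D) E f g p e"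
  unfolding F.ptdprod_iff[OF c]
proof (intro allI impI)
  fix x h assume p: "over_map (colim D) E f g x h"
  note C = pre_dprodD[OF c] and P = over_mapD[OF p]
  note [simp] = C(1-8) P(1-5)
  let ?S = "\<lambda>j. is_transpose (FO D j) E (whisk f (coproj D j)) (whisk p (coproj D j)) (whisk e (coproj D j)) (whisk x (coproj D j)) (whisk h (coproj D j))"
  have ex: "\<exists>!k. ?S j k" if j: "j \<in> Obj (Src D)" for j
  proof -
    interpret R: restriction_pb "FO D j" "colim D" E "coproj D j" by (rule coproj_restriction[OF j])
    show ?thesis using d[OF j] R.over_map_whisk[OF p C(1,2)] unfolding R.I.ptdprod_iff[OF R.pre_dprod_whisk[OF c]] by blast
  qed
  define k where "k j = (THE k. ?S j k)" for j
  have k: "?S j (k j)" if "j \<in> Obj (Src D)" for j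
    using theI'[OF ex[OF that]] by (simp add: k_def)
  have compat: "whisk (k (Cod (Src D) \<alpha>)) (FA D \<alpha>) = k (Dom (Src D) \<alpha>)" if a: "\<alpha> \<in> Arr (Src D)" for \<alpha>
  proof -
    let ?i = "Dom (Src D) \<alpha>" and ?j = "Cod (Src D) \<alpha>"
    have ij: "?i \<in> Obj (Src D)" "?j \<in> Obj (Src D)" using colim_trans[OF D DT a] by simp_all
    interpret R: restriction_pb "FO D ?j" "colim D" E "coproj D ?j" by (rule coproj_restriction[OF ij(2)])
    interpret A: restriction_pb "FO D ?i" "FO D ?j" E "FA D \<alpha>"
      using trans_in[OF a] pbs by unfold_locales
    have "?S ?i (whisk (k ?j) (FA D \<alpha>))"
      using A.is_transpose_whisk[OF R.pre_dprod_whisk[OF c] R.over_map_whisk[OF p C(1,2)] k[OF ij(2)]]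
      by (simp add: whisk_trans[OF a])
    then show ?thesis using ex[OF ij(1)] k[OF ij(1)] by blast
  qed
  have khom: "k j \<in> hom (Fun (FO D j) E) (Dom (Fun (colim D) E) x \<bullet> coproj D j) (Dom (Fun (colim D) E) p \<bullet> coproj D j)"
    if j: "j \<in> Obj (Src D)" for j
  proof -
    interpret R: restriction_pb "FO D j" "colim D" E "coproj D j" by (rule coproj_restriction[OF j])
    show ?thesis using is_transposeD(1-3)[OF k[OF j]] by (simp add: hom_iff)
  qed
  have "\<exists>\<kappa>. \<kappa> \<in> hom (Fun (colim D) E) (Dom (Fun (colim D) E) x) (Dom (Fun (colim D) E) p)
      \<and> (\<forall>j\<in>Obj (Src D). whisk \<kappa> (coproj D j) = k j)"
    by (rule colim_nat[OF E.category_axioms _ _ khom compat]) simp_all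
  then obtain \<kappa> where kap: "\<kappa> \<in> hom (Fun (colim D) E) (Dom (Fun (colim D) E) x) (Dom (Fun (colim D) E) p)"
    and kapj: "\<And>j. j \<in> Obj (Src D) \<Longrightarrow> whisk \<kappa> (coproj D j) = k j" by blast
  note [simp] = homD[OF kap]
  have pk: "p \<cdot>\<^bsub>Fun (colim D) E\<^esub> \<kappa> = x"
  proof (rule colim_arr_eqI)
    fix j assume j: "j \<in> Obj (Src D)"
    interpret R: restriction_pb "FO D j" "colim D" E "coproj D j" by (rule coproj_restriction[OF j])
    show "whisk (p \<cdot>\<^bsub>Fun (colim D) E\<^esub> \<kappa>) (coproj D j) = whisk x (coproj D j)"
      using is_transposeD(4)[OF k[OF j]] by (simp add: R.whisk_comp kapj[OF j])
  qed simp_all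
  note L = F.base_map[OF C(1,4,5) P(1,2) homD[OF kap] pk]
  note [simp] = L(1-3)
  have "e \<cdot>\<^bsub>Fun (colim D) E\<^esub> base_map (colim D) E f p x \<kappa> = h"
  proof (rule colim_arr_eqI)
    fix j assume j: "j \<in> Obj (Src D)"
    interpret R: restriction_pb "FO D j" "colim D" E "coproj D j" by (rule coproj_restriction[OF j])
    show "whisk (e \<cdot>\<^bsub>Fun (colim D) E\<^esub> base_map (colim D) E f p x \<kappa>) (coproj D j) = whisk h (coproj D j)"
      using is_transposeD(5)[OF k[OF j]] by (simp add: R.whisk_comp R.whisk_base_map[OF C(1,4,5) P(1,2) homD[OF kap] pk] kapj[OF j])
  qed simp_all
  then have S: "is_transpose (colim D) E f p e x h \<kappa>" using kap pk by (simp add: is_transpose_def)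
  show "\<exists>!k. is_transpose (colim D) E f p e x h k"
  proof (rule ex1I[of _ \<kappa>])
    fix l assume l: "is_transpose (colim D) E f p e x h l"
    show "l = \<kappa>"
    proof (rule colim_arr_eqI)
      fix j assume j: "j \<in> Obj (Src D)"
      interpret R: restriction_pb "FO D j" "colim D" E "coproj D j" by (rule coproj_restriction[OF j])
      show "whisk l (coproj D j) = whisk \<kappa> (coproj D j)"
        using ex[OF j] R.is_transpose_whisk[OF c p l] R.is_transpose_whisk[OF c p S] by blast
    qed (use is_transposeD[OF l] in simp_all)
  qed (rule S)
qed

end

section \<open>Dependent products over a collage\<close>

context collage_limits
begin

text \<open>\<open>p\<close>, \<open>mP\<close> and \<open>e\<close> live over \<open>D\<close>,
  while \<open>pJ\<close> and \<open>eJ\<close> live over \<open>J\<close> and enter through the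
  matching functor. The two groups are separate arguments because the first is found before both are
  assembled into functors on the collage.\<close>

definition glued_collage where
  "glued_collage f g pJ eJ p mP e \<longleftrightarrow> glued (Fun D E) (whisk f inr) (whisk g inr) (\<mu> (Cod (Fun I E) f)) (\<mu> (Dom (Fun I E) f))
     (\<mu> (Dom (Fun I E) g)) (FA MF pJ) (FA MF (ptpb1 J E (whisk f inl) pJ)) (FA MF (ptpb2 J E (whisk f inl) pJ)) (FA MF eJ)
     p mP (ptpb1 D E (whisk f inr) p) (ptpb2 D E (whisk f inr) p) e"

lemma collage_matching_data:
  assumes f: "f \<in> Arr (Fun I E)" and g: "g \<in> Arr (Fun I E)" "Cod (Fun I E) g = Dom (Fun I E) f"
    and c: "pre_dprod J E (whisk f inl) (whisk g inl) pJ eJ"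
  shows "matching_data (Fun D E) (whisk f inr) (whisk g inr) (\<mu> (Cod (Fun I E) f)) (\<mu> (Dom (Fun I E) f))
     (\<mu> (Dom (Fun I E) g)) (FA MF (whisk f inl)) (FA MF (whisk g inl)) (FA MF pJ)
     (FA MF (ptpb1 J E (whisk f inl) pJ)) (FA MF (ptpb2 J E (whisk f inl) pJ)) (FA MF eJ)"
proof -
  note C = pre_dprodD[OF c]
  note [simp] = f g C(1-8)
  show ?thesis
  proof unfold_locales
    show "FA MF (whisk f inl) \<cdot>\<^bsub>Fun D E\<^esub> \<mu> (Dom (Fun I E) f) = \<mu> (Cod (Fun I E) f) \<cdot>\<^bsub>Fun D E\<^esub> whisk f inr"
      by (rule collage_match_nat) simp
    show "FA MF (whisk g inl) \<cdot>\<^bsub>Fun D E\<^esub> \<mu> (Dom (Fun I E) g) = \<mu> (Dom (Fun I E) f) \<cdot>\<^bsub>Fun D E\<^esub> whisk g inr"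
      using collage_match_nat[OF g(1)] by simp
    show "is_pullback (Fun D E) (FA MF (whisk f inl)) (FA MF pJ) (FA MF (ptpb1 J E (whisk f inl) pJ)) (FA MF (ptpb2 J E (whisk f inl) pJ))"
      by (rule match_pullback[OF ptpb]) simp_all
    show "FA MF (whisk g inl) \<cdot>\<^bsub>Fun D E\<^esub> FA MF eJ = FA MF (ptpb1 J E (whisk f inl) pJ)"
      using MF.FA_comp[of eJ "whisk g inl"] C(9) by simp
  qed simp_all
qed

text \<open>The extension step of the recursion. \<open>glued_exists\<close> provides the boundary
  part with its map \<open>mP\<close> into the matching object, which is just what
  \<open>collage_ext\<close> needs to form a functor. The equations contained in
  \<open>glued\<close> are the compatibilities by which \<open>collage_nat\<close> assembles
  \<open>p\<close> and \<open>e\<close>.\<close>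

lemma collage_step:
  assumes f: "f \<in> Arr (Fun I E)" and g: "g \<in> Arr (Fun I E)" "Cod (Fun I E) g = Dom (Fun I E) f"
    and c: "pre_dprod J E (whisk f inl) (whisk g inl) pJ eJ" and pw: "powerful (Fun D E) (whisk f inr)"
  shows "\<exists>p e. pre_dprod I E f g p e \<and> whisk p inl = pJ \<and> whisk e inl = eJ \<and>
    glued_collage f g pJ eJ (whisk p inr) (\<mu> (Dom (Fun I E) p)) (whisk e inr)"
proof -
  note C = pre_dprodD[OF c]
  note [simp] = f g C(1-8)
  interpret M: matching_data "Fun D E" "whisk f inr" "whisk g inr" "\<mu> (Cod (Fun I E) f)" "\<mu> (Dom (Fun I E) f)"
     "\<mu> (Dom (Fun I E) g)" "FA MF (whisk f inl)" "FA MF (whisk g inl)" "FA MF pJ"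
     "FA MF (ptpb1 J E (whisk f inl) pJ)" "FA MF (ptpb2 J E (whisk f inl) pJ)" "FA MF eJ"
    by (rule collage_matching_data[OF f g c])
  have "\<exists>p mP e. p \<in> Arr (Fun D E) \<and> Cod (Fun D E) p = Cod (Fun D E) (whisk f inr) \<and> glued_collage f g pJ eJ p mP e"
    unfolding glued_collage_def by (rule M.glued_exists[OF pw D.has_pullbacks_Fun D.ptpb]) simp_all
  then obtain pD mP eD where pD [simp]: "pD \<in> Arr (Fun D E)" "Cod (Fun D E) pD = Cod (Fun I E) f \<bullet> inr"
    and gl: "glued_collage f g pJ eJ pD mP eD" by auto
  note G = gluedD[OF gl[unfolded glued_collage_def]]
  have [simp]: "mP \<in> Arr (Fun D E)" "Dom (Fun D E) mP = Dom (Fun D E) pD" "Cod (Fun D E) mP = match_ob D J P (Dom (Fun J E) pJ)"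
    "eD \<in> Arr (Fun D E)" "Dom (Fun D E) eD = Dom (Fun D E) (ptpb1 D E (whisk f inr) pD)" "Cod (Fun D E) eD = Dom (Fun I E) g \<bullet> inr"
    using G by simp_all
  obtain Z where Z [simp]: "Z \<in> Obj (Fun I E)" "Z \<bullet> inl = Dom (Fun J E) pJ" "Z \<bullet> inr = Dom (Fun D E) pD" "\<mu> Z = mP"
    using collage_ext[of "Dom (Fun J E) pJ" "Dom (Fun D E) pD" mP] by (auto simp: hom_iff)
  have "\<exists>p. p \<in> hom (Fun I E) Z (Cod (Fun I E) f) \<and> whisk p inl = pJ \<and> whisk p inr = pD"
    by (rule collage_nat) (simp_all add: hom_iff G(4))
  then obtain p where p: "p \<in> hom (Fun I E) Z (Cod (Fun I E) f)" "whisk p inl = pJ" "whisk p inr = pD" by blast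
  note [simp] = homD[OF p(1)] p(2,3)
  let ?w1 = "ptpb1 I E f p" and ?w2 = "ptpb2 I E f p"
  let ?W = "Dom (Fun I E) ?w1"
  have w: "is_pullback (Fun I E) f p ?w1 ?w2" by (rule I.ptpb) simp_all
  have wJ: "whisk ?w1 inl = ptpb1 J E (whisk f inl) pJ" "whisk ?w2 inl = ptpb2 J E (whisk f inl) pJ"
    using L.whisk_ptpb[of f p] by simp_all
  have wD: "whisk ?w1 inr = ptpb1 D E (whisk f inr) pD" "whisk ?w2 inr = ptpb2 D E (whisk f inr) pD"
    using R.whisk_ptpb[of f p] by simp_all
  have WJ: "?W \<bullet> inl = Dom (Fun J E) (ptpb1 J E (whisk f inl) pJ)" unfolding wJ(1)[symmetric] by simp
  have WD: "?W \<bullet> inr = Dom (Fun D E) (ptpb1 D E (whisk f inr) pD)" unfolding wD(1)[symmetric] by simp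
  \<comment> \<open>The matching functor preserves the pullback, so the matching map of its apex is
    the map induced by the matching maps of the two factors. The last equation in
    \<open>gluedD\<close> thereby becomes the compatibility required for \<open>e\<close>.\<close>
  have muW: "pb_lift (Fun D E) (FA MF (ptpb1 J E (whisk f inl) pJ)) (FA MF (ptpb2 J E (whisk f inl) pJ))
     (\<mu> (Dom (Fun I E) f) \<cdot>\<^bsub>Fun D E\<^esub> ptpb1 D E (whisk f inr) pD) (mP \<cdot>\<^bsub>Fun D E\<^esub> ptpb2 D E (whisk f inr) pD) = \<mu> ?W"
    by (rule D.F.pb_lift_unique[OF M.w'])
      (use collage_match_nat[of ?w1] collage_match_nat[of ?w2] in \<open>simp_all add: wJ wD WJ\<close>)
  have "\<exists>e. e \<in> hom (Fun I E) ?W (Dom (Fun I E) g) \<and> whisk e inl = eJ \<and> whisk e inr = eD"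
  proof (rule collage_nat)
    show "FA MF eJ \<cdot>\<^bsub>Fun D E\<^esub> \<mu> ?W = \<mu> (Dom (Fun I E) g) \<cdot>\<^bsub>Fun D E\<^esub> eD"
      using G(10) by (simp add: muW)
  qed (simp_all add: hom_iff WJ WD)
  then obtain e where e: "e \<in> hom (Fun I E) ?W (Dom (Fun I E) g)" "whisk e inl = eJ" "whisk e inr = eD" by blast
  note [simp] = homD[OF e(1)] e(2,3)
  have "g \<cdot>\<^bsub>Fun I E\<^esub> e = ?w1"
    by (rule collage_eqI) (simp_all add: L.whisk_comp R.whisk_comp wJ wD C(9) G(9))
  then have "pre_dprod I E f g p e" by (simp add: pre_dprod_def hom_iff)
  then show ?thesis using gl by (intro exI[of _ p] exI[of _ e]) simp
qed

text \<open>Over \<open>\<I>\<^sub>n\<close> a transpose is found first over \<open>\<I>\<^bsub><n\<^esub>\<close> and then, by the relative universal property, over \<open>\<partial>\<I>\<^sub>n\<close>.\<close>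

lemma collage_ptdprod:
  assumes c: "pre_dprod I E f g p e"
    and d: "ptdprod J E (whisk f inl) (whisk g inl) (whisk p inl) (whisk e inl)"
    and gl: "glued_collage f g (whisk p inl) (whisk e inl) (whisk p inr) (\<mu> (Dom (Fun I E) p)) (whisk e inr)"
  shows "ptdprod I E f g p e"
  unfolding I.ptdprod_iff[OF c]
proof (intro allI impI)
  fix x h assume p: "over_map I E f g x h"
  note C = pre_dprodD[OF c] and P = over_mapD[OF p]
  note cJ = L.pre_dprod_whisk[OF c] and cD = R.pre_dprod_whisk[OF c]
  note pJ = L.over_map_whisk[OF p C(1,2)] and pD = R.over_map_whisk[OF p C(1,2)]
  note [simp] = C(1-8) P(1-5)
  interpret M: matching_data "Fun D E" "whisk f inr" "whisk g inr" "\<mu> (Cod (Fun I E) f)" "\<mu> (Dom (Fun I E) f)"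
     "\<mu> (Dom (Fun I E) g)" "FA MF (whisk f inl)" "FA MF (whisk g inl)" "FA MF (whisk p inl)"
     "FA MF (ptpb1 J E (whisk f inl) (whisk p inl))" "FA MF (ptpb2 J E (whisk f inl) (whisk p inl))" "FA MF (whisk e inl)"
    by (rule collage_matching_data[OF C(1-3) cJ])
  let ?X = "Dom (Fun I E) x" and ?P = "Dom (Fun I E) p" and ?W = "Dom (Fun I E) (ptpb1 I E f x)"
  have exJ: "\<exists>!k. is_transpose J E (whisk f inl) (whisk p inl) (whisk e inl) (whisk x inl) (whisk h inl) k"
    using d pJ unfolding ptdprod_iff[OF cJ] by blast
  then obtain kJ where kJ: "is_transpose J E (whisk f inl) (whisk p inl) (whisk e inl) (whisk x inl) (whisk h inl) kJ" by blast
  note S = is_transposeD[OF kJ]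
  have [simp]: "kJ \<in> Arr (Fun J E)" "Dom (Fun J E) kJ = ?X \<bullet> inl" "Cod (Fun J E) kJ = ?P \<bullet> inl" using S by simp_all
  \<comment> \<open>Naturality of the matching maps forces the composite of the boundary part of any
    transpose with the matching map of \<open>?P\<close> to be \<open>?q\<close>.\<close>
  let ?q = "FA MF kJ \<cdot>\<^bsub>Fun D E\<^esub> \<mu> ?X"
  have yD: "is_pullback (Fun D E) (whisk f inr) (whisk x inr) (ptpb1 D E (whisk f inr) (whisk x inr)) (ptpb2 D E (whisk f inr) (whisk x inr))"
    by (rule D.ptpb) simp_all
  have y1: "whisk (ptpb1 I E f x) inr = ptpb1 D E (whisk f inr) (whisk x inr)" "whisk (ptpb2 I E f x) inr = ptpb2 D E (whisk f inr) (whisk x inr)"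
    "whisk (ptpb1 I E f x) inl = ptpb1 J E (whisk f inl) (whisk x inl)" "whisk (ptpb2 I E f x) inl = ptpb2 J E (whisk f inl) (whisk x inl)"
    using R.whisk_ptpb[of f x] L.whisk_ptpb[of f x] by simp_all
  have WJ: "Dom (Fun J E) (ptpb1 J E (whisk f inl) (whisk x inl)) = ?W \<bullet> inl"
    "Dom (Fun D E) (ptpb1 D E (whisk f inr) (whisk x inr)) = ?W \<bullet> inr"
    unfolding y1[symmetric] by simp_all
  have [simp]: "Dom (Fun J E) (ptpb1 J E (whisk f inl) (whisk p inl)) = Dom (Fun I E) (ptpb1 I E f p) \<bullet> inl"
    using L.whisk_ptpb[of f p] by simp
  have a: "\<mu> (Cod (Fun I E) f) \<cdot>\<^bsub>Fun D E\<^esub> whisk x inr = FA MF (whisk p inl) \<cdot>\<^bsub>Fun D E\<^esub> ?q"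
    using collage_match_nat[of x] MF.FA_comp[of kJ "whisk p inl"] S(4)
      D.F.assoc'[of "\<mu> ?X" "FA MF kJ" "FA MF (whisk p inl)"] by simp
  have n1: "FA MF (ptpb1 J E (whisk f inl) (whisk x inl)) \<cdot>\<^bsub>Fun D E\<^esub> \<mu> ?W
      = \<mu> (Dom (Fun I E) f) \<cdot>\<^bsub>Fun D E\<^esub> ptpb1 D E (whisk f inr) (whisk x inr)"
    using collage_match_nat[of "ptpb1 I E f x"] by (simp add: y1)
  have n2: "FA MF (ptpb2 J E (whisk f inl) (whisk x inl)) \<cdot>\<^bsub>Fun D E\<^esub> \<mu> ?W = \<mu> ?X \<cdot>\<^bsub>Fun D E\<^esub> ptpb2 D E (whisk f inr) (whisk x inr)"
    using collage_match_nat[of "ptpb2 I E f x"] by (simp add: y1)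
  note Lf = base_map[OF pre_dprodD(1,4,5)[OF cJ] over_mapD(1,2)[OF pJ] S(1-4)]
  have [simp]: "base_map J E (whisk f inl) (whisk p inl) (whisk x inl) kJ \<in> Arr (Fun J E)"
    "Dom (Fun J E) (base_map J E (whisk f inl) (whisk p inl) (whisk x inl) kJ) = ?W \<bullet> inl"
    "Cod (Fun J E) (base_map J E (whisk f inl) (whisk p inl) (whisk x inl) kJ) = Dom (Fun J E) (ptpb1 J E (whisk f inl) (whisk p inl))"
    using Lf by (simp_all add: WJ)
  \<comment> \<open>The base change of \<open>kJ\<close>, taken to matching objects, is the lift
    that occurs in \<open>glued\<close>; so the evaluation equation over \<open>J\<close> supplies
    the compatibility of \<open>whisk h inr\<close>.\<close>
  have ml: "FA MF (base_map J E (whisk f inl) (whisk p inl) (whisk x inl) kJ) \<cdot>\<^bsub>Fun D E\<^esub> \<mu> ?W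
     = pb_lift (Fun D E) (FA MF (ptpb1 J E (whisk f inl) (whisk p inl))) (FA MF (ptpb2 J E (whisk f inl) (whisk p inl)))
      (\<mu> (Dom (Fun I E) f) \<cdot>\<^bsub>Fun D E\<^esub> ptpb1 D E (whisk f inr) (whisk x inr)) (?q \<cdot>\<^bsub>Fun D E\<^esub> ptpb2 D E (whisk f inr) (whisk x inr))"
  proof (rule D.F.pb_lift_unique[OF M.w', symmetric])
    let ?l = "base_map J E (whisk f inl) (whisk p inl) (whisk x inl) kJ"
    have "FA MF (ptpb1 J E (whisk f inl) (whisk p inl)) \<cdot>\<^bsub>Fun D E\<^esub> FA MF ?l = FA MF (ptpb1 J E (whisk f inl) (whisk x inl))"
      using MF.FA_comp[of ?l "ptpb1 J E (whisk f inl) (whisk p inl)"] Lf(4) by simp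
    from D.F.comp_ext[OF this, of "\<mu> ?W"] show "FA MF (ptpb1 J E (whisk f inl) (whisk p inl)) \<cdot>\<^bsub>Fun D E\<^esub> FA MF ?l \<cdot>\<^bsub>Fun D E\<^esub> \<mu> ?W
        = \<mu> (Dom (Fun I E) f) \<cdot>\<^bsub>Fun D E\<^esub> ptpb1 D E (whisk f inr) (whisk x inr)"
      by (simp add: n1)
    have "FA MF (ptpb2 J E (whisk f inl) (whisk p inl)) \<cdot>\<^bsub>Fun D E\<^esub> FA MF ?l = FA MF kJ \<cdot>\<^bsub>Fun D E\<^esub> FA MF (ptpb2 J E (whisk f inl) (whisk x inl))"
      using MF.FA_comp[of ?l "ptpb2 J E (whisk f inl) (whisk p inl)"] MF.FA_comp[of "ptpb2 J E (whisk f inl) (whisk x inl)" kJ] Lf(5)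
      by (simp add: WJ)
    from D.F.comp_ext2[OF this, of "\<mu> ?W"] show "FA MF (ptpb2 J E (whisk f inl) (whisk p inl)) \<cdot>\<^bsub>Fun D E\<^esub> FA MF ?l \<cdot>\<^bsub>Fun D E\<^esub> \<mu> ?W
        = ?q \<cdot>\<^bsub>Fun D E\<^esub> ptpb2 D E (whisk f inr) (whisk x inr)"
      by (simp add: n2 WJ)
  qed simp_all
  have s: "\<mu> (Dom (Fun I E) g) \<cdot>\<^bsub>Fun D E\<^esub> whisk h inr = FA MF (whisk e inl) \<cdot>\<^bsub>Fun D E\<^esub> pb_lift (Fun D E)
      (FA MF (ptpb1 J E (whisk f inl) (whisk p inl))) (FA MF (ptpb2 J E (whisk f inl) (whisk p inl)))
      (\<mu> (Dom (Fun I E) f) \<cdot>\<^bsub>Fun D E\<^esub> ptpb1 D E (whisk f inr) (whisk x inr)) (?q \<cdot>\<^bsub>Fun D E\<^esub> ptpb2 D E (whisk f inr) (whisk x inr))"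
    unfolding ml[symmetric]
    using collage_match_nat[of h] MF.FA_comp[of "base_map J E (whisk f inl) (whisk p inl) (whisk x inl) kJ" "whisk e inl"] S(5)
      D.F.assoc'[of "\<mu> ?W" "FA MF (base_map J E (whisk f inl) (whisk p inl) (whisk x inl) kJ)" "FA MF (whisk e inl)"]
    by simp
  have exD: "\<exists>!k. k \<in> hom (Fun D E) (Dom (Fun D E) (whisk x inr)) (Dom (Fun D E) (whisk p inr)) \<and> whisk p inr \<cdot>\<^bsub>Fun D E\<^esub> k = whisk x inr
      \<and> \<mu> ?P \<cdot>\<^bsub>Fun D E\<^esub> k = ?q \<and> whisk e inr \<cdot>\<^bsub>Fun D E\<^esub> pb_lift (Fun D E) (ptpb1 D E (whisk f inr) (whisk p inr))
        (ptpb2 D E (whisk f inr) (whisk p inr)) (ptpb1 D E (whisk f inr) (whisk x inr)) (k \<cdot>\<^bsub>Fun D E\<^esub> ptpb2 D E (whisk f inr) (whisk x inr)) = whisk h inr"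
    by (rule glued_ex1[OF gl[unfolded glued_collage_def] yD _ a _ _ s]) (use over_mapD(3-6)[OF pD] in \<open>simp_all add: hom_iff\<close>)
  then obtain kD where kD: "kD \<in> hom (Fun D E) (?X \<bullet> inr) (?P \<bullet> inr)" "\<mu> ?P \<cdot>\<^bsub>Fun D E\<^esub> kD = ?q"
    and kD': "is_transpose D E (whisk f inr) (whisk p inr) (whisk e inr) (whisk x inr) (whisk h inr) kD"
    unfolding is_transpose_def base_map_def by auto
  have "\<exists>k. k \<in> hom (Fun I E) ?X ?P \<and> whisk k inl = kJ \<and> whisk k inr = kD"
    by (rule collage_nat) (use kD in \<open>simp_all add: hom_iff\<close>)
  then obtain k where k: "k \<in> hom (Fun I E) ?X ?P" "whisk k inl = kJ" "whisk k inr = kD" by blast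
  note [simp] = homD[OF k(1)]
  have pk: "p \<cdot>\<^bsub>Fun I E\<^esub> k = x"
    by (rule collage_eqI) (simp_all add: L.whisk_comp R.whisk_comp k S(4) is_transposeD(4)[OF kD'])
  note Lk = I.base_map[OF C(1,4,5) P(1,2) homD[OF k(1)] pk]
  have "e \<cdot>\<^bsub>Fun I E\<^esub> base_map I E f p x k = h"
    by (rule collage_eqI) (simp_all add: Lk L.whisk_comp R.whisk_comp k S(5) is_transposeD(5)[OF kD']
      L.whisk_base_map[OF C(1,4,5) P(1,2) homD[OF k(1)] pk] R.whisk_base_map[OF C(1,4,5) P(1,2) homD[OF k(1)] pk])
  then have "is_transpose I E f p e x h k" using k pk by (simp add: is_transpose_def)
  then show "\<exists>!k. is_transpose I E f p e x h k"
  proof (rule ex1I)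
    fix l assume l: "is_transpose I E f p e x h l"
    note lh = is_transposeD(1-3)[OF l]
    have lJ: "whisk l inl = kJ" using exJ kJ L.is_transpose_whisk[OF c p l] by blast
    \<comment> \<open>Naturality of the matching maps shows that the boundary part of any competitor
      \<open>l\<close> solves the same relative problem as \<open>kD\<close>.\<close>
    have "\<mu> ?P \<cdot>\<^bsub>Fun D E\<^esub> whisk l inr = ?q" using collage_match_nat[of l] lh lJ by simp
    then have lD: "whisk l inr = kD"
      using exD R.is_transpose_whisk[OF c p l] kD' kD(2) unfolding is_transpose_def base_map_def by blast
    show "l = k" by (rule collage_eqI) (use lh lJ lD k in simp_all)
  qed
qed

end

section \<open>Dependent products on the iterated gluing category\<close>

lemma iso_functor_inverse:
  assumes "is_iso_functor F" and S: "Src F = C" "Tgt F = D"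
  shows "\<exists>F'. F' \<in> Obj (Fun D C) \<and> F \<bullet> F' = id_func D \<and> F' \<bullet> F = id_func C"
proof -
  have F: "F \<in> Obj (Fun C D)" and bO: "bij_betw (FO F) (Obj C) (Obj D)" and bA: "bij_betw (FA F) (Arr C) (Arr D)"
    using assms by (auto simp: is_iso_functor_def intro: Fun_ObjI)
  interpret F: functor_on C D F using F by unfold_locales
  interpret C: category C by (rule F.catJ)
  interpret D: category D by (rule F.catE)
  define F' where "F' = \<lparr>Src = D, Tgt = C, FO = restrict (inv_into (Obj C) (FO F)) (Obj D),
    FA = restrict (inv_into (Arr C) (FA F)) (Arr D)\<rparr>"
  have O: "FO F' y \<in> Obj C" "FO F (FO F' y) = y" if "y \<in> Obj D" for y
    using that bij_betw_inv_into_right[OF bO that] bO inv_into_into[of y "FO F" "Obj C"] by (auto simp: F'_def bij_betw_def)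
  have A: "FA F' y \<in> Arr C" "FA F (FA F' y) = y" if "y \<in> Arr D" for y
    using that bij_betw_inv_into_right[OF bA that] bA inv_into_into[of y "FA F" "Arr C"] by (auto simp: F'_def bij_betw_def)
  have O': "FO F' (FO F x) = x" if "x \<in> Obj C" for x
    using that bij_betw_inv_into_left[OF bO that] by (simp add: F'_def)
  have A': "FA F' (FA F x) = x" if "x \<in> Arr C" for x
    using that bij_betw_inv_into_left[OF bA that] by (simp add: F'_def)
  have DA: "Dom C (FA F' y) = FO F' (Dom D y)" "Cod C (FA F' y) = FO F' (Cod D y)" if y: "y \<in> Arr D" for y
    using O'[of "Dom C (FA F' y)"] O'[of "Cod C (FA F' y)"] A[OF y] F.FA_arr[OF A(1)[OF y]] by simp_all
  have F': "F' \<in> Obj (Fun D C)"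
  proof (rule functor_onI)
    show "FA F' y \<in> hom C (FO F' (Dom D y)) (FO F' (Cod D y))" if "y \<in> Arr D" for y
      using that A DA by (simp add: hom_iff)
    show "FA F' (Ident D y) = Ident C (FO F' y)" if "y \<in> Obj D" for y
      using A'[of "Ident C (FO F' y)"] O[OF that] by simp
    show "FA F' (z \<cdot>\<^bsub>D\<^esub> y) = FA F' z \<cdot>\<^bsub>C\<^esub> FA F' y" if "y \<in> Arr D" "z \<in> Arr D" "Cod D y = Dom D z" for y z
      using A'[of "FA F' z \<cdot>\<^bsub>C\<^esub> FA F' y"] A[OF that(1)] A[OF that(2)] DA[OF that(1)] DA[OF that(2)] that(3)
      by (simp add: F.FA_comp)
  qed (simp_all add: C.category_axioms D.category_axioms O, simp_all add: F'_def)
  have Fs: "Src F' = D" by (simp add: F'_def)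
  have "F \<bullet> F' = id_func D"
    by (rule Fun_Obj_eqI[OF comp_func_in[OF F' F] id_func_in[OF D.category_axioms]])
      (simp_all add: Fs O A, simp_all add: id_func_def)
  moreover have "F' \<bullet> F = id_func C"
    by (rule Fun_Obj_eqI[OF comp_func_in[OF F F'] id_func_in[OF C.category_axioms]])
      (simp_all add: O' A', simp_all add: id_func_def)
  ultimately show ?thesis using F' by blast
qed

section \<open>Strict coslices and the gluing of compatible candidates\<close>

lemma strict_coslice_simps:
  "\<alpha> \<in> Obj (strict_coslice N n) \<longleftrightarrow> \<alpha> \<in> Arr N \<and> Dom N \<alpha> = n \<and> \<alpha> \<noteq> Ident N n"
  "(\<alpha>, k, \<beta>) \<in> Arr (strict_coslice N n) \<longleftrightarrow> \<alpha> \<in> Obj (strict_coslice N n) \<and> \<beta> \<in> Obj (strict_coslice N n)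
     \<and> k \<in> Arr N \<and> Dom N k = Cod N \<alpha> \<and> Cod N k = Cod N \<beta> \<and> k \<cdot>\<^bsub>N\<^esub> \<alpha> = \<beta>"
  "Dom (strict_coslice N n) (\<alpha>, k, \<beta>) = \<alpha>" "Cod (strict_coslice N n) (\<alpha>, k, \<beta>) = \<beta>"
  "Ident (strict_coslice N n) \<alpha> = (\<alpha>, Ident N (Cod N \<alpha>), \<alpha>)"
  "(\<beta>', l, \<gamma>) \<cdot>\<^bsub>strict_coslice N n\<^esub> (\<alpha>, k, \<beta>) = (\<alpha>, l \<cdot>\<^bsub>N\<^esub> k, \<gamma>)"
  by (auto simp: strict_coslice_def full_subcat_def coslice_def hom_iff)

lemma strict_coslice_homE:
  assumes "t \<in> hom (strict_coslice N n) \<alpha> \<beta>"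
  obtains k where "t = (\<alpha>, k, \<beta>)" "\<alpha> \<in> Obj (strict_coslice N n)" "\<beta> \<in> Obj (strict_coslice N n)"
    "k \<in> Arr N" "Dom N k = Cod N \<alpha>" "Cod N k = Cod N \<beta>" "k \<cdot>\<^bsub>N\<^esub> \<alpha> = \<beta>"
proof -
  obtain a k b where t: "t = (a, k, b)" by (cases t)
  have ab: "a = \<alpha>" "b = \<beta>" using assms by (simp_all add: t hom_iff strict_coslice_simps(3,4))
  show thesis
    by (rule that[of k]) (use assms in \<open>simp_all add: t ab hom_iff strict_coslice_simps(2-4)\<close>)
qed

lemma (in category) category_strict_coslice: "category (strict_coslice C n)"
proof
  let ?S = "strict_coslice C n"
  show "Dom ?S t \<in> Obj ?S" "Cod ?S t \<in> Obj ?S" if t: "t \<in> Arr ?S" for t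
    using t by (cases t, simp add: strict_coslice_simps(2-4))+
  show "Ident ?S \<alpha> \<in> hom ?S \<alpha> \<alpha>" if "\<alpha> \<in> Obj ?S" for \<alpha>
    using that by (simp add: hom_iff strict_coslice_simps)
  show "t \<cdot>\<^bsub>?S\<^esub> s \<in> hom ?S \<alpha> \<gamma>" if s: "s \<in> hom ?S \<alpha> \<beta>" and t: "t \<in> hom ?S \<beta> \<gamma>" for s t \<alpha> \<beta> \<gamma>
  proof -
    obtain k where k: "s = (\<alpha>, k, \<beta>)" "\<alpha> \<in> Obj ?S" "\<beta> \<in> Obj ?S" "k \<in> Arr C" "Dom C k = Cod C \<alpha>" "Cod C k = Cod C \<beta>" "k \<cdot> \<alpha> = \<beta>"
      using s by (rule strict_coslice_homE)
    obtain l where l: "t = (\<beta>, l, \<gamma>)" "\<gamma> \<in> Obj ?S" "l \<in> Arr C" "Dom C l = Cod C \<beta>" "Cod C l = Cod C \<gamma>" "l \<cdot> \<beta> = \<gamma>"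
      using t by (rule strict_coslice_homE)
    have "\<alpha> \<in> Arr C" using k(2) by (simp add: strict_coslice_simps)
    then have "(l \<cdot> k) \<cdot> \<alpha> = \<gamma>" using k l by simp
    then show ?thesis using k l by (simp add: hom_iff strict_coslice_simps(2-4,6))
  qed
  show "t \<cdot>\<^bsub>?S\<^esub> Ident ?S \<alpha> = t" "Ident ?S \<beta> \<cdot>\<^bsub>?S\<^esub> t = t" if t: "t \<in> hom ?S \<alpha> \<beta>" for t \<alpha> \<beta>
    by (rule strict_coslice_homE[OF t]; simp add: strict_coslice_simps)+
  show "(t \<cdot>\<^bsub>?S\<^esub> s) \<cdot>\<^bsub>?S\<^esub> r = t \<cdot>\<^bsub>?S\<^esub> (s \<cdot>\<^bsub>?S\<^esub> r)"
    if r: "r \<in> hom ?S w \<alpha>" and s: "s \<in> hom ?S \<alpha> \<beta>" and t: "t \<in> hom ?S \<beta> \<gamma>" for r s t w \<alpha> \<beta> \<gamma>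
    by (rule strict_coslice_homE[OF r], rule strict_coslice_homE[OF s], rule strict_coslice_homE[OF t])
      (simp add: strict_coslice_simps(6))
qed

lemma (in category) strict_coslice_proj_in: "strict_coslice_proj C n \<in> Obj (Fun (strict_coslice C n) C)"
proof (rule functor_onI)
  let ?S = "strict_coslice C n" and ?F = "strict_coslice_proj C n"
  interpret S: category ?S by (rule category_strict_coslice)
  have O: "FO ?F \<alpha> = Cod C \<alpha>" if "\<alpha> \<in> Obj ?S" for \<alpha> using that by (simp add: strict_coslice_proj_def)
  have A: "FA ?F t = mid t" if "t \<in> Arr ?S" for t using that by (simp add: strict_coslice_proj_def)
  show "FO ?F \<alpha> \<in> Obj C" if "\<alpha> \<in> Obj ?S" for \<alpha> using that by (simp add: O strict_coslice_simps)
  show "FA ?F t \<in> hom C (FO ?F (Dom ?S t)) (FO ?F (Cod ?S t))" if "t \<in> Arr ?S" for t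
    using that by (cases t) (simp add: A O hom_iff strict_coslice_simps(2-4))
  show "FA ?F (Ident ?S \<alpha>) = Ident C (FO ?F \<alpha>)" if "\<alpha> \<in> Obj ?S" for \<alpha>
    using that S.ident_arr(1)[OF that] by (simp add: A O strict_coslice_simps(5))
  show "FA ?F (t \<cdot>\<^bsub>?S\<^esub> s) = FA ?F t \<cdot> FA ?F s" if "s \<in> Arr ?S" "t \<in> Arr ?S" "Cod ?S s = Dom ?S t" for s t
    using that S.comp_arr(1)[OF that] by (cases s; cases t) (simp add: A strict_coslice_simps(6))
qed (simp_all add: category_axioms category_strict_coslice strict_coslice_proj_def)

text \<open>The common domain of the \<open>p j\<close> is glued first, then the projections. The
  evaluations can be glued only because the pointwise pullback of the glued projection restricts
  strictly to the pullbacks on which the \<open>e j\<close> are defined.\<close>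

lemma (in colim_restriction) colim_pre_dprod:
  assumes f: "f \<in> Arr (Fun (colim D) E)" and g: "g \<in> Arr (Fun (colim D) E)" "Cod (Fun (colim D) E) g = Dom (Fun (colim D) E) f"
    and c: "\<And>j. j \<in> Obj (Src D) \<Longrightarrow> pre_dprod (FO D j) E (whisk f (coproj D j)) (whisk g (coproj D j)) (p j) (e j)"
    and compat: "\<And>\<alpha>. \<alpha> \<in> Arr (Src D) \<Longrightarrow> whisk (p (Cod (Src D) \<alpha>)) (FA D \<alpha>) = p (Dom (Src D) \<alpha>)"
      "\<And>\<alpha>. \<alpha> \<in> Arr (Src D) \<Longrightarrow> whisk (e (Cod (Src D) \<alpha>)) (FA D \<alpha>) = e (Dom (Src D) \<alpha>)"
  shows "\<exists>q d. pre_dprod (colim D) E f g q d \<and> (\<forall>j\<in>Obj (Src D). whisk q (coproj D j) = p j \<and> whisk d (coproj D j) = e j)"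
proof -
  note [simp] = f g
  note C = pre_dprodD[OF c]
  have fib: "category (FO D j)" if "j \<in> Obj (Src D)" for j using that by (rule colim_fibre[OF D DT])
  have fc: "functor_category_pb (FO D j) E" if "j \<in> Obj (Src D)" for j
    using fib[OF that] pbs E.category_axioms
    by (simp add: functor_category_pb_def functor_category_def functor_category_pb_axioms_def)
  have Cf: "Cod (Fun (FO D j) E) (p j) = Cod (Fun (colim D) E) f \<bullet> coproj D j"
    "Cod (Fun (FO D j) E) (e j) = Dom (Fun (colim D) E) g \<bullet> coproj D j" if j: "j \<in> Obj (Src D)" for j
  proof -
    interpret R: restriction_pb "FO D j" "colim D" E "coproj D j" by (rule coproj_restriction[OF j])
    show "Cod (Fun (FO D j) E) (p j) = Cod (Fun (colim D) E) f \<bullet> coproj D j"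
      "Cod (Fun (FO D j) E) (e j) = Dom (Fun (colim D) E) g \<bullet> coproj D j" using C(5,8)[OF j] by simp_all
  qed
  have "\<exists>U. U \<in> Obj (Fun (colim D) E) \<and> (\<forall>j\<in>Obj (Src D). U \<bullet> coproj D j = Dom (Fun (FO D j) E) (p j))"
  proof (rule colim_functor[OF E.category_axioms])
    show "Dom (Fun (FO D j) E) (p j) \<in> Obj (Fun (FO D j) E)" if "j \<in> Obj (Src D)" for j
      using C(4)[OF that] fc[OF that] by (simp add: functor_category_pb_def functor_category.category_Fun category.dom_in)
    show "Dom (Fun (FO D (Cod (Src D) \<alpha>)) E) (p (Cod (Src D) \<alpha>)) \<bullet> FA D \<alpha> = Dom (Fun (FO D (Dom (Src D) \<alpha>)) E) (p (Dom (Src D) \<alpha>))"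
      if a: "\<alpha> \<in> Arr (Src D)" for \<alpha>
      using arg_cong[OF compat(1)[OF a], of NDom] by (simp add: Fun_sel whisk_sel)
  qed
  then obtain U where U [simp]: "U \<in> Obj (Fun (colim D) E)"
    and Uj: "\<And>j. j \<in> Obj (Src D) \<Longrightarrow> U \<bullet> coproj D j = Dom (Fun (FO D j) E) (p j)" by blast
  have "\<exists>q. q \<in> hom (Fun (colim D) E) U (Cod (Fun (colim D) E) f) \<and> (\<forall>j\<in>Obj (Src D). whisk q (coproj D j) = p j)"
    by (rule colim_nat[OF E.category_axioms _ _ _ compat(1)]) (simp_all add: Uj C(4) hom_iff Cf)
  then obtain q where q: "q \<in> hom (Fun (colim D) E) U (Cod (Fun (colim D) E) f)"
    and qj: "\<And>j. j \<in> Obj (Src D) \<Longrightarrow> whisk q (coproj D j) = p j" by blast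
  note [simp] = homD[OF q]
  let ?W = "ptpb1 (colim D) E f q"
  have Wj: "whisk ?W (coproj D j) = ptpb1 (FO D j) E (whisk f (coproj D j)) (p j)"
    "Dom (Fun (colim D) E) ?W \<bullet> coproj D j = Dom (Fun (FO D j) E) (e j)" if j: "j \<in> Obj (Src D)" for j
  proof -
    interpret R: restriction_pb "FO D j" "colim D" E "coproj D j" by (rule coproj_restriction[OF j])
    show 1: "whisk ?W (coproj D j) = ptpb1 (FO D j) E (whisk f (coproj D j)) (p j)"
      using R.whisk_ptpb(1)[of f q] by (simp add: qj[OF j])
    show "Dom (Fun (colim D) E) ?W \<bullet> coproj D j = Dom (Fun (FO D j) E) (e j)"
      using C(7)[OF j] unfolding 1[symmetric] by simp
  qed
  have "\<exists>d. d \<in> hom (Fun (colim D) E) (Dom (Fun (colim D) E) ?W) (Dom (Fun (colim D) E) g) \<and> (\<forall>j\<in>Obj (Src D). whisk d (coproj D j) = e j)"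
    by (rule colim_nat[OF E.category_axioms _ _ _ compat(2)]) (simp_all add: Wj C(6) hom_iff Cf)
  then obtain d where d: "d \<in> hom (Fun (colim D) E) (Dom (Fun (colim D) E) ?W) (Dom (Fun (colim D) E) g)"
    and dj: "\<And>j. j \<in> Obj (Src D) \<Longrightarrow> whisk d (coproj D j) = e j" by blast
  note [simp] = homD[OF d]
  have "g \<cdot>\<^bsub>Fun (colim D) E\<^esub> d = ?W"
  proof (rule colim_arr_eqI)
    fix j assume j: "j \<in> Obj (Src D)"
    interpret R: restriction_pb "FO D j" "colim D" E "coproj D j" by (rule coproj_restriction[OF j])
    show "whisk (g \<cdot>\<^bsub>Fun (colim D) E\<^esub> d) (coproj D j) = whisk ?W (coproj D j)"
      using C(9)[OF j] by (simp add: R.whisk_comp dj[OF j] Wj[OF j])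
  qed simp_all
  then have "pre_dprod (colim D) E f g q d" by (simp add: pre_dprod_def hom_iff)
  then show ?thesis using qj dj by blast
qed

section \<open>The categories and restriction functors of a gluing diagram\<close>

locale gluing_limits = E: category E
  for G :: "('n, 'a, 'o, 'm, 'b, 'c, 'u) gluing" and E :: "('e, 'f) cat" +
  assumes gluing: "iterated_gluing_diagram G" and pbs: "has_pullbacks E"
    and lims: "\<And>n i. n \<in> Obj (Shape G) \<Longrightarrow> i \<in> Obj (Bd G n) \<Longrightarrow>
      has_limits (elements (prof_at (Bd G n) (below G n) (Prof G n) i)) E"
begin

abbreviation N where "N \<equiv> Shape G"
abbreviation \<I> where "\<I> n \<equiv> FO (Diag G) n"
abbreviation Iinf where "Iinf \<equiv> gluing_cat G"
abbreviation co where "co n \<equiv> coproj (Diag G) n"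
abbreviation inl where "inl n \<equiv> collage_inl (Bd G n) (below G n) (Prof G n)"
abbreviation inr where "inr n \<equiv> collage_inr (Bd G n) (below G n) (Prof G n)"
abbreviation col where "col n \<equiv> collage (Bd G n) (below G n) (Prof G n)"

sublocale N: category N
  using gluing by (simp add: iterated_gluing_diagram_def strict_inverse_category_def)

lemma Deg_less: "\<alpha> \<in> Arr N \<Longrightarrow> \<alpha> \<noteq> Ident N (Dom N \<alpha>) \<Longrightarrow> Deg G (Cod N \<alpha>) < Deg G (Dom N \<alpha>)"
  using gluing by (simp add: iterated_gluing_diagram_def strict_inverse_category_def)

lemma Diag: "is_functor (Diag G)" "Src (Diag G) = op_cat N" "Tgt (Diag G) = CAT"
  using gluing by (simp_all add: iterated_gluing_diagram_def)

lemma op_simps [simp]: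
  "Obj (op_cat C) = Obj C" "Arr (op_cat C) = Arr C" "Dom (op_cat C) = Cod C" "Cod (op_cat C) = Dom C"
  "Ident (op_cat C) = Ident C"
  by (simp_all add: op_cat_def)

lemma Diag_in: "Diag G \<in> Obj (Fun (op_cat N) CAT)"
  using Diag by (rule Fun_ObjI)

sublocale Q: colim_restriction "Diag G" E
  by unfold_locales (simp_all add: Diag pbs)

lemma gluing_at:
  assumes "n \<in> Obj N"
  shows "is_profunctor (Bd G n) (below G n) (Prof G n)" "is_iso_functor (Glue G n)"
    "Glue G n \<in> Obj (Fun (col n) (\<I> n))" "category (col n)" "category (\<I> n)"
    "\<And>\<alpha>. \<alpha> \<in> Obj (strict_coslice N n) \<Longrightarrow> Glue G n \<bullet> inl n \<bullet> coproj (below_diag G n) \<alpha> = FA (Diag G) \<alpha>"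
proof -
  show "is_profunctor (Bd G n) (below G n) (Prof G n)" and i: "is_iso_functor (Glue G n)"
    and "\<And>\<alpha>. \<alpha> \<in> Obj (strict_coslice N n) \<Longrightarrow> Glue G n \<bullet> inl n \<bullet> coproj (below_diag G n) \<alpha> = FA (Diag G) \<alpha>"
    using gluing assms by (simp_all add: iterated_gluing_diagram_def)
  show g: "Glue G n \<in> Obj (Fun (col n) (\<I> n))"
    using gluing assms i by (simp add: iterated_gluing_diagram_def Fun_ObjI is_iso_functor_def)
  show "category (col n)" "category (\<I> n)" using Fun_ObjD[OF g] by simp_all
qed

lemma collage_limits_at: "n \<in> Obj N \<Longrightarrow> collage_limits (Bd G n) (below G n) (Prof G n) E"
  using gluing_at[of n] lims pbs E.category_axioms
  by (simp add: collage_limits_def collage_limits_axioms_def profunctor_limits_def profunctor_limits_axioms_def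
      is_profunctor_def functor_category_pb_def functor_category_pb_axioms_def functor_category_def)

lemma below_diag:
  assumes n: "n \<in> Obj N"
  shows "is_functor (below_diag G n)" "Src (below_diag G n) = op_cat (strict_coslice N n)" "Tgt (below_diag G n) = CAT"
    "\<alpha> \<in> Obj (strict_coslice N n) \<Longrightarrow> FO (below_diag G n) \<alpha> = \<I> (Cod N \<alpha>)"
    "(\<alpha>, k, \<beta>) \<in> Arr (strict_coslice N n) \<Longrightarrow> FA (below_diag G n) (\<alpha>, k, \<beta>) = FA (Diag G) k"
proof -
  have P: "op_func (strict_coslice_proj N n) \<in> Obj (Fun (op_cat (strict_coslice N n)) (op_cat N))"
    by (rule functor_op_func[OF N.strict_coslice_proj_in])
  have "below_diag G n \<in> Obj (Fun (op_cat (strict_coslice N n)) CAT)"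
    unfolding below_diag_def by (rule comp_func_in[OF P Diag_in])
  then show "is_functor (below_diag G n)" and s: "Src (below_diag G n) = op_cat (strict_coslice N n)"
    and "Tgt (below_diag G n) = CAT" using Fun_ObjD by blast+
  have [simp]: "Src (op_func (strict_coslice_proj N n)) = op_cat (strict_coslice N n)" using Fun_ObjD[OF P] by simp
  show "\<alpha> \<in> Obj (strict_coslice N n) \<Longrightarrow> FO (below_diag G n) \<alpha> = \<I> (Cod N \<alpha>)"
    by (simp add: below_diag_def) (simp add: op_func_def strict_coslice_proj_def)
  show "(\<alpha>, k, \<beta>) \<in> Arr (strict_coslice N n) \<Longrightarrow> FA (below_diag G n) (\<alpha>, k, \<beta>) = FA (Diag G) k"
    by (simp add: below_diag_def) (simp add: op_func_def strict_coslice_proj_def)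
qed

lemma below_colim: "n \<in> Obj N \<Longrightarrow> colim_restriction (below_diag G n) E"
  using below_diag[of n] pbs E.category_axioms
  by (simp add: colim_restriction_def colim_restriction_axioms_def colim_diagram_def)

lemma FA_Diag_ident: "n \<in> Obj N \<Longrightarrow> FA (Diag G) (Ident N n) = id_func (\<I> n)"
  using functor_on.FA_ident[of "op_cat N" CAT "Diag G" n] Diag_in by (simp add: functor_on_def CAT_def)

lemma co_in: "n \<in> Obj N \<Longrightarrow> co n \<in> Obj (Fun (\<I> n) Iinf)"
  using Q.coproj_in by (simp add: Diag gluing_cat_def)

text \<open>Through \<open>K n\<close> a functor on \<open>\<I>\<^sub>\<infinity>\<close> is seen on
  the collage instead of on \<open>\<I>\<^sub>n\<close>, where the lemmas about collages apply; both
  inclusions factor through it.\<close>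

definition K where "K n = co n \<bullet> Glue G n"

lemma K_in: "n \<in> Obj N \<Longrightarrow> K n \<in> Obj (Fun (col n) Iinf)"
  unfolding K_def by (rule comp_func_in[OF gluing_at(3) co_in])

lemma inl_in: "n \<in> Obj N \<Longrightarrow> inl n \<in> Obj (Fun (below G n) (col n))"
  by (rule collage_limits.inl_in[OF collage_limits_at])

lemma inr_in: "n \<in> Obj N \<Longrightarrow> inr n \<in> Obj (Fun (Bd G n) (col n))"
  by (rule collage_limits.inr_in[OF collage_limits_at])

lemma coproj_below_in:
  assumes n: "n \<in> Obj N" and a: "\<alpha> \<in> Obj (strict_coslice N n)"
  shows "coproj (below_diag G n) \<alpha> \<in> Obj (Fun (\<I> (Cod N \<alpha>)) (below G n))"
proof -
  interpret B: colim_restriction "below_diag G n" E by (rule below_colim[OF n])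
  show ?thesis using B.coproj_in[of \<alpha>] a by (simp add: below_diag[OF n] below_def)
qed

lemma incl_bd: "n \<in> Obj N \<Longrightarrow> incl_bd G n = K n \<bullet> inr n"
  unfolding incl_bd_def K_def by (rule comp_func_assoc[OF inr_in gluing_at(3) co_in, symmetric])

lemma incl_below: "n \<in> Obj N \<Longrightarrow> incl_below G n = K n \<bullet> inl n"
  unfolding incl_below_def K_def by (rule comp_func_assoc[OF inl_in gluing_at(3) co_in, symmetric])

lemma incl_bd_in: "n \<in> Obj N \<Longrightarrow> incl_bd G n \<in> Obj (Fun (Bd G n) Iinf)"
  unfolding incl_bd by (rule comp_func_in[OF inr_in K_in])

lemma incl_below_in: "n \<in> Obj N \<Longrightarrow> incl_below G n \<in> Obj (Fun (below G n) Iinf)"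
  unfolding incl_below by (rule comp_func_in[OF inl_in K_in])

text \<open>On the copy of \<open>\<I>\<close> indexed by \<open>\<alpha>\<close> the inclusion
  followed by \<open>Glue G n\<close> is the functor induced by \<open>\<alpha>\<close>, and the
  cocone equation absorbs that functor into the coprojection at
  \<open>Cod N \<alpha>\<close>.\<close>

lemma incl_below_coproj:
  assumes n: "n \<in> Obj N" and a: "\<alpha> \<in> Obj (strict_coslice N n)"
  shows "incl_below G n \<bullet> coproj (below_diag G n) \<alpha> = co (Cod N \<alpha>)"
proof -
  note c = coproj_below_in[OF n a]
  have al: "\<alpha> \<in> Arr N" "Dom N \<alpha> = n" using a by (simp_all add: strict_coslice_simps)
  have "incl_below G n \<bullet> coproj (below_diag G n) \<alpha> = co n \<bullet> (Glue G n \<bullet> inl n) \<bullet> coproj (below_diag G n) \<alpha>"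
    unfolding incl_below_def by (rule comp_func_assoc[OF c comp_func_in[OF inl_in[OF n] gluing_at(3)[OF n]] co_in[OF n]])
  also have "(Glue G n \<bullet> inl n) \<bullet> coproj (below_diag G n) \<alpha> = FA (Diag G) \<alpha>"
    using comp_func_assoc[OF c inl_in[OF n] gluing_at(3)[OF n]] gluing_at(6)[OF n a] by simp
  also have "co n \<bullet> FA (Diag G) \<alpha> = co (Cod N \<alpha>)"
    using coproj_cocone[OF Diag(1,3), of \<alpha>] al by (simp add: Diag)
  finally show ?thesis .
qed

lemma whisk_incl:
  assumes n: "n \<in> Obj N" and t: "\<tau> \<in> Arr (Fun Iinf E)"
  shows "whisk (whisk \<tau> (K n)) (inl n) = whisk \<tau> (incl_below G n)"
    "whisk (whisk \<tau> (K n)) (inr n) = whisk \<tau> (incl_bd G n)"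
    "whisk (whisk \<tau> (co n)) (Glue G n) = whisk \<tau> (K n)"
    "\<alpha> \<in> Obj (strict_coslice N n) \<Longrightarrow> whisk (whisk \<tau> (incl_below G n)) (coproj (below_diag G n) \<alpha>) = whisk \<tau> (co (Cod N \<alpha>))"
proof -
  show "whisk (whisk \<tau> (K n)) (inl n) = whisk \<tau> (incl_below G n)"
    using whisk_whisk[OF K_in[OF n] inl_in[OF n] t] by (simp add: incl_below[OF n])
  show "whisk (whisk \<tau> (K n)) (inr n) = whisk \<tau> (incl_bd G n)"
    using whisk_whisk[OF K_in[OF n] inr_in[OF n] t] by (simp add: incl_bd[OF n])
  show "whisk (whisk \<tau> (co n)) (Glue G n) = whisk \<tau> (K n)"
    using whisk_whisk[OF co_in[OF n] gluing_at(3)[OF n] t] by (simp add: K_def)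
  show "\<alpha> \<in> Obj (strict_coslice N n) \<Longrightarrow> whisk (whisk \<tau> (incl_below G n)) (coproj (below_diag G n) \<alpha>) = whisk \<tau> (co (Cod N \<alpha>))"
    using whisk_whisk[OF incl_below_in[OF n] coproj_below_in[OF n] t] by (simp add: incl_below_coproj[OF n])
qed

lemma restriction_at:
  assumes n: "n \<in> Obj N"
  shows "restriction_pb (col n) Iinf E (K n)" "restriction_pb (\<I> n) Iinf E (co n)"
    "restriction_pb (below G n) Iinf E (incl_below G n)" "restriction_pb (Bd G n) Iinf E (incl_bd G n)"
  using K_in[OF n] co_in[OF n] incl_below_in[OF n] incl_bd_in[OF n] pbs E.category_axioms
  by (simp_all add: restriction_pb_def restriction_pb_axioms_def restriction_def functor_on_def)

end

section \<open>Construction of the dependent product by recursion on the degree\<close>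

locale gluing_dprod = gluing_limits +
  fixes f g
  assumes f [simp]: "f \<in> Arr (Fun Iinf E)" and g [simp]: "g \<in> Arr (Fun Iinf E)" "Cod (Fun Iinf E) g = Dom (Fun Iinf E) f"
    and pw: "\<And>n. n \<in> Obj N \<Longrightarrow> powerful (Fun (Bd G n) E) (whisk f (incl_bd G n))"
begin

text \<open>\<open>good S n\<close>: the pair \<open>S n\<close> is a candidate for the dependent product over \<open>\<I>\<^sub>n\<close>. It restricts strictly to the
  candidates \<open>S n'\<close> of lower degree and satisfies the relative universal property over them.\<close>

definition good where
  "good S n pe \<longleftrightarrow> (let p = fst pe; e = snd pe in
     pre_dprod (\<I> n) E (whisk f (co n)) (whisk g (co n)) p e
     \<and> (\<forall>\<alpha>\<in>Obj (strict_coslice N n). whisk p (FA (Diag G) \<alpha>) = fst (S (Cod N \<alpha>)) \<and> whisk e (FA (Diag G) \<alpha>) = snd (S (Cod N \<alpha>)))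
     \<and> collage_limits.glued_collage (Bd G n) (below G n) (Prof G n) E (whisk f (K n)) (whisk g (K n))
         (whisk (whisk p (Glue G n)) (inl n)) (whisk (whisk e (Glue G n)) (inl n)) (whisk (whisk p (Glue G n)) (inr n))
         (collage_match (Bd G n) (below G n) (Prof G n) (Dom (Fun (\<I> n) E) p \<bullet> Glue G n))
         (whisk (whisk e (Glue G n)) (inr n)))"

text \<open>Only the existence of good pairs is available, so the recursion has to choose. As one
  pair is chosen for each object, any two later stages restrict to the same lower pair, with
  equality and not just up to isomorphism.\<close>

definition candidate where
  "candidate = wfrec (measure (Deg G)) (\<lambda>S n. SOME pe. good S n pe)"

text \<open>\<open>good S n\<close> consults \<open>S\<close> only at codomains of non-identity maps
  out of \<open>n\<close>. The degree drops there, so cutting the recursive function off changes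
  nothing.\<close>

lemma candidate: "candidate n = (SOME pe. good candidate n pe)"
proof -
  have "good (cut candidate (measure (Deg G)) n) n pe = good candidate n pe" for pe
  proof -
    have "cut candidate (measure (Deg G)) n (Cod N \<alpha>) = candidate (Cod N \<alpha>)" if "\<alpha> \<in> Obj (strict_coslice N n)" for \<alpha>
      using that Deg_less[of \<alpha>] by (simp add: cut_def strict_coslice_simps)
    then show ?thesis unfolding good_def Let_def by simp
  qed
  then show ?thesis
    using def_wfrec[OF eq_reflection[OF candidate_def] wf_measure, of n] by simp
qed

text \<open>\<open>good\<close> covers the non-identity maps; an identity induces the identity
  functor, along which restriction does nothing.\<close>

lemma good_trans:
  assumes k: "k \<in> Arr N" and gd: "good candidate (Dom N k) (candidate (Dom N k))"
  shows "whisk (fst (candidate (Dom N k))) (FA (Diag G) k) = fst (candidate (Cod N k))"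
    "whisk (snd (candidate (Dom N k))) (FA (Diag G) k) = snd (candidate (Cod N k))"
proof -
  have c: "pre_dprod (\<I> (Dom N k)) E (whisk f (co (Dom N k))) (whisk g (co (Dom N k))) (fst (candidate (Dom N k))) (snd (candidate (Dom N k)))"
    using gd by (simp add: good_def Let_def)
  have "whisk (fst (candidate (Dom N k))) (FA (Diag G) k) = fst (candidate (Cod N k))
      \<and> whisk (snd (candidate (Dom N k))) (FA (Diag G) k) = snd (candidate (Cod N k))"
  proof (cases "k = Ident N (Dom N k)")
    case True
    then have "Cod N k = Dom N k" using k N.ident_arr(3)[of "Dom N k"] by simp
    moreover have "FA (Diag G) k = id_func (\<I> (Dom N k))"
      using FA_Diag_ident[of "Dom N k"] True k by simp
    ultimately show ?thesis using whisk_id_func[OF pre_dprodD(4)[OF c]] whisk_id_func[OF pre_dprodD(6)[OF c]] by simp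
  next
    case False
    then have "k \<in> Obj (strict_coslice N (Dom N k))" using k by (simp add: strict_coslice_simps)
    then show ?thesis using gd by (simp add: good_def Let_def)
  qed
  then show "whisk (fst (candidate (Dom N k))) (FA (Diag G) k) = fst (candidate (Cod N k))"
    "whisk (snd (candidate (Dom N k))) (FA (Diag G) k) = snd (candidate (Cod N k))" by simp_all
qed

text \<open>The piece at \<open>\<alpha>\<close> is the candidate at \<open>Cod N \<alpha>\<close>,
  so pieces with the same codomain coincide, and a map of the coslice relates its two pieces by
  \<open>good_trans\<close>.\<close>

lemma below_pre_dprod:
  assumes n: "n \<in> Obj N" and IH: "\<And>m. m \<in> Obj N \<Longrightarrow> Deg G m < Deg G n \<Longrightarrow> good candidate m (candidate m)"
  shows "\<exists>q d. pre_dprod (below G n) E (whisk f (incl_below G n)) (whisk g (incl_below G n)) q d \<and>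
    (\<forall>\<alpha>\<in>Obj (strict_coslice N n). whisk q (coproj (below_diag G n) \<alpha>) = fst (candidate (Cod N \<alpha>))
       \<and> whisk d (coproj (below_diag G n) \<alpha>) = snd (candidate (Cod N \<alpha>)))"
proof -
  interpret B: colim_restriction "below_diag G n" E by (rule below_colim[OF n])
  interpret R: restriction_pb "below G n" Iinf E "incl_below G n" by (rule restriction_at[OF n])
  note bd = below_diag[OF n]
  have gd: "good candidate (Cod N \<alpha>) (candidate (Cod N \<alpha>))" if "\<alpha> \<in> Obj (strict_coslice N n)" for \<alpha>
    using that Deg_less[of \<alpha>] by (intro IH) (simp_all add: strict_coslice_simps)
  have "\<exists>q d. pre_dprod (colim (below_diag G n)) E (whisk f (incl_below G n)) (whisk g (incl_below G n)) q d \<and>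
    (\<forall>\<alpha>\<in>Obj (Src (below_diag G n)). whisk q (coproj (below_diag G n) \<alpha>) = fst (candidate (Cod N \<alpha>))
       \<and> whisk d (coproj (below_diag G n) \<alpha>) = snd (candidate (Cod N \<alpha>)))"
  proof (rule B.colim_pre_dprod)
    show "pre_dprod (FO (below_diag G n) \<alpha>) E (whisk (whisk f (incl_below G n)) (coproj (below_diag G n) \<alpha>))
      (whisk (whisk g (incl_below G n)) (coproj (below_diag G n) \<alpha>)) (fst (candidate (Cod N \<alpha>))) (snd (candidate (Cod N \<alpha>)))"
      if "\<alpha> \<in> Obj (Src (below_diag G n))" for \<alpha>
      using that gd[of \<alpha>] by (simp add: bd whisk_incl[OF n] good_def Let_def)
    fix t assume "t \<in> Arr (Src (below_diag G n))"
    then obtain \<alpha> k \<beta> where [simp]: "t = (\<alpha>, k, \<beta>)" and t: "(\<alpha>, k, \<beta>) \<in> Arr (strict_coslice N n)"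
      by (cases t) (simp add: bd)
    then have k: "k \<in> Arr N" "Dom N k = Cod N \<alpha>" "Cod N k = Cod N \<beta>" "\<alpha> \<in> Obj (strict_coslice N n)"
      by (simp_all add: strict_coslice_simps(2))
    show "whisk (fst (candidate (Cod N (Cod (Src (below_diag G n)) t)))) (FA (below_diag G n) t)
        = fst (candidate (Cod N (Dom (Src (below_diag G n)) t)))"
      "whisk (snd (candidate (Cod N (Cod (Src (below_diag G n)) t)))) (FA (below_diag G n) t)
        = snd (candidate (Cod N (Dom (Src (below_diag G n)) t)))"
      using good_trans[OF k(1)] gd[OF k(4)] k t by (simp_all add: bd strict_coslice_simps(3,4))
  qed (use R.whisk_arr in \<open>simp_all add: below_def[symmetric]\<close>)
  then show ?thesis by (simp add: bd below_def)
qed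

text \<open>It suffices to exhibit one good pair, since \<open>candidate\<close> then selects a good
  one. The pair is made on the collage by \<open>collage_step\<close> and moved to
  \<open>\<I>\<^sub>n\<close>.\<close>

lemma good_candidate: "n \<in> Obj N \<Longrightarrow> good candidate n (candidate n)"
proof (induction "Deg G n" arbitrary: n rule: less_induct)
  case less
  note n = \<open>n \<in> Obj N\<close>
  obtain q d where qd: "pre_dprod (below G n) E (whisk f (incl_below G n)) (whisk g (incl_below G n)) q d"
    and qda: "\<And>\<alpha>. \<alpha> \<in> Obj (strict_coslice N n) \<Longrightarrow> whisk q (coproj (below_diag G n) \<alpha>) = fst (candidate (Cod N \<alpha>))
       \<and> whisk d (coproj (below_diag G n) \<alpha>) = snd (candidate (Cod N \<alpha>))"
    using below_pre_dprod[OF n] less(1) by blast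
  interpret C: collage_limits "Bd G n" "below G n" "Prof G n" E by (rule collage_limits_at[OF n])
  interpret R: restriction_pb "col n" Iinf E "K n" by (rule restriction_at[OF n])
  have "\<exists>p e. pre_dprod (col n) E (whisk f (K n)) (whisk g (K n)) p e \<and> whisk p (inl n) = q \<and> whisk e (inl n) = d \<and>
    C.glued_collage (whisk f (K n)) (whisk g (K n)) q d (whisk p (inr n)) (C.\<mu> (Dom (Fun (col n) E) p)) (whisk e (inr n))"
    by (rule C.collage_step) (use qd pw[OF n] in \<open>simp_all add: whisk_incl[OF n]\<close>)
  then obtain p e where pe: "pre_dprod (col n) E (whisk f (K n)) (whisk g (K n)) p e" and qp: "whisk p (inl n) = q" "whisk e (inl n) = d"
    and gl: "C.glued_collage (whisk f (K n)) (whisk g (K n)) q d (whisk p (inr n)) (C.\<mu> (Dom (Fun (col n) E) p)) (whisk e (inr n))"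
    by blast
  \<comment> \<open>\<open>collage_step\<close> works over the collage, whereas \<open>good\<close>
    speaks of \<open>\<I>\<^sub>n\<close>; restriction along the inverse \<open>L\<close> of the
    gluing isomorphism carries the pair across.\<close>
  obtain L where L: "L \<in> Obj (Fun (\<I> n) (col n))" "Glue G n \<bullet> L = id_func (\<I> n)" "L \<bullet> Glue G n = id_func (col n)"
    using iso_functor_inverse[OF gluing_at(2)[OF n]] Fun_ObjD[OF gluing_at(3)[OF n]] by blast
  interpret L: restriction_pb "\<I> n" "col n" E L using L(1) pbs by unfold_locales
  interpret H: restriction_pb "col n" "\<I> n" E "Glue G n" using gluing_at(3)[OF n] pbs by unfold_locales
  have LG: "whisk (whisk \<tau> L) (Glue G n) = \<tau>" if "\<tau> \<in> Arr (Fun (col n) E)" for \<tau>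
    using whisk_whisk[OF L(1) gluing_at(3)[OF n] that] whisk_id_func[OF that] by (simp add: L(3))
  have KL: "whisk (whisk \<tau> (K n)) L = whisk \<tau> (co n)" if t: "\<tau> \<in> Arr (Fun Iinf E)" for \<tau>
  proof -
    have "K n \<bullet> L = co n" unfolding K_def comp_func_assoc[OF L(1) gluing_at(3)[OF n] co_in[OF n]] L(2)
      by (rule comp_id_func[OF co_in[OF n]])
    then show ?thesis using whisk_whisk[OF K_in[OF n] L(1) t] by simp
  qed
  note P = pre_dprodD[OF pe]
  \<comment> \<open>The functor induced by \<open>\<alpha>\<close> factors through
    \<open>Glue G n\<close>, which cancels \<open>L\<close>. So the restriction to a lower stage can
    be computed inside the collage, where it is known.\<close>
  have res: "whisk (whisk \<tau> L) (FA (Diag G) \<alpha>) = whisk (whisk \<tau> (inl n)) (coproj (below_diag G n) \<alpha>)"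
    if t: "\<tau> \<in> Arr (Fun (col n) E)" and a: "\<alpha> \<in> Obj (strict_coslice N n)" for \<tau> \<alpha>
  proof -
    note c = coproj_below_in[OF n a]
    note ic = comp_func_in[OF c inl_in[OF n]]
    have "whisk (whisk \<tau> L) (FA (Diag G) \<alpha>) = whisk (whisk \<tau> L) (Glue G n \<bullet> inl n \<bullet> coproj (below_diag G n) \<alpha>)"
      by (simp add: gluing_at(6)[OF n a])
    also have "\<dots> = whisk (whisk (whisk \<tau> L) (Glue G n)) (inl n \<bullet> coproj (below_diag G n) \<alpha>)"
      by (rule whisk_whisk[OF gluing_at(3)[OF n] ic, where E = E, symmetric]) (use t in simp)
    also have "\<dots> = whisk (whisk \<tau> (inl n)) (coproj (below_diag G n) \<alpha>)"
      using whisk_whisk[OF inl_in[OF n] c t] by (simp add: LG[OF t])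
    finally show ?thesis .
  qed
  have "pre_dprod (\<I> n) E (whisk f (co n)) (whisk g (co n)) (whisk p L) (whisk e L)"
    using L.pre_dprod_whisk[OF pe] by (simp add: KL)
  moreover have "Dom (Fun (\<I> n) E) (whisk p L) \<bullet> Glue G n = Dom (Fun (col n) E) p"
  proof -
    have "Dom (Fun (col n) E) (whisk (whisk p L) (Glue G n)) = Dom (Fun (col n) E) p" by (simp only: LG[OF P(4)])
    then show ?thesis using P(4) by simp
  qed
  ultimately have "good candidate n (whisk p L, whisk e L)"
    unfolding good_def Let_def using gl P qda by (simp add: LG res qp)
  then show ?case by (subst candidate) (rule someI)
qed

abbreviation \<mu> where "\<mu> n \<equiv> collage_match (Bd G n) (below G n) (Prof G n)"

text \<open>The \<open>glued_collage\<close> clauses are kept in the conclusion because the pullback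
  formula is read off from them, not from the universal property over
  \<open>\<I>\<^sub>\<infinity>\<close>.\<close>

lemma gluing_dprod:
  "\<exists>p e. ptdprod Iinf E f g p e \<and> (\<forall>n\<in>Obj N. collage_limits.glued_collage (Bd G n) (below G n) (Prof G n) E
     (whisk f (K n)) (whisk g (K n)) (whisk p (incl_below G n)) (whisk e (incl_below G n))
     (whisk p (incl_bd G n)) (\<mu> n (Dom (Fun Iinf E) p \<bullet> K n)) (whisk e (incl_bd G n)))"
proof -
  have "\<exists>p e. pre_dprod (colim (Diag G)) E f g p e \<and> (\<forall>n\<in>Obj (Src (Diag G)). whisk p (co n) = fst (candidate n) \<and> whisk e (co n) = snd (candidate n))"
  proof (rule Q.colim_pre_dprod)
    show "pre_dprod (\<I> n) E (whisk f (co n)) (whisk g (co n)) (fst (candidate n)) (snd (candidate n))" if "n \<in> Obj (Src (Diag G))" for n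
      using good_candidate[of n] that by (simp add: Diag good_def Let_def)
    show "whisk (fst (candidate (Cod (Src (Diag G)) \<alpha>))) (FA (Diag G) \<alpha>) = fst (candidate (Dom (Src (Diag G)) \<alpha>))"
      "whisk (snd (candidate (Cod (Src (Diag G)) \<alpha>))) (FA (Diag G) \<alpha>) = snd (candidate (Dom (Src (Diag G)) \<alpha>))"
      if "\<alpha> \<in> Arr (Src (Diag G))" for \<alpha>
      using good_trans[of \<alpha>] good_candidate[of "Dom N \<alpha>"] that by (simp_all add: Diag)
  qed (simp_all flip: gluing_cat_def)
  then obtain p e where pe: "pre_dprod Iinf E f g p e"
    and pen: "\<And>n. n \<in> Obj N \<Longrightarrow> whisk p (co n) = fst (candidate n)" "\<And>n. n \<in> Obj N \<Longrightarrow> whisk e (co n) = snd (candidate n)"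
    by (auto simp: Diag gluing_cat_def)
  note P = pre_dprodD[OF pe]
  note [simp] = P(1-8)
  have gl: "collage_limits.glued_collage (Bd G n) (below G n) (Prof G n) E
     (whisk f (K n)) (whisk g (K n)) (whisk p (incl_below G n)) (whisk e (incl_below G n))
     (whisk p (incl_bd G n)) (\<mu> n (Dom (Fun Iinf E) p \<bullet> K n)) (whisk e (incl_bd G n))" if n: "n \<in> Obj N" for n
  proof -
    interpret R: restriction_pb "\<I> n" Iinf E "co n" by (rule restriction_at[OF n])
    have "(Dom (Fun Iinf E) p \<bullet> co n) \<bullet> Glue G n = Dom (Fun Iinf E) p \<bullet> K n"
      unfolding K_def by (rule comp_func_assoc[OF gluing_at(3)[OF n] co_in[OF n]]) (rule R.J.F.dom_in, simp)
    then show ?thesis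
      using good_candidate[OF n] unfolding good_def Let_def pen[OF n, symmetric]
      by (simp add: whisk_incl[OF n])
  qed
  \<comment> \<open>The second induction on the degree: the universal property passes from the lower
    stages to their colimit, from there to the collage by the relative universal property, and then
    through the isomorphism \<open>Glue G n\<close>.\<close>
  have dn: "n \<in> Obj N \<Longrightarrow> ptdprod (\<I> n) E (whisk f (co n)) (whisk g (co n)) (whisk p (co n)) (whisk e (co n))" for n
  proof (induction "Deg G n" arbitrary: n rule: less_induct)
    case less
    note n = \<open>n \<in> Obj N\<close>
    interpret C: collage_limits "Bd G n" "below G n" "Prof G n" E by (rule collage_limits_at[OF n])
    interpret R: restriction_pb "col n" Iinf E "K n" by (rule restriction_at[OF n])
    interpret R': restriction_pb "\<I> n" Iinf E "co n" by (rule restriction_at[OF n])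
    interpret Rb: restriction_pb "below G n" Iinf E "incl_below G n" by (rule restriction_at[OF n])
    interpret B: colim_restriction "below_diag G n" E by (rule below_colim[OF n])
    note bd = below_diag[OF n]
    have "ptdprod (below G n) E (whisk f (incl_below G n)) (whisk g (incl_below G n)) (whisk p (incl_below G n)) (whisk e (incl_below G n))"
    proof (rule B.colim_ptdprod[folded below_def])
      show "pre_dprod (below G n) E (whisk f (incl_below G n)) (whisk g (incl_below G n)) (whisk p (incl_below G n)) (whisk e (incl_below G n))"
        by (rule Rb.pre_dprod_whisk[OF pe])
      fix \<alpha> assume "\<alpha> \<in> Obj (Src (below_diag G n))"
      then have a: "\<alpha> \<in> Obj (strict_coslice N n)" by (simp add: bd)
      then have "\<alpha> \<in> Arr N" "Dom N \<alpha> = n" "\<alpha> \<noteq> Ident N n" by (simp_all add: strict_coslice_simps)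
      then have "ptdprod (\<I> (Cod N \<alpha>)) E (whisk f (co (Cod N \<alpha>))) (whisk g (co (Cod N \<alpha>))) (whisk p (co (Cod N \<alpha>))) (whisk e (co (Cod N \<alpha>)))"
        using Deg_less[of \<alpha>] by (intro less(1)) simp_all
      then show "ptdprod (FO (below_diag G n) \<alpha>) E (whisk (whisk f (incl_below G n)) (coproj (below_diag G n) \<alpha>))
          (whisk (whisk g (incl_below G n)) (coproj (below_diag G n) \<alpha>)) (whisk (whisk p (incl_below G n)) (coproj (below_diag G n) \<alpha>))
          (whisk (whisk e (incl_below G n)) (coproj (below_diag G n) \<alpha>))"
        using a by (simp add: bd whisk_incl[OF n])
    qed
    then have dc: "ptdprod (col n) E (whisk f (K n)) (whisk g (K n)) (whisk p (K n)) (whisk e (K n))"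
      by (intro C.collage_ptdprod[OF R.pre_dprod_whisk[OF pe]]) (use gl[OF n] in \<open>simp_all add: whisk_incl[OF n]\<close>)
    obtain L where L: "L \<in> Obj (Fun (\<I> n) (col n))" "Glue G n \<bullet> L = id_func (\<I> n)" "L \<bullet> Glue G n = id_func (col n)"
      using iso_functor_inverse[OF gluing_at(2)[OF n]] Fun_ObjD[OF gluing_at(3)[OF n]] by blast
    show ?case
      by (rule ptdprod_iso[OF gluing_at(3)[OF n] L E.category_axioms pbs R'.pre_dprod_whisk[OF pe]])
        (use dc in \<open>simp add: whisk_incl[OF n]\<close>)
  qed
  have "ptdprod (colim (Diag G)) E f g p e"
    by (rule Q.colim_ptdprod) (use pe dn in \<open>simp_all add: Diag gluing_cat_def\<close>)
  then show ?thesis using gl unfolding gluing_cat_def by blast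
qed

end

section \<open>The pullback formula\<close>

context category
begin

lemma pb_map_ident:
  assumes w: "is_pullback C f p w1 w2"
  shows "pb_lift C w1 w2 w1 (Ident C (Dom C p) \<cdot> w2) = Ident C (Dom C w1)"
proof -
  note [simp] = pbD(1-8)[OF w]
  show ?thesis by (rule pb_lift_unique[OF w]) simp_all
qed

text \<open>\<open>\<theta>\<close> and \<open>\<eta>\<close> are the transposes of the two
  evaluations along the respective other dependent product.\<close>

lemma dprod_iso:
  assumes d: "dprod C f g p w1 w2 e" and d': "dprod C f g q v1 v2 b"
  shows "\<exists>\<theta> \<eta>. \<theta> \<in> hom C (Dom C q) (Dom C p) \<and> \<eta> \<in> hom C (Dom C p) (Dom C q) \<and> \<theta> \<cdot> \<eta> = Ident C (Dom C p)
    \<and> \<eta> \<cdot> \<theta> = Ident C (Dom C q) \<and> p \<cdot> \<theta> = q \<and> b = e \<cdot> pb_lift C w1 w2 v1 (\<theta> \<cdot> v2)"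
proof -
  note D = dprodD[OF d] and D' = dprodD[OF d']
  \<comment> \<open>All data are generalised, so that the claim can be used a second time with the
    roles exchanged for the other composite.\<close>
  have inv: "k \<cdot> l = Ident C (Dom C p)"
    if d: "dprod C f g p w1 w2 e" and d': "dprod C f g q v1 v2 b"
      and k: "k \<in> Arr C" "Dom C k = Dom C q" "Cod C k = Dom C p" "p \<cdot> k = q" "e \<cdot> pb_lift C w1 w2 v1 (k \<cdot> v2) = b"
      and l: "l \<in> Arr C" "Dom C l = Dom C p" "Cod C l = Dom C q" "q \<cdot> l = p" "b \<cdot> pb_lift C v1 v2 w1 (l \<cdot> w2) = e"
    for p w1 w2 e q v1 v2 b k l
  proof -
    note D = dprodD[OF d] and D' = dprodD[OF d']
    note [simp] = pbD(1-8)[OF D(3)] pbD(1-8)[OF D'(3)] k(1-3) l(1-3) pb_map[OF D(3) D'(3) k(1-4)] pb_map[OF D'(3) D(3) l(1-4)] D(4-6) D'(4-6)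
    have "e \<cdot> pb_lift C w1 w2 w1 ((k \<cdot> l) \<cdot> w2) = e"
      unfolding pb_map_comp[OF D(3) D'(3) D(3) k(1-4) l(1-4), symmetric]
      by (subst comp_ext[OF k(5)]) (simp_all add: l(5))
    moreover have "p \<cdot> k \<cdot> l = p" using comp_ext[OF k(4), of l] l(4) by simp
    ultimately show ?thesis
      using pb_map_ident[OF D(3)] by (rule_tac dprod_eqI[OF d D(3)]) simp_all
  qed
  obtain k where k: "k \<in> Arr C" "Dom C k = Dom C q" "Cod C k = Dom C p" "p \<cdot> k = q" "e \<cdot> pb_lift C w1 w2 v1 (k \<cdot> v2) = b"
    using dprod_ex1[OF d D'(3), of b] D' unfolding hom_iff by blast
  obtain l where l: "l \<in> Arr C" "Dom C l = Dom C p" "Cod C l = Dom C q" "q \<cdot> l = p" "b \<cdot> pb_lift C v1 v2 w1 (l \<cdot> w2) = e"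
    using dprod_ex1[OF d' D(3), of e] D unfolding hom_iff by blast
  have "k \<in> hom C (Dom C q) (Dom C p)" "l \<in> hom C (Dom C p) (Dom C q)" using k(1-3) l(1-3) by (simp_all add: hom_iff)
  then show ?thesis using inv[OF d d' k l] inv[OF d' d l k] k(4) k(5)[symmetric] by blast
qed

text \<open>Naturality of the counit at \<open>l\<close>, read on middle components. It shows that
  \<open>Pi_match_map\<close> satisfies the condition \<open>ec\<close> of
  \<open>matching_square\<close>.\<close>

lemma Pi_FA:
  assumes pw: "powerful C f" and g: "g \<in> Arr C" "Cod C g = Dom C f" and g': "g' \<in> Arr C" "Cod C g' = Dom C f"
    and l: "l \<in> Arr C" "Dom C l = Dom C g" "Cod C l = Dom C g'" "g' \<cdot> l = g"
  defines "c \<equiv> mid (FA (Pi_functor C f) (g, l, g'))" and "p \<equiv> Pi_ob C f g" and "p' \<equiv> Pi_ob C f g'"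
  shows "c \<in> Arr C" "Dom C c = Dom C p" "Cod C c = Dom C p'" "p' \<cdot> c = p"
    "mid (ev C f g') \<cdot> pb_lift C (pb1 C f p') (pb2 C f p') (pb1 C f p) (c \<cdot> pb2 C f p) = l \<cdot> mid (ev C f g)"
proof -
  note P = powerfulD[OF pw]
  let ?A = "slice C (Cod C f)" and ?B = "slice C (Dom C f)" and ?\<epsilon> = "snd (dep_prod C f)"
  interpret F: functor_on ?A ?B "pb_functor C f" by unfold_locales (rule pb_functor_in[OF P(1,2)])
  have "Pi_functor C f \<in> Obj (Fun ?B ?A)"
    using P(3) F.src F.tgt unfolding is_right_adjoint_def by (intro Fun_ObjI) simp_all
  then interpret R: functor_on ?B ?A "Pi_functor C f" by unfold_locales
  have t: "(g, l, g') \<in> Arr ?B" using g g' l by simp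
  have h: "FA (Pi_functor C f) (g, l, g') \<in> hom ?A p p'" using R.FA_arr[OF t] by (simp add: hom_iff p_def p'_def)
  then obtain k where k: "FA (Pi_functor C f) (g, l, g') = (p, k, p')" "p \<in> Arr C" "Cod C p = Cod C f" "p' \<in> Arr C"
    "Cod C p' = Cod C f" "k \<in> Arr C" "Dom C k = Dom C p" "Cod C k = Dom C p'" "p' \<cdot> k = p"
    unfolding slice_hom_iff by blast
  have ck: "c = k" by (simp add: c_def k(1))
  show "c \<in> Arr C" "Dom C c = Dom C p" "Cod C c = Dom C p'" "p' \<cdot> c = p" using k by (simp_all add: ck)
  note e = Pi_dprod(2)[OF pw g, folded p_def] and e' = Pi_dprod(2)[OF pw g', folded p'_def]
  have nt: "is_ntrans ?\<epsilon>" "NDom ?\<epsilon> = pb_functor C f \<bullet> Pi_functor C f" "NCod ?\<epsilon> = id_func ?B"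
    using P(3) F.tgt unfolding is_right_adjoint_def by simp_all
  have "\<forall>t\<in>Arr ?B. At ?\<epsilon> (Cod ?B t) \<cdot>\<^bsub>?B\<^esub> FA (pb_functor C f \<bullet> Pi_functor C f) t
      = FA (id_func ?B) t \<cdot>\<^bsub>?B\<^esub> At ?\<epsilon> (Dom ?B t)"
    using nt(1) unfolding is_ntrans_def Let_def nt(2,3) by simp
  from bspec[OF this t] have "ev C f g' \<cdot>\<^bsub>?B\<^esub> FA (pb_functor C f) (p, k, p') = (g, l, g') \<cdot>\<^bsub>?B\<^esub> ev C f g"
    using t by (simp add: ev_def k(1)) (simp add: id_func_def)
  then have "(pb1 C f p', mid (ev C f g'), g') \<cdot>\<^bsub>?B\<^esub> FA (pb_functor C f) (p, k, p')
      = (g, l, g') \<cdot>\<^bsub>?B\<^esub> (pb1 C f p, mid (ev C f g), g)" using e e' by metis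
  then show "mid (ev C f g') \<cdot> pb_lift C (pb1 C f p') (pb2 C f p') (pb1 C f p) (c \<cdot> pb2 C f p) = l \<cdot> mid (ev C f g)"
    using k by (simp add: ck pb_functor_def)
qed

text \<open>In \<open>ev_comparison\<close> the map to be transposed lives on the chosen pullback
  and contains the comparison with the preserved square. Passing to the preserved square removes
  that comparison.\<close>

lemma transpose_change:
  assumes D: "is_pullback C f p u1 u2" and y: "is_pullback C f x y1 y2" and w: "is_pullback C f x w1 w2"
    and e: "e \<in> Arr C" "Dom C e = Dom C u1" and b: "b \<in> Arr C" "Dom C b = Dom C w1"
    and k: "k \<in> Arr C" "Dom C k = Dom C x" "Cod C k = Dom C p" "p \<cdot> k = x"
    and eq: "e \<cdot> pb_lift C u1 u2 y1 (k \<cdot> y2) = b \<cdot> pb_lift C w1 w2 y1 y2"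
  shows "e \<cdot> pb_lift C u1 u2 w1 (k \<cdot> w2) = b"
proof -
  note [simp] = pbD(1-8)[OF D] pbD(1-8)[OF y] pbD(1-8)[OF w] e b k(1-3)
  have i: "Ident C (Dom C x) \<in> Arr C" "Dom C (Ident C (Dom C x)) = Dom C x" "Cod C (Ident C (Dom C x)) = Dom C x"
    "x \<cdot> Ident C (Dom C x) = x" by simp_all
  note l = pb_map[OF y w i] and l' = pb_map[OF w y i] and lk = pb_map[OF D y k]
  have s: "Ident C (Dom C x) \<cdot> w2 = w2" "Ident C (Dom C x) \<cdot> y2 = y2" "k \<cdot> Ident C (Dom C x) = k" by simp_all
  note l = l[unfolded s] and l' = l'[unfolded s]
  note [simp] = l l' lk
  have "e \<cdot> pb_lift C u1 u2 w1 (k \<cdot> w2) = e \<cdot> pb_lift C u1 u2 y1 (k \<cdot> y2) \<cdot> pb_lift C y1 y2 w1 w2"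
    using pb_map_comp[OF D y w k i] unfolding s by simp
  also have "\<dots> = b \<cdot> pb_lift C w1 w2 y1 y2 \<cdot> pb_lift C y1 y2 w1 w2" by (subst comp_ext[OF eq]) simp_all
  also have "pb_lift C w1 w2 y1 y2 \<cdot> pb_lift C y1 y2 w1 w2 = Ident C (Dom C w1)"
    by (rule pb_eqI[OF w]) (simp_all add: comp_ext[OF l'(4)] comp_ext[OF l'(5)])
  finally show ?thesis by simp
qed

end

text \<open>The composite of the theorem is the transpose along \<open>r\<close> required by the square; \<open>k0\<close>, \<open>k1\<close>, \<open>k2\<close> stand for
  \<open>M\<^sub>n(ev)\<^sup>\<ddagger>\<close>, its pullback along \<open>m\<^sub>n A\<close>, and \<open>(B|\<^bsub>=n\<^esub> \<times>\<^bsub>M\<^sub>n B\<^esub> ev)\<^sup>\<ddagger>\<close>.\<close>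

lemma (in matching_data) composite_transpose:
  assumes s: "dprod C f' g' q s1 s2 \<epsilon>3"
    and k0: "k0 \<in> Arr C" "Dom C k0 = Dom C p'" "Cod C k0 = Dom C q" "q \<cdot> k0 = p'"
      "\<epsilon>3 \<cdot> pb_lift C s1 s2 w1' (k0 \<cdot> w2') = e'"
    and t: "is_pullback C mA q t1 t2" and z: "is_pullback C mA p' z1 z2"
    and k1: "k1 \<in> Arr C" "Dom C k1 = Dom C z1" "Cod C k1 = Dom C t1" "t1 \<cdot> k1 = z1" "t2 \<cdot> k1 = k0 \<cdot> z2"
    and y: "is_pullback C mB g' y1 y2" and d2: "dprod C r y1 \<pi>2 v1 v2 \<epsilon>2" and u: "is_pullback C r t1 u1 u2"
    and k2: "k2 \<in> Arr C" "Dom C k2 = Dom C t1" "Cod C k2 = Dom C \<pi>2" "\<pi>2 \<cdot> k2 = t1"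
    and L: "L \<in> Arr C" "Dom C L = Dom C u1" "Cod C L = Dom C y1" "y1 \<cdot> L = u1"
      "y2 \<cdot> L = \<epsilon>3 \<cdot> pb_lift C s1 s2 (mB \<cdot> u1) (t2 \<cdot> u2)" "\<epsilon>2 \<cdot> pb_lift C v1 v2 u1 (k2 \<cdot> u2) = L"
    and x: "is_pullback C r z1 x1 x2"
  shows "\<pi>2 \<cdot> k2 \<cdot> k1 = z1"
    "\<epsilon>2 \<cdot> pb_lift C v1 v2 x1 ((k2 \<cdot> k1) \<cdot> x2) = pb_lift C y1 y2 x1 (e' \<cdot> pb_lift C w1' w2' (mB \<cdot> x1) (z2 \<cdot> x2))"
proof -
  note S = dprodD[OF s] and D2 = dprodD[OF d2]
  interpret Q: matching_data C r g mA mB mC f' g' q s1 s2 \<epsilon>3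
    by unfold_locales (use S in \<open>simp_all add: nat_f nat_g\<close>)
  note [simp] = S(4-6) D2(4-6) pbD(1-8)[OF t] pbD(1-8)[OF z] pbD(1-8)[OF y] pbD(1-8)[OF u] pbD(1-8)[OF x]
    pbD(1-8)[OF D2(3)] k0(1-3) k1(1-3) k2(1-3) L(1-3)
  show p: "\<pi>2 \<cdot> k2 \<cdot> k1 = z1" using comp_ext[OF k2(4), of k1] k1(4) by simp
  note zt = z_arr[OF z] and tt = Q.z_arr[OF t]
  note ml = Q.match_lift[OF u tt] and mz = match_lift[OF x zt] and lx = pb_map[OF u x k1(1-4)]
    and lk2 = pb_map[OF D2(3) u k2] and l0 = pb_map[OF S(3) w' k0(1-4)]
  note [simp] = ml mz lx lk2 l0
  have "pb_lift C y1 y2 x1 (e' \<cdot> pb_lift C w1' w2' (mB \<cdot> x1) (z2 \<cdot> x2)) = L \<cdot> pb_lift C u1 u2 x1 (k1 \<cdot> x2)"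
  proof (rule pb_lift_unique[OF y])
    show "y1 \<cdot> L \<cdot> pb_lift C u1 u2 x1 (k1 \<cdot> x2) = x1" by (subst comp_ext[OF L(4)]) simp_all
    have "y2 \<cdot> L \<cdot> pb_lift C u1 u2 x1 (k1 \<cdot> x2)
        = \<epsilon>3 \<cdot> pb_lift C s1 s2 (mB \<cdot> u1) (t2 \<cdot> u2) \<cdot> pb_lift C u1 u2 x1 (k1 \<cdot> x2)"
      by (subst comp_ext[OF L(5)]) simp_all
    also have "\<dots> = \<epsilon>3 \<cdot> pb_lift C s1 s2 (mB \<cdot> x1) ((t2 \<cdot> k1) \<cdot> x2)"
      unfolding Q.match_lift_comp[OF u tt x k1(1-4)] ..
    \<comment> \<open>Since \<open>t2 \<cdot> k1 = k0 \<cdot> z2\<close>, the lift factors through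
      the base change of \<open>k0\<close> along \<open>f'\<close>. The evaluation after that base
      change is \<open>e'\<close>, as \<open>k0\<close> is the transpose of
      \<open>e'\<close>.\<close>
    also have "\<dots> = \<epsilon>3 \<cdot> pb_lift C s1 s2 w1' (k0 \<cdot> w2') \<cdot> pb_lift C w1' w2' (mB \<cdot> x1) (z2 \<cdot> x2)"
    proof -
      have "pb_lift C s1 s2 (mB \<cdot> x1) ((t2 \<cdot> k1) \<cdot> x2)
          = pb_lift C s1 s2 w1' (k0 \<cdot> w2') \<cdot> pb_lift C w1' w2' (mB \<cdot> x1) (z2 \<cdot> x2)"
      proof (rule pb_lift_unique[OF S(3)])
        show "s1 \<cdot> pb_lift C s1 s2 w1' (k0 \<cdot> w2') \<cdot> pb_lift C w1' w2' (mB \<cdot> x1) (z2 \<cdot> x2) = mB \<cdot> x1"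
          by (subst comp_ext[OF l0(4)]) simp_all
        have "s2 \<cdot> pb_lift C s1 s2 w1' (k0 \<cdot> w2') \<cdot> pb_lift C w1' w2' (mB \<cdot> x1) (z2 \<cdot> x2) = k0 \<cdot> z2 \<cdot> x2"
          by (subst comp_ext[OF l0(5)]) simp_all
        then show "s2 \<cdot> pb_lift C s1 s2 w1' (k0 \<cdot> w2') \<cdot> pb_lift C w1' w2' (mB \<cdot> x1) (z2 \<cdot> x2) = (t2 \<cdot> k1) \<cdot> x2"
          by (simp add: k1(5))
      qed (use S in simp_all)
      then show ?thesis by simp
    qed
    also have "\<dots> = e' \<cdot> pb_lift C w1' w2' (mB \<cdot> x1) (z2 \<cdot> x2)" by (subst comp_ext[OF k0(5)]) simp_all
    finally show "y2 \<cdot> L \<cdot> pb_lift C u1 u2 x1 (k1 \<cdot> x2) = e' \<cdot> pb_lift C w1' w2' (mB \<cdot> x1) (z2 \<cdot> x2)" .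
  qed simp_all
  then show "\<epsilon>2 \<cdot> pb_lift C v1 v2 x1 ((k2 \<cdot> k1) \<cdot> x2) = pb_lift C y1 y2 x1 (e' \<cdot> pb_lift C w1' w2' (mB \<cdot> x1) (z2 \<cdot> x2))"
    unfolding pb_map_comp[OF D2(3) u x k2 k1(1-4), symmetric] by (subst comp_ext[OF L(6)]) simp_all
qed

section \<open>Restriction, matching objects and matching maps on the gluing category\<close>

context gluing_limits
begin

lemma lim_lift_cong:
  "(\<And>x. x \<in> Obj (Src F) \<Longrightarrow> l x = l' x) \<Longrightarrow> lim_lift F L l = lim_lift F L l'"
  by (simp add: lim_lift_def cong: conj_cong ball_cong)

text \<open>Links the matching maps of the statement with the lemmas on collages. The two families
  of legs are compared only on objects of the category of elements, since composite functors are
  undefined elsewhere; hence the appeal to \<open>lim_lift_cong\<close>.\<close>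

lemma match_map_collage:
  assumes n: "n \<in> Obj N" and X: "X \<in> Obj (Fun Iinf E)"
  shows "match_map G E n X = collage_match (Bd G n) (below G n) (Prof G n) (X \<bullet> K n)"
proof -
  interpret C: collage_limits "Bd G n" "below G n" "Prof G n" E by (rule collage_limits_at[OF n])
  interpret Rb: restriction_pb "below G n" Iinf E "incl_below G n" by (rule restriction_at[OF n])
  interpret Rd: restriction_pb "Bd G n" Iinf E "incl_bd G n" by (rule restriction_at[OF n])
  have KS: "Src (K n) = col n" using Fun_ObjD[OF K_in[OF n]] by simp
  have 1: "(X \<bullet> K n) \<bullet> inl n = X \<bullet> incl_below G n"
    using comp_func_assoc[OF inl_in[OF n] K_in[OF n] X] by (simp add: incl_below[OF n])
  have 2: "(X \<bullet> K n) \<bullet> inr n = X \<bullet> incl_bd G n"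
    using comp_func_assoc[OF inr_in[OF n] K_in[OF n] X] by (simp add: incl_bd[OF n])
  have Xb: "X \<bullet> incl_below G n \<in> Obj (Fun (below G n) E)" using X by simp
  have GS: "Src (Glue G n) = col n" using Fun_ObjD[OF gluing_at(3)[OF n]] by simp
  have "lim_lift (match_diag (Bd G n) (below G n) (Prof G n) (X \<bullet> incl_below G n) i)
      (FO X (FO (incl_bd G n) i)) (\<lambda>(j, u). FA X (het_arr G n i u j))
    = lim_lift (match_diag (Bd G n) (below G n) (Prof G n) (X \<bullet> incl_below G n) i)
      (FO (X \<bullet> K n) (Inr i)) (\<lambda>(j, u). FA (X \<bullet> K n) (Het i u j))" if i: "i \<in> Obj (Bd G n)" for i
  proof -
    have o: "FO X (FO (incl_bd G n) i) = FO (X \<bullet> K n) (Inr i)"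
      using i by (simp add: incl_bd[OF n] KS)
    show ?thesis unfolding o
    proof (rule lim_lift_cong)
      fix x assume "x \<in> Obj (Src (match_diag (Bd G n) (below G n) (Prof G n) (X \<bullet> incl_below G n) i))"
      then have "x \<in> Obj (C.El i)" by (simp only: C.match_diag_sel(1)[OF Xb i])
      moreover obtain j u where [simp]: "x = (j, u)" by (cases x)
      ultimately have "Het i u j \<in> Arr (col n)" using i C.El_simps(1)[OF i] by simp
      then show "(case x of (j, u) \<Rightarrow> FA X (het_arr G n i u j)) = (case x of (j, u) \<Rightarrow> FA (X \<bullet> K n) (Het i u j))"
        by (simp add: het_arr_def KS del: collage_simps(5)) (simp add: K_def GS del: collage_simps(5))
    qed
  qed
  then show ?thesis
    unfolding match_map_def collage_match_def 1 2
    using X by (simp add: restr_eq_def match_def cong: restrict_cong)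
qed

lemma restr_eq_in: "n \<in> Obj N \<Longrightarrow> restr_eq G E n \<in> Obj (Fun (Fun Iinf E) (Fun (Bd G n) E))"
  unfolding restr_eq_def
  by (rule restriction.precomp_in) (use restriction_at(4)[of n] in \<open>simp add: restriction_pb_def\<close>)

lemma restr_eq_FA: "n \<in> Obj N \<Longrightarrow> \<tau> \<in> Arr (Fun Iinf E) \<Longrightarrow> FA (restr_eq G E n) \<tau> = whisk \<tau> (incl_bd G n)"
  unfolding restr_eq_def
  by (rule restriction.precomp_sel(4)[of "Bd G n" Iinf]) (use restriction_at(4)[of n] in \<open>simp_all add: restriction_pb_def\<close>)

lemma restr_eq_pullback:
  assumes n: "n \<in> Obj N" and pb: "is_pullback (Fun Iinf E) a b c d"
  shows "is_pullback (Fun (Bd G n) E) (FA (restr_eq G E n) a) (FA (restr_eq G E n) b) (FA (restr_eq G E n) c) (FA (restr_eq G E n) d)"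
  using restriction_pb.whisk_pullback[OF restriction_at(4)[OF n] pb] pbD[OF pb] by (simp add: restr_eq_FA[OF n])

lemma match_in: "n \<in> Obj N \<Longrightarrow> match G E n \<in> Obj (Fun (Fun Iinf E) (Fun (Bd G n) E))"
  unfolding match_def
  by (rule comp_func_in[OF restriction.precomp_in profunctor_limits.match_functor_in])
    (use restriction_at(3)[of n] collage_limits_at[of n] in \<open>simp_all add: restriction_pb_def collage_limits_def\<close>)

lemma match_FA:
  assumes n: "n \<in> Obj N" and t: "\<tau> \<in> Arr (Fun Iinf E)"
  shows "FA (match G E n) \<tau> = FA (match_functor (Bd G n) (below G n) (Prof G n) E) (whisk \<tau> (incl_below G n))"
proof -
  interpret Rb: restriction_pb "below G n" Iinf E "incl_below G n" by (rule restriction_at[OF n])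
  show ?thesis using t by (simp add: match_def)
qed

lemma match_pullback:
  assumes n: "n \<in> Obj N" and pb: "is_pullback (Fun Iinf E) a b c d"
  shows "is_pullback (Fun (Bd G n) E) (FA (match G E n) a) (FA (match G E n) b) (FA (match G E n) c) (FA (match G E n) d)"
proof -
  interpret C: collage_limits "Bd G n" "below G n" "Prof G n" E by (rule collage_limits_at[OF n])
  show ?thesis
    using C.match_pullback[OF restriction_pb.whisk_pullback[OF restriction_at(3)[OF n] pb]] pbD[OF pb] by (simp add: match_FA[OF n])
qed

lemma match_map_arr:
  assumes n: "n \<in> Obj N" and X: "X \<in> Obj (Fun Iinf E)"
  shows "match_map G E n X \<in> hom (Fun (Bd G n) E) (FO (restr_eq G E n) X) (FO (match G E n) X)"
proof -
  interpret C: collage_limits "Bd G n" "below G n" "Prof G n" E by (rule collage_limits_at[OF n])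
  interpret R: restriction_pb "col n" Iinf E "K n" by (rule restriction_at[OF n])
  have "X \<bullet> K n \<in> Obj (Fun (col n) E)" using X by simp
  note m = C.collage_match_arr[OF this, folded match_map_collage[OF n X]]
  have "match_map G E n X \<in> Arr (Fun (Bd G n) E)" by (rule m)
  then show ?thesis by (simp add: hom_iff Fun_sel) (simp add: match_map_def)
qed

lemma match_map_nat:
  assumes n: "n \<in> Obj N" and t: "\<tau> \<in> Arr (Fun Iinf E)"
  shows "FA (match G E n) \<tau> \<cdot>\<^bsub>Fun (Bd G n) E\<^esub> match_map G E n (Dom (Fun Iinf E) \<tau>)
    = match_map G E n (Cod (Fun Iinf E) \<tau>) \<cdot>\<^bsub>Fun (Bd G n) E\<^esub> FA (restr_eq G E n) \<tau>"
proof -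
  interpret C: collage_limits "Bd G n" "below G n" "Prof G n" E by (rule collage_limits_at[OF n])
  interpret R: restriction_pb "col n" Iinf E "K n" by (rule restriction_at[OF n])
  note [simp] = t
  have "whisk \<tau> (K n) \<in> Arr (Fun (col n) E)" by simp
  from C.collage_match_nat[OF this] show ?thesis
    by (simp add: whisk_incl[OF n] match_FA[OF n] restr_eq_FA[OF n] match_map_collage[OF n])
qed

end

lemma (in gluing_limits) gluing_powerful:
  assumes f: "f \<in> Arr (Fun Iinf E)" and pw: "\<And>n. n \<in> Obj N \<Longrightarrow> powerful (Fun (Bd G n) E) (FA (restr_eq G E n) f)"
  shows "powerful (Fun Iinf E) f"
proof -
  interpret F: functor_category_pb Iinf E
    unfolding gluing_cat_def by (rule Q.F.functor_category_pb_axioms)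
  show ?thesis
  proof (rule F.F.powerfulI[OF f])
    show "has_pullbacks_along (Fun Iinf E) f" using F.has_pullbacks_Fun f by (simp add: has_pullbacks_def)
    fix g assume "g \<in> Arr (Fun Iinf E)" "Cod (Fun Iinf E) g = Dom (Fun Iinf E) f"
    then interpret gluing_dprod G E f g
      by unfold_locales (use f pw in \<open>simp_all add: restr_eq_FA\<close>)
    show "\<exists>p w1 w2 e. dprod (Fun Iinf E) f g p w1 w2 e" using gluing_dprod by blast
  qed
qed

section \<open>The formula for the chosen dependent product\<close>

context gluing_dprod
begin

sublocale F: functor_category_pb Iinf E
  unfolding gluing_cat_def by (rule Q.F.functor_category_pb_axioms)

lemma powerful_f: "powerful (Fun Iinf E) f"
  by (rule gluing_powerful) (simp_all add: restr_eq_FA pw)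

abbreviation Pi_g where "Pi_g \<equiv> Pi_ob (Fun Iinf E) f g"
abbreviation ev' where "ev' \<equiv> mid (ev (Fun Iinf E) f g)"

text \<open>Stated for an arbitrary dependent product along \<open>f\<close>, because it is applied
  both to the constructed one and to the chosen one.\<close>

lemma matching_data_at:
  assumes n: "n \<in> Obj N" and d: "dprod (Fun Iinf E) f g p w1 w2 e"
  shows "matching_data (Fun (Bd G n) E) (FA (restr_eq G E n) f) (FA (restr_eq G E n) g) (match_map G E n (Cod (Fun Iinf E) f))
     (match_map G E n (Dom (Fun Iinf E) f)) (match_map G E n (Dom (Fun Iinf E) g)) (FA (match G E n) f) (FA (match G E n) g)
     (FA (match G E n) p) (FA (match G E n) w1) (FA (match G E n) w2) (FA (match G E n) e)"
proof -
  interpret R: functor_on "Fun Iinf E" "Fun (Bd G n) E" "restr_eq G E n" by unfold_locales (rule restr_eq_in[OF n])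
  interpret M: functor_on "Fun Iinf E" "Fun (Bd G n) E" "match G E n" by unfold_locales (rule match_in[OF n])
  interpret D: category "Fun (Bd G n) E" by (rule R.catE)
  note D = dprodD[OF d]
  note [simp] = D(4-6) pbD(1-8)[OF D(3)] homD[OF match_map_arr[OF n]]
  show ?thesis
  proof unfold_locales
    show "is_pullback (Fun (Bd G n) E) (FA (match G E n) f) (FA (match G E n) p) (FA (match G E n) w1) (FA (match G E n) w2)"
      by (rule match_pullback[OF n D(3)])
    show "FA (match G E n) g \<cdot>\<^bsub>Fun (Bd G n) E\<^esub> FA (match G E n) e = FA (match G E n) w1"
      using M.FA_comp[of e g] D(7) by simp
  qed (use match_map_nat[OF n f] match_map_nat[OF n g(1)] in simp_all)
qed

text \<open>Restriction and the matching functor both preserve pullbacks, so they turn the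
  comparison \<open>\<theta>\<close> and its base change into the data required by
  \<open>glued_iso\<close>. The two images of \<open>\<theta>\<close> are compatible by naturality
  of the matching maps.\<close>

lemma glued_Pi:
  assumes n: "n \<in> Obj N"
  shows "glued (Fun (Bd G n) E) (FA (restr_eq G E n) f) (FA (restr_eq G E n) g) (match_map G E n (Cod (Fun Iinf E) f))
     (match_map G E n (Dom (Fun Iinf E) f)) (match_map G E n (Dom (Fun Iinf E) g))
     (FA (match G E n) Pi_g) (FA (match G E n) (pb1 (Fun Iinf E) f Pi_g)) (FA (match G E n) (pb2 (Fun Iinf E) f Pi_g)) (FA (match G E n) ev')
     (FA (restr_eq G E n) Pi_g) (match_map G E n (Dom (Fun Iinf E) Pi_g)) (FA (restr_eq G E n) (pb1 (Fun Iinf E) f Pi_g))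
     (FA (restr_eq G E n) (pb2 (Fun Iinf E) f Pi_g)) (FA (restr_eq G E n) ev')"
proof -
  interpret R: functor_on "Fun Iinf E" "Fun (Bd G n) E" "restr_eq G E n" by unfold_locales (rule restr_eq_in[OF n])
  interpret M: functor_on "Fun Iinf E" "Fun (Bd G n) E" "match G E n" by unfold_locales (rule match_in[OF n])
  interpret C: collage_limits "Bd G n" "below G n" "Prof G n" E by (rule collage_limits_at[OF n])
  interpret K: restriction_pb "col n" Iinf E "K n" by (rule restriction_at[OF n])
  interpret Rb: restriction_pb "below G n" Iinf E "incl_below G n" by (rule restriction_at[OF n])
  interpret Rd: restriction_pb "Bd G n" Iinf E "incl_bd G n" by (rule restriction_at[OF n])
  obtain p e where d: "ptdprod Iinf E f g p e" and gl: "C.glued_collage (whisk f (K n)) (whisk g (K n))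
     (whisk p (incl_below G n)) (whisk e (incl_below G n)) (whisk p (incl_bd G n)) (C.\<mu> (Dom (Fun Iinf E) p \<bullet> K n)) (whisk e (incl_bd G n))"
    using gluing_dprod n by blast
  have d': "dprod (Fun Iinf E) f g Pi_g (pb1 (Fun Iinf E) f Pi_g) (pb2 (Fun Iinf E) f Pi_g) ev'"
    by (rule F.F.Pi_dprod[OF powerful_f g])
  note D = dprodD[OF d] and D' = dprodD[OF d']
  note [simp] = D(4-6) D'(4-6) pbD(1-8)[OF D(3)] pbD(1-8)[OF D'(3)]
  let ?D = "Fun (Bd G n) E" and ?R = "FA (restr_eq G E n)" and ?M = "FA (match G E n)"
  let ?w1 = "ptpb1 Iinf E f p" and ?w2 = "ptpb2 Iinf E f p" and ?v1 = "pb1 (Fun Iinf E) f Pi_g" and ?v2 = "pb2 (Fun Iinf E) f Pi_g"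
  have gl': "glued ?D (?R f) (?R g) (match_map G E n (Cod (Fun Iinf E) f)) (match_map G E n (Dom (Fun Iinf E) f))
     (match_map G E n (Dom (Fun Iinf E) g)) (?M p) (?M ?w1) (?M ?w2) (?M e) (?R p) (match_map G E n (Dom (Fun Iinf E) p)) (?R ?w1) (?R ?w2) (?R e)"
    using gl unfolding C.glued_collage_def
    by (simp add: whisk_incl[OF n] match_FA[OF n] restr_eq_FA[OF n] match_map_collage[OF n] Rb.whisk_ptpb Rd.whisk_ptpb)
  obtain \<theta> \<eta> where \<theta>: "\<theta> \<in> hom (Fun Iinf E) (Dom (Fun Iinf E) Pi_g) (Dom (Fun Iinf E) p)"
    "\<eta> \<in> hom (Fun Iinf E) (Dom (Fun Iinf E) p) (Dom (Fun Iinf E) Pi_g)"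
    "\<theta> \<cdot>\<^bsub>Fun Iinf E\<^esub> \<eta> = Ident (Fun Iinf E) (Dom (Fun Iinf E) p)" "\<eta> \<cdot>\<^bsub>Fun Iinf E\<^esub> \<theta> = Ident (Fun Iinf E) (Dom (Fun Iinf E) Pi_g)"
    "p \<cdot>\<^bsub>Fun Iinf E\<^esub> \<theta> = Pi_g" "ev' = e \<cdot>\<^bsub>Fun Iinf E\<^esub> pb_lift (Fun Iinf E) ?w1 ?w2 ?v1 (\<theta> \<cdot>\<^bsub>Fun Iinf E\<^esub> ?v2)"
    using F.F.dprod_iso[OF d d'] by blast
  note [simp] = homD[OF \<theta>(1)] homD[OF \<theta>(2)]
  have th: "\<theta> \<in> Arr (Fun Iinf E)" "Dom (Fun Iinf E) \<theta> = Dom (Fun Iinf E) Pi_g" "Cod (Fun Iinf E) \<theta> = Dom (Fun Iinf E) p"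
    "p \<cdot>\<^bsub>Fun Iinf E\<^esub> \<theta> = Pi_g" by (simp_all add: \<theta>(5))
  note lm = F.F.pb_map[OF D(3) D'(3) th] and lc = F.F.pb_map_commute[OF D(3) D'(3) th]
  note [simp] = lm
  have obj [simp]: "Dom (Fun Iinf E) p \<in> Obj (Fun Iinf E)" "Dom (Fun Iinf E) Pi_g \<in> Obj (Fun Iinf E)" by simp_all
  interpret X: matching_data ?D "?R f" "?R g" "match_map G E n (Cod (Fun Iinf E) f)" "match_map G E n (Dom (Fun Iinf E) f)"
     "match_map G E n (Dom (Fun Iinf E) g)" "?M f" "?M g" "?M p" "?M ?w1" "?M ?w2" "?M e"
    by (rule matching_data_at[OF n d])
  show ?thesis
  proof (rule X.glued_iso[OF gl'])
    show "is_pullback ?D (?M f) (?M Pi_g) (?M ?v1) (?M ?v2)" by (rule match_pullback[OF n D'(3)])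
    show "is_pullback ?D (?R f) (?R Pi_g) (?R ?v1) (?R ?v2)" by (rule restr_eq_pullback[OF n D'(3)])
    show "?M \<theta> \<in> hom ?D (Dom ?D (?M Pi_g)) (Dom ?D (?M p))" "?M \<eta> \<in> hom ?D (Dom ?D (?M p)) (Dom ?D (?M Pi_g))"
      "?R \<theta> \<in> hom ?D (Dom ?D (?R Pi_g)) (Dom ?D (?R p))" "?R \<eta> \<in> hom ?D (Dom ?D (?R p)) (Dom ?D (?R Pi_g))"
      by (simp_all add: hom_iff)
    show "?M \<theta> \<cdot>\<^bsub>?D\<^esub> ?M \<eta> = Ident ?D (Dom ?D (?M p))" "?M \<eta> \<cdot>\<^bsub>?D\<^esub> ?M \<theta> = Ident ?D (Dom ?D (?M Pi_g))"
      "?M p \<cdot>\<^bsub>?D\<^esub> ?M \<theta> = ?M Pi_g" by (simp_all add: \<theta>(3-5) flip: M.FA_comp)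
    show "?R \<theta> \<cdot>\<^bsub>?D\<^esub> ?R \<eta> = Ident ?D (Dom ?D (?R p))" "?R \<eta> \<cdot>\<^bsub>?D\<^esub> ?R \<theta> = Ident ?D (Dom ?D (?R Pi_g))"
      "?R p \<cdot>\<^bsub>?D\<^esub> ?R \<theta> = ?R Pi_g" by (simp_all add: \<theta>(3-5) flip: R.FA_comp)
    show "?M ev' = ?M e \<cdot>\<^bsub>?D\<^esub> pb_lift ?D (?M ?w1) (?M ?w2) (?M ?v1) (?M \<theta> \<cdot>\<^bsub>?D\<^esub> ?M ?v2)"
      using M.FA_pb_lift[OF D(3) match_pullback[OF n D(3)] _ _ _ _ _ lc] by (simp add: \<theta>(6) M.FA_comp)
    show "?R ev' = ?R e \<cdot>\<^bsub>?D\<^esub> pb_lift ?D (?R ?w1) (?R ?w2) (?R ?v1) (?R \<theta> \<cdot>\<^bsub>?D\<^esub> ?R ?v2)"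
      using R.FA_pb_lift[OF D(3) restr_eq_pullback[OF n D(3)] _ _ _ _ _ lc] by (simp add: \<theta>(6) R.FA_comp)
    show "match_map G E n (Dom (Fun Iinf E) Pi_g) \<in> hom ?D (Dom ?D (?R Pi_g)) (Dom ?D (?M Pi_g))"
      using match_map_arr[OF n obj(2)] by (simp add: hom_iff)
    show "?M \<theta> \<cdot>\<^bsub>?D\<^esub> match_map G E n (Dom (Fun Iinf E) Pi_g) = match_map G E n (Dom (Fun Iinf E) p) \<cdot>\<^bsub>?D\<^esub> ?R \<theta>"
      using match_map_nat[OF n th(1)] by simp
  qed
qed

text \<open>One argument for both uses, with \<open>T\<close> the restriction and with
  \<open>T\<close> the matching functor. The last equation is stated on the image under
  \<open>T\<close> of the square over \<open>\<I>\<^sub>\<infinity>\<close>, which is the square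
  occurring in \<open>glued_Pi\<close>.\<close>

lemma ev_comparison_at:
  assumes T: "T \<in> Obj (Fun (Fun Iinf E) (Fun (Bd G n) E))" and n: "n \<in> Obj N"
    and pres: "\<And>a b c d. is_pullback (Fun Iinf E) a b c d \<Longrightarrow> is_pullback (Fun (Bd G n) E) (FA T a) (FA T b) (FA T c) (FA T d)"
    and pT: "powerful (Fun (Bd G n) E) (FA T f)"
  defines "k \<equiv> mid (ev_comparison T f g)" and "D \<equiv> Fun (Bd G n) E"
  defines "q \<equiv> Pi_ob D (FA T f) (FA T g)"
  shows "ev_comparison T f g = (FA T Pi_g, k, q)" "k \<in> Arr D" "Dom D k = Dom D (FA T Pi_g)" "Cod D k = Dom D q" "q \<cdot>\<^bsub>D\<^esub> k = FA T Pi_g"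
    "mid (ev D (FA T f) (FA T g)) \<cdot>\<^bsub>D\<^esub> pb_lift D (pb1 D (FA T f) q) (pb2 D (FA T f) q) (FA T (pb1 (Fun Iinf E) f Pi_g))
      (k \<cdot>\<^bsub>D\<^esub> FA T (pb2 (Fun Iinf E) f Pi_g)) = FA T ev'"
proof -
  note pT = pT[folded D_def] and pres = pres[folded D_def]
  interpret T: functor_on "Fun Iinf E" D T unfolding D_def by unfold_locales (rule T)
  interpret D: category D by (rule T.catE)
  note pbs = D.powerfulD(2)[OF pT]
  have d': "dprod (Fun Iinf E) f g Pi_g (pb1 (Fun Iinf E) f Pi_g) (pb2 (Fun Iinf E) f Pi_g) ev'"
    by (rule F.F.Pi_dprod[OF powerful_f g])
  note D' = dprodD[OF d']
  note [simp] = D'(4-6) pbD(1-8)[OF D'(3)]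
  note w = pres[OF D'(3)]
  let ?x = "FA T Pi_g" and ?w1 = "FA T (pb1 (Fun Iinf E) f Pi_g)" and ?w2 = "FA T (pb2 (Fun Iinf E) f Pi_g)"
  let ?y1 = "pb1 D (FA T f) ?x" and ?y2 = "pb2 D (FA T f) ?x"
  have y: "is_pullback D (FA T f) ?x ?y1 ?y2" by (rule chosen_pullback[OF pbs]) simp_all
  note [simp] = pbD(1-8)[OF y]
  let ?iso = "pb_lift D ?w1 ?w2 ?y1 ?y2"
  have c: "FA T f \<cdot>\<^bsub>D\<^esub> ?y1 = ?x \<cdot>\<^bsub>D\<^esub> ?y2" using pbD(9)[OF y] .
  have iso: "?iso \<in> Arr D" "Dom D ?iso = Dom D ?y1" "Cod D ?iso = Dom D ?w1" "?w1 \<cdot>\<^bsub>D\<^esub> ?iso = ?y1"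
    by (rule pb_lift[OF w _ _ _ _ _ c]; simp)+
  note [simp] = iso(1-3)
  have gT: "FA T g \<in> Arr D" "Cod D (FA T g) = Dom D (FA T f)" and xT: "?x \<in> Arr D" "Cod D ?x = Cod D (FA T f)" by simp_all
  let ?h = "FA T ev' \<cdot>\<^bsub>D\<^esub> ?iso"
  have gh: "FA T g \<cdot>\<^bsub>D\<^esub> ?h = ?y1"
  proof -
    have "FA T g \<cdot>\<^bsub>D\<^esub> FA T ev' = ?w1" using D'(7) T.FA_comp[of ev' g] by simp
    then show ?thesis using iso(4) by (subst D.comp_ext) simp_all
  qed
  have hh: "?h \<in> Arr D" "Dom D ?h = Dom D ?y1" "Cod D ?h = Dom D (FA T g)" by simp_all
  have evc: "ev_comparison T f g = transpose D (FA T f) ?x (FA T g) (?y1, ?h, FA T g)"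
    by (simp add: ev_comparison_def Let_def)
  note tr = D.transpose[OF pT gT xT hh gh, folded evc k_def q_def]
  show "ev_comparison T f g = (FA T Pi_g, k, q)" "k \<in> Arr D" "Dom D k = Dom D (FA T Pi_g)" "Cod D k = Dom D q" "q \<cdot>\<^bsub>D\<^esub> k = FA T Pi_g"
    by (rule tr)+
  note d = D.Pi_dprod(1)[OF pT gT, folded q_def]
  show "mid (ev D (FA T f) (FA T g)) \<cdot>\<^bsub>D\<^esub> pb_lift D (pb1 D (FA T f) q) (pb2 D (FA T f) q) ?w1 (k \<cdot>\<^bsub>D\<^esub> ?w2) = FA T ev'"
    by (rule D.transpose_change[OF dprodD(3)[OF d] y w _ _ _ _ tr(2-6)]) (simp_all add: dprodD[OF d])
qed

text \<open>The maps of the statement are matched with the data of \<open>matching_square\<close>: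
  \<open>Pi_match_map\<close> is \<open>c\<close>, the composite is \<open>h\<close>, and the two
  projections are the maps \<open>a\<close> and \<open>b\<close> of
  \<open>pullback_of_glued\<close>.\<close>

lemma pullback_formula:
  assumes n: "n \<in> Obj N" and pwM: "powerful (Fun (Bd G n) E) (FA (match G E n) f)"
  defines "D \<equiv> Fun (Bd G n) E"
  shows "is_pullback D (mid (Pi_match_map G E n f g)) (mid (pulled_ev_transpose G E n f g) \<cdot>\<^bsub>D\<^esub> mid (pulled_match_ev G E n f g))
      (mid (proj_restr G E n f g)) (mid (proj_match G E n f g))"
    "Dom D (mid (proj_restr G E n f g)) = FO (restr_eq G E n) (Dom (Fun Iinf E) Pi_g)"
    "pb1 D (match_map G E n (Cod (Fun Iinf E) f)) (FA (match G E n) Pi_g) \<cdot>\<^bsub>D\<^esub> mid (proj_match G E n f g) = FA (restr_eq G E n) Pi_g"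
    "mid (pulled_match_ev G E n f g) \<in> Arr D"
proof -
  interpret R: functor_on "Fun Iinf E" D "restr_eq G E n" unfolding D_def by unfold_locales (rule restr_eq_in[OF n])
  interpret M: functor_on "Fun Iinf E" D "match G E n" unfolding D_def by unfold_locales (rule match_in[OF n])
  interpret D: category D by (rule R.catE)
  interpret DD: collage_limits "Bd G n" "below G n" "Prof G n" E by (rule collage_limits_at[OF n])
  let ?r = "FA (restr_eq G E n) f" and ?g = "FA (restr_eq G E n) g" and ?p = "FA (restr_eq G E n) Pi_g"
  let ?f' = "FA (match G E n) f" and ?g' = "FA (match G E n) g" and ?p' = "FA (match G E n) Pi_g" and ?e' = "FA (match G E n) ev'"
  let ?w1' = "FA (match G E n) (pb1 (Fun Iinf E) f Pi_g)" and ?w2' = "FA (match G E n) (pb2 (Fun Iinf E) f Pi_g)"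
  let ?w1 = "FA (restr_eq G E n) (pb1 (Fun Iinf E) f Pi_g)" and ?w2 = "FA (restr_eq G E n) (pb2 (Fun Iinf E) f Pi_g)"
  let ?mA = "match_map G E n (Cod (Fun Iinf E) f)" and ?mB = "match_map G E n (Dom (Fun Iinf E) f)"
    and ?mC = "match_map G E n (Dom (Fun Iinf E) g)" and ?mP = "match_map G E n (Dom (Fun Iinf E) Pi_g)"
  have pr: "powerful D ?r" using pw[OF n] by (simp add: D_def restr_eq_FA[OF n])
  have pf: "powerful D ?f'" using pwM by (simp add: D_def)
  have hp: "has_pullbacks D" unfolding D_def by (rule DD.D.has_pullbacks_Fun)
  note pb = has_pullbacks_chosen[OF hp]
  have d': "dprod (Fun Iinf E) f g Pi_g (pb1 (Fun Iinf E) f Pi_g) (pb2 (Fun Iinf E) f Pi_g) ev'"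
    by (rule F.F.Pi_dprod[OF powerful_f g])
  note D' = dprodD[OF d']
  note [simp] = D'(4-6) pbD(1-8)[OF D'(3)]
  interpret X: matching_data D ?r ?g ?mA ?mB ?mC ?f' ?g' ?p' ?w1' ?w2' ?e'
    unfolding D_def by (rule matching_data_at[OF n d'])
  note gl = glued_Pi[OF n, folded D_def]
  note GL = gluedD[OF gl]
  note [simp] = GL(1-3)
  let ?\<pi>1 = "Pi_ob D ?r ?g" and ?y1 = "pb1 D ?mB ?g'" and ?y2 = "pb2 D ?mB ?g'" and ?z1 = "pb1 D ?mA ?p'" and ?z2 = "pb2 D ?mA ?p'"
  let ?u1 = "pb1 D ?r ?\<pi>1" and ?u2 = "pb2 D ?r ?\<pi>1" and ?\<epsilon>1 = "mid (ev D ?r ?g)"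
  let ?x1 = "pb1 D ?r ?z1" and ?x2 = "pb2 D ?r ?z1"
  have y: "is_pullback D ?mB ?g' ?y1 ?y2" by (rule pb) simp_all
  have z: "is_pullback D ?mA ?p' ?z1 ?z2" by (rule pb) simp_all
  note [simp] = pbD(1-8)[OF y] pbD(1-8)[OF z]
  have x: "is_pullback D ?r ?z1 ?x1 ?x2" by (rule pb) simp_all
  let ?\<pi>2 = "Pi_ob D ?r ?y1"
  let ?v1 = "pb1 D ?r ?\<pi>2" and ?v2 = "pb2 D ?r ?\<pi>2" and ?\<epsilon>2 = "mid (ev D ?r ?y1)"
  have d1: "dprod D ?r ?g ?\<pi>1 ?u1 ?u2 ?\<epsilon>1" by (rule D.Pi_dprod[OF pr]) simp_all
  have d2: "dprod D ?r ?y1 ?\<pi>2 ?v1 ?v2 ?\<epsilon>2" by (rule D.Pi_dprod[OF pr]) simp_all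
  let ?l = "pb_lift D ?y1 ?y2 ?g ?mC"
  note gmC = X.pair_mC[OF y]
  note [simp] = gmC(1-3)
  let ?c = "mid (Pi_match_map G E n f g)"
  have sel: "NCod f = Cod (Fun Iinf E) f" "NDom f = Dom (Fun Iinf E) f" "NDom g = Dom (Fun Iinf E) g" "NDom Pi_g = Dom (Fun Iinf E) Pi_g"
    by (simp_all add: Fun_sel)
  have Pm: "Pi_match_map G E n f g = FA (Pi_functor D ?r) (?g, ?l, ?y1)"
    by (simp add: Pi_match_map_def Let_def D_def sel)
  have c: "?c \<in> Arr D" "Dom D ?c = Dom D ?\<pi>1" "Cod D ?c = Dom D ?\<pi>2" "?\<pi>2 \<cdot>\<^bsub>D\<^esub> ?c = ?\<pi>1"
    "?\<epsilon>2 \<cdot>\<^bsub>D\<^esub> pb_lift D ?v1 ?v2 ?u1 (?c \<cdot>\<^bsub>D\<^esub> ?u2) = ?l \<cdot>\<^bsub>D\<^esub> ?\<epsilon>1"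
    unfolding Pm by (rule D.Pi_FA[OF pr]; simp add: gmC)+
  let ?q = "Pi_ob D ?f' ?g'"
  let ?s1 = "pb1 D ?f' ?q" and ?s2 = "pb2 D ?f' ?q" and ?\<epsilon>3 = "mid (ev D ?f' ?g')"
  have s: "dprod D ?f' ?g' ?q ?s1 ?s2 ?\<epsilon>3" by (rule D.Pi_dprod[OF pf]) simp_all
  have evs: "ev D ?f' ?g' = (?s1, ?\<epsilon>3, ?g')" by (rule D.Pi_dprod(2)[OF pf]) simp_all
  note S = dprodD[OF s]
  note [simp] = S(4-6) pbD(1-8)[OF S(3)]
  note k0 = ev_comparison_at[OF match_in[OF n] n match_pullback[OF n] pwM, folded D_def]
  let ?k0 = "mid (ev_comparison (match G E n) f g)"
  note [simp] = k0(2-4)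
  let ?t1 = "pb1 D ?mA ?q" and ?t2 = "pb2 D ?mA ?q"
  have t: "is_pullback D ?mA ?q ?t1 ?t2" by (rule pb) simp_all
  note [simp] = pbD(1-8)[OF t]
  let ?k1 = "mid (pulled_match_ev G E n f g)"
  \<comment> \<open>The right side of \<open>k0(1)\<close> contains its left side, so rewriting with
    it would loop; the needed instance is formed by congruence.\<close>
  have pbk0: "FA (pb_functor D ?mA) (ev_comparison (match G E n) f g) = FA (pb_functor D ?mA) (?p', ?k0, ?q)"
    by (rule arg_cong[OF k0(1)])
  have k1e: "?k1 = pb_lift D ?t1 ?t2 ?z1 (?k0 \<cdot>\<^bsub>D\<^esub> ?z2)"
    unfolding pulled_match_ev_def sel D_def[symmetric] pbk0
    using k0(5) by (simp add: pb_functor_def)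
  have k1: "?k1 \<in> Arr D" "Dom D ?k1 = Dom D ?z1" "Cod D ?k1 = Dom D ?t1" "?t1 \<cdot>\<^bsub>D\<^esub> ?k1 = ?z1" "?t2 \<cdot>\<^bsub>D\<^esub> ?k1 = ?k0 \<cdot>\<^bsub>D\<^esub> ?z2"
    unfolding k1e using D.pb_map[OF t z k0(2-5)] by simp_all
  let ?o1 = "pb1 D ?r ?t1" and ?o2 = "pb2 D ?r ?t1"
  have u: "is_pullback D ?r ?t1 ?o1 ?o2" by (rule pb) simp_all
  note [simp] = pbD(1-8)[OF u]
  \<comment> \<open>Here the dependent product along the matching map \<open>?f'\<close> takes the
    place of the matching object of the dependent product; \<open>match_lift\<close> then gives the
    map \<open>r\<close> in the definition of \<open>pulled_ev_transpose\<close>.\<close>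
  interpret Y: matching_data D ?r ?g ?mA ?mB ?mC ?f' ?g' ?q ?s1 ?s2 ?\<epsilon>3
    by unfold_locales (use S in \<open>simp_all add: X.nat_f X.nat_g\<close>)
  note rr = Y.match_lift[OF u Y.z_arr[OF t]]
  let ?rr = "pb_lift D ?s1 ?s2 (?mB \<cdot>\<^bsub>D\<^esub> ?o1) (?t2 \<cdot>\<^bsub>D\<^esub> ?o2)"
  let ?a1 = "pb1 D ?mB ?s1" and ?a2 = "pb2 D ?mB ?s1"
  have a: "is_pullback D ?mB ?s1 ?a1 ?a2" by (rule pb) simp_all
  note [simp] = pbD(1-8)[OF a] rr(1-3)
  let ?iso = "pb_lift D ?a1 ?a2 ?o1 ?rr"
  have iso: "?iso \<in> Arr D" "Dom D ?iso = Dom D ?o1" "Cod D ?iso = Dom D ?a1" "?a1 \<cdot>\<^bsub>D\<^esub> ?iso = ?o1" "?a2 \<cdot>\<^bsub>D\<^esub> ?iso = ?rr"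
    by (rule pb_lift[OF a]; simp add: rr(4))+
  let ?b = "pb_lift D ?y1 ?y2 ?a1 (?\<epsilon>3 \<cdot>\<^bsub>D\<^esub> ?a2)"
  have b: "?b \<in> Arr D" "Dom D ?b = Dom D ?a1" "Cod D ?b = Dom D ?y1" "?y1 \<cdot>\<^bsub>D\<^esub> ?b = ?a1" "?y2 \<cdot>\<^bsub>D\<^esub> ?b = ?\<epsilon>3 \<cdot>\<^bsub>D\<^esub> ?a2"
    by (rule D.pb_map[OF y a]; simp add: S(7))+
  note [simp] = iso(1-3) b(1-3)
  \<comment> \<open>\<open>?b\<close> is the pullback of the evaluation along \<open>?mB\<close>,
    and \<open>?iso\<close> rebrackets the iterated pullback; \<open>?L\<close> is thus the map
    whose transpose is \<open>pulled_ev_transpose\<close>.\<close>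
  let ?L = "?b \<cdot>\<^bsub>D\<^esub> ?iso"
  have L: "?L \<in> Arr D" "Dom D ?L = Dom D ?o1" "Cod D ?L = Dom D ?y1" "?y1 \<cdot>\<^bsub>D\<^esub> ?L = ?o1" "?y2 \<cdot>\<^bsub>D\<^esub> ?L = ?\<epsilon>3 \<cdot>\<^bsub>D\<^esub> ?rr"
    by (simp_all add: D.comp_ext[OF b(4)] D.comp_ext[OF b(5)] iso)
  let ?k2 = "mid (pulled_ev_transpose G E n f g)"
  have "FA (pb_functor D ?mB) (ev D ?f' ?g') = FA (pb_functor D ?mB) (?s1, ?\<epsilon>3, ?g')"
    by (rule arg_cong[OF evs])
  also have "\<dots> = (?a1, ?b, ?y1)" using S(7) by (simp add: pb_functor_def)
  finally have pet: "pulled_ev_transpose G E n f g = transpose D ?r ?t1 ?y1 (?o1, ?L, ?y1)"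
    by (simp add: pulled_ev_transpose_def Let_def sel flip: D_def)
  have k2: "?k2 \<in> Arr D" "Dom D ?k2 = Dom D ?t1" "Cod D ?k2 = Dom D ?\<pi>2" "?\<pi>2 \<cdot>\<^bsub>D\<^esub> ?k2 = ?t1"
    "?\<epsilon>2 \<cdot>\<^bsub>D\<^esub> pb_lift D ?v1 ?v2 ?o1 (?k2 \<cdot>\<^bsub>D\<^esub> ?o2) = ?L"
    unfolding pet by (rule D.transpose(2-6)[OF pr]; use L in simp)+
  note h = X.composite_transpose[OF s k0(2-6) t z k1 y d2 u k2(1-4) L k2(5) x]
  interpret Z: matching_square D ?r ?g ?mA ?mB ?mC ?f' ?g' ?p' ?w1' ?w2' ?e' ?\<pi>1 ?u1 ?u2 ?\<epsilon>1 ?y1 ?y2 ?\<pi>2 ?v1 ?v2 ?\<epsilon>2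
    ?z1 ?z2 ?x1 ?x2 ?c "?k2 \<cdot>\<^bsub>D\<^esub> ?k1"
    by unfold_locales (use d1 d2 y z x c k1 k2 h in simp_all)
  note a = ev_comparison_at[OF restr_eq_in[OF n] n restr_eq_pullback[OF n] pr[unfolded D_def], folded D_def proj_restr_def]
  let ?b' = "mid (proj_match G E n f g)"
  have b'e: "?b' = pb_lift D ?z1 ?z2 ?p ?mP"
    by (simp add: proj_match_def Let_def sel flip: D_def)
  have b': "?b' \<in> Arr D" "Dom D ?b' = Dom D ?p" "Cod D ?b' = Dom D ?z1" "?z1 \<cdot>\<^bsub>D\<^esub> ?b' = ?p" "?z2 \<cdot>\<^bsub>D\<^esub> ?b' = ?mP"
    unfolding b'e by (rule pb_lift[OF z]; use GL(4) in simp)+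
  show "is_pullback D ?c (?k2 \<cdot>\<^bsub>D\<^esub> ?k1) (mid (proj_restr G E n f g)) ?b'"
    by (rule Z.pullback_of_glued[OF D.powerfulD(2)[OF pr] gl a(2-6) b'])
  show "Dom D (mid (proj_restr G E n f g)) = FO (restr_eq G E n) (Dom (Fun Iinf E) Pi_g)" using a(3) by simp
  show "?z1 \<cdot>\<^bsub>D\<^esub> ?b' = ?p" by (rule b'(4))
  show "?k1 \<in> Arr D" by (rule k1)
qed

end

text \<open>The two equations before the square say that its apex is the value of the dependent
  product at \<open>[i]\<^sub>n\<close>, and that its leg to the fibre product recovers the
  restriction of the projection to \<open>A\<close>. So the square describes the dependent product
  as a map to \<open>A\<close> and not only its domain.\<close>

theorem theorem5p4:
  fixes G :: "('n, 'a, 'o, 'm, 'b, 'c, 'u) gluing"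
    and E :: "('e, 'f) cat"
    and f :: "(('n \<times> 'o) set, ('n, 'o, 'm) colim_arr, 'e, 'f) ntrans"
    and A B :: "(('n \<times> 'o) set, ('n, 'o, 'm) colim_arr, 'e, 'f) func"
  assumes "iterated_gluing_diagram G"
    and "category E" and "has_pullbacks E"
    and "\<And>n i. n \<in> Obj (Shape G) \<Longrightarrow> i \<in> Obj (Bd G n) \<Longrightarrow>
           has_limits (elements (prof_at (Bd G n) (below G n) (Prof G n) i)) E"
    and "f \<in> hom (Fun (gluing_cat G) E) B A"
    and "\<And>n. n \<in> Obj (Shape G) \<Longrightarrow> powerful (Fun (Bd G n) E) (FA (restr_eq G E n) f)"
    and "\<And>n. n \<in> Obj (Shape G) \<Longrightarrow> powerful (Fun (Bd G n) E) (FA (match G E n) f)"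
  shows "powerful (Fun (gluing_cat G) E) f \<and>
    (\<forall>C. \<forall>g\<in>hom (Fun (gluing_cat G) E) C B. \<forall>n\<in>Obj (Shape G). \<forall>i\<in>Obj (Bd G n).
       Dom E (At (mid (proj_restr G E n f g)) i)
         = FO (NDom (Pi_ob (Fun (gluing_cat G) E) f g)) (FO (incl_bd G n) i) \<and>
       pb1 (Fun (Bd G n) E) (match_map G E n A) (FA (match G E n) (Pi_ob (Fun (gluing_cat G) E) f g))
         \<cdot>\<^bsub>Fun (Bd G n) E\<^esub> mid (proj_match G E n f g)
         = FA (restr_eq G E n) (Pi_ob (Fun (gluing_cat G) E) f g) \<and>
       is_pullback E
         (At (mid (Pi_match_map G E n f g)) i)
         (At (mid (pulled_ev_transpose G E n f g)) i \<cdot>\<^bsub>E\<^esub> At (mid (pulled_match_ev G E n f g)) i)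
         (At (mid (proj_restr G E n f g)) i)
         (At (mid (proj_match G E n f g)) i))"
proof -
  interpret gluing_limits G E
    using assms(1-4) by (simp add: gluing_limits_def gluing_limits_axioms_def)
  have fh: "f \<in> Arr (Fun (gluing_cat G) E)" "Dom (Fun (gluing_cat G) E) f = B" "Cod (Fun (gluing_cat G) E) f = A"
    using homD[OF assms(5)] by simp_all
  have pwf: "powerful (Fun (gluing_cat G) E) f" by (rule gluing_powerful[OF fh(1) assms(6)])
  show ?thesis
  proof (intro conjI allI ballI)
    show "powerful (Fun (gluing_cat G) E) f" by (rule pwf)
    fix C g n i
    assume gh: "g \<in> hom (Fun (gluing_cat G) E) C B" and n: "n \<in> Obj (Shape G)" and i: "i \<in> Obj (Bd G n)"
    interpret gluing_dprod G E f g
      by unfold_locales (use fh homD[OF gh] assms(6) in \<open>simp_all add: restr_eq_FA\<close>)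
    interpret C: collage_limits "Bd G n" "below G n" "Prof G n" E by (rule collage_limits_at[OF n])
    interpret Rd: restriction_pb "Bd G n" "gluing_cat G" E "incl_bd G n" by (rule restriction_at[OF n])
    note F = pullback_formula[OF n assms(7)[OF n]]
    let ?a = "mid (proj_restr G E n f g)"
    note pb = F(1)
    have "Dom (Fun (gluing_cat G) E) Pi_g \<in> Obj (Fun (gluing_cat G) E)"
      using pbD(2)[OF dprodD(3)[OF F.F.Pi_dprod(1)[OF pwf]], of g] homD[OF gh] fh by simp
    then have R: "FO (restr_eq G E n) (Dom (Fun (gluing_cat G) E) Pi_g) = Dom (Fun (gluing_cat G) E) Pi_g \<bullet> incl_bd G n"
      by (simp add: restr_eq_def)
    show "Dom E (At ?a i) = FO (NDom Pi_g) (FO (incl_bd G n) i)"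
      using i pbD(4)[OF pb] F(2) by (simp add: R) (simp add: Fun_sel)
    show "pb1 (Fun (Bd G n) E) (match_map G E n A) (FA (match G E n) Pi_g) \<cdot>\<^bsub>Fun (Bd G n) E\<^esub> mid (proj_match G E n f g)
        = FA (restr_eq G E n) Pi_g" using F(3) by (simp add: fh)
    show "is_pullback E (At (mid (Pi_match_map G E n f g)) i)
         (At (mid (pulled_ev_transpose G E n f g)) i \<cdot>\<^bsub>E\<^esub> At (mid (pulled_match_ev G E n f g)) i)
         (At ?a i) (At (mid (proj_match G E n f g)) i)"
      \<comment> \<open>The formula is proved in the functor category over the boundary and
        evaluated at \<open>i\<close>, pullbacks there being pointwise.\<close>
      using C.D.fun_pullbackD[OF pb i] i by simp
  qed
qed

end
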